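(* The topological stable rank of $H^\infty+C$ is $2$.
   Context: $H^\infty$ is the algebra of bounded holomorphic functions on the open unit disk, identified via boundary values with a closed subalgebra of $L^\infty(\mathbb T)$, where $\mathbb T$ is the unit circle. The Sarason algebra $H^\infty+C=\{f+g: f\in H^\infty,\ g\in C(\mathbb T)\}$ is a uniformly closed subalgebra of $L^\infty(\mathbb T)$ (norm $\|\cdot\|_\infty$). For a commutative unital Banach algebra $A$, $U_n(A)$ is the set of $(a_1,\dots,a_n)\in A^n$ for which there is $(x_1,\dots,x_n)\in A^n$ with $\sum_{j=1}^n a_jx_j=1$. The topological stable rank $\mathrm{tsr}(A)$ is the smallest integer $n\ge1$ such that $U_n(A)$ is dense in $A^n$ ($\infty$ if there is none). *)

theory Defs
  imports "HOL-Probability.Probability" "HOL-Library.Extended_Nat"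
begin

section \<open>Topological stable rank\<close>

text \<open>
  A Banach algebra occurs here as a subset \<open>A\<close> of an ambient commutative unital Banach algebra
  (intended: a closed subalgebra containing \<open>1\<close>). The \<open>n\<close>-tuples over \<open>A\<close> are the
  extensional functions on \<open>{..<n}\<close>, and \<open>A\<^sup>n\<close> carries the product of the norm topologies.
  The Bezout coefficients are required to lie in \<open>A\<close>.
\<close>

definition unimodular_tuples :: "nat \<Rightarrow> 'a::comm_ring_1 set \<Rightarrow> (nat \<Rightarrow> 'a) set" where
  "unimodular_tuples n A =
     {a \<in> {..<n} \<rightarrow>\<^sub>E A. \<exists>x \<in> {..<n} \<rightarrow>\<^sub>E A. (\<Sum>j<n. a j * x j) = 1}"

definition unimodular_dense :: "nat \<Rightarrow> 'a::{comm_ring_1, real_normed_algebra_1, banach} set \<Rightarrow> bool" where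
  "unimodular_dense n A \<longleftrightarrow>
     product_topology (\<lambda>_. top_of_set A) {..<n} closure_of unimodular_tuples n A = ({..<n} \<rightarrow>\<^sub>E A)"

text \<open>The infimum of the empty set in \<^typ>\<open>enat\<close> is \<open>\<infinity>\<close>; a nonempty infimum is attained.\<close>

definition tsr :: "'a::{comm_ring_1, real_normed_algebra_1, banach} set \<Rightarrow> enat" where
  "tsr A = Inf {enat n |n. n \<ge> 1 \<and> unimodular_dense n A}"

lemma unimodular_dense_iff:
  "unimodular_dense n A \<longleftrightarrow>
     (\<forall>a \<in> {..<n} \<rightarrow>\<^sub>E A. \<forall>e>0. \<exists>u \<in> unimodular_tuples n A. \<forall>j<n. norm (u j - a j) < e)"
    (is "_ \<longleftrightarrow> ?R")
proof -
  let ?T = "product_topology (\<lambda>_. top_of_set A) {..<n}"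
  let ?U = "unimodular_tuples n A"
  have top: "topspace ?T = ({..<n} \<rightarrow>\<^sub>E A)"
    by simp
  have "unimodular_dense n A \<longleftrightarrow> ({..<n} \<rightarrow>\<^sub>E A) \<subseteq> ?T closure_of ?U"
    unfolding unimodular_dense_def using closure_of_subset_topspace[of ?T ?U] top by blast
  also have "\<dots> \<longleftrightarrow> ?R"
  proof
    assume L: "({..<n} \<rightarrow>\<^sub>E A) \<subseteq> ?T closure_of ?U"
    show ?R
    proof (intro ballI allI impI)
      fix a and e :: real assume a: "a \<in> {..<n} \<rightarrow>\<^sub>E A" and e: "e > 0"
      let ?V = "PiE {..<n} (\<lambda>j. A \<inter> ball (a j) e)"
      have "openin ?T ?V"
        by (intro openin_PiE_gen[THEN iffD2] disjI2 conjI ballI) auto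
      moreover have "a \<in> ?V" using a e by (auto simp: PiE_iff)
      ultimately obtain u where "u \<in> ?U" "u \<in> ?V"
        using subsetD[OF L a] unfolding closure_of_def by blast
      then show "\<exists>u\<in>?U. \<forall>j<n. norm (u j - a j) < e"
        by (intro bexI[of _ u]) (auto simp: PiE_iff dist_norm norm_minus_commute)
    qed
  next
    assume R: ?R
    show "({..<n} \<rightarrow>\<^sub>E A) \<subseteq> ?T closure_of ?U"
    proof
      fix a assume a: "a \<in> {..<n} \<rightarrow>\<^sub>E A"
      have "\<exists>u\<in>?U. u \<in> V" if V: "openin ?T V" "a \<in> V" for V
      proof -
        obtain W where W: "\<forall>j. j < n \<longrightarrow> openin (top_of_set A) (W j)" "a \<in> PiE {..<n} W"
            "PiE {..<n} W \<subseteq> V"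
          using bspec[OF V(1)[unfolded openin_product_topology_alt] V(2)] by auto
        have "\<exists>e>0. \<forall>y\<in>A. dist y (a j) < e \<longrightarrow> y \<in> W j" if "j < n" for j
        proof -
          have "openin (top_of_set A) (W j)" "a j \<in> W j"
            using W that by (auto simp: PiE_iff)
          then show ?thesis unfolding openin_euclidean_subtopology_iff by blast
        qed
        then obtain e where e: "\<And>j. j < n \<Longrightarrow> e j > 0"
            "\<And>j y. j < n \<Longrightarrow> y \<in> A \<Longrightarrow> dist y (a j) < e j \<Longrightarrow> y \<in> W j"
          by metis
        define d where "d = Min (insert (1::real) (e ` {..<n}))"
        have d: "d > 0" "\<And>j. j < n \<Longrightarrow> d \<le> e j"
          unfolding d_def using e by (auto intro: Min_le)
        obtain u where u: "u \<in> ?U" "\<forall>j<n. norm (u j - a j) < d"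
          using R a d by blast
        have "u \<in> PiE {..<n} W"
        proof (rule PiE_I)
          fix j assume "j \<in> {..<n}"
          then have "u j \<in> A" "norm (u j - a j) < e j"
            using u d(2)[of j] unfolding unimodular_tuples_def by (auto simp: PiE_iff)
          then show "u j \<in> W j" using e(2)[of j "u j"] \<open>j \<in> {..<n}\<close> by (simp add: dist_norm)
        next
          fix j assume "j \<notin> {..<n}"
          then show "u j = undefined"
            using u(1) unfolding unimodular_tuples_def by (auto simp: PiE_iff extensional_def)
        qed
        then show ?thesis using u W by blast
      qed
      then show "a \<in> ?T closure_of ?U"
        using a by (auto simp: closure_of_def)
    qed
  qed
  finally show ?thesis .
qed


section \<open>The Banach algebra \<open>L\<^sup>\<infinity>\<close> of the unit circle\<close>

text \<open>Normalized arc length, as a Borel measure on \<^typ>\<open>complex\<close> concentrated on the unit circle.\<close>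

definition circle_measure :: "complex measure" where
  "circle_measure = distr (uniform_measure lborel {0..2 * pi}) borel cis"

lemma sets_circle_measure [simp, measurable_cong]: "sets circle_measure = sets borel"
  by (simp add: circle_measure_def)

lemma borel_measurable_cis [measurable]: "cis \<in> borel_measurable borel"
  by (intro borel_measurable_continuous_onI continuous_intros)

lemma space_circle_measure [simp]: "space circle_measure = UNIV"
  by (simp add: circle_measure_def)

interpretation circle: prob_space circle_measure
proof -
  have "prob_space (uniform_measure lborel {0..2 * pi})"
    by (rule prob_space_uniform_measure) auto
  then show "prob_space circle_measure"
    unfolding circle_measure_def by (rule prob_space.prob_space_distr) measurable
qed

lemma AE_circle_measure_norm: "AE z in circle_measure. norm z = 1"
  unfolding circle_measure_def by (subst AE_distr_iff) auto

definition circle_esssup :: "(complex \<Rightarrow> complex) \<Rightarrow> ereal" where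
  "circle_esssup f = esssup circle_measure (\<lambda>z. ereal (norm (f z)))"

definition ess_bounded :: "(complex \<Rightarrow> complex) \<Rightarrow> bool" where
  "ess_bounded f \<longleftrightarrow> f \<in> borel_measurable circle_measure \<and> circle_esssup f < \<infinity>"

lemma ess_bounded_measurable [measurable_dest]:
  "ess_bounded f \<Longrightarrow> f \<in> borel_measurable circle_measure"
  by (simp add: ess_bounded_def)

lemma circle_esssup_le_iff:
  assumes "f \<in> borel_measurable circle_measure"
  shows "circle_esssup f \<le> ereal c \<longleftrightarrow> (AE z in circle_measure. norm (f z) \<le> c)"
proof
  assume *: "circle_esssup f \<le> ereal c"
  have "AE z in circle_measure. ereal (norm (f z)) \<le> circle_esssup f"
    unfolding circle_esssup_def by (rule esssup_AE)
  then show "AE z in circle_measure. norm (f z) \<le> c"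
  proof eventually_elim
    case (elim z)
    then have "ereal (norm (f z)) \<le> ereal c" using * by (rule order_trans)
    then show ?case by simp
  qed
next
  assume "AE z in circle_measure. norm (f z) \<le> c"
  then show "circle_esssup f \<le> ereal c"
    unfolding circle_esssup_def using assms by (intro esssup_I) auto
qed

lemma circle_esssup_nonneg: "circle_esssup f \<ge> 0"
proof -
  have "0 = esssup circle_measure (\<lambda>_. 0 :: ereal)"
    by (subst esssup_const) (simp_all add: circle.emeasure_space_1[simplified])
  also have "\<dots> \<le> circle_esssup f"
    unfolding circle_esssup_def by (rule esssup_mono) auto
  finally show ?thesis .
qed

lemma ess_bounded_iff:
  "ess_bounded f \<longleftrightarrow> f \<in> borel_measurable circle_measure \<and>
     (\<exists>c. AE z in circle_measure. norm (f z) \<le> c)"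
proof (cases "f \<in> borel_measurable circle_measure")
  case True
  have "circle_esssup f < \<infinity> \<longleftrightarrow> (\<exists>c. circle_esssup f \<le> ereal c)"
    using circle_esssup_nonneg[of f] by (cases "circle_esssup f") auto
  then show ?thesis using True by (simp add: ess_bounded_def circle_esssup_le_iff)
qed (simp add: ess_bounded_def)

lemma circle_esssup_real_le_iff:
  assumes "ess_bounded f"
  shows "real_of_ereal (circle_esssup f) \<le> c \<longleftrightarrow> (AE z in circle_measure. norm (f z) \<le> c)"
proof -
  have "real_of_ereal (circle_esssup f) \<le> c \<longleftrightarrow> circle_esssup f \<le> ereal c"
    using assms circle_esssup_nonneg[of f]
    by (cases "circle_esssup f") (auto simp: ess_bounded_def)
  then show ?thesis
    using assms by (simp add: circle_esssup_le_iff ess_bounded_def)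
qed

lemma ess_bounded_const: "ess_bounded (\<lambda>_. c)"
  unfolding ess_bounded_iff by auto

lemma ess_bounded_add:
  assumes "ess_bounded f" "ess_bounded g"
  shows "ess_bounded (\<lambda>z. f z + g z)"
proof -
  obtain b c where "AE z in circle_measure. norm (f z) \<le> b" "AE z in circle_measure. norm (g z) \<le> c"
    using assms by (auto simp: ess_bounded_iff)
  then have "AE z in circle_measure. norm (f z + g z) \<le> b + c"
    by eventually_elim (rule norm_triangle_mono)
  then show ?thesis using assms unfolding ess_bounded_iff by auto
qed

lemma norm_mult_mono: "norm x \<le> b \<Longrightarrow> norm y \<le> c \<Longrightarrow> norm (x * y) \<le> b * c"
  for x y :: "'a::real_normed_algebra"
  by (rule order_trans[OF norm_mult_ineq])
    (meson mult_mono norm_ge_zero order_trans)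

lemma ess_bounded_mult:
  assumes "ess_bounded f" "ess_bounded g"
  shows "ess_bounded (\<lambda>z. f z * g z)"
proof -
  obtain b c where "AE z in circle_measure. norm (f z) \<le> b" "AE z in circle_measure. norm (g z) \<le> c"
    using assms by (auto simp: ess_bounded_iff)
  then have "AE z in circle_measure. norm (f z * g z) \<le> b * c"
    by eventually_elim (rule norm_mult_mono)
  then show ?thesis using assms unfolding ess_bounded_iff by auto
qed

lemma ess_bounded_uminus: "ess_bounded f \<Longrightarrow> ess_bounded (\<lambda>z. - f z)"
  unfolding ess_bounded_iff by auto

lemma ess_bounded_diff:
  "ess_bounded f \<Longrightarrow> ess_bounded g \<Longrightarrow> ess_bounded (\<lambda>z. f z - g z)"
  using ess_bounded_add[OF _ ess_bounded_uminus, of f g] by simp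

lemma ess_bounded_scaleR: "ess_bounded f \<Longrightarrow> ess_bounded (\<lambda>z. r *\<^sub>R f z)"
  using ess_bounded_mult[OF ess_bounded_const, of f "of_real r"] by (simp add: scaleR_conv_of_real)

definition linf_rel :: "(complex \<Rightarrow> complex) \<Rightarrow> (complex \<Rightarrow> complex) \<Rightarrow> bool" where
  "linf_rel f g \<longleftrightarrow> ess_bounded f \<and> ess_bounded g \<and> (AE z in circle_measure. f z = g z)"

lemma linf_rel_AE_iff:
  assumes "linf_rel f g" and "\<And>z. f z = g z \<Longrightarrow> P z \<longleftrightarrow> Q z"
  shows "(AE z in circle_measure. P z) \<longleftrightarrow> (AE z in circle_measure. Q z)"
proof (rule eventually_subst)
  have "AE z in circle_measure. f z = g z" using assms(1) by (simp add: linf_rel_def)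
  then show "AE z in circle_measure. P z \<longleftrightarrow> Q z"
    by eventually_elim (rule assms(2))
qed

quotient_type linf = "complex \<Rightarrow> complex" / partial: linf_rel
proof (rule part_equivpI)
  show "\<exists>f. linf_rel f f"
    unfolding linf_rel_def using ess_bounded_const by blast
  show "symp linf_rel"
    unfolding linf_rel_def by (auto intro!: sympI elim!: eventually_mono)
  show "transp linf_rel"
  proof (rule transpI)
    fix f g h assume "linf_rel f g" "linf_rel g h"
    then show "linf_rel f h"
      unfolding linf_rel_def by auto
  qed
qed

instantiation linf :: comm_ring_1
begin

lift_definition zero_linf :: linf is "\<lambda>_. 0"
  by (simp add: linf_rel_def ess_bounded_const)

lift_definition one_linf :: linf is "\<lambda>_. 1"
  by (simp add: linf_rel_def ess_bounded_const)

lift_definition plus_linf :: "linf \<Rightarrow> linf \<Rightarrow> linf" is "\<lambda>f g z. f z + g z"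
  unfolding linf_rel_def by (auto intro!: ess_bounded_add)

lift_definition minus_linf :: "linf \<Rightarrow> linf \<Rightarrow> linf" is "\<lambda>f g z. f z - g z"
  unfolding linf_rel_def by (auto intro!: ess_bounded_diff)

lift_definition times_linf :: "linf \<Rightarrow> linf \<Rightarrow> linf" is "\<lambda>f g z. f z * g z"
  unfolding linf_rel_def by (auto intro!: ess_bounded_mult)

lift_definition uminus_linf :: "linf \<Rightarrow> linf" is "\<lambda>f z. - f z"
  unfolding linf_rel_def by (auto intro: ess_bounded_uminus)

instance
proof
  show "(0::linf) \<noteq> 1"
    by transfer (auto simp: linf_rel_def)
qed (transfer; auto simp: linf_rel_def algebra_simps ess_bounded_const
      intro!: ess_bounded_add ess_bounded_mult ess_bounded_diff ess_bounded_uminus)+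

end

instantiation linf :: real_normed_algebra_1
begin

lift_definition scaleR_linf :: "real \<Rightarrow> linf \<Rightarrow> linf" is "\<lambda>r f z. r *\<^sub>R f z"
  unfolding linf_rel_def by (auto intro: ess_bounded_scaleR)

lift_definition norm_linf :: "linf \<Rightarrow> real" is "\<lambda>f. real_of_ereal (circle_esssup f)"
proof -
  fix f g assume *: "linf_rel f g"
  then have "AE z in circle_measure. ereal (norm (f z)) = ereal (norm (g z))"
    unfolding linf_rel_def by (auto elim!: eventually_mono)
  then have "circle_esssup f = circle_esssup g"
    using * unfolding linf_rel_def circle_esssup_def by (intro esssup_AE_cong) auto
  then show "real_of_ereal (circle_esssup f) = real_of_ereal (circle_esssup g)"
    by simp
qed

definition dist_linf :: "linf \<Rightarrow> linf \<Rightarrow> real" where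
  "dist_linf f g = norm (f - g)"

definition sgn_linf :: "linf \<Rightarrow> linf" where
  "sgn_linf f = inverse (norm f) *\<^sub>R f"

definition uniformity_linf :: "(linf \<times> linf) filter" where
  "uniformity_linf = (INF e\<in>{0<..}. principal {(f, g). dist f g < e})"

definition open_linf :: "linf set \<Rightarrow> bool" where
  "open_linf U \<longleftrightarrow> (\<forall>f\<in>U. eventually (\<lambda>(f', g). f' = f \<longrightarrow> g \<in> U) uniformity)"

lift_definition linf_bounded_by :: "linf \<Rightarrow> real \<Rightarrow> bool"
  is "\<lambda>f c. AE z in circle_measure. norm (f z) \<le> c"
  by (intro ext linf_rel_AE_iff) auto

lemma norm_linf_le_iff: "norm f \<le> c \<longleftrightarrow> linf_bounded_by f c" for f :: linf
  by transfer (simp add: linf_rel_def circle_esssup_real_le_iff)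

lemma linf_bounded_by_norm: "linf_bounded_by f (norm f)"
  by (simp flip: norm_linf_le_iff)

lemma norm_linf_scaleR_le: "norm (r *\<^sub>R f) \<le> \<bar>r\<bar> * norm f" for f :: linf
proof -
  have "linf_bounded_by (r *\<^sub>R f) (\<bar>r\<bar> * c)" if "linf_bounded_by f c" for c
    using that by transfer (auto elim!: eventually_mono intro: mult_left_mono)
  then show ?thesis by (simp add: norm_linf_le_iff linf_bounded_by_norm)
qed

instance
proof
  fix f g h :: linf and r s :: real
  show "dist f g = norm (f - g)" by (rule dist_linf_def)
  show "sgn f = inverse (norm f) *\<^sub>R f" by (rule sgn_linf_def)
  show "uniformity = (INF e\<in>{0<..}. principal {(f::linf, g). dist f g < e})"
    by (rule uniformity_linf_def)
  show "open U \<longleftrightarrow> (\<forall>f\<in>U. eventually (\<lambda>(f', g). f' = f \<longrightarrow> g \<in> U) uniformity)" for U :: "linf set"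
    by (rule open_linf_def)
  show "r *\<^sub>R (f + g) = r *\<^sub>R f + r *\<^sub>R g"
    by transfer (auto simp: linf_rel_def algebra_simps intro!: ess_bounded_add ess_bounded_scaleR)
  show "(r + s) *\<^sub>R f = r *\<^sub>R f + s *\<^sub>R f"
    by transfer (auto simp: linf_rel_def algebra_simps intro!: ess_bounded_add ess_bounded_scaleR)
  show "r *\<^sub>R s *\<^sub>R f = (r * s) *\<^sub>R f"
    by transfer (auto simp: linf_rel_def intro!: ess_bounded_scaleR)
  show one: "1 *\<^sub>R f = f" for f :: linf
    by transfer (auto simp: linf_rel_def)
  show "r *\<^sub>R f * g = r *\<^sub>R (f * g)"
    by transfer (auto simp: linf_rel_def intro!: ess_bounded_mult ess_bounded_scaleR)
  show "f * r *\<^sub>R g = r *\<^sub>R (f * g)"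
    by transfer (auto simp: linf_rel_def intro!: ess_bounded_mult ess_bounded_scaleR)
  show "norm f = 0 \<longleftrightarrow> f = 0"
  proof
    assume "norm f = 0"
    then have "linf_bounded_by f 0" using linf_bounded_by_norm[of f] by simp
    then show "f = 0" by transfer (auto simp: linf_rel_def ess_bounded_const)
  next
    assume "f = 0"
    have "norm (0::linf) \<le> 0" unfolding norm_linf_le_iff by transfer simp
    moreover have "norm (0::linf) \<ge> 0" by transfer (simp add: circle_esssup_nonneg real_of_ereal_pos)
    ultimately show "norm f = 0" using \<open>f = 0\<close> by simp
  qed
  show "norm (f + g) \<le> norm f + norm g"
  proof -
    have "linf_bounded_by (f + g) (b + c)" if "linf_bounded_by f b" "linf_bounded_by g c" for b c
      using that by transfer (erule (1) eventually_elim2, rule norm_triangle_mono)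
    then show ?thesis by (simp add: norm_linf_le_iff linf_bounded_by_norm)
  qed
  show "norm (f * g) \<le> norm f * norm g"
  proof -
    have "linf_bounded_by (f * g) (b * c)" if "linf_bounded_by f b" "linf_bounded_by g c" for b c
      using that by transfer (erule (1) eventually_elim2, rule norm_mult_mono)
    then show ?thesis by (simp add: norm_linf_le_iff linf_bounded_by_norm)
  qed
  show "norm (r *\<^sub>R f) = \<bar>r\<bar> * norm f"
  proof (cases "r = 0")
    case True
    have "0 *\<^sub>R f = 0" by transfer (auto simp: linf_rel_def ess_bounded_const)
    moreover have "norm (0 *\<^sub>R f) \<le> 0" using norm_linf_scaleR_le[of 0 f] by simp
    moreover have "norm (0::linf) \<ge> 0" by transfer (simp add: circle_esssup_nonneg real_of_ereal_pos)
    ultimately show ?thesis using True by simp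
  next
    case False
    have "norm ((1 / r) *\<^sub>R (r *\<^sub>R f)) \<le> \<bar>1 / r\<bar> * norm (r *\<^sub>R f)" by (rule norm_linf_scaleR_le)
    moreover have "(1 / r) *\<^sub>R (r *\<^sub>R f) = f"
      using False by transfer (auto simp: linf_rel_def)
    ultimately have "\<bar>r\<bar> * norm f \<le> norm (r *\<^sub>R f)"
      using False by (simp add: field_simps)
    then show ?thesis using norm_linf_scaleR_le[of r f] by simp
  qed
  show "norm (1::linf) = 1"
  proof -
    have "norm (1::linf) = real_of_ereal (circle_esssup (\<lambda>_. 1))"
      by transfer simp
    also have "circle_esssup (\<lambda>_. 1) = 1"
      unfolding circle_esssup_def
      by (subst esssup_const) (simp_all add: circle.emeasure_space_1[simplified] one_ereal_def)
    finally show ?thesis by simp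
  qed
qed

end

lemma linf_Cauchy_bound:
  fixes X :: "nat \<Rightarrow> linf"
  assumes "\<And>e. e > 0 \<Longrightarrow> \<exists>N. \<forall>m\<ge>N. \<forall>n\<ge>N. norm (X m - X n) < e"
  shows "\<exists>L. \<forall>e>0. \<exists>N. \<forall>n\<ge>N. norm (X n - L) \<le> e"
proof -
  define F where "F n = rep_linf (X n)" for n
  have rel: "linf_rel (F n) (F n)" for n
    unfolding F_def by (rule Quotient_rep_reflp[OF Quotient_linf])
  have abs: "abs_linf (F n) = X n" for n
    unfolding F_def by (rule Quotient_abs_rep[OF Quotient_linf])
  have eb: "ess_bounded (F n)" for n using rel by (simp add: linf_rel_def)
  then have [measurable]: "F n \<in> borel_measurable circle_measure" for n
    by (simp add: ess_bounded_def)
  have rel_diff: "linf_rel (\<lambda>z. f z - g z) (\<lambda>z. f z - g z)" if "ess_bounded f" "ess_bounded g" for f g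
    using that by (simp add: linf_rel_def ess_bounded_diff)
  have norm_diff: "norm (abs_linf f - abs_linf g) \<le> c \<longleftrightarrow>
      (AE z in circle_measure. norm (f z - g z) \<le> c)" if "ess_bounded f" "ess_bounded g" for f g c
    using that rel_diff[OF that]
    by (simp add: norm_linf_le_iff minus_linf.abs_eq linf_bounded_by.abs_eq linf_rel_def)
  have "AE z in circle_measure. norm (F m z - F n z) \<le> norm (X m - X n)" for m n
    using norm_diff[OF eb eb, of m n "norm (X m - X n)"] by (simp add: abs)
  then have all: "AE z in circle_measure. \<forall>m n. norm (F m z - F n z) \<le> norm (X m - X n)"
    by (simp add: AE_all_countable)
  define L where "L z = lim (\<lambda>n. F n z)" for z
  have Lmeas [measurable]: "L \<in> borel_measurable circle_measure"
    unfolding L_def by (rule borel_measurable_lim_metric) simp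
  have conv: "(\<lambda>n. F n z) \<longlonglongrightarrow> L z" if "\<forall>m n. norm (F m z - F n z) \<le> norm (X m - X n)" for z
  proof -
    have "Cauchy (\<lambda>n. F n z)"
      unfolding Cauchy_def dist_norm using assms that by (meson le_less_trans)
    then show ?thesis
      unfolding L_def using Cauchy_convergent_iff convergent_LIMSEQ_iff by blast
  qed
  have close: "\<exists>N. \<forall>n\<ge>N. AE z in circle_measure. norm (F n z - L z) \<le> e" if "e > 0" for e
  proof -
    obtain N where N: "\<forall>m\<ge>N. \<forall>n\<ge>N. norm (X m - X n) < e" using assms \<open>e > 0\<close> by blast
    have "AE z in circle_measure. norm (F n z - L z) \<le> e" if "n \<ge> N" for n
      using all
    proof eventually_elim
      case (elim z)
      have "(\<lambda>m. norm (F n z - F m z)) \<longlonglongrightarrow> norm (F n z - L z)"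
        by (intro tendsto_intros conv elim)
      moreover have "norm (F n z - F m z) \<le> e" if "m \<ge> N" for m
        using elim N \<open>n \<ge> N\<close> that by (meson less_imp_le order_trans)
      ultimately show ?case
        by (intro tendsto_upperbound[of _ _ sequentially])
          (auto simp: eventually_sequentially)
    qed
    then show ?thesis by blast
  qed
  have Leb: "ess_bounded L"
  proof -
    obtain N where "AE z in circle_measure. norm (F N z - L z) \<le> 1" using close[of 1] by auto
    then have "ess_bounded (\<lambda>z. F N z - L z)" unfolding ess_bounded_iff by auto
    from ess_bounded_diff[OF eb[of N] this] show ?thesis by simp
  qed
  have "\<exists>N. \<forall>n\<ge>N. norm (X n - abs_linf L) \<le> e" if "e > 0" for e
    using close[OF that] norm_diff[OF eb Leb] by (simp add: abs)
  then show ?thesis by blast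
qed

instance linf :: banach
proof
  fix X :: "nat \<Rightarrow> linf" assume "Cauchy X"
  then have "\<exists>L. \<forall>e>0. \<exists>N. \<forall>n\<ge>N. norm (X n - L) \<le> e"
    by (intro linf_Cauchy_bound) (simp add: Cauchy_def dist_norm)
  then obtain L where L: "\<And>e. e > 0 \<Longrightarrow> \<exists>N. \<forall>n\<ge>N. norm (X n - L) \<le> e" by blast
  have "X \<longlonglongrightarrow> L"
  proof (rule metric_LIMSEQ_I)
    fix e :: real assume "e > 0"
    then obtain N where "\<forall>n\<ge>N. norm (X n - L) \<le> e / 2" using L[of "e / 2"] by auto
    then show "\<exists>N. \<forall>n\<ge>N. dist (X n) L < e"
      using \<open>e > 0\<close> by (intro exI[of _ N]) (fastforce simp: dist_norm)
  qed
  then show "convergent X" by (auto simp: convergent_def)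
qed


section \<open>The Sarason algebra\<close>

lift_definition represented_by :: "linf \<Rightarrow> (complex \<Rightarrow> complex) \<Rightarrow> bool"
  is "\<lambda>\<phi> g. AE z in circle_measure. \<phi> z = g z"
  by (intro ext linf_rel_AE_iff) auto

definition C_circle :: "linf set" where
  "C_circle = {\<phi>. \<exists>g. continuous_on (sphere 0 1) g \<and> represented_by \<phi> g}"

text \<open>Boundary values are radial limits; by Fatou's theorem they exist almost everywhere for every
  bounded holomorphic function on the disk.\<close>

lift_definition boundary_value_of :: "linf \<Rightarrow> (complex \<Rightarrow> complex) \<Rightarrow> bool"
  is "\<lambda>\<phi> f. AE z in circle_measure. ((\<lambda>r::real. f (of_real r * z)) \<longlongrightarrow> \<phi> z) (at_left 1)"
  by (intro ext linf_rel_AE_iff) auto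

definition H_inf :: "linf set" where
  "H_inf = {\<phi>. \<exists>f. f holomorphic_on ball 0 1 \<and> bounded (f ` ball 0 1) \<and> boundary_value_of \<phi> f}"

definition H_inf_plus_C :: "linf set" where
  "H_inf_plus_C = {f + g |f g. f \<in> H_inf \<and> g \<in> C_circle}"

end

theory Submission
  imports Defs "HOL-Complex_Analysis.Complex_Analysis" "HOL-Real_Asymp.Real_Asymp"
begin

text \<open>
  Multiplying by a power of \<open>z\<close> moves an element of \<open>H\<^sup>\<infinity> + C\<close> as close to \<open>H\<^sup>\<infinity>\<close> as we like, and
  \<open>z\<^sup>-\<^sup>n H\<^sup>\<infinity>\<close> lies in \<open>H\<^sup>\<infinity> + C\<close>, so the upper bound reduces to the density of unimodular pairs in
  \<open>H\<^sup>\<infinity>\<close> of the disc. By normal families it is enough to solve the Bezout equation, with bounds depending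
  only on the admitted error, on the windows \<open>(0,1) \<times> (2^-n, 2)\<close> of the upper half-plane.

  There, label the dyadic squares according to whether \<open>g\<close> is small or large, with hysteresis between two very
  different thresholds. Large values of \<open>g\<close> force the label switches, and hence the walls between the two
  regions, to form a Carleson family. Perturb \<open>f\<close> so that it is bounded below at the wall centres and at the
  zeros of \<open>g\<close> in the large region. Away from its zeros near the walls, \<open>f\<close> then absorbs the error made when
  local data are glued across the walls: replace \<open>g\<close> by \<open>g + s e\<close> with \<open>e\<close> a glued indicator of the
  small region, take the glued inverses of \<open>g + s\<close> and of the zero-free part of \<open>g\<close> as coefficients, and
  note that the defect is \<open>O(|f|)\<close>, hence a bounded multiple of \<open>f\<close>. The zeros of \<open>f\<close> near the walls form a
  Blaschke product along a Carleson family, handled by interpolation after one more perturbation of \<open>g\<close>.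

  For the lower bound, \<open>exp(-(1+z)/(1-z)) - 1/2\<close> has zeros accumulating at \<open>1\<close>, whereas an invertible element
  near it would be approximated by \<open>z\<^sup>-\<^sup>n h\<close> with \<open>h\<close> zero-free near \<open>1\<close>.
\<close>

section \<open>Blaschke factors of the upper half-plane\<close>

text \<open>Normal families dictate the shape: the limit exists only if the Bezout coefficients obey
  a bound fixed before f, g and the window. In exchange, a window makes the tree, the walls and all
  Blaschke products finite. Hysteresis is needed because a single threshold would not limit the
  number of label changes. With a lower threshold that is a high power of the upper one, a square in
  which g is large has at most half of its base covered by first squares in which g is uniformly
  tiny, so every second switch loses a factor 2 and the total length of the walls is bounded. The
  Cauchy integrals of the jumps along walls are tamed by a multiple of f in the kernel, but this
  requires f to be bounded below on whole wall squares, whereas a perturbation controls it only at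
  centres. This is why the zeros of f near the walls are split off and returned at the end. The
  perturbations come in a fixed order, each small against the bounds won before. Boundary values
  need Fatou's theorem, obtained here from the almost everywhere differentiability of a
  primitive.\<close>

definition uhp :: "complex set" where "uhp = {z. Im z > 0}"

text \<open>\<open>pk = 1 - \<rho>\<^sup>2\<close> for the pseudo-hyperbolic distance \<open>\<rho>\<close>; it is also a Poisson kernel up to a factor.\<close>

definition pk :: "complex \<Rightarrow> complex \<Rightarrow> real" where
  "pk w z = 4 * Im w * Im z / (cmod (w - cnj z))\<^sup>2"

definition bf :: "complex \<Rightarrow> complex \<Rightarrow> complex" where
  "bf a z = (z - a) / (z - cnj a)"

definition bprod :: "'i set \<Rightarrow> ('i \<Rightarrow> complex) \<Rightarrow> complex \<Rightarrow> complex" where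
  "bprod A p z = (\<Prod>i\<in>A. bf (p i) z)"

lemma open_uhp: "open uhp"
  unfolding uhp_def by (rule open_halfspace_Im_gt)

lemma convex_uhp: "convex uhp"
  unfolding uhp_def by (rule convex_halfspace_Im_gt)

lemma uhp_Im: "z \<in> uhp \<longleftrightarrow> Im z > 0"
  by (simp add: uhp_def)

lemma uhp_cnj_ne: "w \<in> uhp \<Longrightarrow> z \<in> uhp \<Longrightarrow> w - cnj z \<noteq> 0"
  by (auto simp: uhp_def complex_eq_iff)

lemma cmod_cnj_diff: "(cmod (w - cnj z))\<^sup>2 = (cmod (w - z))\<^sup>2 + 4 * Im w * Im z"
  by (simp only: cmod_power2) (simp add: power2_eq_square algebra_simps)

lemma cmod_cnj_swap: "cmod (z - cnj w) = cmod (w - cnj z)"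
proof -
  have "z - cnj w = - cnj (w - cnj z)" by simp
  then show ?thesis by (metis complex_mod_cnj norm_minus_cancel)
qed

lemma pk_sym: "pk w z = pk z w"
  unfolding pk_def by (simp add: cmod_cnj_swap[of z w] mult_ac)

lemma pk_pos: "w \<in> uhp \<Longrightarrow> z \<in> uhp \<Longrightarrow> pk w z > 0"
  using uhp_cnj_ne[of w z] unfolding pk_def uhp_def by auto

lemma pk_bf:
  assumes "w \<in> uhp" "z \<in> uhp" shows "(cmod (bf z w))\<^sup>2 = 1 - pk w z"
proof -
  define D where "D = (cmod (w - cnj z))\<^sup>2"
  have D: "D > 0" using uhp_cnj_ne[OF assms] by (simp add: D_def)
  have "(cmod (bf z w))\<^sup>2 = (D - 4 * Im w * Im z) / D"
    using cmod_cnj_diff[of w z] by (simp add: bf_def norm_divide power_divide D_def)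
  then show ?thesis using D by (simp add: pk_def D_def[symmetric] diff_divide_distrib)
qed

lemma pk_le1: "w \<in> uhp \<Longrightarrow> z \<in> uhp \<Longrightarrow> pk w z \<le> 1"
  using pk_bf[of w z] zero_le_power2[of "cmod (bf z w)"] by linarith

lemma bf_le1: "w \<in> uhp \<Longrightarrow> z \<in> uhp \<Longrightarrow> cmod (bf z w) < 1"
  using pk_bf[of w z] pk_pos[of w z] by (smt (verit) norm_ge_zero one_le_power)

lemma bf_eq0: "w \<in> uhp \<Longrightarrow> z \<in> uhp \<Longrightarrow> bf z w = 0 \<longleftrightarrow> w = z"
  using uhp_cnj_ne[of w z] by (auto simp: bf_def)

lemma bf_hol: "a \<in> uhp \<Longrightarrow> bf a holomorphic_on uhp"
  unfolding bf_def[abs_def] by (intro holomorphic_intros) (use uhp_cnj_ne in auto)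

lemma bprod_hol: "(\<And>i. i \<in> A \<Longrightarrow> p i \<in> uhp) \<Longrightarrow> bprod A p holomorphic_on uhp"
  unfolding bprod_def[abs_def] by (intro holomorphic_intros bf_hol)

lemma bprod_le1: "(\<And>i. i \<in> A \<Longrightarrow> p i \<in> uhp) \<Longrightarrow> w \<in> uhp \<Longrightarrow> cmod (bprod A p w) \<le> 1"
  unfolding bprod_def prod_norm[symmetric] by (intro prod_le_1) (auto intro: less_imp_le[OF bf_le1])

lemma bprod_eq0: "finite A \<Longrightarrow> (\<And>i. i \<in> A \<Longrightarrow> p i \<in> uhp) \<Longrightarrow> w \<in> uhp \<Longrightarrow> bprod A p w = 0 \<longleftrightarrow> (\<exists>i\<in>A. p i = w)"
  unfolding bprod_def by (auto simp: bf_eq0)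

lemma bprod_norm2: "(\<And>i. i \<in> A \<Longrightarrow> p i \<in> uhp) \<Longrightarrow> w \<in> uhp \<Longrightarrow> (cmod (bprod A p w))\<^sup>2 = (\<Prod>i\<in>A. 1 - pk w (p i))"
  unfolding bprod_def prod_norm[symmetric] prod_power_distrib by (intro prod.cong refl pk_bf)

lemma bprod_exp:
  assumes "finite A" "\<And>i. i \<in> A \<Longrightarrow> p i \<in> uhp" "w \<in> uhp"
  shows "(cmod (bprod A p w))\<^sup>2 \<le> exp (- (\<Sum>i\<in>A. pk w (p i)))"
proof -
  have "(\<Prod>i\<in>A. 1 - pk w (p i)) \<le> (\<Prod>i\<in>A. exp (- pk w (p i)))"
    using assms by (intro prod_mono conjI) (auto simp: pk_le1 intro: exp_ge_add_one_self[of "- _", simplified])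
  then show ?thesis using assms by (simp add: bprod_norm2 sum_negf[symmetric] exp_sum)
qed

text \<open>The map \<open>z \<mapsto> (a - cnj a * z) / (1 - z)\<close> inverts \<open>bf a\<close>
  and carries the disc to the half-plane, so that the Schwarz lemma of the disc can be pulled
  back.\<close>

lemma bf_cayley:
  assumes "a \<in> uhp"
  shows "cmod z < 1 \<Longrightarrow> (a - cnj a * z) / (1 - z) \<in> uhp"
    and "w \<in> uhp \<Longrightarrow> (a - cnj a * bf a w) / (1 - bf a w) = w"
proof -
  assume z: "cmod z < 1"
  have z1: "1 - z \<noteq> 0" using z by auto
  have "cmod (1 - z) > 0" using z1 by simp
  have eq: "(a - cnj a * z) / (1 - z) = (a - cnj a * z) * cnj (1 - z) / (of_real ((cmod (1 - z))\<^sup>2))"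
    using z1 by (simp add: complex_norm_square[of "1 - z"] divide_simps mult_ac flip: of_real_power)
  have "Im ((a - cnj a * z) * cnj (1 - z)) = Im a * (1 - (cmod z)\<^sup>2)"
    unfolding cmod_power2 by (simp add: power2_eq_square algebra_simps)
  moreover have "(cmod z)\<^sup>2 < 1" using z by (simp add: abs_square_less_1)
  ultimately have "Im ((a - cnj a * z) * cnj (1 - z)) > 0" using assms by (simp add: uhp_def)
  then show "(a - cnj a * z) / (1 - z) \<in> uhp"
    unfolding eq uhp_def mem_Collect_eq using \<open>cmod (1 - z) > 0\<close>
    by (subst Im_divide_of_real) simp
next
  assume w: "w \<in> uhp"
  have 1: "w - cnj a \<noteq> 0" using uhp_cnj_ne w assms by blast
  have 2: "a - cnj a \<noteq> 0" using uhp_cnj_ne assms by blast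
  have "1 - bf a w = (a - cnj a) / (w - cnj a)" using 1 by (simp add: bf_def field_simps)
  moreover have "a - cnj a * bf a w = w * (a - cnj a) / (w - cnj a)" using 1 by (simp add: bf_def field_simps)
  ultimately show "(a - cnj a * bf a w) / (1 - bf a w) = w" using 1 2 by simp
qed

text \<open>\<open>Schwarz_Lemma\<close> wants a strict bound by 1, so F is first divided by some
  \<open>N > M\<close>; then N decreases to M.\<close>

lemma bf_schwarz:
  assumes F: "F holomorphic_on uhp" and M: "\<And>z. z \<in> uhp \<Longrightarrow> cmod (F z) \<le> M"
    and a: "a \<in> uhp" and Fa: "F a = 0" and w: "w \<in> uhp"
  shows "cmod (F w) \<le> M * cmod (bf a w)"
proof -
  have M0: "M \<ge> 0" using M[OF a] by (meson norm_ge_zero order_trans)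
  have "cmod (F w) \<le> N * cmod (bf a w)" if "N > M" for N
  proof -
    have N: "N > 0" using M0 that by simp
    define G where "G z = F ((a - cnj a * z) / (1 - z)) / of_real N" for z
    have "(\<lambda>z. F ((a - cnj a * z) / (1 - z))) holomorphic_on ball 0 1"
      by (rule holomorphic_on_compose_gen[OF _ F, unfolded o_def])
        (auto intro!: holomorphic_intros bf_cayley(1)[OF a])
    then have G: "G holomorphic_on ball 0 1" unfolding G_def using N by (intro holomorphic_intros) auto
    have G0: "G 0 = 0" using Fa by (simp add: G_def)
    have G1: "cmod (G z) < 1" if "cmod z < 1" for z
      using M[OF bf_cayley(1)[OF a that]] \<open>N > M\<close> N by (simp add: G_def norm_divide)
    have "cmod (G (bf a w)) \<le> cmod (bf a w)"
      by (rule Schwarz_Lemma(1)[OF G G0 G1]) (use bf_le1 w a in auto)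
    then show ?thesis using N by (simp add: G_def bf_cayley(2)[OF a w] norm_divide field_simps)
  qed
  then have *: "N > M \<Longrightarrow> cmod (F w) \<le> N * cmod (bf a w)" for N by blast
  show ?thesis
  proof (rule field_le_epsilon)
    fix e :: real assume e: "e > 0"
    have "cmod (F w) \<le> (M + e) * cmod (bf a w)" using * e by simp
    also have "\<dots> \<le> M * cmod (bf a w) + e" using bf_le1[OF w a] e by (simp add: algebra_simps mult_left_le_one_le)
    finally show "cmod (F w) \<le> M * cmod (bf a w) + e" .
  qed
qed

text \<open>Dividing by a Blaschke factor does not enlarge the sup bound: off a this is
  \<open>bf_schwarz\<close>, at a it follows by continuity. The unchanged M is what allows any
  number of zeros to be removed.\<close>

lemma bf_divide:
  assumes F: "F holomorphic_on uhp" and M: "\<And>z. z \<in> uhp \<Longrightarrow> cmod (F z) \<le> M"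
    and a: "a \<in> uhp" and Fa: "F a = 0"
  obtains Q where "Q holomorphic_on uhp" "\<And>z. z \<in> uhp \<Longrightarrow> F z = bf a z * Q z"
    "\<And>z. z \<in> uhp \<Longrightarrow> cmod (Q z) \<le> M"
proof -
  define Q where "Q z = (if z = a then deriv F a else (F z - F a) / (z - a)) * (z - cnj a)" for z
  have Q: "Q holomorphic_on uhp"
    unfolding Q_def by (intro holomorphic_intros pole_lemma[OF F]) (use a open_uhp in \<open>simp add: interior_open\<close>)
  have eq: "F z = bf a z * Q z" if "z \<in> uhp" for z
    using uhp_cnj_ne[OF that a] Fa by (auto simp: Q_def bf_def)
  have b: "cmod (Q z) \<le> M" if z: "z \<in> uhp" "z \<noteq> a" for z
  proof -
    have "cmod (bf a z) * cmod (Q z) \<le> M * cmod (bf a z)"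
      using bf_schwarz[OF F M a Fa z(1)] unfolding eq[OF z(1)] norm_mult .
    moreover have "cmod (bf a z) > 0" using bf_eq0[OF z(1) a] z by simp
    ultimately show ?thesis by (simp add: mult.commute)
  qed
  have "cmod (Q a) \<le> M"
  proof -
    have "isCont Q a" using Q a open_uhp holomorphic_on_imp_continuous_on continuous_on_eq_continuous_at by blast
    then have "((\<lambda>z. cmod (Q z)) \<longlongrightarrow> cmod (Q a)) (at a)" by (intro tendsto_norm) (simp add: isCont_def)
    moreover have "eventually (\<lambda>z. cmod (Q z) \<le> M) (at a)"
      using eventually_at_in_open[OF open_uhp a] by eventually_elim (use b in auto)
    ultimately show ?thesis by (rule tendsto_upperbound) simp
  qed
  then show ?thesis using that[of Q] Q eq b by metis
qed

lemma bprod_divide: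
  assumes F: "F holomorphic_on uhp" and M: "\<And>z. z \<in> uhp \<Longrightarrow> cmod (F z) \<le> M"
    and A: "finite A" "inj_on p A" "\<And>i. i \<in> A \<Longrightarrow> p i \<in> uhp" "\<And>i. i \<in> A \<Longrightarrow> F (p i) = 0"
  shows "\<exists>Q. Q holomorphic_on uhp \<and> (\<forall>z\<in>uhp. F z = bprod A p z * Q z \<and> cmod (Q z) \<le> M)"
  using A
proof (induction A rule: finite_induct)
  case empty
  then show ?case using F M by (intro exI[of _ F]) (auto simp: bprod_def)
next
  case (insert a A)
  then obtain Q where Q: "Q holomorphic_on uhp" "\<And>z. z\<in>uhp \<Longrightarrow> F z = bprod A p z * Q z" "\<And>z. z\<in>uhp \<Longrightarrow> cmod (Q z) \<le> M"
    by auto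
  have "bprod A p (p a) \<noteq> 0" using insert by (subst bprod_eq0) (auto simp: inj_on_def)
  then have "Q (p a) = 0" using Q(2)[of "p a"] insert.prems by auto
  then obtain R where "R holomorphic_on uhp" "\<And>z. z \<in> uhp \<Longrightarrow> Q z = bf (p a) z * R z" "\<And>z. z \<in> uhp \<Longrightarrow> cmod (R z) \<le> M"
    using bf_divide[OF Q(1) Q(3)] insert.prems by (metis insertI1)
  then show ?case using Q(2) insert(1,2) by (intro exI[of _ R]) (auto simp: bprod_def)
qed

text \<open>Jensen's inequality as a bound on mass: d is at most M times the modulus of the product
  at w, and \<open>bprod_exp\<close> turns this into a bound for all zeros seen from w, whatever
  their number.\<close>

lemma bprod_jensen:
  assumes A: "finite A" "\<And>i. i \<in> A \<Longrightarrow> p i \<in> uhp" and w: "w \<in> uhp"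
    and F: "F w = bprod A p w * Q" "cmod Q \<le> M" "cmod (F w) \<ge> d" "d > 0"
  shows "(\<Sum>i\<in>A. pk w (p i)) \<le> 2 * ln (M / d)"
proof -
  have "d \<le> cmod (bprod A p w) * M"
    using F by (metis mult_left_mono norm_ge_zero norm_mult order_trans)
  moreover have M: "M > 0" using F by (metis calculation less_le_trans mult_le_0_iff norm_ge_zero norm_le_zero_iff not_less)
  ultimately have "(d / M)\<^sup>2 \<le> (cmod (bprod A p w))\<^sup>2" using F(4) by (intro power_mono) (auto simp: field_simps)
  also have "\<dots> \<le> exp (- (\<Sum>i\<in>A. pk w (p i)))" by (rule bprod_exp[OF A w])
  finally have "ln ((d/M)\<^sup>2) \<le> - (\<Sum>i\<in>A. pk w (p i))" using F(4) M
    by (metis divide_pos_pos exp_gt_zero ln_exp ln_le_cancel_iff zero_less_power)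
  moreover have "ln ((d/M)\<^sup>2) = - (2 * ln (M/d))" using F(4) M by (simp add: ln_realpow ln_div)
  ultimately show ?thesis by simp
qed

text \<open>Counting zeros with Jensen's inequality bounds the length of every partial factorization, so a
  longest one removes all zeros in \<open>K\<close>.\<close>

lemma bprod_factor:
  assumes F: "F holomorphic_on uhp" and M: "\<And>z. z \<in> uhp \<Longrightarrow> cmod (F z) \<le> M"
    and w: "w \<in> uhp" "F w \<noteq> 0" and K: "compact K" "K \<subseteq> uhp"
  shows "\<exists>(n::nat) p Q. p ` {..<n} \<subseteq> K \<and> Q holomorphic_on uhp \<and>
     (\<forall>z\<in>uhp. F z = bprod {..<n} p z * Q z \<and> cmod (Q z) \<le> M) \<and> (\<forall>z\<in>K. Q z \<noteq> 0)"
proof -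
  define good where "good n p Q \<longleftrightarrow> p ` {..<n} \<subseteq> K \<and> Q holomorphic_on uhp \<and>
     (\<forall>z\<in>uhp. F z = bprod {..<n} p z * Q z \<and> cmod (Q z) \<le> M)" for n :: nat and p Q
  have "\<exists>c>0. \<forall>z\<in>K. pk w z \<ge> c"
  proof (cases "K = {}")
    case False
    have "continuous_on K (\<lambda>z. pk w z)" unfolding pk_def
      using uhp_cnj_ne[OF w(1)] K by (intro continuous_intros) auto
    then obtain z0 where "z0 \<in> K" "\<forall>z\<in>K. pk w z0 \<le> pk w z"
      using continuous_attains_inf[OF K(1) False] by blast
    then show ?thesis using pk_pos[OF w(1), of z0] K by blast
  qed (auto intro: exI[of _ 1])
  then obtain c where c: "c > 0" "\<And>z. z \<in> K \<Longrightarrow> pk w z \<ge> c" by blast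
  define B where "B = nat \<lceil>2 * ln (M / cmod (F w)) / c\<rceil>"
  have bound: "n \<le> B" if g: "good n p Q" for n p Q
  proof -
    have "(\<Sum>i<n. pk w (p i)) \<le> 2 * ln (M / cmod (F w))"
      using g w K by (intro bprod_jensen[where F = F and Q = "Q w"]) (auto simp: good_def)
    moreover have "(\<Sum>i<n. pk w (p i)) \<ge> (\<Sum>i<n. c)"
      using g by (intro sum_mono c(2)) (auto simp: good_def)
    ultimately have "real n \<le> 2 * ln (M / cmod (F w)) / c" using c by (simp add: field_simps)
    then show ?thesis unfolding B_def by linarith
  qed
  have "good 0 (\<lambda>_. 0) F" using F M by (auto simp: good_def bprod_def)
  then have "\<exists>n. (\<exists>p Q. good n p Q) \<and> (\<forall>m. (\<exists>p Q. good m p Q) \<longrightarrow> m \<le> n)"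
    using Nat.ex_has_greatest_nat[of "\<lambda>n. \<exists>p Q. good n p Q" 0 "B"] bound by (metis)
  then obtain n p Q where g: "good n p Q" and mx: "\<And>m p Q. good m p Q \<Longrightarrow> m \<le> n" by blast
  have "Q z \<noteq> 0" if z: "z \<in> K" for z
  proof
    assume "Q z = 0"
    then obtain R where R: "R holomorphic_on uhp" "\<And>x. x \<in> uhp \<Longrightarrow> Q x = bf z x * R x" "\<And>x. x \<in> uhp \<Longrightarrow> cmod (R x) \<le> M"
      using bf_divide[of Q M z] g z K unfolding good_def by blast
    have "good (Suc n) (p(n := z)) R"
      unfolding good_def
    proof (intro conjI ballI)
      show "(p(n := z)) ` {..<Suc n} \<subseteq> K" using g z by (auto simp: good_def lessThan_Suc)
      fix x assume x: "x \<in> uhp"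
      have "bprod {..<Suc n} (p(n := z)) x = bf z x * bprod {..<n} p x"
        unfolding bprod_def lessThan_Suc by (subst prod.insert) (auto intro!: prod.cong)
      then show "F x = bprod {..<Suc n} (p(n := z)) x * R x" using g x R(2) by (auto simp: good_def)
    qed (use R in auto)
    then show False using mx by fastforce
  qed
  then show ?thesis using g unfolding good_def by blast
qed

section \<open>Interpolation on Carleson families\<close>

text \<open>The conformally invariant form of the Carleson measure condition for the points
  \<open>p i\<close> with masses \<open>Im (p i)\<close>. The index set allows repeated points, that
  is, zeros with multiplicity.\<close>

definition car :: "real \<Rightarrow> 'i set \<Rightarrow> ('i \<Rightarrow> complex) \<Rightarrow> bool" where
  "car K A p \<longleftrightarrow> finite A \<and> (\<forall>i\<in>A. p i \<in> uhp) \<and> (\<forall>w\<in>uhp. (\<Sum>i\<in>A. pk w (p i)) \<le> K)"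

text \<open>Peter Jones's explicit interpolating functions, here without the Blaschke factors.\<close>

definition jones :: "real \<Rightarrow> 'i set \<Rightarrow> ('i \<Rightarrow> complex) \<Rightarrow> 'i \<Rightarrow> complex \<Rightarrow> complex" where
  "jones K A p k z = (2 * \<i> * of_real (Im (p k)) / (z - cnj (p k)))\<^sup>2 *
     exp (- (\<Sum>j\<in>{j\<in>A. Im (p j) \<le> Im (p k)}. 4 * \<i> * of_real (Im (p j)) / (z - cnj (p j))
        - 4 * \<i> * of_real (Im (p j)) / (p k - cnj (p j))) / of_real K)"

lemma Re_jones_exponent: "Re (4 * \<i> * of_real y / (z - cnj p)) = 4 * y * (Im z + Im p) / (cmod (z - cnj p))\<^sup>2"
  by (simp add: Re_divide cmod_power2)

lemma jones_hol:
  assumes "car K A p" "k \<in> A" shows "jones K A p k holomorphic_on uhp"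
proof -
  have "p j \<in> uhp" if "j \<in> A" for j using assms that by (auto simp: car_def)
  then show ?thesis unfolding jones_def[abs_def] using assms(2)
    by (cases "K = 0") (auto intro!: holomorphic_intros simp: uhp_cnj_ne[simplified])
qed

lemma jones_self: "car K A p \<Longrightarrow> k \<in> A \<Longrightarrow> jones K A p k (p k) = 1"
proof -
  assume "car K A p" "k \<in> A"
  then have "Im (p k) > 0" by (auto simp: car_def uhp_def)
  moreover have "p k - cnj (p k) = 2 * \<i> * of_real (Im (p k))" by (simp add: complex_eq_iff)
  ultimately show ?thesis by (simp add: jones_def)
qed

lemma cmod_jones:
  "cmod (jones K A p k z) = 4 * (Im (p k))\<^sup>2 / (cmod (z - cnj (p k)))\<^sup>2 *
     exp (- (\<Sum>j\<in>{j\<in>A. Im (p j) \<le> Im (p k)}. 4 * Im (p j) * (Im z + Im (p j)) / (cmod (z - cnj (p j)))\<^sup>2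
        - 4 * Im (p j) * (Im (p k) + Im (p j)) / (cmod (p k - cnj (p j)))\<^sup>2) / K)"
  unfolding jones_def norm_mult norm_exp_eq_Re
  by (simp only: Re_divide_of_real uminus_complex.sel Re_sum minus_complex.sel Re_jones_exponent)
     (simp add: norm_power norm_divide norm_mult power_divide power_mult_distrib)

text \<open>Each term of the exponent at z dominates \<open>t j\<close>. The terms that normalise
  the function at \<open>p k\<close> involve only points no higher than \<open>p k\<close>, so each
  is at most \<open>2 * pk (p k) (p j)\<close> and together they are at most \<open>2 * K\<close>;
  divided by K this is the factor \<open>exp 2\<close>.\<close>

lemma jones_upper:
  assumes c: "car K A p" and K: "K > 0" and k: "k \<in> A" and z: "z \<in> uhp"
  defines "t \<equiv> \<lambda>j. 4 * (Im (p j))\<^sup>2 / (cmod (z - cnj (p j)))\<^sup>2"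
  shows "cmod (jones K A p k z) \<le> exp 2 * (t k * exp (- (\<Sum>j\<in>{j\<in>A. Im (p j) \<le> Im (p k)}. t j) / K))"
proof -
  let ?S = "{j\<in>A. Im (p j) \<le> Im (p k)}"
  have fin: "finite A" and pu: "\<And>j. j \<in> A \<Longrightarrow> Im (p j) > 0" using c by (auto simp: car_def uhp_def)
  have Iz: "Im z > 0" using z by (simp add: uhp_def)
  have 1: "(\<Sum>j\<in>?S. t j) \<le> (\<Sum>j\<in>?S. 4 * Im (p j) * (Im z + Im (p j)) / (cmod (z - cnj (p j)))\<^sup>2)"
    unfolding t_def power2_eq_square[of "Im _"]
    by (intro sum_mono divide_right_mono) (use pu Iz in \<open>auto simp: algebra_simps intro!: mult_nonneg_nonneg less_imp_le\<close>)
  have "(\<Sum>j\<in>?S. 4 * Im (p j) * (Im (p k) + Im (p j)) / (cmod (p k - cnj (p j)))\<^sup>2)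
     \<le> (\<Sum>j\<in>?S. 2 * pk (p k) (p j))"
    unfolding pk_def times_divide_eq_right
    by (intro sum_mono divide_right_mono) (use pu[OF k] pu in \<open>auto simp: algebra_simps intro!: mult_left_mono\<close>)
  also have "\<dots> \<le> (\<Sum>j\<in>A. 2 * pk (p k) (p j))"
    using fin c k by (intro sum_mono2) (auto intro!: less_imp_le[OF pk_pos] simp: car_def)
  also have "\<dots> \<le> 2 * K" using c k by (auto simp: car_def sum_distrib_left[symmetric])
  finally have 2: "(\<Sum>j\<in>?S. 4 * Im (p j) * (Im (p k) + Im (p j)) / (cmod (p k - cnj (p j)))\<^sup>2) \<le> 2 * K" .
  have "- (\<Sum>j\<in>?S. 4 * Im (p j) * (Im z + Im (p j)) / (cmod (z - cnj (p j)))\<^sup>2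
        - 4 * Im (p j) * (Im (p k) + Im (p j)) / (cmod (p k - cnj (p j)))\<^sup>2) / K \<le> (2 * K - (\<Sum>j\<in>?S. t j)) / K"
    unfolding sum_subtractf using 1 2 K by (intro divide_right_mono) auto
  also have "\<dots> = 2 + - (\<Sum>j\<in>?S. t j) / K" using K by (simp add: field_simps)
  finally have "exp (- (\<Sum>j\<in>?S. 4 * Im (p j) * (Im z + Im (p j)) / (cmod (z - cnj (p j)))\<^sup>2
        - 4 * Im (p j) * (Im (p k) + Im (p j)) / (cmod (p k - cnj (p j)))\<^sup>2) / K) \<le> exp 2 * exp (- (\<Sum>j\<in>?S. t j) / K)"
    by (simp flip: exp_add)
  then have "t k * exp (- (\<Sum>j\<in>?S. 4 * Im (p j) * (Im z + Im (p j)) / (cmod (z - cnj (p j)))\<^sup>2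
        - 4 * Im (p j) * (Im (p k) + Im (p j)) / (cmod (p k - cnj (p j)))\<^sup>2) / K) \<le> t k * (exp 2 * exp (- (\<Sum>j\<in>?S. t j) / K))"
    by (intro mult_left_mono) (auto simp: t_def)
  then show ?thesis unfolding cmod_jones t_def by (simp add: mult_ac)
qed

text \<open>A Riemann sum for \<open>\<integral> exp (- x / K) dx\<close>.\<close>

lemma sum_exp_tail_le:
  fixes t y :: "'i \<Rightarrow> real"
  assumes "finite A" "\<And>i. i \<in> A \<Longrightarrow> t i \<ge> 0" "K > 0"
  shows "(\<Sum>k\<in>A. t k * exp (- (\<Sum>j\<in>{j\<in>A. y j \<le> y k}. t j) / K)) \<le> K * (1 - exp (- (\<Sum>j\<in>A. t j) / K))"
  using assms(1,2)
proof (induction "card A" arbitrary: A)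
  case 0 then show ?case by simp
next
  case (Suc n)
  then have "A \<noteq> {}" by auto
  then have "Max (y ` A) \<in> y ` A" using Suc by (intro Max_in) auto
  then obtain m where m: "m \<in> A" "y m = Max (y ` A)" by auto
  have my: "j \<in> A \<Longrightarrow> y j \<le> y m" for j using m Suc by auto
  define B where "B = A - {m}"
  have B: "finite B" "card B = n" "\<And>i. i \<in> B \<Longrightarrow> t i \<ge> 0" "m \<notin> B" "A = insert m B"
    using Suc m by (auto simp: B_def)
  define S where "S = (\<Sum>j\<in>B. t j)"
  have "{j\<in>A. y j \<le> y m} = A" using my by auto
  then have "(\<Sum>k\<in>A. t k * exp (- (\<Sum>j\<in>{j\<in>A. y j \<le> y k}. t j) / K))
    = t m * exp (- (t m + S) / K) + (\<Sum>k\<in>B. t k * exp (- (\<Sum>j\<in>{j\<in>A. y j \<le> y k}. t j) / K))"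
    using B by (simp add: S_def) (use assms(3) in \<open>auto simp: field_simps\<close>)
  also have "(\<Sum>k\<in>B. t k * exp (- (\<Sum>j\<in>{j\<in>A. y j \<le> y k}. t j) / K)) \<le> (\<Sum>k\<in>B. t k * exp (- (\<Sum>j\<in>{j\<in>B. y j \<le> y k}. t j) / K))"
    using assms(3) Suc B by (intro sum_mono mult_left_mono) (auto intro!: divide_right_mono sum_mono2)
  also have "\<dots> \<le> K * (1 - exp (- S / K))" unfolding S_def by (rule Suc.hyps(1)) (use B in auto)
  also have "t m * exp (- (t m + S) / K) \<le> K * (1 - exp (- t m / K)) * exp (- S / K)"
  proof -
    have "1 + t m / K \<le> exp (t m / K)" by (rule exp_ge_add_one_self)
    then have "(1 + t m / K) * exp (- (t m / K)) \<le> exp (t m / K) * exp (- (t m / K))" by (intro mult_right_mono) auto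
    also have "\<dots> = 1" by (simp flip: exp_add)
    finally have "t m * exp (- t m / K) \<le> K * (1 - exp (- t m / K))" using assms(3) by (simp add: field_simps)
    then have "t m * exp (- t m / K) * exp (- S / K) \<le> K * (1 - exp (- t m / K)) * exp (- S / K)"
      by (rule mult_right_mono) simp
    then show ?thesis by (simp add: mult.assoc add_divide_distrib diff_divide_distrib flip: exp_add)
  qed
  also have "K * (1 - exp (- t m / K)) * exp (- S / K) + K * (1 - exp (- S / K)) = K * (1 - exp (- (t m + S) / K))"
    by (simp add: algebra_simps add_divide_distrib diff_divide_distrib flip: exp_add)
  finally show ?case using B by (simp add: S_def)
qed

text \<open>\<open>jones_upper\<close> brings the sum into the shape of
  \<open>sum_exp_tail_le\<close>, with the points ordered by height. Neither the number of points
  nor their separation enters.\<close>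

lemma jones_sum:
  assumes c: "car K A p" and K: "K > 0" and z: "z \<in> uhp"
  shows "(\<Sum>k\<in>A. cmod (jones K A p k z)) \<le> exp 2 * K"
proof -
  define t where "t = (\<lambda>j. 4 * (Im (p j))\<^sup>2 / (cmod (z - cnj (p j)))\<^sup>2)"
  have "(\<Sum>k\<in>A. cmod (jones K A p k z)) \<le> (\<Sum>k\<in>A. exp 2 * (t k * exp (- (\<Sum>j\<in>{j\<in>A. Im (p j) \<le> Im (p k)}. t j) / K)))"
    unfolding t_def by (intro sum_mono jones_upper assms)
  also have "\<dots> \<le> exp 2 * (K * (1 - exp (- (\<Sum>j\<in>A. t j) / K)))"
    unfolding sum_distrib_left[symmetric] using c K
    by (intro mult_left_mono sum_exp_tail_le) (auto simp: car_def t_def)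
  also have "\<dots> \<le> exp 2 * (K * 1)" using K by (intro mult_left_mono) auto
  finally show ?thesis by simp
qed

text \<open>At heights comparable with that of \<open>p k\<close> the factors
  \<open>Im z + Im (p j)\<close> are at most \<open>(1 + s) * Im z\<close>, so the exponent is
  controlled by the Carleson sum at z; the normalising terms have the favourable sign.\<close>

lemma jones_lower:
  assumes c: "car K A p" and K: "K > 0" and k: "k \<in> A" and z: "z \<in> uhp" and s: "s \<ge> 0" "Im (p k) \<le> s * Im z"
  shows "cmod (jones K A p k z) \<ge> 4 * (Im (p k))\<^sup>2 / (cmod (z - cnj (p k)))\<^sup>2 * exp (- (1 + s))"
proof -
  let ?S = "{j\<in>A. Im (p j) \<le> Im (p k)}"
  have fin: "finite A" and pu: "\<And>j. j \<in> A \<Longrightarrow> Im (p j) > 0" using c by (auto simp: car_def uhp_def)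
  have Iz: "Im z > 0" using z by (simp add: uhp_def)
  have "(\<Sum>j\<in>?S. 4 * Im (p j) * (Im z + Im (p j)) / (cmod (z - cnj (p j)))\<^sup>2) \<le> (\<Sum>j\<in>?S. (1 + s) * pk z (p j))"
    unfolding pk_def times_divide_eq_right
  proof (intro sum_mono divide_right_mono)
    fix j assume j: "j \<in> ?S"
    then have "Im z + Im (p j) \<le> (1 + s) * Im z" using s by (auto simp: algebra_simps)
    then have "(4 * Im (p j)) * (Im z + Im (p j)) \<le> (4 * Im (p j)) * ((1 + s) * Im z)"
      using pu j by (intro mult_left_mono) (auto intro: less_imp_le)
    then show "4 * Im (p j) * (Im z + Im (p j)) \<le> (1 + s) * (4 * Im z * Im (p j))" by (simp add: mult_ac)
  qed auto
  also have "\<dots> \<le> (\<Sum>j\<in>A. (1 + s) * pk z (p j))"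
    using fin c k s z by (intro sum_mono2) (auto intro!: less_imp_le[OF pk_pos] mult_nonneg_nonneg simp: car_def)
  also have "\<dots> \<le> (1 + s) * K" unfolding sum_distrib_left[symmetric] using c z s by (intro mult_left_mono) (auto simp: car_def)
  finally have 1: "(\<Sum>j\<in>?S. 4 * Im (p j) * (Im z + Im (p j)) / (cmod (z - cnj (p j)))\<^sup>2) \<le> (1 + s) * K" .
  have 2: "(\<Sum>j\<in>?S. 4 * Im (p j) * (Im (p k) + Im (p j)) / (cmod (p k - cnj (p j)))\<^sup>2) \<ge> 0"
    using pu[OF k] by (intro sum_nonneg divide_nonneg_nonneg mult_nonneg_nonneg add_nonneg_nonneg) (auto intro: less_imp_le[OF pu])
  have "- (1 + s) = (- ((1 + s) * K)) / K" using K by simp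
  also have "\<dots> \<le> - (\<Sum>j\<in>?S. 4 * Im (p j) * (Im z + Im (p j)) / (cmod (z - cnj (p j)))\<^sup>2
        - 4 * Im (p j) * (Im (p k) + Im (p j)) / (cmod (p k - cnj (p j)))\<^sup>2) / K"
    unfolding sum_subtractf using 1 2 K by (intro divide_right_mono) auto
  finally show ?thesis unfolding cmod_jones by (intro mult_left_mono) auto
qed

section \<open>Separated classes, perturbation at the points of a family, and Bezout equations with
  a Blaschke product\<close>

lemma greedy_colouring:
  assumes "finite A" "\<And>i j. R i j \<Longrightarrow> R j i" "\<And>i. i \<in> A \<Longrightarrow> card {j\<in>A. R i j} \<le> N"
  shows "\<exists>c :: 'i \<Rightarrow> nat. (\<forall>i\<in>A. c i \<le> N) \<and> (\<forall>i\<in>A. \<forall>j\<in>A. i \<noteq> j \<longrightarrow> c i = c j \<longrightarrow> \<not> R i j)"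
  using assms(1,3)
proof (induction A rule: finite_induct)
  case empty then show ?case by simp
next
  case (insert a A)
  have "\<exists>c :: 'i \<Rightarrow> nat. (\<forall>i\<in>A. c i \<le> N) \<and> (\<forall>i\<in>A. \<forall>j\<in>A. i \<noteq> j \<longrightarrow> c i = c j \<longrightarrow> \<not> R i j)"
  proof (rule insert.IH)
    fix i assume "i \<in> A"
    then show "card {j\<in>A. R i j} \<le> N"
      by (intro order_trans[OF card_mono insert.prems[of i]]) (use insert.hyps in auto)
  qed
  then obtain c :: "'i \<Rightarrow> nat" where c0: "(\<forall>i\<in>A. c i \<le> N) \<and> (\<forall>i\<in>A. \<forall>j\<in>A. i \<noteq> j \<longrightarrow> c i = c j \<longrightarrow> \<not> R i j)"
    by (rule exE)
  then have c: "\<And>i. i\<in>A \<Longrightarrow> c i \<le> N" "\<And>i j. i \<in> A \<Longrightarrow> j \<in> A \<Longrightarrow> i \<noteq> j \<Longrightarrow> c i = c j \<Longrightarrow> \<not> R i j"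
    by simp_all
  have "card (c ` {j\<in>A. R a j}) \<le> card {j\<in>A. R a j}" by (rule card_image_le) (use insert in auto)
  also have "\<dots> \<le> card {j\<in>insert a A. R a j}" by (rule card_mono) (use insert in auto)
  also have "\<dots> \<le> N" by (rule insert.prems) auto
  finally have "card (c ` {j\<in>A. R a j}) < card {..N}" by simp
  moreover have "finite (c ` {j\<in>A. R a j})" using insert by auto
  ultimately have "\<not> {..N} \<subseteq> c ` {j\<in>A. R a j}" using card_mono by (metis not_le)
  then obtain x where x: "x \<le> N" "x \<notin> c ` {j\<in>A. R a j}" by auto
  define c' where "c' i = (if i = a then x else c i)" for i
  have xn: "\<not> R a j" if "j \<in> A" "c j = x" for j using x(2) that by blast
  have "\<not> R i j" if ij: "i \<in> insert a A" "j \<in> insert a A" "i \<noteq> j" "c' i = c' j" for i j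
  proof (cases "i = a")
    case True
    then show ?thesis using ij xn[of j] by (simp add: c'_def)
  next
    case i: False
    show ?thesis
    proof (cases "j = a")
      case True
      then have "\<not> R j i" using ij i xn[of i] by (simp add: c'_def)
      then show ?thesis using assms(2) by blast
    next
      case False
      then show ?thesis using ij i c(2)[of i j] by (simp add: c'_def)
    qed
  qed
  moreover have "c' i \<le> N" if "i \<in> insert a A" for i using that x(1) c(1) by (auto simp: c'_def)
  ultimately show ?case by blast
qed

definition ncol :: "real \<Rightarrow> nat" where "ncol K = nat \<lceil>2 * K\<rceil> + 1"

text \<open>The product is the bound found in \<open>separated_interpolation\<close>; the summand 1
  makes the constant at least 1, as the later divisions require.\<close>

definition interpc :: "real \<Rightarrow> real" where "interpc K = 1 + exp (K + 2) * K"

text \<open>A value of \<open>pk\<close> above 3/4 means closeness. Every close point contributes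
  more than 3/4 to the Carleson sum, so there are at most \<open>4/3 * K\<close> of them and the
  greedy colouring needs boundedly many classes.\<close>

lemma car_colouring:
  assumes c: "car K A p"
  shows "\<exists>c :: 'i \<Rightarrow> nat. (\<forall>i\<in>A. c i < ncol K) \<and> (\<forall>i\<in>A. \<forall>j\<in>A. i \<noteq> j \<longrightarrow> c i = c j \<longrightarrow> pk (p i) (p j) \<le> 3/4)"
proof -
  have "\<exists>c :: 'i \<Rightarrow> nat. (\<forall>i\<in>A. c i \<le> nat \<lceil>2 * K\<rceil>) \<and> (\<forall>i\<in>A. \<forall>j\<in>A. i \<noteq> j \<longrightarrow> c i = c j \<longrightarrow> \<not> (pk (p i) (p j) > 3/4))"
  proof (rule greedy_colouring)
    show "finite A" using c by (simp add: car_def)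
    fix i assume i: "i \<in> A"
    let ?S = "{j\<in>A. pk (p i) (p j) > 3/4}"
    have "real (card ?S) * (3/4) = (\<Sum>j\<in>?S. 3/4)" by simp
    also have "\<dots> \<le> (\<Sum>j\<in>?S. pk (p i) (p j))" by (intro sum_mono) auto
    also have "\<dots> \<le> (\<Sum>j\<in>A. pk (p i) (p j))" using c i by (intro sum_mono2) (auto simp: car_def intro!: less_imp_le[OF pk_pos])
    also have "\<dots> \<le> K" using c i by (auto simp: car_def)
    finally have "real (card ?S) \<le> 4/3 * K" by simp
    moreover have "0 \<le> real (card ?S)" by simp
    ultimately show "card ?S \<le> nat \<lceil>2 * K\<rceil>" by linarith
  qed (simp add: pk_sym)
  then show ?thesis unfolding ncol_def by (auto simp: less_Suc_eq_le not_less)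
qed

text \<open>Convexity: on this range the exponential lies below its chord between
  \<open>x = 0\<close> and \<open>x = 3/4\<close>, and \<open>exp (- 3/2) \<le> 1/4\<close> bounds
  the value at the far end.\<close>

lemma exp_m2_le:
  fixes x :: real assumes "0 \<le> x" "x \<le> 3/4" shows "exp (- 2 * x) \<le> 1 - x"
proof -
  have "(4::real) \<le> (1 + 1/2 + (1/2)\<^sup>2 / 2) ^ 3" by (simp add: power2_eq_square power3_eq_cube)
  also have "\<dots> \<le> exp (1/2) ^ 3" by (intro power_mono exp_lower_Taylor_quadratic) auto
  also have "\<dots> = exp (3/2)" by (simp flip: exp_of_nat_mult)
  finally have "exp (- 3/2 :: real) \<le> 1/4" by (simp add: exp_minus field_simps)
  moreover have "convex_on UNIV (exp :: real \<Rightarrow> real)" by (rule exp_convex)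
  then have "exp ((1 - 4/3*x) *\<^sub>R 0 + (4/3*x) *\<^sub>R (- 3/2)) \<le> (1 - 4/3*x) * exp 0 + (4/3*x) * exp (- 3/2)"
    using assms by (intro convex_onD) auto
  moreover have "4/3*x * exp (- 3/2) \<le> 4/3*x * (1/4)" using assms calculation(1) by (intro mult_left_mono) auto
  ultimately show ?thesis by simp
qed

text \<open>Within a separated class the Blaschke product over the other points is at least
  \<open>exp (- K)\<close> at each point, by \<open>exp_m2_le\<close>. Multiplied by it and
  normalised, the Jones function acquires the missing zeros; taking the Jones functions of the whole
  family keeps the sum bounded.\<close>

lemma separated_interpolation:
  assumes c: "car K A p" and K: "K > 0" and B: "B \<subseteq> A"
    and sep: "\<And>i j. i \<in> B \<Longrightarrow> j \<in> B \<Longrightarrow> i \<noteq> j \<Longrightarrow> pk (p i) (p j) \<le> 3/4"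
  shows "\<exists>\<psi>. (\<forall>i\<in>B. \<psi> i holomorphic_on uhp) \<and> (\<forall>i\<in>B. \<forall>j\<in>B. \<psi> i (p j) = (if i = j then 1 else 0)) \<and>
     (\<forall>z\<in>uhp. (\<Sum>i\<in>B. cmod (\<psi> i z)) \<le> interpc K)"
proof -
  have fin: "finite A" "finite B" and pu: "\<And>i. i \<in> A \<Longrightarrow> p i \<in> uhp" using c B by (auto simp: car_def finite_subset)
  define q where "q i = bprod (B - {i}) p" for i
  define \<psi> where "\<psi> i z = jones K A p i z * q i z / q i (p i)" for i z
  have q: "cmod (q i (p i)) \<ge> exp (- K)" if i: "i \<in> B" for i
  proof -
    have "(exp (- K))\<^sup>2 = exp (- 2 * K)" by (simp flip: exp_of_nat_mult)
    also have "\<dots> \<le> exp (\<Sum>j\<in>B-{i}. - 2 * pk (p i) (p j))"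
    proof -
      have "(\<Sum>j\<in>B-{i}. pk (p i) (p j)) \<le> (\<Sum>j\<in>A. pk (p i) (p j))"
        using fin pu B i by (intro sum_mono2) (auto intro!: less_imp_le[OF pk_pos])
      also have "\<dots> \<le> K" using c i B by (auto simp: car_def)
      finally show ?thesis by (simp add: sum_distrib_left[symmetric] sum_negf)
    qed
    also have "\<dots> = (\<Prod>j\<in>B-{i}. exp (- 2 * pk (p i) (p j)))" using fin by (simp add: exp_sum)
    also have "\<dots> \<le> (\<Prod>j\<in>B-{i}. 1 - pk (p i) (p j))"
      using sep i pu B by (intro prod_mono conjI exp_m2_le) (auto intro!: less_imp_le[OF pk_pos])
    also have "\<dots> = (cmod (q i (p i)))\<^sup>2" unfolding q_def using i pu B by (subst bprod_norm2) auto
    finally show ?thesis by (rule power2_le_imp_le) simp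
  qed
  have qpos: "cmod (q i (p i)) > 0" if "i \<in> B" for i using q[OF that] by (meson exp_gt_zero less_le_trans)
  have "\<psi> i holomorphic_on uhp" if "i \<in> B" for i
    unfolding \<psi>_def q_def using that B pu qpos[OF that]
    by (intro holomorphic_intros jones_hol[OF c] bprod_hol) (auto simp: q_def)
  moreover have "\<psi> i (p j) = (if i = j then 1 else 0)" if "i \<in> B" "j \<in> B" for i j
  proof (cases "i = j")
    case True then show ?thesis using that jones_self[OF c] B qpos[of i] by (auto simp: \<psi>_def)
  next
    case False
    then have "q i (p j) = 0" unfolding q_def using that fin pu B by (subst bprod_eq0) auto
    then show ?thesis using False by (simp add: \<psi>_def)
  qed
  moreover have "(\<Sum>i\<in>B. cmod (\<psi> i z)) \<le> interpc K" if z: "z \<in> uhp" for z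
  proof -
    have "(\<Sum>i\<in>B. cmod (\<psi> i z)) \<le> (\<Sum>i\<in>B. exp K * cmod (jones K A p i z))"
    proof (rule sum_mono)
      fix i assume i: "i \<in> B"
      have "cmod (q i z) \<le> 1" unfolding q_def using pu B z by (intro bprod_le1) auto
      have "cmod (\<psi> i z) = cmod (jones K A p i z) * cmod (q i z) * (1 / cmod (q i (p i)))"
        by (simp add: \<psi>_def norm_mult norm_divide)
      also have "\<dots> \<le> cmod (jones K A p i z) * 1 * (1 / exp (- K))"
        using \<open>cmod (q i z) \<le> 1\<close> q[OF i] qpos[OF i] by (intro mult_mono divide_left_mono) (auto simp: mult_left_le)
      finally show "cmod (\<psi> i z) \<le> exp K * cmod (jones K A p i z)" by (simp add: exp_minus mult.commute field_simps)
    qed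
    also have "\<dots> \<le> exp K * (\<Sum>i\<in>A. cmod (jones K A p i z))"
      unfolding sum_distrib_left[symmetric] using fin B by (intro mult_left_mono sum_mono2) auto
    also have "\<dots> \<le> exp K * (exp 2 * K)" using jones_sum[OF c K z] by (intro mult_left_mono) auto
    finally show ?thesis by (simp add: interpc_def exp_add mult_ac)
  qed
  ultimately show ?thesis by blast
qed

lemma interpc_ge1: "K > 0 \<Longrightarrow> interpc K \<ge> 1" by (simp add: interpc_def)

text \<open>Only the points where h is smaller than \<open>t / 2\<close> receive a push of size t;
  the interpolating functions do not interact on the class, so the other values there stay as they
  were.\<close>

lemma perturb_class:
  assumes c: "car K A p" and K: "K > 0" and B: "B \<subseteq> A"
    and sep: "\<And>i j. i \<in> B \<Longrightarrow> j \<in> B \<Longrightarrow> i \<noteq> j \<Longrightarrow> pk (p i) (p j) \<le> 3/4"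
    and h: "h holomorphic_on uhp" and t: "t \<ge> 0"
  shows "\<exists>h'. h' holomorphic_on uhp \<and> (\<forall>z\<in>uhp. cmod (h' z - h z) \<le> interpc K * t) \<and> (\<forall>i\<in>B. cmod (h' (p i)) \<ge> t / 2)"
proof -
  obtain \<psi> where \<psi>: "\<And>i. i\<in>B \<Longrightarrow> \<psi> i holomorphic_on uhp"
    "\<And>i j. i \<in> B \<Longrightarrow> j\<in>B \<Longrightarrow> \<psi> i (p j) = (if i = j then 1 else 0)"
    "\<And>z. z \<in> uhp \<Longrightarrow> (\<Sum>i\<in>B. cmod (\<psi> i z)) \<le> interpc K"
  proof -
    have "\<exists>\<psi>. (\<forall>i\<in>B. \<psi> i holomorphic_on uhp) \<and> (\<forall>i\<in>B. \<forall>j\<in>B. \<psi> i (p j) = (if i = j then 1 else 0)) \<and>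
       (\<forall>z\<in>uhp. (\<Sum>i\<in>B. cmod (\<psi> i z)) \<le> interpc K)"
      by (rule separated_interpolation[OF c K B sep])
    then show ?thesis using that by blast
  qed
  have fin: "finite B" using c B by (auto simp: car_def finite_subset)
  define w :: "'a \<Rightarrow> complex" where "w i = (if cmod (h (p i)) < t / 2 then of_real t else 0)" for i
  define h' where "h' z = h z + (\<Sum>i\<in>B. w i * \<psi> i z)" for z
  have "h' holomorphic_on uhp" unfolding h'_def by (intro holomorphic_intros h \<psi>(1))
  moreover have "cmod (h' z - h z) \<le> interpc K * t" if z: "z \<in> uhp" for z
  proof -
    have "cmod (h' z - h z) \<le> (\<Sum>i\<in>B. cmod (w i * \<psi> i z))" unfolding h'_def by (simp add: norm_sum)
    also have "\<dots> \<le> (\<Sum>i\<in>B. t * cmod (\<psi> i z))" using t by (intro sum_mono) (auto simp: norm_mult w_def intro!: mult_right_mono)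
    also have "\<dots> \<le> t * interpc K" unfolding sum_distrib_left[symmetric] using \<psi>(3)[OF z] t by (intro mult_left_mono)
    finally show ?thesis by (simp add: mult.commute)
  qed
  moreover have "cmod (h' (p i)) \<ge> t / 2" if i: "i \<in> B" for i
  proof -
    have "(\<Sum>j\<in>B. w j * \<psi> j (p i)) = (\<Sum>j\<in>B. if j = i then w j else 0)" using i \<psi>(2) by (intro sum.cong) auto
    then have "h' (p i) = h (p i) + w i" using i fin by (simp add: h'_def)
    moreover have "cmod (h (p i) + of_real t) \<ge> t / 2" if "cmod (h (p i)) < t / 2"
      using norm_diff_ineq[of "of_real t" "h (p i)"] that t by (simp add: add.commute)
    ultimately show ?thesis by (auto simp: w_def)
  qed
  ultimately show ?thesis by blast
qed

text \<open>The colour classes are treated one after the other. Each correction is at most half of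
  the lower bound won so far, so earlier points stay safe; every class divides the bound by
  \<open>4 * interpc K\<close>, and the changes add up to a geometric series below e.\<close>

lemma perturb_aux:
  assumes c: "car K A p" and K: "K > 0" and h: "h holomorphic_on uhp" and e: "e > 0"
    and col: "\<And>i j. i \<in> A \<Longrightarrow> j \<in> A \<Longrightarrow> i \<noteq> j \<Longrightarrow> c i = (c j :: nat) \<Longrightarrow> pk (p i) (p j) \<le> 3/4"
  shows "\<exists>h'. h' holomorphic_on uhp \<and> (\<forall>z\<in>uhp. cmod (h' z - h z) \<le> e * (1 - (1/4)^n)) \<and>
    (\<forall>i\<in>A. c i < n \<longrightarrow> cmod (h' (p i)) \<ge> e / (4 * interpc K) ^ n)"
proof (induction n)
  case 0 then show ?case using h by (intro exI[of _ h]) auto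
next
  case (Suc n)
  define M where "M = interpc K"
  have M: "M \<ge> 1" unfolding M_def by (rule interpc_ge1[OF K])
  define \<kappa> where "\<kappa> = e / (4 * M) ^ n"
  have \<kappa>: "\<kappa> > 0" "\<kappa> \<le> e * (1/4)^n"
  proof -
    have "(4::real) ^ n \<le> (4 * M) ^ n" using M by (intro power_mono) auto
    then have "e / (4 * M) ^ n \<le> e / 4 ^ n" using e by (intro divide_left_mono) auto
    then show "\<kappa> \<le> e * (1/4)^n" by (simp add: \<kappa>_def power_divide)
  qed (use M e in \<open>auto simp: \<kappa>_def\<close>)
  obtain h1 where h1: "h1 holomorphic_on uhp" "\<And>z. z\<in>uhp \<Longrightarrow> cmod (h1 z - h z) \<le> e * (1 - (1/4)^n)"
    "\<And>i. i\<in>A \<Longrightarrow> c i < n \<Longrightarrow> cmod (h1 (p i)) \<ge> \<kappa>" using Suc unfolding \<kappa>_def M_def by blast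
  let ?B = "{i\<in>A. c i = n}"
  obtain h2 where h2: "h2 holomorphic_on uhp" "\<And>z. z\<in>uhp \<Longrightarrow> cmod (h2 z - h1 z) \<le> M * (\<kappa> / (2 * M))"
    "\<And>i. i\<in>?B \<Longrightarrow> cmod (h2 (p i)) \<ge> \<kappa> / (2 * M) / 2"
  proof -
    have "\<exists>h'. h' holomorphic_on uhp \<and> (\<forall>z\<in>uhp. cmod (h' z - h1 z) \<le> interpc K * (\<kappa> / (2 * M))) \<and> (\<forall>i\<in>?B. cmod (h' (p i)) \<ge> \<kappa> / (2 * M) / 2)"
    proof (rule perturb_class[OF c K _ _ h1(1)])
      show "0 \<le> \<kappa> / (2 * M)" using M \<kappa> by simp
    qed (use col in auto)
    then show ?thesis using that unfolding M_def by blast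
  qed
  have d: "cmod (h2 z - h1 z) \<le> \<kappa> / 2" if "z \<in> uhp" for z using h2(2)[OF that] M by simp
  have "cmod (h2 z - h z) \<le> e * (1 - (1/4)^Suc n)" if z: "z \<in> uhp" for z
  proof -
    have "cmod (h2 z - h z) \<le> cmod (h2 z - h1 z) + cmod (h1 z - h z)"
      by (metis add.commute diff_add_cancel group_cancel.sub1 norm_triangle_ineq)
    also have "\<dots> \<le> \<kappa> / 2 + e * (1 - (1/4)^n)" by (intro add_mono d h1(2) z)
    also have "\<dots> \<le> e * (1/4)^n / 2 + e * (1 - (1/4)^n)" using \<kappa> by simp
    also have "\<dots> \<le> e * (1 - (1/4)^Suc n)" using e by (simp add: field_simps)
    finally show ?thesis .
  qed
  moreover have "cmod (h2 (p i)) \<ge> e / (4 * interpc K) ^ Suc n" if i: "i \<in> A" "c i < Suc n" for i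
  proof -
    have k: "e / (4 * interpc K) ^ Suc n = \<kappa> / (4 * M)" by (simp add: \<kappa>_def M_def)
    show ?thesis
    proof (cases "c i = n")
      case True then show ?thesis unfolding k using h2(3)[of i] i by simp
    next
      case False
      then have "\<kappa> \<le> cmod (h1 (p i))" using h1(3) i by auto
      moreover have "cmod (h1 (p i)) \<le> cmod (h2 (p i)) + cmod (h2 (p i) - h1 (p i))"
        by (metis add.commute norm_minus_commute norm_triangle_sub)
      moreover have "cmod (h2 (p i) - h1 (p i)) \<le> \<kappa> / 2" using c i by (intro d) (auto simp: car_def)
      moreover have "\<kappa> / (4 * M) \<le> \<kappa> / 2" using M \<kappa> by (intro divide_left_mono) auto
      ultimately show ?thesis unfolding k by linarith
    qed
  qed
  ultimately show ?case using h2(1) by blast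
qed

definition perturbc :: "real \<Rightarrow> real \<Rightarrow> real" where "perturbc K e = e / (4 * interpc K) ^ ncol K"

lemma perturbc_pos: "K > 0 \<Longrightarrow> e > 0 \<Longrightarrow> perturbc K e > 0"
  using interpc_ge1[of K] by (simp add: perturbc_def)

lemma perturb_off_zero:
  assumes c: "car K A p" and K: "K > 0" and h: "h holomorphic_on uhp" and e: "e > 0"
  shows "\<exists>h'. h' holomorphic_on uhp \<and> (\<forall>z\<in>uhp. cmod (h' z - h z) \<le> e) \<and> (\<forall>i\<in>A. cmod (h' (p i)) \<ge> perturbc K e)"
proof -
  obtain c :: "'a \<Rightarrow> nat" where c0: "(\<forall>i\<in>A. c i < ncol K) \<and> (\<forall>i\<in>A. \<forall>j\<in>A. i \<noteq> j \<longrightarrow> c i = c j \<longrightarrow> pk (p i) (p j) \<le> 3/4)"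
    using car_colouring[OF c] by (rule exE)
  then have c': "\<And>i. i\<in>A \<Longrightarrow> c i < ncol K" "\<And>i j. i\<in>A \<Longrightarrow> j \<in> A \<Longrightarrow> i \<noteq> j \<Longrightarrow> c i = c j \<Longrightarrow> pk (p i) (p j) \<le> 3/4"
    by simp_all
  have "\<exists>h'. h' holomorphic_on uhp \<and> (\<forall>z\<in>uhp. cmod (h' z - h z) \<le> e * (1 - (1/4)^ncol K)) \<and>
    (\<forall>i\<in>A. c i < ncol K \<longrightarrow> cmod (h' (p i)) \<ge> e / (4 * interpc K) ^ ncol K)"
    by (rule perturb_aux[OF c K h e c'(2)])
  then obtain h' where h': "h' holomorphic_on uhp" "\<And>z. z\<in>uhp \<Longrightarrow> cmod (h' z - h z) \<le> e * (1 - (1/4)^ncol K)"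
    "\<And>i. i\<in>A \<Longrightarrow> c i < ncol K \<Longrightarrow> cmod (h' (p i)) \<ge> e / (4 * interpc K) ^ ncol K"
    by auto
  have "e * (1 - (1/4)^ncol K) \<le> e" using e by (simp add: algebra_simps)
  then show ?thesis using h' c'(1) unfolding perturbc_def by (meson order_trans)
qed

text \<open>On one class, y interpolates \<open>1 / h\<close>, so \<open>1 - y * h\<close> vanishes
  there and is divisible by the product of the class without loss in the bound. Multiplying the
  relations of two classes gives one for their union; \<open>1 + L * cmod (Y z)\<close> is
  submultiplicative under this step and is therefore the quantity carried along.\<close>

lemma bezout_bprod_aux:
  assumes c: "car K A p" and K: "K > 0" and h: "h holomorphic_on uhp"
    and L: "L > 0" "\<And>z. z \<in> uhp \<Longrightarrow> cmod (h z) \<le> L"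
    and k: "k > 0" "\<And>i. i \<in> A \<Longrightarrow> cmod (h (p i)) \<ge> k"
    and col: "\<And>i j. i \<in> A \<Longrightarrow> j \<in> A \<Longrightarrow> i \<noteq> j \<Longrightarrow> c i = (c j :: nat) \<Longrightarrow> pk (p i) (p j) \<le> 3/4"
  shows "\<exists>X Y. X holomorphic_on uhp \<and> Y holomorphic_on uhp \<and>
    (\<forall>z\<in>uhp. X z * bprod {i\<in>A. c i < n} p z + Y z * h z = 1 \<and> cmod (X z) \<le> (1 + L * (interpc K / k)) ^ n
       \<and> 1 + L * cmod (Y z) \<le> (1 + L * (interpc K / k)) ^ n)"
proof (induction n)
  case 0 then show ?case by (rule exI[of _ "\<lambda>_. 1"], rule exI[of _ "\<lambda>_. 0"]) (auto simp: bprod_def)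
next
  case (Suc n)
  define \<mu> where "\<mu> = interpc K / k"
  have \<mu>: "\<mu> > 0" unfolding \<mu>_def using interpc_ge1[OF K] k by auto
  have fin: "finite A" and pu: "\<And>i. i \<in> A \<Longrightarrow> p i \<in> uhp" using c by (auto simp: car_def)
  obtain X Y where XY: "X holomorphic_on uhp" "Y holomorphic_on uhp"
    "\<And>z. z \<in> uhp \<Longrightarrow> X z * bprod {i\<in>A. c i < n} p z + Y z * h z = 1"
    "\<And>z. z \<in> uhp \<Longrightarrow> cmod (X z) \<le> (1 + L * \<mu>) ^ n"
    "\<And>z. z \<in> uhp \<Longrightarrow> 1 + L * cmod (Y z) \<le> (1 + L * \<mu>) ^ n"
    using Suc unfolding \<mu>_def by blast
  let ?B = "{i\<in>A. c i = n}"
  obtain \<psi> where \<psi>: "\<And>i. i\<in>?B \<Longrightarrow> \<psi> i holomorphic_on uhp"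
    "\<And>i j. i \<in> ?B \<Longrightarrow> j\<in>?B \<Longrightarrow> \<psi> i (p j) = (if i = j then 1 else 0)"
    "\<And>z. z \<in> uhp \<Longrightarrow> (\<Sum>i\<in>?B. cmod (\<psi> i z)) \<le> interpc K"
  proof -
    have "\<exists>\<psi>. (\<forall>i\<in>?B. \<psi> i holomorphic_on uhp) \<and> (\<forall>i\<in>?B. \<forall>j\<in>?B. \<psi> i (p j) = (if i = j then 1 else 0)) \<and>
       (\<forall>z\<in>uhp. (\<Sum>i\<in>?B. cmod (\<psi> i z)) \<le> interpc K)"
      by (rule separated_interpolation[OF c K]) (use col in auto)
    then show ?thesis using that by blast
  qed
  define y where "y z = (\<Sum>i\<in>?B. \<psi> i z / h (p i))" for z
  have y: "y holomorphic_on uhp" unfolding y_def using k by (intro holomorphic_intros \<psi>(1)) force+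
  have ymu: "cmod (y z) \<le> \<mu>" if z: "z \<in> uhp" for z
  proof -
    have "cmod (y z) \<le> (\<Sum>i\<in>?B. cmod (\<psi> i z / h (p i)))" unfolding y_def by (rule norm_sum)
    also have "\<dots> \<le> (\<Sum>i\<in>?B. cmod (\<psi> i z) / k)" unfolding norm_divide using k
      by (intro sum_mono divide_left_mono) (auto intro!: mult_pos_pos intro: less_le_trans)
    also have "\<dots> \<le> interpc K / k" unfolding sum_divide_distrib[symmetric] using \<psi>(3)[OF z] k by (intro divide_right_mono) auto
    finally show ?thesis by (simp add: \<mu>_def)
  qed
  have yh: "cmod (1 - y z * h z) \<le> 1 + L * \<mu>" if z: "z \<in> uhp" for z
  proof -
    have "cmod (y z * h z) \<le> \<mu> * L" unfolding norm_mult using ymu[OF z] L(2)[OF z] \<mu> by (intro mult_mono) auto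
    then show ?thesis using norm_triangle_ineq4[of 1 "y z * h z"] by (simp add: mult.commute)
  qed
  have hol1: "(\<lambda>z. 1 - y z * h z) holomorphic_on uhp" by (intro holomorphic_intros y h)
  have inj: "inj_on p ?B"
  proof (rule inj_onI)
    fix i j assume ij: "i \<in> ?B" "j \<in> ?B" "p i = p j"
    have "pk (p i) (p i) = 1" using pk_bf[of "p i" "p i"] pu ij bf_eq0[of "p i" "p i"] by auto
    then show "i = j" using col[of i j] ij by auto
  qed
  have van: "1 - y (p i) * h (p i) = 0" if i: "i \<in> ?B" for i
  proof -
    have "y (p i) = (\<Sum>j\<in>?B. if j = i then 1 / h (p i) else 0)" unfolding y_def using i \<psi>(2) by (intro sum.cong) auto
    also have "\<dots> = 1 / h (p i)" using i fin by simp
    finally show ?thesis using k i by force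
  qed
  obtain Q where Q: "Q holomorphic_on uhp" "\<And>z. z \<in> uhp \<Longrightarrow> 1 - y z * h z = bprod ?B p z * Q z" "\<And>z. z \<in> uhp \<Longrightarrow> cmod (Q z) \<le> 1 + L * \<mu>"
  proof -
    have "\<exists>Q. Q holomorphic_on uhp \<and> (\<forall>z\<in>uhp. 1 - y z * h z = bprod ?B p z * Q z \<and> cmod (Q z) \<le> 1 + L * \<mu>)"
      by (rule bprod_divide[OF hol1 yh _ inj]) (use fin pu van in auto)
    then show ?thesis using that by blast
  qed
  have spl: "bprod {i\<in>A. c i < Suc n} p z = bprod {i\<in>A. c i < n} p z * bprod ?B p z" for z
  proof -
    have "{i\<in>A. c i < Suc n} = {i\<in>A. c i < n} \<union> ?B" by auto
    then show ?thesis unfolding bprod_def using fin by (simp only:) (subst prod.union_disjoint, auto)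
  qed
  define X' where "X' z = X z * Q z" for z
  define Y' where "Y' z = Y z + y z - Y z * y z * h z" for z
  show ?case unfolding \<mu>_def[symmetric]
  proof (rule exI[of _ X'], rule exI[of _ Y'], intro conjI ballI)
    show "X' holomorphic_on uhp" "Y' holomorphic_on uhp" unfolding X'_def Y'_def by (intro holomorphic_intros XY Q y h)+
    fix z assume z: "z \<in> uhp"
    have "(1 - Y z * h z) * (1 - y z * h z) = X z * bprod {i\<in>A. c i < n} p z * (bprod ?B p z * Q z)"
      using XY(3)[OF z] Q(2)[OF z] by (metis add_diff_cancel_right')
    then show "X' z * bprod {i\<in>A. c i < Suc n} p z + Y' z * h z = 1"
      unfolding spl X'_def Y'_def by (simp add: algebra_simps)
    show "cmod (X' z) \<le> (1 + L * \<mu>) ^ Suc n"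
      unfolding X'_def norm_mult power_Suc2 using XY(4)[OF z] Q(3)[OF z] by (intro mult_mono) (auto intro: order_trans[OF norm_ge_zero])
    have "cmod (Y' z) \<le> cmod (Y z) + cmod (y z) + cmod (Y z) * cmod (y z) * L"
    proof -
      have "cmod (Y' z) \<le> cmod (Y z + y z) + cmod (Y z * y z * h z)" unfolding Y'_def by (rule norm_triangle_ineq4)
      also have "\<dots> \<le> (cmod (Y z) + cmod (y z)) + cmod (Y z) * cmod (y z) * L"
        unfolding norm_mult using L(2)[OF z] by (intro add_mono norm_triangle_ineq mult_left_mono) auto
      finally show ?thesis .
    qed
    then have "1 + L * cmod (Y' z) \<le> 1 + L * (cmod (Y z) + cmod (y z) + cmod (Y z) * cmod (y z) * L)"
      using L by (intro add_left_mono mult_left_mono) auto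
    also have "\<dots> = (1 + L * cmod (Y z)) * (1 + L * cmod (y z))" by (simp add: algebra_simps)
    also have "\<dots> \<le> (1 + L * \<mu>) ^ n * (1 + L * \<mu>)"
      using XY(5)[OF z] ymu[OF z] L \<mu> by (intro mult_mono) auto
    finally show "1 + L * cmod (Y' z) \<le> (1 + L * \<mu>) ^ Suc n" by (simp add: mult.commute)
  qed
qed

text \<open>The factor \<open>1 + 1 / L\<close> lets one constant dominate the bound for X and the
  bound for Y, which is smaller by the factor L.\<close>

definition bezoutc :: "real \<Rightarrow> real \<Rightarrow> real \<Rightarrow> real" where
  "bezoutc K L k = (1 + L * (interpc K / k)) ^ ncol K * (1 + 1 / L)"

lemma bezout_bprod:
  assumes c: "car K A p" and K: "K > 0" and h: "h holomorphic_on uhp"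
    and L: "L > 0" "\<And>z. z \<in> uhp \<Longrightarrow> cmod (h z) \<le> L"
    and k: "k > 0" "\<And>i. i \<in> A \<Longrightarrow> cmod (h (p i)) \<ge> k"
  shows "\<exists>X Y. X holomorphic_on uhp \<and> Y holomorphic_on uhp \<and>
    (\<forall>z\<in>uhp. X z * bprod A p z + Y z * h z = 1 \<and> cmod (X z) \<le> bezoutc K L k \<and> cmod (Y z) \<le> bezoutc K L k)"
proof -
  obtain c :: "'a \<Rightarrow> nat" where c0: "(\<forall>i\<in>A. c i < ncol K) \<and> (\<forall>i\<in>A. \<forall>j\<in>A. i \<noteq> j \<longrightarrow> c i = c j \<longrightarrow> pk (p i) (p j) \<le> 3/4)"
    using car_colouring[OF c] by (rule exE)
  then have c': "\<And>i. i\<in>A \<Longrightarrow> c i < ncol K" "\<And>i j. i\<in>A \<Longrightarrow> j \<in> A \<Longrightarrow> i \<noteq> j \<Longrightarrow> c i = c j \<Longrightarrow> pk (p i) (p j) \<le> 3/4"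
    by simp_all
  define D where "D = (1 + L * (interpc K / k)) ^ ncol K"
  have D: "D \<ge> 1" unfolding D_def using interpc_ge1[OF K] L k by (intro one_le_power) auto
  have "\<exists>X Y. X holomorphic_on uhp \<and> Y holomorphic_on uhp \<and>
    (\<forall>z\<in>uhp. X z * bprod {i\<in>A. c i < ncol K} p z + Y z * h z = 1 \<and> cmod (X z) \<le> (1 + L * (interpc K / k)) ^ ncol K
       \<and> 1 + L * cmod (Y z) \<le> (1 + L * (interpc K / k)) ^ ncol K)"
    by (rule bezout_bprod_aux[OF c K h L k c'(2)])
  then obtain X Y where XY: "X holomorphic_on uhp" "Y holomorphic_on uhp"
    "\<And>z. z \<in> uhp \<Longrightarrow> X z * bprod {i\<in>A. c i < ncol K} p z + Y z * h z = 1"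
    "\<And>z. z \<in> uhp \<Longrightarrow> cmod (X z) \<le> D" "\<And>z. z \<in> uhp \<Longrightarrow> 1 + L * cmod (Y z) \<le> D"
    unfolding D_def by auto
  have "{i\<in>A. c i < ncol K} = A" using c'(1) by auto
  moreover have "D \<le> bezoutc K L k" unfolding bezoutc_def D_def[symmetric] using D L by (simp add: mult_le_cancel_left1)
  moreover have "D / L \<le> bezoutc K L k" unfolding bezoutc_def D_def[symmetric] using D L by (simp add: field_simps)
  moreover have "cmod (Y z) \<le> D / L" if "z \<in> uhp" for z using XY(5)[OF that] L by (simp add: field_simps)
  ultimately have "cmod (X z) \<le> bezoutc K L k" "cmod (Y z) \<le> bezoutc K L k" "X z * bprod A p z + Y z * h z = 1" if "z \<in> uhp" for z
    using XY(3,4)[OF that] that order_trans by (metis, metis, metis)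
  then show ?thesis using XY(1,2) by blast
qed

section \<open>Dyadic nodes\<close>

text \<open>The node \<open>(m, j)\<close> stands for the dyadic interval \<open>[j / 2^m, (j + 1) / 2^m)\<close> and for the square of
  side \<open>2^-m\<close> above it whose lower edge is at height \<open>2^-m\<close>.\<close>

definition side :: "nat \<Rightarrow> real" where "side m = 1 / 2 ^ m"

definition cen :: "nat \<times> nat \<Rightarrow> complex" where
  "cen J = Complex ((real (snd J) + 1/2) * side (fst J)) (3/2 * side (fst J))"

text \<open>The tree order with the ancestor as first argument; it is reflexive, so packing sums
  include the node itself.\<close>

definition below :: "nat \<times> nat \<Rightarrow> nat \<times> nat \<Rightarrow> bool" where
  "below I J \<longleftrightarrow> fst I \<le> fst J \<and> snd J div 2 ^ (fst J - fst I) = snd I"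

text \<open>The Carleson packing condition in dyadic form. Nodes are attached to indices so that
  several zeros may share a node; the bound on \<open>snd\<close> keeps all nodes over the unit
  interval.\<close>

definition npack :: "real \<Rightarrow> 'a set \<Rightarrow> ('a \<Rightarrow> nat \<times> nat) \<Rightarrow> bool" where
  "npack K A nd \<longleftrightarrow> finite A \<and> (\<forall>a\<in>A. snd (nd a) < 2 ^ fst (nd a)) \<and>
     (\<forall>I. (\<Sum>a\<in>{a\<in>A. below I (nd a)}. side (fst (nd a))) \<le> K * side (fst I))"

lemma side_pos [simp]: "side m > 0" by (simp add: side_def)
lemma side_ge0 [simp]: "side m \<ge> 0" by (simp add: side_def)
lemma side_ne0 [simp]: "side m \<noteq> 0" by (simp add: side_def)
lemma side_Suc: "side (Suc m) = side m / 2" by (simp add: side_def)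
lemma side_0 [simp]: "side 0 = 1" by (simp add: side_def)
lemma side_add: "side (m + k) = side m * side k" by (simp add: side_def power_add)
lemma side_le_iff: "side m \<le> side l \<longleftrightarrow> l \<le> m" by (simp add: side_def field_simps)
lemma Im_cen: "Im (cen J) = 3/2 * side (fst J)" by (simp add: cen_def)
lemma Re_cen: "Re (cen J) = (real (snd J) + 1/2) * side (fst J)" by (simp add: cen_def)
lemma side_2pow: "side k * 2 ^ k = 1" by (simp add: side_def)

lemma cen_uhp: "cen J \<in> uhp" by (simp add: uhp_def Im_cen)

lemma below_Re:
  assumes "below I J"
  shows "real (snd I) * side (fst I) \<le> Re (cen J)" "Re (cen J) < (real (snd I) + 1) * side (fst I)"
proof -
  define k where "k = fst J - fst I"
  have J: "fst J = fst I + k" and d: "snd J div 2 ^ k = snd I" using assms by (auto simp: below_def k_def)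
  have "snd I * 2 ^ k \<le> snd J" unfolding d[symmetric] by (metis div_mult_mod_eq le_add1)
  moreover have "snd J < (snd I + 1) * 2 ^ k" using d dividend_less_div_times[of "2 ^ k" "snd J"] by simp
  ultimately have 1: "snd I * 2 ^ k \<le> snd J" "snd J + 1 \<le> (snd I + 1) * 2 ^ k" by simp_all
  have "real (snd I) * 2 ^ k \<le> real (snd J)" using of_nat_mono[OF 1(1), where ?'a = real] by simp
  moreover have "real (snd J) + 1 \<le> (real (snd I) + 1) * 2 ^ k"
    using of_nat_mono[OF 1(2), where ?'a = real] by (simp add: algebra_simps)
  ultimately have 2: "real (snd I) \<le> real (snd J) * side k" "(real (snd J) + 1) * side k \<le> real (snd I) + 1"
    by (simp_all add: side_def field_simps)
  have "real (snd I) \<le> (real (snd J) + 1/2) * side k" using 2(1) by (simp add: algebra_simps add_increasing2)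
  then show "real (snd I) * side (fst I) \<le> Re (cen J)"
    using mult_right_mono[of _ _ "side (fst I)"] by (auto simp: Re_cen J side_add mult_ac)
  have "(real (snd J) + 1/2) * side k < (real (snd J) + 1) * side k" by (intro mult_strict_right_mono) auto
  then have "(real (snd J) + 1/2) * side k < real (snd I) + 1" using 2(2) by linarith
  then show "Re (cen J) < (real (snd I) + 1) * side (fst I)"
    using mult_strict_right_mono[of _ _ "side (fst I)"] by (auto simp: Re_cen J side_add mult_ac)
qed

lemma card_near_floor: "card {i::nat. x - 2 < real i \<and> real i \<le> x + 1} \<le> 3 \<and> finite {i::nat. x - 2 < real i \<and> real i \<le> x + 1}"
proof -
  let ?S = "{i::nat. x - 2 < real i \<and> real i \<le> x + 1}"
  have sub: "int ` ?S \<subseteq> {\<lfloor>x\<rfloor> - 1..\<lfloor>x\<rfloor> + 1}"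
  proof
    fix y assume "y \<in> int ` ?S"
    then obtain i where "y = int i" "x - 2 < real i" "real i \<le> x + 1" by auto
    then show "y \<in> {\<lfloor>x\<rfloor> - 1..\<lfloor>x\<rfloor> + 1}" by auto linarith+
  qed
  have "finite (int ` ?S)" using sub finite_subset by blast
  then have "finite ?S" by (rule finite_imageD) auto
  moreover have "card ?S = card (int ` ?S)" by (rule card_image[symmetric]) auto
  moreover have "card (int ` ?S) \<le> card {\<lfloor>x\<rfloor> - 1..\<lfloor>x\<rfloor> + 1}" by (rule card_mono[OF _ sub]) auto
  ultimately show ?thesis by simp
qed

lemma sum_UNION_le:
  fixes f :: "'a \<Rightarrow> real"
  assumes "finite I" "\<And>i. i \<in> I \<Longrightarrow> finite (B i)" "\<And>x. f x \<ge> 0"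
  shows "sum f (\<Union>i\<in>I. B i) \<le> (\<Sum>i\<in>I. sum f (B i))"
  using assms(1,2)
proof (induction I rule: finite_induct)
  case (insert i I)
  have "sum f (B i \<union> (\<Union>j\<in>I. B j)) \<le> sum f (B i) + sum f (\<Union>j\<in>I. B j)"
    using sum.union_inter[of "B i" "\<Union>j\<in>I. B j" f] insert sum_nonneg[of "B i \<inter> (\<Union>j\<in>I. B j)" f] assms(3) by simp
  then show ?case using insert by simp
qed simp

text \<open>Choose the dyadic length with \<open>H \<le> side l < 2 * H\<close>. At most three
  intervals of this length reach the given one, each carrying \<open>K * side l\<close>; hence
  \<open>6 = 3 * 2\<close>. For \<open>H \<ge> 1\<close> the root alone suffices.\<close>

lemma npack_box:
  assumes np: "npack K A nd" and K: "K \<ge> 0" and H: "H > 0"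
  shows "(\<Sum>a\<in>{a\<in>A. \<bar>Re (cen (nd a)) - u\<bar> \<le> H \<and> side (fst (nd a)) \<le> H}. side (fst (nd a))) \<le> 6 * K * H"
proof -
  let ?B = "{a\<in>A. \<bar>Re (cen (nd a)) - u\<bar> \<le> H \<and> side (fst (nd a)) \<le> H}"
  have fin: "finite A" using np by (simp add: npack_def)
  show ?thesis
  proof (cases "H \<ge> 1")
    case True
    have "(\<Sum>a\<in>?B. side (fst (nd a))) \<le> (\<Sum>a\<in>{a\<in>A. below (0,0) (nd a)}. side (fst (nd a)))"
      using fin np by (intro sum_mono2) (auto simp: below_def npack_def)
    also have "\<dots> \<le> K * side (fst (0::nat, 0::nat))" using np unfolding npack_def by blast
    also have "\<dots> \<le> 6 * K * H" using True K mult_mono[of 1 "6 * H" K K] by (simp add: mult_ac)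
    finally show ?thesis .
  next
    case False
    obtain n0 where "(1/2::real) ^ n0 < H" using real_arch_pow_inv[OF H, of "1/2"] by auto
    then have ex: "side n0 < H" by (simp add: side_def power_one_over)
    define n where "n = (LEAST n. side n < H)"
    have n: "side n < H" "\<And>k. k < n \<Longrightarrow> \<not> side k < H"
      unfolding n_def using ex by (auto intro: LeastI dest: not_less_Least)
    have "n \<noteq> 0" using n(1) False by (intro notI) simp
    then obtain l where l: "n = Suc l" by (cases n) auto
    have lH: "H \<le> side l" "side l < 2 * H" using n(2)[of l] n(1) l by (auto simp: side_Suc)
    define x where "x = u / side l"
    let ?I = "{i::nat. x - 2 < real i \<and> real i \<le> x + 1}"
    have sub: "?B \<subseteq> (\<Union>i\<in>?I. {a\<in>A. below (l,i) (nd a)})"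
    proof
      fix a assume a: "a \<in> ?B"
      define i where "i = snd (nd a) div 2 ^ (fst (nd a) - l)"
      have "side (fst (nd a)) \<le> side l" using a lH by auto
      then have b: "below (l,i) (nd a)" by (simp add: below_def i_def side_le_iff)
      have "real i * side l \<le> u + side l" "u - side l < (real i + 1) * side l"
        using below_Re[OF b] a lH by auto
      then have "real i \<le> x + 1" "x - 2 < real i"
        by (simp_all add: x_def field_simps)
      then show "a \<in> (\<Union>i\<in>?I. {a\<in>A. below (l,i) (nd a)})" using b a by auto
    qed
    have "(\<Sum>a\<in>?B. side (fst (nd a))) \<le> (\<Sum>a\<in>(\<Union>i\<in>?I. {a\<in>A. below (l,i) (nd a)}). side (fst (nd a)))"
      using fin sub by (intro sum_mono2) (auto intro: finite_subset[of _ A])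
    also have "\<dots> \<le> (\<Sum>i\<in>?I. \<Sum>a\<in>{a\<in>A. below (l,i) (nd a)}. side (fst (nd a)))"
      using fin card_near_floor[of x] by (intro sum_UNION_le) auto
    also have "\<dots> \<le> (\<Sum>i\<in>?I. K * side l)"
      using np unfolding npack_def by (intro sum_mono) (metis fst_conv)
    also have "\<dots> = real (card ?I) * (K * side l)" by simp
    also have "\<dots> \<le> 3 * (K * side l)" using card_near_floor[of x] K by (intro mult_right_mono) auto
    also have "\<dots> \<le> 3 * (K * (2 * H))" using K lH by (intro mult_left_mono) auto
    finally show ?thesis by simp
  qed
qed

lemma near_cen:
  assumes "q \<in> cball (cen J) (9/10 * side (fst J))"
  shows "Im q \<ge> 3/5 * side (fst J)" "Im q \<le> 12/5 * side (fst J)" "\<bar>Re q - Re (cen J)\<bar> \<le> 9/10 * side (fst J)" "q \<in> uhp"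
proof -
  have "cmod (q - cen J) \<le> 9/10 * side (fst J)" using assms by (simp add: dist_norm norm_minus_commute)
  then have 1: "\<bar>Re (q - cen J)\<bar> \<le> 9/10 * side (fst J)" "\<bar>Im (q - cen J)\<bar> \<le> 9/10 * side (fst J)"
    using abs_Re_le_cmod abs_Im_le_cmod order_trans by blast+
  then show *: "Im q \<ge> 3/5 * side (fst J)" "Im q \<le> 12/5 * side (fst J)" "\<bar>Re q - Re (cen J)\<bar> \<le> 9/10 * side (fst J)"
    unfolding abs_le_iff minus_complex.sel Im_cen using side_pos[of "fst J"] by linarith+
  show "q \<in> uhp" using *(1) side_pos[of "fst J"] unfolding uhp_def by (auto intro: less_le_trans[of 0 "3/5 * side (fst J)"])
qed

text \<open>\<open>2880 = 240 * 6 * 2\<close>: the bound of one kernel value, the count of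
  \<open>npack_box\<close>, and a geometric series.\<close>

definition packc :: real where "packc = 2880"

text \<open>Seen from w at height v, nodes are sorted by the first scale \<open>2 ^ m * v\<close> at
  which they are horizontally close and small enough. The kernel decays like the inverse of
  \<open>4 ^ m\<close> while the packed mass grows like \<open>2 ^ m\<close>, so the scales add up
  geometrically.\<close>

lemma npack_car:
  assumes np: "npack K A nd" and K: "K \<ge> 0" and p: "\<And>a. a \<in> A \<Longrightarrow> p a \<in> cball (cen (nd a)) (9/10 * side (fst (nd a)))"
  shows "car (packc * K) A p"
  unfolding car_def
proof (intro conjI ballI)
  show fin: "finite A" using np by (simp add: npack_def)
  show "p a \<in> uhp" if "a \<in> A" for a using near_cen(4)[OF p[OF that]] .
  fix w assume w: "w \<in> uhp"
  define u v where "u = Re w" and "v = Im w"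
  have v: "v > 0" using w by (simp add: v_def uhp_def)
  define s where "s a = side (fst (nd a))" for a
  define Q where "Q m a \<longleftrightarrow> \<bar>Re (cen (nd a)) - u\<bar> \<le> 2 ^ m * v \<and> s a \<le> 2 ^ m * v" for m a
  have Qm: "Q m' a" if "Q m a" "m \<le> m'" for m m' a
  proof -
    have "2 ^ m * v \<le> 2 ^ m' * v" using that v by (intro mult_right_mono power_increasing) auto
    then show ?thesis using that unfolding Q_def by linarith
  qed
  have exQ: "\<exists>m. Q m a" for a
  proof -
    obtain m where "max \<bar>Re (cen (nd a)) - u\<bar> (s a) / v < 2 ^ m" using real_arch_pow[of 2] by auto
    then have "max \<bar>Re (cen (nd a)) - u\<bar> (s a) < 2 ^ m * v" using v by (simp add: field_simps)
    then show ?thesis unfolding Q_def by (intro exI[of _ m]) auto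
  qed
  define mm where "mm a = (LEAST m. Q m a)" for a
  have mm: "Q (mm a) a" "\<And>k. k < mm a \<Longrightarrow> \<not> Q k a" for a
    unfolding mm_def using exQ[of a] by (auto intro: LeastI_ex dest: not_less_Least)
  define M where "M = Suc (Max (insert 0 (mm ` A)))"
  have M: "mm a < M" if "a \<in> A" for a using that fin unfolding M_def by (simp add: less_Suc_eq_le)
  have one: "pk w (p a) \<le> 240 * s a / (4 ^ mm a * v)" if a: "a \<in> A" for a
  proof -
    note n = near_cen[OF p[OF a]]
    have s: "s a > 0" by (simp add: s_def)
    define D where "D = cmod (w - cnj (p a))"
    have D: "D \<ge> v + Im (p a)" "D \<ge> \<bar>u - Re (p a)\<bar>"
      unfolding D_def using abs_Im_le_cmod[of "w - cnj (p a)"] abs_Re_le_cmod[of "w - cnj (p a)"] by (auto simp: u_def v_def)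
    \<comment> \<open>The preceding scale failed, so either the horizontal distance or the size of
      the square keeps w and \<open>cnj (p a)\<close> apart; 1/5 absorbs the displacement of
      \<open>p a\<close> from the centre.\<close>
    have Dge: "D \<ge> 2 ^ mm a * v / 5"
    proof (cases "mm a")
      case 0
      have "Im (p a) > 0" using n(4) by (simp add: uhp_def)
      then show ?thesis using 0 D v by simp
    next
      case (Suc k)
      then have "\<not> Q k a" using mm(2) by auto
      then consider "\<bar>Re (cen (nd a)) - u\<bar> > 2 ^ k * v" | "s a > 2 ^ k * v" unfolding Q_def by linarith
      then show ?thesis
      proof cases
        case 1
        have "2 ^ k * v < \<bar>u - Re (p a)\<bar> + 9/10 * s a" using 1 n(3) unfolding s_def by linarith
        also have "\<dots> \<le> D + 3/2 * D" using D n(1) v unfolding s_def by linarith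
        finally show ?thesis using Suc by simp
      next
        case 2 then show ?thesis using D n(1) v Suc unfolding s_def by simp
      qed
    qed
    then have "(2 ^ mm a * v / 5)\<^sup>2 \<le> D\<^sup>2" using v by (intro power_mono) auto
    moreover have "(2 ^ mm a * v / 5)\<^sup>2 = 4 ^ mm a * v\<^sup>2 / 25"
      by (simp add: power_mult_distrib power_divide power_mult[symmetric] mult.commute[of _ 2]) (simp add: power_mult)
    ultimately have D2: "4 ^ mm a * v\<^sup>2 / 25 \<le> D\<^sup>2" by simp
    have "pk w (p a) = 4 * v * Im (p a) / D\<^sup>2" by (simp add: pk_def v_def D_def)
    also have "\<dots> \<le> 4 * v * (12/5 * s a) / D\<^sup>2" using n(2) v by (intro divide_right_mono mult_left_mono) (auto simp: s_def)
    also have "\<dots> \<le> 4 * v * (12/5 * s a) / (4 ^ mm a * v\<^sup>2 / 25)"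
    proof (rule divide_left_mono[OF D2])
      have "4 ^ mm a * v\<^sup>2 / 25 > 0" using v by simp
      then show "0 < D\<^sup>2 * (4 ^ mm a * v\<^sup>2 / 25)" using D2 by (intro mult_pos_pos) auto
    qed (use v s in auto)
    also have "\<dots> = 240 * s a / (4 ^ mm a * v)" using v by (simp add: power2_eq_square)
    finally show ?thesis .
  qed
  have "(\<Sum>a\<in>A. pk w (p a)) \<le> (\<Sum>a\<in>A. \<Sum>m<M. if Q m a then 240 * s a / (4 ^ m * v) else 0)"
  proof (rule sum_mono)
    fix a assume a: "a \<in> A"
    have "240 * s a / (4 ^ mm a * v) = (if Q (mm a) a then 240 * s a / (4 ^ mm a * v) else 0)" using mm(1) by simp
    also have "\<dots> \<le> (\<Sum>m<M. if Q m a then 240 * s a / (4 ^ m * v) else 0)"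
      using M[OF a] v by (intro member_le_sum) (auto simp: s_def)
    finally show "pk w (p a) \<le> (\<Sum>m<M. if Q m a then 240 * s a / (4 ^ m * v) else 0)" using one[OF a] by simp
  qed
  also have "\<dots> = (\<Sum>m<M. \<Sum>a\<in>A. if Q m a then 240 * s a / (4 ^ m * v) else 0)" by (rule sum.swap)
  also have "\<dots> = (\<Sum>m<M. 240 / (4 ^ m * v) * (\<Sum>a\<in>{a\<in>A. Q m a}. s a))"
    using fin by (intro sum.cong refl) (auto simp: sum_distrib_left sum.inter_filter intro!: sum.cong)
  also have "\<dots> \<le> (\<Sum>m<M. 240 / (4 ^ m * v) * (6 * K * (2 ^ m * v)))"
    using npack_box[OF np K] v unfolding Q_def s_def by (intro sum_mono mult_left_mono) auto
  also have "\<dots> = (\<Sum>m<M. 1440 * K * (1/2) ^ m)"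
  proof (rule sum.cong[OF refl])
    fix m
    have "(4::real) ^ m = 2 ^ m * 2 ^ m" by (simp flip: power_mult_distrib)
    then show "240 / (4 ^ m * v) * (6 * K * (2 ^ m * v)) = 1440 * K * (1/2) ^ m" using v by (simp add: power_one_over field_simps)
  qed
  also have "\<dots> = 1440 * K * (2 - 2 * (1/2) ^ M)" unfolding sum_distrib_left[symmetric] by (simp add: geometric_sum)
  also have "\<dots> \<le> 1440 * K * 2" using K by (intro mult_left_mono) auto
  finally show "(\<Sum>a\<in>A. pk w (p a)) \<le> packc * K" by (simp add: packc_def)
qed

section \<open>Labelled dyadic trees\<close>

primrec tot :: "(nat \<Rightarrow> nat \<Rightarrow> real) \<Rightarrow> nat \<Rightarrow> nat \<Rightarrow> nat \<Rightarrow> real" where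
  "tot w 0 m j = w m j"
| "tot w (Suc d) m j = w m j + tot w d (Suc m) (2 * j) + tot w d (Suc m) (2 * j + 1)"

lemma split_dyadic_range:
  "{j * 2 ^ Suc k..<(j + 1) * 2 ^ Suc k} = {2 * j * 2 ^ k..<(2 * j + 1) * 2 ^ k} \<union> {(2 * j + 1) * 2 ^ k..<(2 * j + 1 + 1) * 2 ^ k}"
  for j k :: nat
  by (subst ivl_disj_un_two(3)) (auto simp: algebra_simps)

lemma tot_sum: "tot w d m j = (\<Sum>k\<le>d. \<Sum>i\<in>{j * 2 ^ k..<(j + 1) * 2 ^ k}. w (m + k) i)"
proof (induction d arbitrary: m j)
  case 0 then show ?case by simp
next
  case (Suc d)
  have "(\<Sum>k\<le>Suc d. \<Sum>i\<in>{j * 2 ^ k..<(j + 1) * 2 ^ k}. w (m + k) i)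
    = w m j + (\<Sum>k\<le>d. \<Sum>i\<in>{j * 2 ^ Suc k..<(j + 1) * 2 ^ Suc k}. w (m + Suc k) i)"
    by (subst sum.atMost_Suc_shift) simp
  also have "(\<Sum>k\<le>d. \<Sum>i\<in>{j * 2 ^ Suc k..<(j + 1) * 2 ^ Suc k}. w (m + Suc k) i)
    = (\<Sum>k\<le>d. (\<Sum>i\<in>{2 * j * 2 ^ k..<(2 * j + 1) * 2 ^ k}. w (Suc m + k) i) + (\<Sum>i\<in>{(2 * j + 1) * 2 ^ k..<(2 * j + 1 + 1) * 2 ^ k}. w (Suc m + k) i))"
    unfolding split_dyadic_range by (intro sum.cong refl) (subst sum.union_disjoint, auto)
  finally show ?case by (simp only: tot.simps Suc.IH sum.distrib add.assoc)
qed

lemma tot_add: "tot (\<lambda>m j. w m j + w' m j) d m j = tot w d m j + tot w' d m j"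
  by (induction d arbitrary: m j) simp_all

text \<open>The label \<open>True\<close> marks the region where \<open>g\<close> is small; it is entered at a node satisfying \<open>sm\<close> and left at
  a node satisfying \<open>bg\<close>. A node satisfying neither inherits the label of its parent.\<close>

locale labelled_tree =
  fixes sm bg :: "nat \<Rightarrow> nat \<Rightarrow> bool"
begin

primrec lab :: "nat \<Rightarrow> nat \<Rightarrow> bool" where
  "lab 0 j = (\<not> bg 0 j)"
| "lab (Suc m) j = (if lab m (j div 2) then \<not> bg (Suc m) j else sm (Suc m) j)"

definition swt :: "nat \<Rightarrow> nat \<Rightarrow> bool" where
  "swt m j \<longleftrightarrow> m > 0 \<and> lab m j \<noteq> lab (m - 1) (j div 2)"

lemma swt_0 [simp]: "\<not> swt 0 j" by (simp add: swt_def)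
lemma swt_Suc: "swt (Suc m) j \<longleftrightarrow> lab (Suc m) j \<noteq> lab m (j div 2)" by (simp add: swt_def)

lemma swt_small: "swt m j \<Longrightarrow> lab m j \<Longrightarrow> sm m j"
  by (cases m) (auto simp: swt_Suc lab.simps split: if_splits)

lemma swt_big: "swt m j \<Longrightarrow> \<not> lab m j \<Longrightarrow> bg m j"
  by (cases m) (auto simp: swt_Suc lab.simps split: if_splits)

declare lab.simps(2) [simp del]

definition swtw :: "nat \<Rightarrow> nat \<Rightarrow> real" where "swtw m j = (if swt m j then side m else 0)"

text \<open>The first label switches strictly below a node, down to relative depth \<open>d\<close>, and their total length.\<close>

primrec FS :: "nat \<Rightarrow> nat \<Rightarrow> nat \<Rightarrow> (nat \<times> nat) set" where
  "FS 0 m j = {}"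
| "FS (Suc d) m j = (if swt (Suc m) (2 * j) then {(Suc m, 2 * j)} else FS d (Suc m) (2 * j)) \<union>
     (if swt (Suc m) (2 * j + 1) then {(Suc m, 2 * j + 1)} else FS d (Suc m) (2 * j + 1))"

primrec fs :: "nat \<Rightarrow> nat \<Rightarrow> nat \<Rightarrow> real" where
  "fs 0 m j = 0"
| "fs (Suc d) m j = (if swt (Suc m) (2 * j) then side (Suc m) else fs d (Suc m) (2 * j)) +
     (if swt (Suc m) (2 * j + 1) then side (Suc m) else fs d (Suc m) (2 * j + 1))"

lemma fs_bounds: "0 \<le> fs d m j \<and> fs d m j \<le> side m"
proof (induction d arbitrary: m j)
  case 0 then show ?case by simp
next
  case (Suc d)
  have "0 \<le> (if swt (Suc m) i then side (Suc m) else fs d (Suc m) i) \<and> (if swt (Suc m) i then side (Suc m) else fs d (Suc m) i) \<le> side (Suc m)" for i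
    using Suc by simp
  from this[of "2 * j"] this[of "2 * j + 1"] show ?case by (simp add: side_Suc)
qed

lemma FS_finite: "finite (FS d m j)"
  by (induction d arbitrary: m j) auto

lemma below_trans: "below I J \<Longrightarrow> below J K \<Longrightarrow> below I K"
proof -
  assume a: "below I J" "below J K"
  have "snd K div 2 ^ (fst K - fst I) = snd K div (2 ^ (fst K - fst J) * 2 ^ (fst J - fst I))"
    using a by (simp add: below_def flip: power_add)
  also have "\<dots> = snd I" using a by (simp add: below_def div_mult2_eq)
  finally show ?thesis using a by (simp add: below_def)
qed

lemma below_child: "below (m, j) (Suc m, 2 * j)" "below (m, j) (Suc m, 2 * j + 1)"
  by (auto simp: below_def)

lemma FS_below: "J \<in> FS d m j \<Longrightarrow> below (m, j) J \<and> m < fst J \<and> fst J \<le> m + d"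
proof (induction d arbitrary: m j)
  case 0 then show ?case by simp
next
  case (Suc d)
  have "below (Suc m, i) J \<and> fst J \<le> Suc m + d \<and> Suc m \<le> fst J"
    if "J \<in> (if swt (Suc m) i then {(Suc m, i)} else FS d (Suc m) i)" for i
    using that Suc.IH[of "Suc m" i] by (auto simp: below_def split: if_splits)
  note step = this
  have "J \<in> (if swt (Suc m) (2*j) then {(Suc m, 2*j)} else FS d (Suc m) (2*j)) \<or>
        J \<in> (if swt (Suc m) (2*j+1) then {(Suc m, 2*j+1)} else FS d (Suc m) (2*j+1))"
    using Suc.prems unfolding FS.simps by (rule UnE) simp_all
  then show ?case
  proof
    assume "J \<in> (if swt (Suc m) (2*j) then {(Suc m, 2*j)} else FS d (Suc m) (2*j))"
    from step[OF this] have "below (Suc m, 2*j) J" "m < fst J" "fst J \<le> m + Suc d" by simp_all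
    then show ?thesis using below_trans[OF below_child(1), of m j J] by blast
  next
    assume "J \<in> (if swt (Suc m) (2*j+1) then {(Suc m, 2*j+1)} else FS d (Suc m) (2*j+1))"
    from step[OF this] have "below (Suc m, 2*j+1) J" "m < fst J" "fst J \<le> m + Suc d" by simp_all
    then show ?thesis using below_trans[OF below_child(2), of m j J] by blast
  qed
qed

lemma FS_swt: "J \<in> FS d m j \<Longrightarrow> swt (fst J) (snd J) \<and> lab (fst J) (snd J) \<noteq> lab m j"
proof (induction d arbitrary: m j)
  case 0 then show ?case by simp
next
  case (Suc d)
  have "swt (fst J) (snd J) \<and> lab (fst J) (snd J) \<noteq> lab m (i div 2)"
    if "J \<in> (if swt (Suc m) i then {(Suc m, i)} else FS d (Suc m) i)" for i
    using that Suc.IH[of "Suc m" i] by (auto simp: swt_Suc split: if_splits)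
  note step = this
  have "J \<in> (if swt (Suc m) (2*j) then {(Suc m, 2*j)} else FS d (Suc m) (2*j)) \<or>
        J \<in> (if swt (Suc m) (2*j+1) then {(Suc m, 2*j+1)} else FS d (Suc m) (2*j+1))"
    using Suc.prems unfolding FS.simps by (rule UnE) simp_all
  then show ?case
  proof
    assume "J \<in> (if swt (Suc m) (2*j) then {(Suc m, 2*j)} else FS d (Suc m) (2*j))"
    from step[OF this] show ?thesis by simp
  next
    assume "J \<in> (if swt (Suc m) (2*j+1) then {(Suc m, 2*j+1)} else FS d (Suc m) (2*j+1))"
    from step[OF this] show ?thesis by simp
  qed
qed

lemma FS_bound: "J \<in> FS d m j \<Longrightarrow> j < 2 ^ m \<Longrightarrow> snd J < 2 ^ fst J"
proof -
  assume J: "J \<in> FS d m j" and j: "j < 2 ^ m"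
  from FS_below[OF J] have b: "snd J div 2 ^ (fst J - m) = j" "m \<le> fst J" by (auto simp: below_def)
  then have "snd J div 2 ^ (fst J - m) < 2 ^ m" using j by simp
  then have "snd J < 2 ^ m * 2 ^ (fst J - m)" by (simp add: less_mult_imp_div_less div_less_iff_less_mult)
  then show ?thesis using b by (simp flip: power_add)
qed

end

definition dyint :: "nat \<times> nat \<Rightarrow> real set" where
  "dyint J = {real (snd J) * side (fst J)..<(real (snd J) + 1) * side (fst J)}"

lemma below_dyint: assumes "below I J" shows "dyint J \<subseteq> dyint I"
proof -
  define k where "k = fst J - fst I"
  have J: "fst J = fst I + k" and d: "snd J div 2 ^ k = snd I" using assms by (auto simp: below_def k_def)
  have 1: "snd I * 2 ^ k \<le> snd J" using d by (metis div_mult_mod_eq le_add1)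
  have "snd J < (snd I + 1) * 2 ^ k" using d by (metis Suc_eq_plus1 dividend_less_div_times mult.commute mult_Suc_right zero_less_numeral zero_less_power add.commute)
  then have 2: "snd J + 1 \<le> (snd I + 1) * 2 ^ k" by simp
  have "real (snd I * 2 ^ k) \<le> real (snd J)" "real (snd J + 1) \<le> real ((snd I + 1) * 2 ^ k)"
    using 1 2 of_nat_le_iff by blast+
  then have "real (snd I) * 2 ^ k \<le> real (snd J)" "real (snd J) + 1 \<le> (real (snd I) + 1) * 2 ^ k"
    by (simp_all add: algebra_simps)
  then have "real (snd I) \<le> real (snd J) * side k" "(real (snd J) + 1) * side k \<le> real (snd I) + 1"
    by (simp_all add: side_def field_simps)
  then have "real (snd I) * side (fst I) \<le> real (snd J) * side k * side (fst I)" "(real (snd J) + 1) * side k * side (fst I) \<le> (real (snd I) + 1) * side (fst I)"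
    by (auto intro!: mult_right_mono simp del: mult_le_cancel_right)
  then show ?thesis unfolding dyint_def J side_add by (auto simp: mult_ac)
qed

lemma measure_dyint: "measure lborel (dyint J) = side (fst J)" "dyint J \<in> sets borel" "emeasure lborel (dyint J) < top"
  by (simp_all add: dyint_def algebra_simps)

text \<open>Disjoint intervals inside \<open>dyint I\<close> have total length at most that of
  \<open>dyint I\<close>, by Lebesgue measure.\<close>

lemma disjoint_dyint_pack:
  assumes "finite F" "\<And>J J'. J \<in> F \<Longrightarrow> J' \<in> F \<Longrightarrow> J \<noteq> J' \<Longrightarrow> dyint J \<inter> dyint J' = {}"
    "\<And>J. J \<in> F \<Longrightarrow> snd J < 2 ^ fst J"
  shows "npack 1 F id"
  unfolding npack_def
proof (intro conjI allI ballI)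
  fix I
  let ?G = "{J\<in>F. below I (id J)}"
  have "(\<Sum>J\<in>?G. side (fst (id J))) = (\<Sum>J\<in>?G. measure lborel (dyint J))" by (simp add: measure_dyint)
  also have "\<dots> = measure lborel (\<Union>J\<in>?G. dyint J)"
  proof (rule measure_finite_Union[symmetric])
    show "disjoint_family_on dyint ?G" unfolding disjoint_family_on_def using assms(2) by blast
    show "emeasure lborel (dyint J) \<noteq> \<infinity>" for J using measure_dyint(3)[of J] by (simp add: less_top)
  qed (use assms(1) measure_dyint(2) in auto)
  also have "\<dots> \<le> measure lborel (dyint I)"
  proof (rule measure_mono_fmeasurable)
    show "(\<Union>J\<in>?G. dyint J) \<subseteq> dyint I" using below_dyint[of I] by auto
    show "(\<Union>J\<in>?G. dyint J) \<in> sets lborel" using assms(1) measure_dyint(2) by (intro sets.finite_UN) auto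
    show "dyint I \<in> fmeasurable lborel" by (rule fmeasurableI) (use measure_dyint in auto)
  qed
  finally show "(\<Sum>J\<in>?G. side (fst (id J))) \<le> 1 * side (fst I)" by (simp add: measure_dyint)
qed (use assms in auto)

context labelled_tree
begin

lemma dyint_children_disjoint: "below (Suc m, 2 * j) J \<Longrightarrow> below (Suc m, 2 * j + 1) J' \<Longrightarrow> dyint J \<inter> dyint J' = {}"
proof -
  assume "below (Suc m, 2 * j) J" "below (Suc m, 2 * j + 1) J'"
  then have "dyint J \<subseteq> dyint (Suc m, 2 * j)" "dyint J' \<subseteq> dyint (Suc m, 2 * j + 1)" by (auto dest: below_dyint)
  moreover have "dyint (Suc m, 2 * j) \<inter> dyint (Suc m, 2 * j + 1) = {}" by (auto simp: dyint_def)
  ultimately show ?thesis by blast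
qed

lemma FS_child_below: "J \<in> (if swt (Suc m) i then {(Suc m, i)} else FS d (Suc m) i) \<Longrightarrow> below (Suc m, i) J"
  using FS_below[of J d "Suc m" i] by (auto simp: below_def split: if_splits)

lemma FS_disjoint: "J \<in> FS d m j \<Longrightarrow> J' \<in> FS d m j \<Longrightarrow> J \<noteq> J' \<Longrightarrow> dyint J \<inter> dyint J' = {}"
proof (induction d arbitrary: m j)
  case 0 then show ?case by simp
next
  case (Suc d)
  let ?S = "\<lambda>i. if swt (Suc m) i then {(Suc m, i)} else FS d (Suc m) i"
  have same: "dyint J \<inter> dyint J' = {}" if "J \<in> ?S i" "J' \<in> ?S i" for i
    using that Suc.IH[of "Suc m" i] Suc.prems(3) by (auto split: if_splits)
  have "J \<in> ?S (2*j) \<or> J \<in> ?S (2*j+1)" "J' \<in> ?S (2*j) \<or> J' \<in> ?S (2*j+1)" using Suc.prems by auto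
  then show ?case using same[of "2*j"] same[of "2*j+1"] dyint_children_disjoint[of m j J J'] dyint_children_disjoint[of m j J' J]
      FS_child_below[of J] FS_child_below[of J'] by (metis Int_commute)
qed

lemma FS_npack: "j < 2 ^ m \<Longrightarrow> npack 1 (FS d m j) id"
  by (rule disjoint_dyint_pack) (use FS_finite FS_disjoint FS_bound in auto)

lemma fs_sum: "fs d m j = (\<Sum>J\<in>FS d m j. side (fst J))"
proof (induction d arbitrary: m j)
  case 0 then show ?case by simp
next
  case (Suc d)
  let ?S = "\<lambda>i. if swt (Suc m) i then {(Suc m, i)} else FS d (Suc m) i"
  have "?S (2*j) \<inter> ?S (2*j+1) = {}"
  proof (rule ccontr)
    assume "?S (2*j) \<inter> ?S (2*j+1) \<noteq> {}"
    then obtain J where "J \<in> ?S (2*j)" "J \<in> ?S (2*j+1)" by blast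
    then have "below (Suc m, 2*j) J" "below (Suc m, 2*j+1) J" by (metis FS_child_below)+
    then show False by (simp add: below_def)
  qed
  moreover have "finite (?S i)" for i by (simp add: FS_finite)
  ultimately have "(\<Sum>J\<in>FS (Suc d) m j. side (fst J)) = (\<Sum>J\<in>?S (2*j). side (fst J)) + (\<Sum>J\<in>?S (2*j+1). side (fst J))"
    unfolding FS.simps by (intro sum.union_disjoint)
  then show ?case by (simp add: Suc.IH)
qed

text \<open>The weights 3 and 4 make the recursion close. A switch to \<open>False\<close> costs its
  own length plus 4 times the next first switches, which by P fill at most half of it:
  \<open>1 + 4 / 2 = 3\<close>. For a switch to \<open>True\<close> only \<open>fs_bounds\<close> is
  available: \<open>1 + 3 = 4\<close>.\<close>

lemma swt_sum_strict:
  assumes P: "\<And>d m j. swt m j \<Longrightarrow> \<not> lab m j \<Longrightarrow> fs d m j \<le> side m / 2"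
  shows "tot swtw d m j - swtw m j \<le> (if lab m j then 3 else 4) * fs d m j"
proof (induction d arbitrary: m j)
  case 0 then show ?case by simp
next
  case (Suc d)
  have child: "tot swtw d (Suc m) i \<le> (if lab m (i div 2) then 3 else 4) * (if swt (Suc m) i then side (Suc m) else fs d (Suc m) i)" for i
  proof (cases "swt (Suc m) i")
    case False
    then have "lab (Suc m) i = lab m (i div 2)" by (simp add: swt_Suc)
    moreover have "swtw (Suc m) i = 0" using False by (simp add: swtw_def)
    ultimately show ?thesis using Suc.IH[of "Suc m" i] False by simp
  next
    case True
    then have l: "lab (Suc m) i \<longleftrightarrow> \<not> lab m (i div 2)" by (simp add: swt_Suc)
    show ?thesis
    proof (cases "lab m (i div 2)")
      case lt: True
      then have "fs d (Suc m) i \<le> side (Suc m) / 2" using P[OF True] l by simp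
      moreover have "swtw (Suc m) i = side (Suc m)" using True by (simp add: swtw_def)
      ultimately show ?thesis using Suc.IH[of "Suc m" i] True lt l by simp
    next
      case lf: False
      have "fs d (Suc m) i \<le> side (Suc m)" using fs_bounds by blast
      moreover have "swtw (Suc m) i = side (Suc m)" using True by (simp add: swtw_def)
      ultimately show ?thesis using Suc.IH[of "Suc m" i] True lf l by simp
    qed
  qed
  have "tot swtw (Suc d) m j - swtw m j = tot swtw d (Suc m) (2*j) + tot swtw d (Suc m) (2*j+1)" by simp
  also have "\<dots> \<le> (if lab m j then 3 else 4) * (if swt (Suc m) (2*j) then side (Suc m) else fs d (Suc m) (2*j))
    + (if lab m j then 3 else 4) * (if swt (Suc m) (2*j+1) then side (Suc m) else fs d (Suc m) (2*j+1))"
    using child[of "2*j"] child[of "2*j+1"] by (intro add_mono) simp_all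
  finally show ?case by (simp add: algebra_simps)
qed

lemma swt_sum:
  assumes P: "\<And>d m j. swt m j \<Longrightarrow> \<not> lab m j \<Longrightarrow> fs d m j \<le> side m / 2"
  shows "tot swtw d m j \<le> 5 * side m"
proof -
  have "tot swtw d m j \<le> side m + (if lab m j then 3 else 4) * fs d m j"
  proof -
    have "swtw m j \<le> side m" by (simp add: swtw_def)
    then show ?thesis using swt_sum_strict[OF P, of d m j] by linarith
  qed
  also have "(if lab m j then 3 else 4) * fs d m j \<le> 4 * fs d m j" using fs_bounds[of d m j] by auto
  also have "fs d m j \<le> side m" using fs_bounds by blast
  finally show ?thesis by simp
qed

text \<open>Two neighbouring nodes with different labels that are separated by the midpoint of \<open>(m, j)\<close> lie below a
  switch on one of the two chains ending at that midpoint.\<close>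

definition RR :: "nat \<Rightarrow> nat \<Rightarrow> nat \<Rightarrow> real" where
  "RR d m j = (\<Sum>k\<le>d. swtw (m + k) ((j + 1) * 2 ^ k - 1))"

definition LL :: "nat \<Rightarrow> nat \<Rightarrow> nat \<Rightarrow> real" where
  "LL d m j = (\<Sum>k\<le>d. swtw (m + k) (j * 2 ^ k))"

definition mid :: "nat \<Rightarrow> nat \<Rightarrow> nat \<Rightarrow> real" where
  "mid d m j = (\<Sum>k\<le>d. if lab (Suc m + k) ((2 * j + 1) * 2 ^ k - 1) \<noteq> lab (Suc m + k) ((2 * j + 1) * 2 ^ k) then side (Suc m + k) else 0)"

definition DD :: "nat \<Rightarrow> nat \<Rightarrow> nat \<Rightarrow> nat set" where
  "DD m j k = {i. j * 2 ^ k \<le> i \<and> i + 1 < (j + 1) * 2 ^ k \<and> lab (m + k) i \<noteq> lab (m + k) (i + 1)}"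

text \<open>The total length of the vertical walls strictly inside the subtree; jumps across its two
  outer edges are left to the ancestors.\<close>

definition vv :: "nat \<Rightarrow> nat \<Rightarrow> nat \<Rightarrow> real" where
  "vv d m j = (\<Sum>k\<le>d. side (m + k) * real (card (DD m j k)))"

lemma RR_Suc: "RR (Suc d) m j = swtw m j + RR d (Suc m) (2 * j + 1)"
  unfolding RR_def by (subst sum.atMost_Suc_shift) (simp add: algebra_simps)

lemma LL_Suc: "LL (Suc d) m j = swtw m j + LL d (Suc m) (2 * j)"
  unfolding LL_def by (subst sum.atMost_Suc_shift) (simp add: algebra_simps)

lemma DD_finite: "finite (DD m j k)"
  by (rule finite_subset[of _ "{..<(j+1)*2^k}"]) (auto simp: DD_def)

lemma DD_0: "DD m j 0 = {}" by (auto simp: DD_def)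

lemma DD_Suc:
  "card (DD m j (Suc k)) \<le> card (DD (Suc m) (2 * j) k) + card (DD (Suc m) (2 * j + 1) k) +
    (if lab (Suc m + k) ((2 * j + 1) * 2 ^ k - 1) \<noteq> lab (Suc m + k) ((2 * j + 1) * 2 ^ k) then 1 else 0)"
proof -
  let ?c = "(2 * j + 1) * 2 ^ k"
  let ?M = "if lab (Suc m + k) (?c - 1) \<noteq> lab (Suc m + k) ?c then {?c - 1} else {}"
  have "?c > 0" by simp
  then have c: "?c \<ge> 1" by linarith
  have "DD m j (Suc k) \<subseteq> DD (Suc m) (2 * j) k \<union> DD (Suc m) (2 * j + 1) k \<union> ?M"
  proof
    fix i assume i: "i \<in> DD m j (Suc k)"
    have b: "2 * j * 2 ^ k \<le> i" "i + 1 < (2 * j + 1 + 1) * 2 ^ k" and l: "lab (Suc m + k) i \<noteq> lab (Suc m + k) (i + 1)"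
      using i by (auto simp: DD_def algebra_simps)
    consider "i + 1 < ?c" | "i + 1 = ?c" | "?c \<le> i" by linarith
    then show "i \<in> DD (Suc m) (2 * j) k \<union> DD (Suc m) (2 * j + 1) k \<union> ?M"
    proof cases
      case 2
      then have "i = ?c - 1" by simp
      then show ?thesis using l 2 by simp
    qed (use b l in \<open>auto simp: DD_def\<close>)
  qed
  then have "card (DD m j (Suc k)) \<le> card (DD (Suc m) (2 * j) k \<union> DD (Suc m) (2 * j + 1) k \<union> ?M)"
    by (intro card_mono) (auto simp: DD_finite)
  also have "\<dots> \<le> card (DD (Suc m) (2 * j) k) + card (DD (Suc m) (2 * j + 1) k) + card ?M"
    by (meson add_mono card_Un_le le_refl order_trans)
  also have "card ?M = (if lab (Suc m + k) (?c - 1) \<noteq> lab (Suc m + k) ?c then 1 else 0)" by simp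
  finally show ?thesis .
qed

lemma vv_Suc: "vv (Suc d) m j \<le> vv d (Suc m) (2 * j) + vv d (Suc m) (2 * j + 1) + mid d m j"
proof -
  have "vv (Suc d) m j = (\<Sum>k\<le>d. side (Suc m + k) * real (card (DD m j (Suc k))))"
    unfolding vv_def by (subst sum.atMost_Suc_shift) (simp add: DD_0)
  also have "\<dots> \<le> (\<Sum>k\<le>d. side (Suc m + k) * (real (card (DD (Suc m) (2 * j) k)) + real (card (DD (Suc m) (2 * j + 1) k)) +
    (if lab (Suc m + k) ((2 * j + 1) * 2 ^ k - 1) \<noteq> lab (Suc m + k) ((2 * j + 1) * 2 ^ k) then 1 else 0)))"
  proof (intro sum_mono mult_left_mono)
    fix k
    show "real (card (DD m j (Suc k))) \<le> real (card (DD (Suc m) (2 * j) k)) + real (card (DD (Suc m) (2 * j + 1) k)) +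
    (if lab (Suc m + k) ((2 * j + 1) * 2 ^ k - 1) \<noteq> lab (Suc m + k) ((2 * j + 1) * 2 ^ k) then 1 else 0)"
      using of_nat_mono[OF DD_Suc[of m j k], where ?'a = real] by (simp split: if_splits)
  qed simp
  also have "\<dots> = vv d (Suc m) (2 * j) + vv d (Suc m) (2 * j + 1) + mid d m j"
    unfolding vv_def mid_def sum.distrib[symmetric] by (intro sum.cong refl) (simp add: distrib_left)
  finally show ?thesis .
qed

lemma chain_no_switch:
  assumes "\<And>k. k \<le> n \<Longrightarrow> \<not> swt (Suc m + k) (g k)" "g 0 div 2 = j" "\<And>k. g (Suc k) div 2 = g k"
  shows "lab (Suc m + n) (g n) = lab m j"
  using assms(1)
proof (induction n)
  case 0 then show ?case using assms(2) by (simp add: swt_Suc)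
next
  case (Suc n)
  then have "\<not> swt (Suc (Suc m + n)) (g (Suc n))" by (metis add_Suc_right order_refl)
  then show ?case using Suc assms(3)[of n] unfolding swt_Suc by simp
qed

lemma chainR_div: "((i + 1) * 2 ^ Suc k - 1) div 2 = (i + 1) * 2 ^ k - (1::nat)" for i k :: nat
proof -
  have "(i + 1) * 2 ^ k > 0" by simp
  then obtain t where t: "(i + 1) * 2 ^ k = Suc t" using gr0_conv_Suc by blast
  have "(i + 1) * 2 ^ Suc k = 2 * ((i + 1) * 2 ^ k)" by simp
  then show ?thesis unfolding t by simp
qed

lemma sum_triangle_swap: "(\<Sum>k\<le>d. \<Sum>i\<le>k. f i k) = (\<Sum>i\<le>d. \<Sum>k\<in>{i..d}. f i k)" for f :: "nat \<Rightarrow> nat \<Rightarrow> real"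
proof (induction d)
  case (Suc d)
  have "(\<Sum>i\<le>Suc d. \<Sum>k\<in>{i..Suc d}. f i k) = (\<Sum>i\<le>Suc d. (\<Sum>k\<in>{i..d}. f i k) + f i (Suc d))"
    by (intro sum.cong refl) (simp add: atLeastAtMostSuc_conv add.commute)
  then show ?case using Suc by (simp add: sum.distrib)
qed simp

text \<open>If the labels on both sides of the midpoint differ at depth k, one of the two chains has
  switched at some depth \<open>i \<le> k\<close>. The jump is charged to that switch; a switch pays
  for all deeper levels, a geometric sum of at most twice its length.\<close>

lemma mid_le: "mid d m j \<le> 2 * RR d (Suc m) (2 * j) + 2 * LL d (Suc m) (2 * j + 1)"
proof -
  define r where "r k = (2 * j + 1) * 2 ^ k - 1" for k :: nat
  define l where "l k = (2 * j + 1) * 2 ^ k" for k :: nat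
  define W where "W k = (if swt (Suc m + k) (r k) then 1 else 0 :: real) + (if swt (Suc m + k) (l k) then 1 else 0)" for k
  have W0: "W k \<ge> 0" for k by (simp add: W_def)
  have step: "(if lab (Suc m + k) (r k) \<noteq> lab (Suc m + k) (l k) then side (Suc m + k) else 0) \<le> (\<Sum>i\<le>k. side (Suc m + k) * W i)" for k
  proof (cases "\<exists>i\<le>k. swt (Suc m + i) (r i) \<or> swt (Suc m + i) (l i)")
    case True
    then obtain i where i: "i \<le> k" "W i \<ge> 1" by (auto simp: W_def)
    have "side (Suc m + k) \<le> side (Suc m + k) * W i" using i by simp
    also have "\<dots> \<le> (\<Sum>i\<le>k. side (Suc m + k) * W i)" using i W0 by (intro member_le_sum) auto
    finally show ?thesis using W0 by (auto intro: sum_nonneg)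
  next
    case False
    have rd: "r (Suc k) div 2 = r k" for k
      using chainR_div[of "2 * j" k] unfolding r_def by simp
    have "lab (Suc m + k) (r k) = lab m j" by (rule chain_no_switch) (use False rd in \<open>auto simp: r_def\<close>)
    moreover have "lab (Suc m + k) (l k) = lab m j" by (rule chain_no_switch) (use False in \<open>auto simp: l_def algebra_simps\<close>)
    ultimately show ?thesis using W0 by (auto intro: sum_nonneg)
  qed
  have geo: "(\<Sum>k\<in>{i..d}. side (Suc m + k)) \<le> 2 * side (Suc m + i)" for i
  proof -
    have "(\<Sum>k\<in>{i..d}. side (Suc m + k)) \<le> 2 * side (Suc m + i) - (if i \<le> d then side (Suc m + d) else 0)"
    proof (induction d)
      case 0 then show ?case by auto
    next
      case (Suc d)
      then show ?case by (cases "i \<le> d"; cases "i = Suc d") (auto simp: side_Suc)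
    qed
    then show ?thesis by (auto split: if_splits intro: order_trans)
  qed
  have "mid d m j \<le> (\<Sum>k\<le>d. \<Sum>i\<le>k. side (Suc m + k) * W i)"
    unfolding mid_def using step unfolding r_def l_def by (intro sum_mono)
  also have "\<dots> = (\<Sum>i\<le>d. \<Sum>k\<in>{i..d}. side (Suc m + k) * W i)" by (rule sum_triangle_swap)
  also have "\<dots> = (\<Sum>i\<le>d. (\<Sum>k\<in>{i..d}. side (Suc m + k)) * W i)" by (simp add: sum_distrib_right)
  also have "\<dots> \<le> (\<Sum>i\<le>d. 2 * side (Suc m + i) * W i)" using geo W0 by (intro sum_mono mult_right_mono)
  also have "\<dots> = (\<Sum>i\<le>d. 2 * swtw (Suc m + i) (r i) + 2 * swtw (Suc m + i) (l i))"
    by (intro sum.cong refl) (simp add: W_def swtw_def)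
  also have "\<dots> = 2 * RR d (Suc m) (2 * j) + 2 * LL d (Suc m) (2 * j + 1)"
    by (simp add: RR_def LL_def r_def l_def sum.distrib sum_distrib_left)
  finally show ?thesis .
qed

text \<open>The induction closes only with the outer chains on the left: the jumps under the
  midpoint are paid by the inner chains of the two children, the outer chains of the children are
  handed on to the parent, and a switch at the node itself occurs in both of its chains, whence the
  factor 4.\<close>

lemma vv_le_aux: "vv d m j + 2 * RR d m j + 2 * LL d m j \<le> 4 * tot swtw d m j"
proof (induction d arbitrary: m j)
  case 0 then show ?case by (simp add: vv_def DD_0 RR_def LL_def)
next
  case (Suc d)
  have arith: "v + 2 * (s + r2) + 2 * (s + l1) \<le> 4 * (s + t1 + t2)"
    if "v \<le> v1 + v2 + x" "x \<le> 2 * r1 + 2 * l2" "v1 + 2 * r1 + 2 * l1 \<le> 4 * t1" "v2 + 2 * r2 + 2 * l2 \<le> 4 * t2"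
    for v v1 v2 x r1 r2 l1 l2 s t1 t2 :: real using that by (simp add: algebra_simps)
  show ?case unfolding RR_Suc LL_Suc tot.simps by (rule arith[OF vv_Suc mid_le Suc Suc])
qed

lemma vv_le: "vv d m j \<le> 4 * tot swtw d m j"
proof -
  have "RR d m j \<ge> 0" "LL d m j \<ge> 0" unfolding RR_def LL_def swtw_def by (auto intro!: sum_nonneg)
  then show ?thesis using vv_le_aux[of d m j] by linarith
qed

text \<open>The reasons why a node of the finite tree can fail to be an \<open>inner_node\<close> of
  its label class: top or bottom row, outer columns, or a label change towards the parent, a child
  or a horizontal neighbour.\<close>

definition wall :: "nat \<Rightarrow> nat \<Rightarrow> nat \<Rightarrow> bool" where
  "wall n m j \<longleftrightarrow> m = 0 \<or> m = n \<or> swt m j \<or> swt (Suc m) (2 * j) \<or> swt (Suc m) (2 * j + 1) \<or> j = 0 \<or> Suc j = 2 ^ m \<or>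
     lab m j \<noteq> lab m (j - 1) \<or> lab m j \<noteq> lab m (Suc j)"

definition Wall :: "nat \<Rightarrow> (nat \<times> nat) set" where
  "Wall n = {J. fst J \<le> n \<and> snd J < 2 ^ fst J \<and> wall n (fst J) (snd J)}"

lemma Wall_finite: "finite (Wall n)"
proof -
  have "Wall n \<subseteq> {..n} \<times> {..<2 ^ n}"
    unfolding Wall_def by (auto intro: less_le_trans power_increasing)
  then show ?thesis by (rule finite_subset) auto
qed

lemma geo_sides: "(\<Sum>k\<le>d. side (m + k)) \<le> 2 * side m"
proof -
  have "(\<Sum>k\<le>d. side (m + k)) = 2 * side m - side (m + d)" by (induction d) (auto simp: side_Suc)
  then show ?thesis by simp
qed

lemma tot_single:
  assumes "\<And>k. card {i \<in> {j * 2 ^ k..<(j + 1) * 2 ^ k}. P (m + k) i} \<le> 1"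
  shows "tot (\<lambda>m j. if P m j then side m else 0) d m j \<le> 2 * side m"
proof -
  have "tot (\<lambda>m j. if P m j then side m else 0) d m j = (\<Sum>k\<le>d. side (m + k) * real (card {i \<in> {j * 2 ^ k..<(j + 1) * 2 ^ k}. P (m + k) i}))"
    unfolding tot_sum by (intro sum.cong refl) (subst sum.inter_filter[symmetric], auto)
  also have "\<dots> \<le> (\<Sum>k\<le>d. side (m + k))"
  proof (rule sum_mono)
    fix k
    have "real (card {i \<in> {j * 2 ^ k..<(j + 1) * 2 ^ k}. P (m + k) i}) \<le> 1" using assms[of k] by linarith
    then show "side (m + k) * real (card {i \<in> {j * 2 ^ k..<(j + 1) * 2 ^ k}. P (m + k) i}) \<le> side (m + k)"
      using mult_left_mono[of _ 1 "side (m + k)"] by simp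
  qed
  also have "\<dots> \<le> 2 * side m" by (rule geo_sides)
  finally show ?thesis .
qed

text \<open>Compared with \<open>vv\<close>, each generation has at most one more jump, namely
  towards a neighbour outside the subtree: on the right for \<open>s = 0\<close>, on the left for
  \<open>s = 1\<close>. These extra jumps add up to at most \<open>2 * side m\<close>.\<close>

lemma tot_diff:
  assumes s: "s = 0 \<or> s = 1"
  shows "tot (\<lambda>m j. if lab m (j - s) \<noteq> lab m (j - s + 1) \<and> j \<ge> s then side m else 0) d m j \<le> 2 * side m + vv d m j"
proof -
  have "tot (\<lambda>m j. if lab m (j - s) \<noteq> lab m (j - s + 1) \<and> j \<ge> s then side m else 0) d m j
    = (\<Sum>k\<le>d. side (m + k) * real (card {i \<in> {j * 2 ^ k..<(j + 1) * 2 ^ k}. lab (m + k) (i - s) \<noteq> lab (m + k) (i - s + 1) \<and> i \<ge> s}))"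
    unfolding tot_sum by (intro sum.cong refl) (subst sum.inter_filter[symmetric], simp_all)
  also have "\<dots> \<le> (\<Sum>k\<le>d. side (m + k) * (1 + real (card (DD m j k))))"
  proof (intro sum_mono mult_left_mono)
    fix k
    let ?S = "{i \<in> {j * 2 ^ k..<(j + 1) * 2 ^ k}. lab (m + k) (i - s) \<noteq> lab (m + k) (i - s + 1) \<and> i \<ge> s}"
    let ?e = "if s = 0 then (j + 1) * 2 ^ k - 1 else j * 2 ^ k - 1"
    have "(\<lambda>i. i - s) ` ?S \<subseteq> insert ?e (DD m j k)"
    proof
      fix x assume "x \<in> (\<lambda>i. i - s) ` ?S"
      then obtain i where i: "x = i - s" "j * 2 ^ k \<le> i" "i < (j + 1) * 2 ^ k" "lab (m + k) (i - s) \<noteq> lab (m + k) (i - s + 1)" "s \<le> i"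
        by auto
      show "x \<in> insert ?e (DD m j k)"
      proof (cases "s = 0")
        case True
        then have l: "x = i" "lab (m + k) i \<noteq> lab (m + k) (i + 1)" using i(1,4) by simp_all
        consider "i + 1 < (j + 1) * 2 ^ k" | "i = (j + 1) * 2 ^ k - 1" using i(3) by linarith
        then show ?thesis
        proof cases
          case 1 then show ?thesis using l i(2) unfolding DD_def by blast
        next
          case 2 then show ?thesis using True l(1) by simp
        qed
      next
        case False
        then have s1: "s = 1" using s by simp
        then have l: "x = i - 1" "lab (m + k) (i - 1) \<noteq> lab (m + k) (i - 1 + 1)" "i \<ge> 1" using i by simp_all
        consider "j * 2 ^ k \<le> i - 1" | "i = j * 2 ^ k" using i(2) by linarith
        then show ?thesis
        proof cases
          case 1
          have "i - 1 + 1 < (j + 1) * 2 ^ k" using i(3) l(3) by linarith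
          then show ?thesis using 1 l(1,2) unfolding DD_def by blast
        next
          case 2 then show ?thesis using False l(1) by simp
        qed
      qed
    qed
    then have "card ((\<lambda>i. i - s) ` ?S) \<le> card (insert ?e (DD m j k))" by (intro card_mono) (auto simp: DD_finite)
    also have "\<dots> \<le> 1 + card (DD m j k)" by (simp add: card_insert_le_m1 DD_finite card_insert_if)
    also have "card ((\<lambda>i. i - s) ` ?S) = card ?S" by (rule card_image) (auto simp: inj_on_def)
    finally show "real (card ?S) \<le> 1 + real (card (DD m j k))" by linarith
  qed simp
  also have "\<dots> = (\<Sum>k\<le>d. side (m + k)) + vv d m j" by (simp add: vv_def distrib_left sum.distrib)
  also have "\<dots> \<le> 2 * side m + vv d m j" using geo_sides by simp
  finally show ?thesis .
qed

lemma below_sum_le_tot: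
  assumes F: "finite F" "\<And>J. J \<in> F \<Longrightarrow> fst J \<le> n" and w: "\<And>m j. w m j \<ge> 0" "\<And>J. J \<in> F \<Longrightarrow> side (fst J) \<le> w (fst J) (snd J)"
    and l: "l \<le> n"
  shows "(\<Sum>J\<in>{J\<in>F. below (l, i) J}. side (fst J)) \<le> tot w (n - l) l i"
proof -
  let ?R = "SIGMA k:{..n - l}. {i * 2 ^ k..<(i + 1) * 2 ^ k}"
  have "(\<Sum>J\<in>{J\<in>F. below (l, i) J}. side (fst J)) \<le> (\<Sum>J\<in>{J\<in>F. below (l, i) J}. w (fst J) (snd J))"
    using w by (intro sum_mono) auto
  also have "\<dots> = (\<Sum>x\<in>(\<lambda>J. (fst J - l, snd J)) ` {J\<in>F. below (l, i) J}. w (l + fst x) (snd x))"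
  proof (subst sum.reindex)
    show "inj_on (\<lambda>J. (fst J - l, snd J)) {J\<in>F. below (l, i) J}"
    proof (rule inj_onI)
      fix J J' assume "J \<in> {J\<in>F. below (l, i) J}" "J' \<in> {J\<in>F. below (l, i) J}" "(fst J - l, snd J) = (fst J' - l, snd J')"
      then have "l \<le> fst J" "l \<le> fst J'" "fst J - l = fst J' - l" "snd J = snd J'" by (simp_all add: below_def)
      then show "J = J'" by (intro prod_eqI) linarith+
    qed
  qed (auto simp: below_def intro!: sum.cong)
  also have "\<dots> \<le> (\<Sum>x\<in>?R. w (l + fst x) (snd x))"
  proof (rule sum_mono2)
    show "(\<lambda>J. (fst J - l, snd J)) ` {J\<in>F. below (l, i) J} \<subseteq> ?R"
    proof (rule image_subsetI)
      fix J assume J: "J \<in> {J\<in>F. below (l, i) J}"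
      define a b where "a = fst J" and "b = snd J"
      have h: "a \<le> n" "b div 2 ^ (a - l) = i" "l \<le> a" using F J by (auto simp: below_def a_def b_def)
      have "i * 2 ^ (a - l) \<le> b" using h(2) by (metis div_mult_mod_eq le_add1)
      moreover have "b < (i + 1) * 2 ^ (a - l)" using h(2) dividend_less_div_times[of "2 ^ (a - l)" b] by simp
      ultimately show "(fst J - l, snd J) \<in> ?R" using h by (auto simp flip: a_def b_def)
    qed
  qed (use w in auto)
  also have "\<dots> = tot w (n - l) l i" unfolding tot_sum by (subst sum.Sigma) (auto simp: case_prod_beta)
  finally show ?thesis .
qed

text \<open>\<open>65 = 1 + 1 + 5 + 10 + 2 + 2 + 22 + 22\<close>, in the order of the weights below:
  top row, bottom row, switches, switches of children (counted twice because their sides are half as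
  long), the two outer columns, and the changes towards the right and the left neighbour.\<close>

lemma Wall_npack:
  assumes P: "\<And>d m j. swt m j \<Longrightarrow> \<not> lab m j \<Longrightarrow> fs d m j \<le> side m / 2"
  shows "npack 65 (Wall n) id"
  unfolding npack_def
proof (intro conjI allI ballI)
  show "finite (Wall n)" by (rule Wall_finite)
  show "snd (id J) < 2 ^ fst (id J)" if "J \<in> Wall n" for J using that by (simp add: Wall_def)
  fix I :: "nat \<times> nat"
  obtain l i where I: "I = (l, i)" by (cases I)
  show "(\<Sum>J\<in>{J \<in> Wall n. below I (id J)}. side (fst (id J))) \<le> 65 * side (fst I)"
  proof (cases "l \<le> n")
    case False
    then have "{J \<in> Wall n. below I (id J)} = {}" by (auto simp: Wall_def below_def I)
    then show ?thesis by (simp only: sum.empty) simp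
  next
    case l: True
    define d where "d = n - l"
    define w1 where "w1 m j = (if m = 0 then side m else 0)" for m j :: nat
    define w2 where "w2 m j = (if m = n then side m else 0)" for m j :: nat
    define w4 where "w4 m j = 2 * swtw (Suc m) (2 * j) + 2 * swtw (Suc m) (2 * j + 1)" for m j
    define w5 where "w5 m j = (if j = 0 then side m else 0)" for m j :: nat
    define w6 where "w6 m j = (if Suc j = 2 ^ m then side m else 0)" for m j :: nat
    define w7 where "w7 m j = (if lab m (j - 0) \<noteq> lab m (j - 0 + 1) \<and> j \<ge> 0 then side m else 0)" for m j :: nat
    define w8 where "w8 m j = (if lab m (j - 1) \<noteq> lab m (j - 1 + 1) \<and> j \<ge> 1 then side m else 0)" for m j :: nat
    define w where "w m j = w1 m j + (w2 m j + (swtw m j + (w4 m j + (w5 m j + (w6 m j + (w7 m j + w8 m j))))))" for m j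
    note ws = w1_def w2_def w4_def w5_def w6_def w7_def w8_def swtw_def
    have t1: "tot w1 d l i \<le> side l"
    proof -
      have "tot w1 d l i = (\<Sum>k\<le>d. if k = 0 then (if l = 0 then side 0 else 0) else 0)"
        unfolding tot_sum w1_def by (intro sum.cong refl) auto
      then show ?thesis by simp
    qed
    have t2: "tot w2 d l i \<le> side l"
    proof -
      have "tot w2 d l i = (\<Sum>k\<le>d. if k = d then 2 ^ d * side n else 0)"
        unfolding tot_sum w2_def using l by (intro sum.cong refl) (auto simp: d_def algebra_simps)
      also have "\<dots> = 2 ^ d * side n" by simp
      also have "side n = side l * side d" using l by (simp add: d_def flip: side_add)
      finally show ?thesis using side_2pow[of d] by (simp add: mult_ac)
    qed
    have t3: "tot swtw d l i \<le> 5 * side l" by (rule swt_sum[OF P])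
    have t4: "tot w4 d l i \<le> 10 * side l"
    proof -
      have "tot w4 d l i \<le> 2 * tot swtw (Suc d) l i - 2 * swtw l i" for l i
      proof (induction d arbitrary: l i)
        case 0 then show ?case by (simp add: w4_def)
      next
        case (Suc d)
        have arith: "2 * a + 2 * b + u + v \<le> 2 * (s + p + q) - 2 * s" if "u \<le> 2 * p - 2 * a" "v \<le> 2 * q - 2 * b"
          for a b u v s p q :: real using that by (simp add: algebra_simps)
        show ?case unfolding tot.simps(2)[of _ "Suc d" l i] tot.simps(2)[of w4] w4_def[of l i] by (rule arith[OF Suc.IH Suc.IH])
      qed
      moreover have "tot swtw (Suc d) l i \<le> 5 * side l" by (rule swt_sum[OF P])
      moreover have "swtw l i \<ge> 0" by (simp add: swtw_def)
      ultimately show ?thesis by (smt (verit))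
    qed
    have t5: "tot w5 d l i \<le> 2 * side l"
      unfolding w5_def
    proof (rule tot_single)
      fix k
      have "{ia \<in> {i * 2 ^ k..<(i + 1) * 2 ^ k}. ia = 0} \<subseteq> {0}" by auto
      then show "card {ia \<in> {i * 2 ^ k..<(i + 1) * 2 ^ k}. ia = 0} \<le> 1" using card_mono[of "{0::nat}"] by fastforce
    qed
    have t6: "tot w6 d l i \<le> 2 * side l"
      unfolding w6_def
    proof (rule tot_single)
      fix k
      have "{ia \<in> {i * 2 ^ k..<(i + 1) * 2 ^ k}. Suc ia = 2 ^ (l + k)} \<subseteq> {2 ^ (l + k) - 1}" by auto
      then show "card {ia \<in> {i * 2 ^ k..<(i + 1) * 2 ^ k}. Suc ia = 2 ^ (l + k)} \<le> 1"
        using card_mono[of "{2 ^ (l + k) - 1::nat}"] by fastforce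
    qed
    have v: "vv d l i \<le> 20 * side l" using vv_le[of d l i] t3 by linarith
    have t7: "tot w7 d l i \<le> 22 * side l" using tot_diff[of 0 d l i] v unfolding w7_def by simp
    have t8: "tot w8 d l i \<le> 22 * side l" using tot_diff[of 1 d l i] v unfolding w8_def by simp
    have "(\<Sum>J\<in>{J\<in>Wall n. below (l, i) J}. side (fst J)) \<le> tot w (n - l) l i"
    proof (rule below_sum_le_tot[OF Wall_finite _ _ _ l])
      show "0 \<le> w m j" for m j
        unfolding w_def by (intro add_nonneg_nonneg) (simp_all add: ws)
      show "side (fst J) \<le> w (fst J) (snd J)" if J: "J \<in> Wall n" for J
      proof -
        define m j where "m = fst J" and "j = snd J"
        have s: "side m = 2 * side (Suc m)" by (simp add: side_Suc)
        have nn: "w1 m j \<ge> 0" "w2 m j \<ge> 0" "swtw m j \<ge> 0" "w4 m j \<ge> 0" "w5 m j \<ge> 0" "w6 m j \<ge> 0" "w7 m j \<ge> 0" "w8 m j \<ge> 0"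
          by (simp_all add: ws)
        have "wall n m j" using J by (simp add: Wall_def m_def j_def)
        then have "w1 m j \<ge> side m \<or> w2 m j \<ge> side m \<or> swtw m j \<ge> side m \<or> w4 m j \<ge> side m \<or> w5 m j \<ge> side m \<or> w6 m j \<ge> side m \<or> w7 m j \<ge> side m \<or> w8 m j \<ge> side m"
          unfolding wall_def ws s by (cases "j = 0") auto
        then show ?thesis unfolding w_def using nn by (auto simp flip: m_def j_def)
      qed
    qed (auto simp: Wall_def)
    also have "tot w (n - l) l i = tot w1 d l i + (tot w2 d l i + (tot swtw d l i + (tot w4 d l i + (tot w5 d l i + (tot w6 d l i + (tot w7 d l i + tot w8 d l i))))))"
      unfolding w_def tot_add d_def ..
    finally show ?thesis using t1 t2 t3 t4 t5 t6 t7 t8 by (simp add: I)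
  qed
qed

end

section \<open>Small values below a large value\<close>

lemma bf_real: "a \<in> uhp \<Longrightarrow> Im z = 0 \<Longrightarrow> cmod (bf a z) = 1"
proof -
  assume a: "a \<in> uhp" and z: "Im z = 0"
  have "(cmod (z - cnj a))\<^sup>2 = (cmod (z - a))\<^sup>2" using cmod_cnj_diff[of z a] z by simp
  then have "cmod (z - cnj a) = cmod (z - a)" by (metis norm_ge_zero power2_eq_imp_eq)
  moreover have "z - cnj a \<noteq> 0" using a z by (auto simp: uhp_def complex_eq_iff)
  moreover have "z \<noteq> a" using a z by (auto simp: uhp_def)
  ultimately show ?thesis by (simp add: bf_def norm_divide)
qed

lemma bf_infinity: "(bf a \<longlongrightarrow> 1) at_infinity"
proof -
  have "filterlim (\<lambda>z. z - cnj a) at_infinity at_infinity"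
    using tendsto_add_filterlim_at_infinity'[OF filterlim_ident tendsto_const[of "- cnj a"]] by simp
  then have "((\<lambda>z. (cnj a - a) / (z - cnj a)) \<longlongrightarrow> 0) at_infinity"
    by (intro tendsto_divide_0[OF tendsto_const])
  then have "((\<lambda>z. 1 + (cnj a - a) / (z - cnj a)) \<longlongrightarrow> 1 + 0) at_infinity" by (intro tendsto_intros)
  moreover have "eventually (\<lambda>z. 1 + (cnj a - a) / (z - cnj a) = bf a z) at_infinity"
    using eventually_not_equal_at_infinity[of "cnj a"] by eventually_elim (simp add: bf_def field_simps)
  ultimately show ?thesis by (simp add: tendsto_cong)
qed

text \<open>The modulus of a finite Blaschke product is 1 on the real axis and tends to 1 at
  infinity. Sublevel sets therefore stay away from both, which makes the maximum principle available
  without boundary values of the other functions.\<close>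

lemma bprod_sublevel_compact:
  assumes A: "finite A" "\<And>i. i \<in> A \<Longrightarrow> p i \<in> uhp" and t: "t < 1"
  shows "compact {z\<in>uhp. cmod (bprod A p z) \<le> t}"
proof -
  have eq: "{z\<in>uhp. cmod (bprod A p z) \<le> t} = {z. Im z \<ge> 0} \<inter> {z\<in>{z. Im z \<ge> 0}. cmod (bprod A p z) \<le> t}"
  proof -
    have "Im z > 0" if "Im z \<ge> 0" "cmod (bprod A p z) \<le> t" for z
    proof (rule ccontr)
      assume "\<not> Im z > 0"
      then have "cmod (bprod A p z) = 1" using that A bf_real by (simp add: bprod_def prod_norm[symmetric])
      then show False using that t by simp
    qed
    then show ?thesis by (auto simp: uhp_def)
  qed
  have "continuous_on {z. Im z \<ge> 0} (bprod A p)"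
    unfolding bprod_def[abs_def] bf_def
  proof (intro continuous_intros ballI)
    fix i z assume "i \<in> A" "z \<in> {z. Im z \<ge> 0}"
    then have "Im (z - cnj (p i)) > 0" using A(2)[of i] by (simp add: uhp_def)
    then show "z - cnj (p i) \<noteq> 0" by auto
  qed
  then have "closed {z\<in>{z. Im z \<ge> 0}. cmod (bprod A p z) \<le> t}"
    by (intro continuous_on_closed_Collect_le continuous_intros closed_halfspace_Im_ge)
  then have cl: "closed {z\<in>uhp. cmod (bprod A p z) \<le> t}" unfolding eq by (intro closed_Int closed_halfspace_Im_ge)
  have "((\<lambda>z. cmod (bprod A p z)) \<longlongrightarrow> cmod (\<Prod>i\<in>A. 1)) at_infinity"
    unfolding bprod_def[abs_def] by (intro tendsto_norm tendsto_prod bf_infinity)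
  then have "eventually (\<lambda>z. cmod (bprod A p z) > t) at_infinity" using t by (intro order_tendstoD(1)) auto
  then obtain R where R: "\<And>z. cmod z \<ge> R \<Longrightarrow> cmod (bprod A p z) > t" by (auto simp: eventually_at_infinity)
  have "{z\<in>uhp. cmod (bprod A p z) \<le> t} \<subseteq> cball 0 R"
  proof
    fix z assume "z \<in> {z\<in>uhp. cmod (bprod A p z) \<le> t}"
    then show "z \<in> cball 0 R" using R[of z] by (cases "cmod z \<ge> R") auto
  qed
  then show ?thesis using cl bounded_subset[OF bounded_cball] by (auto simp: compact_eq_bounded_closed)
qed

text \<open>Maximum principle for the quotient of g by the n-th power of the product, on the set
  where the product is at most t, minus the discs. Where the product has modulus t, the bound 1 for
  g suffices; on the circles the smallness of g is assumed. Finally t tends to 1.\<close>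

lemma schwarz_with_holes:
  assumes A: "finite A" "\<And>i. i \<in> A \<Longrightarrow> p i \<in> uhp" and r: "\<And>i. i \<in> A \<Longrightarrow> r i > 0 \<and> cball (p i) (r i) \<subseteq> uhp"
    and g: "g holomorphic_on uhp" "\<And>z. z \<in> uhp \<Longrightarrow> cmod (g z) \<le> 1"
    and small: "\<And>i z. i \<in> A \<Longrightarrow> dist (p i) z = r i \<Longrightarrow> cmod (g z) \<le> cmod (bprod A p z) ^ n"
    and w: "w \<in> uhp" "\<And>i. i \<in> A \<Longrightarrow> w \<notin> ball (p i) (r i)"
  shows "cmod (g w) \<le> cmod (bprod A p w) ^ n"
proof -
  have nz: "bprod A p z \<noteq> 0" if "z \<in> uhp" "\<And>i. i \<in> A \<Longrightarrow> z \<notin> ball (p i) (r i)" for z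
  proof
    assume "bprod A p z = 0"
    then have "\<exists>i\<in>A. p i = z" using bprod_eq0[OF A that(1)] by simp
    then show False using that(2) r by fastforce
  qed
  have main: "cmod (g w) \<le> cmod (bprod A p w) ^ n / t ^ n" if t: "cmod (bprod A p w) < t" "t < 1" for t
  proof -
    have t0: "t > 0" using t(1) by (rule le_less_trans[OF norm_ge_zero])
    define S where "S = {z\<in>uhp. cmod (bprod A p z) \<le> t} - (\<Union>i\<in>A. ball (p i) (r i))"
    have S: "compact S" unfolding S_def by (intro compact_diff bprod_sublevel_compact A t open_UN) auto
    define h where "h z = g z / bprod A p z ^ n" for z
    have Su: "S \<subseteq> uhp" by (auto simp: S_def)
    have nzS: "z \<in> S \<Longrightarrow> bprod A p z \<noteq> 0" for z by (intro nz) (auto simp: S_def)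
    have h: "h holomorphic_on S"
      unfolding h_def using Su nzS by (intro holomorphic_intros holomorphic_on_subset[OF g(1)] holomorphic_on_subset[OF bprod_hol] A) auto
    have "cmod (h w) \<le> 1 / t ^ n"
    proof (rule maximum_modulus_frontier[where f = h and S = S])
      show "h holomorphic_on interior S" using h interior_subset by (rule holomorphic_on_subset)
      show "continuous_on (closure S) h" using h S by (simp add: compact_imp_closed holomorphic_on_imp_continuous_on)
      show "bounded S" using S by (rule compact_imp_bounded)
      show "w \<in> S" using w t by (auto simp: S_def)
      fix z assume z: "z \<in> frontier S"
      then have zS: "z \<in> S" using S by (simp add: compact_imp_closed frontier_def)
      have bt: "cmod (bprod A p z) \<le> t" using zS by (simp add: S_def)
      have "cmod (g z) * t ^ n \<le> cmod (bprod A p z) ^ n"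
      proof (cases "cmod (bprod A p z) = t")
        case True
        then show ?thesis using g(2)[of z] zS Su t0 by (simp add: mult_left_le_one_le subset_eq)
      next
        case False
        have "\<exists>i\<in>A. dist (p i) z = r i"
        proof (rule ccontr)
          assume no: "\<not> (\<exists>i\<in>A. dist (p i) z = r i)"
          let ?V = "{z\<in>uhp. cmod (bprod A p z) < t} - (\<Union>i\<in>A. cball (p i) (r i))"
          have "continuous_on uhp (\<lambda>z. cmod (bprod A p z))"
            by (intro continuous_intros holomorphic_on_imp_continuous_on bprod_hol A)
          then have "open (uhp \<inter> (\<lambda>z. cmod (bprod A p z)) -` {..<t})"
            by (rule continuous_open_preimage[OF _ open_uhp]) simp
          moreover have "uhp \<inter> (\<lambda>z. cmod (bprod A p z)) -` {..<t} = {z\<in>uhp. cmod (bprod A p z) < t}" by auto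
          ultimately have "open {z\<in>uhp. cmod (bprod A p z) < t}" by simp
          then have "open ?V" using A by (intro open_Diff closed_UN) auto
          moreover have "z \<in> ?V" using zS no bt False by (force simp: S_def)
          moreover have "?V \<subseteq> S" by (force simp: S_def)
          ultimately have "z \<in> interior S" by (meson interiorI)
          then show False using z by (simp add: frontier_def)
        qed
        then obtain i where i: "i \<in> A" "dist (p i) z = r i" by blast
        have "cmod (g z) * t ^ n \<le> cmod (g z) * 1" using t0 t by (intro mult_left_mono power_le_one) auto
        then show ?thesis using small[OF i] by simp
      qed
      moreover have "cmod (bprod A p z) > 0" using nzS[OF zS] by simp
      ultimately show "cmod (h z) \<le> 1 / t ^ n" using t0 by (simp add: h_def norm_divide norm_power field_simps)
    qed
    moreover have "cmod (bprod A p w) > 0" using nz[OF w] by simp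
    ultimately show ?thesis by (simp add: h_def norm_divide norm_power field_simps)
  qed
  have bw: "cmod (bprod A p w) < 1" if "A \<noteq> {}"
  proof -
    obtain a where a: "a \<in> A" using \<open>A \<noteq> {}\<close> by blast
    have "cmod (bprod A p w) = cmod (bf (p a) w) * cmod (bprod (A - {a}) p w)"
      unfolding bprod_def using A a by (subst prod.remove[of A a]) (auto simp: norm_mult)
    also have "\<dots> \<le> cmod (bf (p a) w) * 1" using A w by (intro mult_left_mono bprod_le1) auto
    also have "\<dots> < 1" using bf_le1[OF w(1) A(2)[OF a]] by simp
    finally show ?thesis .
  qed
  show ?thesis
  proof (cases "A = {}")
    case True then show ?thesis using g w by (simp add: bprod_def)
  next
    case False
    have lim: "((\<lambda>t. cmod (bprod A p w) ^ n / t ^ n) \<longlongrightarrow> cmod (bprod A p w) ^ n / 1 ^ n) (at_left (1::real))"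
      by (intro tendsto_intros) auto
    have ev: "eventually (\<lambda>t. cmod (g w) \<le> cmod (bprod A p w) ^ n / t ^ n) (at_left (1::real))"
      by (rule eventually_at_leftI[OF _ bw[OF False]]) (use main in auto)
    show ?thesis using tendsto_lowerbound[OF lim ev] by simp
  qed
qed

text \<open>The chord argument of \<open>exp_m2_le\<close> on a longer range;
  \<open>80/81 = 1 - (1/9)\<^sup>2\<close> fits Blaschke factors of modulus at least 1/9.\<close>

lemma exp_m6_le:
  fixes x :: real assumes "0 \<le> x" "x \<le> 80/81" shows "exp (- 6 * x) \<le> 1 - x"
proof -
  have "(81::real) \<le> (1 + 1/2 + (1/2)\<^sup>2 / 2) ^ 11" by (simp add: power2_eq_square field_simps)
  also have "\<dots> \<le> exp (1/2) ^ 11" by (intro power_mono exp_lower_Taylor_quadratic) auto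
  also have "\<dots> = exp (11/2)" by (simp flip: exp_of_nat_mult)
  also have "\<dots> \<le> exp (160/27)" by simp
  finally have "exp (- 160/27 :: real) \<le> 1/81" by (simp add: exp_minus field_simps)
  moreover have "convex_on UNIV (exp :: real \<Rightarrow> real)" by (rule exp_convex)
  then have "exp ((1 - 81/80*x) *\<^sub>R 0 + (81/80*x) *\<^sub>R (- 160/27)) \<le> (1 - 81/80*x) * exp 0 + (81/80*x) * exp (- 160/27)"
    using assms by (intro convex_onD) auto
  moreover have "81/80*x * exp (- 160/27) \<le> 81/80*x * (1/81)" using assms calculation(1) by (intro mult_left_mono) auto
  ultimately show ?thesis by simp
qed

lemma bprod_lower:
  assumes c: "car K A p" and z: "z \<in> uhp" and far: "\<And>i. i \<in> A \<Longrightarrow> cmod (z - cnj (p i)) \<le> 9 * cmod (z - p i)"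
  shows "cmod (bprod A p z) \<ge> exp (- 3 * K)"
proof -
  have fin: "finite A" and pu: "\<And>i. i \<in> A \<Longrightarrow> p i \<in> uhp" and S: "(\<Sum>i\<in>A. pk z (p i)) \<le> K" using c z by (auto simp: car_def)
  have one: "exp (- 6 * pk z (p i)) \<le> 1 - pk z (p i)" if i: "i \<in> A" for i
  proof (rule exp_m6_le)
    show "0 \<le> pk z (p i)" using pk_pos[OF z pu[OF i]] by simp
    have "z - cnj (p i) \<noteq> 0" using uhp_cnj_ne z pu i by blast
    then have "1/9 \<le> cmod (bf (p i) z)" using far[OF i] by (simp add: bf_def norm_divide field_simps)
    then have "(1/9)\<^sup>2 \<le> (cmod (bf (p i) z))\<^sup>2" by (intro power_mono) auto
    then show "pk z (p i) \<le> 80/81" unfolding pk_bf[OF z pu[OF i]] by (simp add: power2_eq_square)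
  qed
  have "(exp (- 3 * K))\<^sup>2 = exp (- 6 * K)" by (simp flip: exp_of_nat_mult)
  also have "\<dots> \<le> exp (\<Sum>i\<in>A. - 6 * pk z (p i))" using S by (simp add: sum_distrib_left[symmetric] sum_negf)
  also have "\<dots> = (\<Prod>i\<in>A. exp (- 6 * pk z (p i)))" using fin by (simp add: exp_sum)
  also have "\<dots> \<le> (\<Prod>i\<in>A. 1 - pk z (p i))" using one by (intro prod_mono) auto
  also have "\<dots> = (cmod (bprod A p z))\<^sup>2" using pu z by (simp add: bprod_norm2)
  finally show ?thesis by (rule power2_le_imp_le) simp
qed

lemma dyint_disjoint_Re:
  assumes "dyint J \<inter> dyint J' = {}"
  shows "\<bar>Re (cen J) - Re (cen J')\<bar> \<ge> side (fst J) / 2 + side (fst J') / 2"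
proof -
  define a b a' b' where "a = real (snd J) * side (fst J)" and "b = (real (snd J) + 1) * side (fst J)"
    and "a' = real (snd J') * side (fst J')" and "b' = (real (snd J') + 1) * side (fst J')"
  have ab: "a < b" "a' < b'" "b = a + side (fst J)" "b' = a' + side (fst J')" by (auto simp: a_def b_def a'_def b'_def algebra_simps)
  have "{a..<b} \<inter> {a'..<b'} = {}" using assms by (simp add: dyint_def a_def b_def a'_def b'_def)
  then have "b \<le> a' \<or> b' \<le> a" using ab
  proof (cases "a \<le> a'")
    case True
    then have "a' \<notin> {a..<b}" using \<open>{a..<b} \<inter> {a'..<b'} = {}\<close> ab(2) by (auto simp: disjoint_iff)
    then show ?thesis using True by auto
  next
    case False
    then have "a \<notin> {a'..<b'}" using \<open>{a..<b} \<inter> {a'..<b'} = {}\<close> ab(1) by (auto simp: disjoint_iff)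
    then show ?thesis using False by auto
  qed
  moreover have "Re (cen J) = a + side (fst J) / 2" "Re (cen J') = a' + side (fst J') / 2"
    by (auto simp: a_def a'_def Re_cen algebra_simps)
  ultimately show ?thesis using ab by (auto simp: abs_if)
qed

text \<open>On circles around the centres the Blaschke product of the centres is at least
  \<open>exp (- 3 * packc)\<close>, so g is below its n-th power there, and by
  \<open>schwarz_with_holes\<close> also at w. If the squares covered more than half of the base,
  the kernel sum at w would exceed 1/10 and push this power below \<eta>. Thus n measures the gap
  between the two thresholds.\<close>

lemma small_below_large:
  assumes F: "finite F" "npack 1 F id" "\<And>J J'. J \<in> F \<Longrightarrow> J' \<in> F \<Longrightarrow> J \<noteq> J' \<Longrightarrow> dyint J \<inter> dyint J' = {}"
    and bel: "\<And>J. J \<in> F \<Longrightarrow> below I J"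
    and g: "g holomorphic_on uhp" "\<And>z. z \<in> uhp \<Longrightarrow> cmod (g z) \<le> 1"
    and small: "\<And>J z. J \<in> F \<Longrightarrow> z \<in> cball (cen J) (4/5 * side (fst J)) \<Longrightarrow> cmod (g z) \<le> exp (- 3 * packc * real n)"
    and w: "w \<in> cball (cen I) (4/5 * side (fst I))" "cmod (g w) > \<eta>"
    and \<eta>: "0 < \<eta>" "exp (- 3 * packc * real n) \<le> \<eta>" and n: "20 * ln (1 / \<eta>) \<le> real n" "n > 0"
  shows "(\<Sum>J\<in>F. side (fst J)) \<le> side (fst I) / 2"
proof -
  have car: "car (packc * 1) F cen" by (rule npack_car[OF F(2)]) auto
  have wI: "w \<in> cball (cen I) (9/10 * side (fst I))" using w(1) side_pos[of "fst I"] unfolding mem_cball by linarith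
  have wu: "w \<in> uhp" by (rule near_cen(4)[OF wI])
  have b: "cmod (g w) \<le> cmod (bprod F cen w) ^ n"
  proof (rule schwarz_with_holes[where r = "\<lambda>J. 2/5 * side (fst J)"])
    fix J assume J: "J \<in> F"
    show "cen J \<in> uhp" by (rule cen_uhp)
    have "cball (cen J) (2/5 * side (fst J)) \<subseteq> cball (cen J) (9/10 * side (fst J))" by (intro subset_cball) simp
    then show "2/5 * side (fst J) > 0 \<and> cball (cen J) (2/5 * side (fst J)) \<subseteq> uhp" using near_cen(4)[of _ J] by auto
    have sub: "ball (cen J) (2/5 * side (fst J)) \<subseteq> cball (cen J) (4/5 * side (fst J))"
    proof
      fix x assume "x \<in> ball (cen J) (2/5 * side (fst J))"
      then have "dist (cen J) x < 2/5 * side (fst J)" by simp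
      then have "dist (cen J) x \<le> 4/5 * side (fst J)" using side_pos[of "fst J"] by linarith
      then show "x \<in> cball (cen J) (4/5 * side (fst J))" by simp
    qed
    show "w \<notin> ball (cen J) (2/5 * side (fst J))"
    proof
      assume "w \<in> ball (cen J) (2/5 * side (fst J))"
      then have "cmod (g w) \<le> \<eta>" using small[OF J, of w] sub \<eta>(2) by fastforce
      then show False using w by simp
    qed
    fix z assume z: "dist (cen J) z = 2/5 * side (fst J)"
    have zc: "z \<in> cball (cen J) (4/5 * side (fst J))" "z \<in> cball (cen J) (9/10 * side (fst J))"
      unfolding mem_cball z using side_pos[of "fst J"] by linarith+
    have zu: "z \<in> uhp" by (rule near_cen(4)[OF zc(2)])
    have dR: "\<bar>Re z - Re (cen J)\<bar> \<le> 2/5 * side (fst J)"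
      using abs_Re_le_cmod[of "z - cen J"] z by (simp add: dist_norm norm_minus_commute)
    \<comment> \<open>The factor 9: a centre and its conjugate are 3 sides apart, while z is 2/5 of
      a side away from its own centre and at least half a side from any other.\<close>
    have "cmod (z - cnj (cen J')) \<le> 9 * cmod (z - cen J')" if J': "J' \<in> F" for J'
    proof -
      have tri: "cmod (z - cnj (cen J')) \<le> cmod (z - cen J') + 3 * side (fst J')"
      proof -
        have "cmod (z - cnj (cen J')) \<le> cmod (z - cen J') + cmod (cen J' - cnj (cen J'))"
          using norm_triangle_ineq[of "z - cen J'" "cen J' - cnj (cen J')"] by simp
        also have "cen J' - cnj (cen J') = \<i> * of_real (3 * side (fst J'))" by (simp add: complex_eq_iff Im_cen)
        also have "cmod \<dots> = 3 * side (fst J')" by (simp add: norm_mult)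
        finally show ?thesis by simp
      qed
      show ?thesis
      proof (cases "J' = J")
        case True
        then have "cmod (z - cen J') = 2/5 * side (fst J')" using z by (simp add: dist_norm norm_minus_commute)
        then show ?thesis using tri side_pos[of "fst J'"] by linarith
      next
        case False
        have "side (fst J) / 2 + side (fst J') / 2 \<le> \<bar>Re (cen J) - Re (cen J')\<bar>" using dyint_disjoint_Re F(3)[OF J J'] False by blast
        then have "\<bar>Re (z - cen J')\<bar> \<ge> side (fst J') / 2" using dR side_pos[of "fst J"] by (simp add: abs_if split: if_splits)
        then have "cmod (z - cen J') \<ge> side (fst J') / 2" using abs_Re_le_cmod order_trans by blast
        then show ?thesis using tri norm_ge_zero[of "z - cen J'"] by linarith
      qed
    qed
    then have "cmod (bprod F cen z) \<ge> exp (- 3 * (packc * 1))" by (intro bprod_lower[OF car zu])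
    then have "exp (- 3 * (packc * 1)) ^ n \<le> cmod (bprod F cen z) ^ n" by (intro power_mono) auto
    moreover have "exp (- 3 * (packc * 1)) ^ n = exp (- 3 * packc * real n)" by (simp add: mult_ac flip: exp_of_nat_mult)
    ultimately show "cmod (g z) \<le> cmod (bprod F cen z) ^ n" using small[OF J zc(1)] by linarith
  qed (use F g wu in auto)
  define s where "s = side (fst I)"
  have s: "s > 0" by (simp add: s_def)
  have pkl: "pk w (cen J) \<ge> 1/5 * side (fst J) / s" if J: "J \<in> F" for J
  proof -
    have "cmod (w - cen I) \<le> 4/5 * s" using w(1) by (simp add: dist_norm norm_minus_commute s_def)
    then have "\<bar>Re (w - cen I)\<bar> \<le> 4/5 * s" "\<bar>Im (w - cen I)\<bar> \<le> 4/5 * s"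
      using abs_Re_le_cmod abs_Im_le_cmod order_trans by blast+
    then have w1: "\<bar>Re w - Re (cen I)\<bar> \<le> 4/5 * s" "Im w \<ge> 7/10 * s" "Im w \<le> 23/10 * s"
      unfolding s_def by (simp_all only: minus_complex.sel Im_cen)
    have hs: "side (fst J) \<le> s" using bel[OF J] by (simp add: below_def s_def side_le_iff)
    have ar: "\<bar>c - (q + s / 2)\<bar> \<le> s / 2" if "q \<le> c" "c < q + s" for c q :: real
      using that by linarith
    have "Re (cen I) = real (snd I) * s + s / 2" by (simp add: Re_cen s_def algebra_simps)
    moreover have "real (snd I) * s \<le> Re (cen J)" "Re (cen J) < real (snd I) * s + s"
      using below_Re[OF bel[OF J]] by (simp_all add: s_def algebra_simps)
    ultimately have "\<bar>Re (cen J) - Re (cen I)\<bar> \<le> s / 2" using ar by simp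
    moreover have "Re (w - cnj (cen J)) = Re w - Re (cen J)" by simp
    ultimately have 1: "\<bar>Re (w - cnj (cen J))\<bar> \<le> 13/10 * s" using w1(1) by linarith
    have "Im (w - cnj (cen J)) = Im w + 3/2 * side (fst J)" by (simp add: Im_cen)
    then have 2: "\<bar>Im (w - cnj (cen J))\<bar> \<le> 38/10 * s" using w1 hs s side_pos[of "fst J"] by linarith
    have "(cmod (w - cnj (cen J)))\<^sup>2 = \<bar>Re (w - cnj (cen J))\<bar>\<^sup>2 + \<bar>Im (w - cnj (cen J))\<bar>\<^sup>2" by (simp only: cmod_power2 power2_abs)
    also have "\<dots> \<le> (13/10 * s)\<^sup>2 + (38/10 * s)\<^sup>2" using 1 2 by (intro add_mono power_mono) auto
    also have "\<dots> \<le> 17 * s\<^sup>2" by (simp add: power_mult_distrib power2_eq_square)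
    finally have D: "(cmod (w - cnj (cen J)))\<^sup>2 \<le> 17 * s\<^sup>2" .
    have Dp: "(cmod (w - cnj (cen J)))\<^sup>2 > 0" using uhp_cnj_ne[OF wu cen_uhp] by simp
    have "1/5 * side (fst J) / s \<le> 4 * (7/10 * s) * (3/2 * side (fst J)) / (17 * s\<^sup>2)"
      using s by (simp add: field_simps power2_eq_square)
    also have "\<dots> \<le> 4 * Im w * Im (cen J) / (17 * s\<^sup>2)"
      using w1 s by (intro divide_right_mono mult_mono) (auto simp: Im_cen)
    also have "\<dots> \<le> pk w (cen J)" unfolding pk_def using D Dp w1 s
      by (intro divide_left_mono) (auto simp: Im_cen intro!: mult_nonneg_nonneg)
    finally show ?thesis .
  qed
  define \<Phi> where "\<Phi> = (\<Sum>J\<in>F. side (fst J))"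
  have "1/5 * \<Phi> / s \<le> (\<Sum>J\<in>F. pk w (cen J))"
    unfolding \<Phi>_def sum_distrib_left sum_divide_distrib by (intro sum_mono pkl)
  then have "(cmod (bprod F cen w))\<^sup>2 \<le> exp (- (1/5 * \<Phi> / s))"
    using bprod_exp[OF F(1) _ wu, of cen] cen_uhp by (smt (verit) exp_le_cancel_iff)
  then have "((cmod (bprod F cen w))\<^sup>2) ^ n \<le> exp (- (1/5 * \<Phi> / s)) ^ n" by (intro power_mono) auto
  also have "\<dots> = exp (- (real n * \<Phi> / (5 * s)))" by (simp flip: exp_of_nat_mult)
  finally have 1: "(cmod (bprod F cen w) ^ n)\<^sup>2 \<le> exp (- (real n * \<Phi> / (5 * s)))" by (simp add: power_mult[symmetric] mult.commute)
  have "\<eta>\<^sup>2 \<le> (cmod (bprod F cen w) ^ n)\<^sup>2" using w(2) b \<eta> by (intro power_mono) auto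
  then have "\<eta>\<^sup>2 \<le> exp (- (real n * \<Phi> / (5 * s)))" using 1 by simp
  then have "ln (\<eta>\<^sup>2) \<le> - (real n * \<Phi> / (5 * s))" using \<eta>(1) by (metis exp_gt_zero ln_exp ln_le_cancel_iff zero_less_power)
  then have "real n * \<Phi> / (5 * s) \<le> 2 * ln (1 / \<eta>)" using \<eta>(1) by (simp add: ln_realpow ln_div)
  also have "\<dots> \<le> real n / 10" using n by simp
  finally have "real n * (\<Phi> / (5 * s)) \<le> real n * (1 / 10)" by simp
  then have "\<Phi> / (5 * s) \<le> 1 / 10" using n(2) by (simp only: mult_le_cancel_left_pos of_nat_0_less_iff)
  then show ?thesis using s by (simp add: \<Phi>_def s_def field_simps)
qed

section \<open>Gluing across a Carleson family of walls\<close>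

text \<open>\<open>(\<psi> \<zeta> - \<psi> z) / (\<zeta> - z)\<close> is the average of
  \<open>deriv \<psi>\<close> over the segment from z to \<zeta>, which makes sense also for z on
  the path; convexity keeps the segment in U. The double integral is holomorphic in z by
  differentiation under the integral sign.\<close>

lemma difference_quotient_integral:
  assumes \<psi>: "\<psi> holomorphic_on U" and U: "open U" "convex U"
    and seg: "closed_segment b c \<subseteq> U" and u: "continuous_on (closed_segment b c) u"
  shows "\<exists>D. D holomorphic_on U \<and>
    (\<forall>z\<in>U - closed_segment b c. D z = contour_integral (linepath b c) (\<lambda>\<zeta>. u \<zeta> * ((\<psi> \<zeta> - \<psi> z) / (\<zeta> - z))))"
proof -
  define \<gamma> where "\<gamma> = linepath b c"
  have \<gamma>seg: "\<gamma> s \<in> closed_segment b c" if "s \<in> {0..1}" for s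
    using that path_image_linepath[of b c] unfolding \<gamma>_def path_image_def by blast
  have \<gamma>c: "continuous_on A \<gamma>" for A unfolding \<gamma>_def by (rule continuous_on_linepath)
  have d1: "deriv \<psi> holomorphic_on U" using \<psi> U by (intro holomorphic_deriv)
  have d2: "deriv (deriv \<psi>) holomorphic_on U" by (rule holomorphic_deriv[OF d1 U(1)])
  have inU: "z + of_real t * (\<gamma> s - z) \<in> U" if "z \<in> U" "s \<in> {0..1}" "t \<in> {0..1}" for z s t
  proof -
    have "(1 - t) *\<^sub>R z + t *\<^sub>R \<gamma> s \<in> U" using that \<gamma>seg seg by (intro convexD[OF U(2)]) auto
    then show ?thesis by (simp add: scaleR_conv_of_real algebra_simps)
  qed
  define f where "f z x = u (\<gamma> (fst x)) * deriv \<psi> (z + of_real (snd x) * (\<gamma> (fst x) - z)) * (c - b)" for z and x :: "real \<times> real"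
  define fx where "fx z x = u (\<gamma> (fst x)) * (deriv (deriv \<psi>) (z + of_real (snd x) * (\<gamma> (fst x) - z)) * (1 - of_real (snd x))) * (c - b)" for z and x :: "real \<times> real"
  define D where "D z = integral (cbox (0,0) (1,1)) (f z)" for z
  have box: "x \<in> cbox (0,0) (1,1) \<longleftrightarrow> fst x \<in> {0..1} \<and> snd x \<in> {0..1}" for x :: "real \<times> real"
    by (cases x) (simp add: cbox_Pair_eq)
  have ug: "continuous_on {0..1} (\<lambda>s. u (\<gamma> s))"
    by (rule continuous_on_compose2[OF u \<gamma>c]) (use \<gamma>seg in auto)
  have ug2: "continuous_on (cbox (0,0) (1,1)) (\<lambda>x :: real \<times> real. u (\<gamma> (fst x)))"
    by (rule continuous_on_compose2[OF ug continuous_on_fst[OF continuous_on_id]]) (auto simp: box)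
  have g2: "continuous_on A (\<lambda>x :: real \<times> real. \<gamma> (fst x))" for A
    by (rule continuous_on_compose2[OF \<gamma>c[of UNIV] continuous_on_fst[OF continuous_on_id]]) auto
  have fcont: "continuous_on (cbox (0,0) (1,1)) (f z)" if z: "z \<in> U" for z
  proof -
    have "continuous_on (cbox (0,0) (1,1)) (\<lambda>x :: real \<times> real. deriv \<psi> (z + of_real (snd x) * (\<gamma> (fst x) - z)))"
      by (rule continuous_on_compose2[OF holomorphic_on_imp_continuous_on[OF d1]])
        (auto intro!: continuous_intros g2 inU[OF z] simp: box)
    then show ?thesis unfolding f_def by (intro continuous_intros ug2)
  qed
  have "D holomorphic_on U"
    unfolding D_def
  proof (rule leibniz_rule_holomorphic[OF _ _ _ U(2)])
    fix z and x :: "real \<times> real" assume z: "z \<in> U" and x: "x \<in> cbox (0,0) (1,1)"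
    let ?p = "z + of_real (snd x) * (\<gamma> (fst x) - z)"
    have "?p \<in> U" using inU[OF z] x box by blast
    then have dd: "(deriv \<psi> has_field_derivative deriv (deriv \<psi>) ?p) (at ?p)"
      using d1 U(1) holomorphic_derivI by blast
    have "((\<lambda>z. z + of_real (snd x) * (\<gamma> (fst x) - z)) has_field_derivative (1 - of_real (snd x))) (at z within U)"
      by (auto intro!: derivative_eq_intros)
    from DERIV_chain2[OF dd this]
    show "((\<lambda>z. f z x) has_field_derivative fx z x) (at z within U)"
      unfolding f_def fx_def by (intro DERIV_cmult DERIV_cmult_right)
  next
    show "f z integrable_on cbox (0,0) (1,1)" if "z \<in> U" for z by (intro integrable_continuous fcont that)
  next
    have 1: "continuous_on (U \<times> cbox (0,0) (1,1)) (\<lambda>y :: complex \<times> real \<times> real. deriv (deriv \<psi>) (fst y + of_real (snd (snd y)) * (\<gamma> (fst (snd y)) - fst y)))"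
    proof (rule continuous_on_compose2[OF holomorphic_on_imp_continuous_on[OF d2]])
      have "continuous_on (U \<times> cbox (0,0) (1,1)) (\<lambda>y :: complex \<times> real \<times> real. \<gamma> (fst (snd y)))"
        by (rule continuous_on_compose2[OF \<gamma>c[of UNIV]]) (auto intro!: continuous_intros)
      then show "continuous_on (U \<times> cbox (0,0) (1,1)) (\<lambda>y :: complex \<times> real \<times> real. fst y + of_real (snd (snd y)) * (\<gamma> (fst (snd y)) - fst y))"
        by (intro continuous_intros)
      show "(\<lambda>y :: complex \<times> real \<times> real. fst y + of_real (snd (snd y)) * (\<gamma> (fst (snd y)) - fst y)) ` (U \<times> cbox (0,0) (1,1)) \<subseteq> U"
        using inU box by auto
    qed
    have 2: "continuous_on (U \<times> cbox (0,0) (1,1)) (\<lambda>y :: complex \<times> real \<times> real. u (\<gamma> (fst (snd y))))"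
      by (rule continuous_on_compose2[OF ug]) (auto intro!: continuous_intros simp: box)
    show "continuous_on (U \<times> cbox (0,0) (1,1)) (\<lambda>(z, x). fx z x)"
      unfolding fx_def case_prod_beta by (intro continuous_intros 1 2)
  qed
  moreover have "D z = contour_integral \<gamma> (\<lambda>\<zeta>. u \<zeta> * ((\<psi> \<zeta> - \<psi> z) / (\<zeta> - z)))" if z: "z \<in> U - closed_segment b c" for z
  proof -
    have inner: "integral (cbox 0 1) (\<lambda>t. f z (s, t)) = u (\<gamma> s) * ((\<psi> (\<gamma> s) - \<psi> z) / (\<gamma> s - z)) * (c - b)" if s: "s \<in> {0..1}" for s
    proof -
      have ne: "\<gamma> s - z \<noteq> 0" using \<gamma>seg[OF s] z by auto
      have "((\<lambda>t. deriv \<psi> (z + of_real t * (\<gamma> s - z)) * (\<gamma> s - z)) has_integral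
        (\<psi> (z + of_real 1 * (\<gamma> s - z)) - \<psi> (z + of_real 0 * (\<gamma> s - z)))) {0..1}"
      proof (rule fundamental_theorem_of_calculus)
        fix t :: real assume t: "t \<in> {0..1}"
        have "(\<psi> has_field_derivative deriv \<psi> (z + of_real t * (\<gamma> s - z))) (at (z + of_real t * (\<gamma> s - z)))"
          using inU[of z s t] z s t \<psi> U(1) holomorphic_derivI by blast
        moreover have "((\<lambda>t. z + of_real t * (\<gamma> s - z)) has_vector_derivative (\<gamma> s - z)) (at t within {0..1})"
          by (auto intro!: derivative_eq_intros simp: has_vector_derivative_def scaleR_conv_of_real)
        ultimately show "((\<lambda>t. \<psi> (z + of_real t * (\<gamma> s - z))) has_vector_derivative deriv \<psi> (z + of_real t * (\<gamma> s - z)) * (\<gamma> s - z)) (at t within {0..1})"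
          using field_vector_diff_chain_within[of "\<lambda>t. z + of_real t * (\<gamma> s - z)" "\<gamma> s - z" t "{0..1}" \<psi> "deriv \<psi> (z + of_real t * (\<gamma> s - z))"]
          by (simp add: o_def mult.commute has_field_derivative_at_within)
      qed simp
      then have "((\<lambda>t. deriv \<psi> (z + of_real t * (\<gamma> s - z)) * (\<gamma> s - z)) has_integral (\<psi> (\<gamma> s) - \<psi> z)) {0..1}" by simp
      from has_integral_mult_right[OF this, of "u (\<gamma> s) * (c - b) / (\<gamma> s - z)"]
      have "((\<lambda>t. f z (s, t)) has_integral u (\<gamma> s) * (c - b) / (\<gamma> s - z) * (\<psi> (\<gamma> s) - \<psi> z)) {0..1}"
        using ne by (simp add: f_def mult_ac)
      then show ?thesis by (simp add: integral_unique mult_ac)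
    qed
    have "D z = integral (cbox 0 1) (\<lambda>s. integral (cbox 0 1) (\<lambda>t. f z (s, t)))"
      unfolding D_def by (rule integral_prod_continuous) (use fcont z in auto)
    also have "\<dots> = integral {0..1} (\<lambda>s. u (\<gamma> s) * ((\<psi> (\<gamma> s) - \<psi> z) / (\<gamma> s - z)) * (c - b))"
      unfolding cbox_interval[symmetric] using inner by (intro integral_cong) (auto simp: cbox_interval)
    also have "\<dots> = contour_integral \<gamma> (\<lambda>\<zeta>. u \<zeta> * ((\<psi> \<zeta> - \<psi> z) / (\<zeta> - z)))"
      unfolding \<gamma>_def contour_integral_integral by (simp add: vector_derivative_linepath_at)
    finally show ?thesis .
  qed
  ultimately show ?thesis unfolding \<gamma>_def by blast
qed

section \<open>Dyadic squares, their edges, and Cauchy integrals over the boundary of a union of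
  squares\<close>

definition blo :: "nat \<times> nat \<Rightarrow> complex" where
  "blo J = Complex (real (snd J) * side (fst J)) (side (fst J))"

definition bhi :: "nat \<times> nat \<Rightarrow> complex" where
  "bhi J = Complex ((real (snd J) + 1) * side (fst J)) (2 * side (fst J))"

text \<open>Edges of squares: \<open>(True, J)\<close> is the left edge of \<open>J\<close>, directed upwards, and \<open>(False, J)\<close> its top edge,
  directed to the right. The lower edge of \<open>J\<close> consists of the top edges of its two children.\<close>

fun ebeg eend :: "bool \<times> nat \<times> nat \<Rightarrow> complex" where
  "ebeg (True, m, j) = Complex (real j * side m) (side m)"
| "ebeg (False, m, j) = Complex (real j * side m) (2 * side m)"
| "eend (True, m, j) = Complex (real j * side m) (2 * side m)"
| "eend (False, m, j) = Complex ((real j + 1) * side m) (2 * side m)"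

definition eint :: "(complex \<Rightarrow> complex) \<Rightarrow> bool \<times> nat \<times> nat \<Rightarrow> complex" where
  "eint f e = contour_integral (linepath (ebeg e) (eend e)) f"

text \<open>The edges that the counterclockwise boundaries of the squares traverse in their own
  direction: the right edge, which is the left edge of the right neighbour, and the two halves of
  the lower edge. The left and top edges, traversed backwards, form \<open>eneg\<close>.\<close>

definition epos :: "(nat \<times> nat) set \<Rightarrow> (bool \<times> nat \<times> nat) set" where
  "epos \<Lambda> = (\<lambda>J. (True, fst J, Suc (snd J))) ` \<Lambda> \<union> ((\<lambda>J. (False, Suc (fst J), 2 * snd J)) ` \<Lambda> \<union> (\<lambda>J. (False, Suc (fst J), Suc (2 * snd J))) ` \<Lambda>)"

definition eneg :: "(nat \<times> nat) set \<Rightarrow> (bool \<times> nat \<times> nat) set" where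
  "eneg \<Lambda> = Pair True ` \<Lambda> \<union> Pair False ` \<Lambda>"

definition bsides :: "nat \<times> nat \<Rightarrow> (bool \<times> nat \<times> nat) set" where
  "bsides J = {(True, J), (False, J), (True, fst J, Suc (snd J)), (False, Suc (fst J), 2 * snd J), (False, Suc (fst J), Suc (2 * snd J))}"

lemma sum_epos:
  fixes h :: "bool \<times> nat \<times> nat \<Rightarrow> complex"
  assumes "finite \<Lambda>"
  shows "(\<Sum>e\<in>epos \<Lambda>. h e) = (\<Sum>J\<in>\<Lambda>. h (True, fst J, Suc (snd J)) + (h (False, Suc (fst J), 2 * snd J) + h (False, Suc (fst J), Suc (2 * snd J))))"
proof -
  have i: "inj_on (\<lambda>J. (True, fst J, Suc (snd J))) \<Lambda>" "inj_on (\<lambda>J. (False, Suc (fst J), 2 * snd J)) \<Lambda>"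
    "inj_on (\<lambda>J. (False, Suc (fst J), Suc (2 * snd J))) \<Lambda>"
    by (auto simp: inj_on_def)
  have 1: "(\<lambda>J. (True, fst J, Suc (snd J))) ` \<Lambda> \<inter> ((\<lambda>J. (False, Suc (fst J), 2 * snd J)) ` \<Lambda> \<union> (\<lambda>J. (False, Suc (fst J), Suc (2 * snd J))) ` \<Lambda>) = {}"
    by auto
  have 2: "(\<lambda>J. (False, Suc (fst J), 2 * snd J)) ` \<Lambda> \<inter> (\<lambda>J. (False, Suc (fst J), Suc (2 * snd J))) ` \<Lambda> = {}"
    by auto presburger
  show ?thesis unfolding epos_def
    using assms by (simp add: sum.union_disjoint[OF _ _ 1] sum.union_disjoint[OF _ _ 2] sum.reindex[OF i(1)] sum.reindex[OF i(2)] sum.reindex[OF i(3)] sum.distrib)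
qed

lemma sum_eneg:
  fixes h :: "bool \<times> nat \<times> nat \<Rightarrow> complex"
  assumes "finite \<Lambda>"
  shows "(\<Sum>e\<in>eneg \<Lambda>. h e) = (\<Sum>J\<in>\<Lambda>. h (True, J) + h (False, J))"
proof -
  have 1: "Pair True ` \<Lambda> \<inter> Pair False ` \<Lambda> = {}" by auto
  show ?thesis unfolding eneg_def
    using assms by (simp add: sum.union_disjoint[OF _ _ 1] sum.reindex inj_on_def sum.distrib)
qed

text \<open>71/100 is just above half the diagonal \<open>sqrt 2 / 2\<close>. The later radii
  73/100, 74/100 and 3/4 leave room between the edges, the region far from the walls and the domain
  of the local data.\<close>

lemma cbox_cen: "cbox (blo J) (bhi J) \<subseteq> cball (cen J) (71/100 * side (fst J))"
proof
  fix z assume z: "z \<in> cbox (blo J) (bhi J)"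
  define h where "h = side (fst J)"
  have c: "real (snd J) * h \<le> Re z" "Re z \<le> real (snd J) * h + h" "h \<le> Im z" "Im z \<le> 2 * h"
    using z by (auto simp: in_cbox_complex_iff blo_def bhi_def h_def algebra_simps)
  have "Re (z - cen J) = Re z - (real (snd J) * h + h / 2)" "Im (z - cen J) = Im z - 3/2 * h"
    by (simp_all add: Re_cen Im_cen h_def algebra_simps)
  then have "\<bar>Re (z - cen J)\<bar> \<le> h / 2" "\<bar>Im (z - cen J)\<bar> \<le> h / 2" using c by linarith+
  then have "\<bar>Re (z - cen J)\<bar>\<^sup>2 + \<bar>Im (z - cen J)\<bar>\<^sup>2 \<le> (h/2)\<^sup>2 + (h/2)\<^sup>2" by (intro add_mono power_mono) auto
  then have "(cmod (z - cen J))\<^sup>2 \<le> h\<^sup>2 / 2" by (simp add: cmod_power2 power_divide)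
  also have "\<dots> \<le> (71/100 * h)\<^sup>2" by (simp add: power_mult_distrib power_divide)
  finally have "cmod (z - cen J) \<le> 71/100 * h" by (rule power2_le_imp_le) (simp add: h_def)
  then show "z \<in> cball (cen J) (71/100 * side (fst J))" by (simp add: dist_norm norm_minus_commute h_def)
qed

lemma bsides_segment:
  assumes "e \<in> bsides J" shows "closed_segment (ebeg e) (eend e) \<subseteq> cbox (blo J) (bhi J)" "cmod (eend e - ebeg e) \<le> side (fst J)"
proof -
  obtain m j where J: "J = (m, j)" by (cases J)
  have s: "side (Suc m) = side m / 2" by (rule side_Suc)
  have "ebeg e \<in> cbox (blo J) (bhi J) \<and> eend e \<in> cbox (blo J) (bhi J)"
    using assms side_pos[of m] unfolding bsides_def J
    by (auto simp: in_cbox_complex_iff blo_def bhi_def s algebra_simps simp del: side_pos side_ge0)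
  then show "closed_segment (ebeg e) (eend e) \<subseteq> cbox (blo J) (bhi J)" by (simp add: closed_segment_subset convex_box)
  have c: "Complex a b - Complex c b = of_real (a - c)" "Complex a b - Complex a c = \<i> * of_real (b - c)" for a b c by (simp_all add: complex_eq_iff)
  show "cmod (eend e - ebeg e) \<le> side (fst J)"
    using assms side_pos[of m] unfolding bsides_def J
    by (auto simp: c norm_mult s algebra_simps simp del: side_pos side_ge0 of_real_add of_real_diff of_real_mult of_real_divide)
qed

lemma rectpath_box_integral:
  assumes f: "continuous_on (cbox (blo J) (bhi J) - box (blo J) (bhi J)) f"
  shows "contour_integral (rectpath (blo J) (bhi J)) f =
    eint f (True, fst J, Suc (snd J)) + (eint f (False, Suc (fst J), 2 * snd J) + eint f (False, Suc (fst J), Suc (2 * snd J)))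
     - (eint f (True, J) + eint f (False, J))"
proof -
  obtain m j where J: "J = (m, j)" by (cases J)
  define a1 a2 a3 a4 am where "a1 = blo J" and "a2 = Complex (Re (bhi J)) (Im (blo J))" and "a3 = bhi J"
    and "a4 = Complex (Re (blo J)) (Im (bhi J))" and "am = Complex ((real j + 1/2) * side m) (side m)"
  have bd: "path_image (rectpath a1 a3) = cbox (blo J) (bhi J) - box (blo J) (bhi J)"
    unfolding a1_def a3_def by (rule path_image_rectpath_cbox_minus_box) (auto simp: blo_def bhi_def J intro: mult_right_mono)
  have pim: "path_image (rectpath a1 a3) = closed_segment a1 a2 \<union> (closed_segment a2 a3 \<union> (closed_segment a3 a4 \<union> closed_segment a4 a1))"
    by (simp add: rectpath_def Let_def path_image_join a1_def a2_def a3_def a4_def)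
  have cf: "continuous_on (closed_segment a1 a2) f" "continuous_on (closed_segment a2 a3) f"
    "continuous_on (closed_segment a3 a4) f" "continuous_on (closed_segment a4 a1) f"
    using f unfolding bd[symmetric] pim by (auto elim: continuous_on_subset)
  have "contour_integral (rectpath a1 a3) f = contour_integral (linepath a1 a2) f + (contour_integral (linepath a2 a3) f
      + (contour_integral (linepath a3 a4) f + contour_integral (linepath a4 a1) f))"
    unfolding rectpath_def Let_def a1_def a3_def a2_def[symmetric] a4_def[symmetric]
    unfolding a1_def[symmetric] a3_def[symmetric]
    using cf by (simp add: contour_integral_join contour_integrable_joinI contour_integrable_continuous_linepath valid_path_join)
  also have "contour_integral (linepath a1 a2) f = contour_integral (linepath a1 am) f + contour_integral (linepath am a2) f"
  proof (rule contour_integral_split_linepath[OF cf(1)])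
    have "am = (1 - 1/2) *\<^sub>R a1 + (1/2) *\<^sub>R a2"
      by (simp add: am_def a1_def a2_def blo_def bhi_def J complex_eq_iff algebra_simps)
    then show "am \<in> closed_segment a1 a2" unfolding in_segment by (intro exI[of _ "1/2"]) auto
  qed
  also have "contour_integral (linepath a3 a4) f = - contour_integral (linepath a4 a3) f"
    by (rule contour_integral_reverse_linepath[OF cf(3)])
  also have "contour_integral (linepath a4 a1) f = - contour_integral (linepath a1 a4) f"
    by (rule contour_integral_reverse_linepath[OF cf(4)])
  also have "contour_integral (linepath a1 am) f = eint f (False, Suc (fst J), 2 * snd J)"
    by (simp add: eint_def a1_def am_def blo_def J side_Suc algebra_simps)
  also have "contour_integral (linepath am a2) f = eint f (False, Suc (fst J), Suc (2 * snd J))"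
    by (simp add: eint_def a2_def am_def blo_def bhi_def J side_Suc algebra_simps)
  also have "contour_integral (linepath a2 a3) f = eint f (True, fst J, Suc (snd J))"
    by (simp add: eint_def a2_def a3_def blo_def bhi_def J algebra_simps)
  also have "contour_integral (linepath a4 a3) f = eint f (False, J)"
    by (simp add: eint_def a4_def a3_def blo_def bhi_def J algebra_simps)
  also have "contour_integral (linepath a1 a4) f = eint f (True, J)"
    by (simp add: eint_def a4_def a1_def blo_def bhi_def J algebra_simps)
  finally show ?thesis by (simp add: a1_def a3_def)
qed

text \<open>An edge shared by two squares of \<Lambda> is traversed once in each direction and
  cancels; what remains separates \<Lambda> from its complement.\<close>

lemma sum_jump_edges:
  assumes "finite \<Lambda>" "\<And>J. J \<in> \<Lambda> \<Longrightarrow> continuous_on (cbox (blo J) (bhi J) - box (blo J) (bhi J)) f"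
  shows "(\<Sum>J\<in>\<Lambda>. contour_integral (rectpath (blo J) (bhi J)) f) = (\<Sum>e\<in>epos \<Lambda> - eneg \<Lambda>. eint f e) - (\<Sum>e\<in>eneg \<Lambda> - epos \<Lambda>. eint f e)"
proof -
  have fin: "finite (epos \<Lambda>)" "finite (eneg \<Lambda>)" using assms(1) by (auto simp: epos_def eneg_def)
  have "(\<Sum>J\<in>\<Lambda>. contour_integral (rectpath (blo J) (bhi J)) f) = (\<Sum>e\<in>epos \<Lambda>. eint f e) - (\<Sum>e\<in>eneg \<Lambda>. eint f e)"
    unfolding sum_epos[OF assms(1)] sum_eneg[OF assms(1)] sum_subtractf[symmetric]
    by (intro sum.cong refl rectpath_box_integral assms(2))
  also have "(\<Sum>e\<in>epos \<Lambda>. eint f e) = (\<Sum>e\<in>epos \<Lambda> - eneg \<Lambda>. eint f e) + (\<Sum>e\<in>epos \<Lambda> \<inter> eneg \<Lambda>. eint f e)"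
    using sum.Int_Diff[OF fin(1), of "eint f" "eneg \<Lambda>"] by simp
  also have "(\<Sum>e\<in>eneg \<Lambda>. eint f e) = (\<Sum>e\<in>eneg \<Lambda> - epos \<Lambda>. eint f e) + (\<Sum>e\<in>epos \<Lambda> \<inter> eneg \<Lambda>. eint f e)"
    using sum.Int_Diff[OF fin(2), of "eint f" "epos \<Lambda>"] by (simp add: Int_commute)
  finally show ?thesis by simp
qed

lemma box_unique:
  assumes "z \<in> box (blo J) (bhi J)" "z \<in> box (blo J') (bhi J')" shows "J = J'"
proof -
  obtain m j m' j' where J: "J = (m, j)" "J' = (m', j')" by (cases J, cases J')
  have z: "real j * side m < Re z" "Re z < (real j + 1) * side m" "side m < Im z" "Im z < 2 * side m"
    "real j' * side m' < Re z" "Re z < (real j' + 1) * side m'" "side m' < Im z" "Im z < 2 * side m'"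
    using assms by (auto simp: in_box_complex_iff blo_def bhi_def J)
  have half: "side b \<le> side a / 2" if "a < b" for a b
    using side_le_iff[of b "Suc a"] that by (simp add: side_Suc)
  have "m = m'"
  proof (rule ccontr)
    assume "m \<noteq> m'"
    then consider "m < m'" | "m' < m" by linarith
    then show False using half[of m m'] half[of m' m] z by cases linarith+
  qed
  have "real j * side m < (real j' + 1) * side m" "real j' * side m < (real j + 1) * side m"
    using less_trans[OF z(1) z(6)] less_trans[OF z(5) z(2)] by (simp_all only: \<open>m = m'\<close>)
  then have "real j < real j' + 1" "real j' < real j + 1"
    using mult_less_cancel_right_pos[OF side_pos[of m]] by blast+
  then show ?thesis using J \<open>m = m'\<close> by simp
qed

lemma cauchy_box:
  assumes a: "a holomorphic_on ball (cen J) (3/4 * side (fst J))" and z: "z \<notin> cbox (blo J) (bhi J) - box (blo J) (bhi J)"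
  shows "contour_integral (rectpath (blo J) (bhi J)) (\<lambda>\<zeta>. a \<zeta> / (\<zeta> - z)) = (if z \<in> box (blo J) (bhi J) then 2 * pi * \<i> * a z else 0)"
proof -
  let ?B = "ball (cen J) (3/4 * side (fst J))" and ?g = "rectpath (blo J) (bhi J)"
  have le: "Re (blo J) \<le> Re (bhi J)" "Im (blo J) \<le> Im (bhi J)" by (auto simp: blo_def bhi_def intro: mult_right_mono)
  have pim: "path_image ?g = cbox (blo J) (bhi J) - box (blo J) (bhi J)"
    by (rule path_image_rectpath_cbox_minus_box[OF le])
  have "cball (cen J) (71/100 * side (fst J)) \<subseteq> ?B"
    using side_pos[of "fst J"] by (auto simp: cball_subset_ball_iff)
  then have sub: "cbox (blo J) (bhi J) \<subseteq> ?B" using cbox_cen by blast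
  show ?thesis
  proof (cases "z \<in> ?B")
    case True
    have "((\<lambda>\<zeta>. a \<zeta> / (\<zeta> - z)) has_contour_integral (2 * pi) * \<i> * winding_number ?g z * a z) ?g"
      by (rule Cauchy_integral_formula_convex_simple[OF convex_ball a]) (use True sub z pim in auto)
    then have "contour_integral ?g (\<lambda>\<zeta>. a \<zeta> / (\<zeta> - z)) = (2 * pi) * \<i> * winding_number ?g z * a z"
      by (rule contour_integral_unique)
    moreover have "winding_number ?g z = (if z \<in> box (blo J) (bhi J) then 1 else 0)"
      using winding_number_rectpath[of z] winding_number_rectpath_outside[OF le] z by auto
    ultimately show ?thesis by simp
  next
    case False
    have "((\<lambda>\<zeta>. a \<zeta> / (\<zeta> - z)) has_contour_integral 0) ?g"
      by (rule Cauchy_theorem_convex_simple[where S = ?B]) (use False sub pim a in \<open>auto intro!: holomorphic_intros\<close>)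
    moreover have "z \<notin> box (blo J) (bhi J)" using False sub box_subset_cbox by blast
    ultimately show ?thesis by (simp add: contour_integral_unique)
  qed
qed

text \<open>Five edges per wall node, the Jones sum \<open>exp 2 * K\<close>, the distance
  \<open>1/50 = 73/100 - 71/100\<close> in units of the side, and in the denominator the lower
  bounds of f and of the Jones function.\<close>

definition gluec1 :: "real \<Rightarrow> real \<Rightarrow> real" where
  "gluec1 K \<delta> = 5 * (exp 2 * K) * (50 / (\<delta> * ((16/25) * exp (- 3))))"

text \<open>One summand for each estimate in \<open>glue\<close>: the sup norm, the error away from
  the walls, and the error near the walls, where a lower bound \<delta> for f makes any bounded
  error a multiple of f.\<close>

definition gluec :: "real \<Rightarrow> real \<Rightarrow> real \<Rightarrow> real" where
  "gluec K L \<delta> = (1 + L * gluec1 K \<delta>) + gluec1 K \<delta> + (2 + L * gluec1 K \<delta>) / \<delta>"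

text \<open>For a jump edge this is the one adjacent square in \<Lambda>, whose Jones function
  serves the edge. If the node naming the edge is outside \<Lambda>, it is the left neighbour for a
  vertical edge and the parent for a horizontal one.\<close>

definition eown :: "(nat \<times> nat) set \<Rightarrow> bool \<times> nat \<times> nat \<Rightarrow> nat \<times> nat" where
  "eown \<Lambda> e = (if snd e \<in> \<Lambda> then snd e else if fst e then (fst (snd e), snd (snd e) - 1) else (fst (snd e) - 1, snd (snd e) div 2))"

definition inner_node :: "(nat \<times> nat) set \<Rightarrow> nat \<times> nat \<Rightarrow> bool" where
  "inner_node \<Lambda> J \<longleftrightarrow> (fst J, Suc (snd J)) \<in> \<Lambda> \<and> snd J > 0 \<and> (fst J, snd J - 1) \<in> \<Lambda> \<and>
     (Suc (fst J), 2 * snd J) \<in> \<Lambda> \<and> (Suc (fst J), Suc (2 * snd J)) \<in> \<Lambda> \<and> fst J > 0 \<and> (fst J - 1, snd J div 2) \<in> \<Lambda>"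

lemma eown_jump:
  assumes "e \<in> (epos \<Lambda> - eneg \<Lambda>) \<union> (eneg \<Lambda> - epos \<Lambda>)"
  shows "eown \<Lambda> e \<in> \<Lambda>" "e \<in> bsides (eown \<Lambda> e)" "\<not> inner_node \<Lambda> (eown \<Lambda> e)"
proof -
  obtain b m j where e: "e = (b, m, j)" by (cases e)
  have "eown \<Lambda> e \<in> \<Lambda> \<and> e \<in> bsides (eown \<Lambda> e) \<and> \<not> inner_node \<Lambda> (eown \<Lambda> e)"
    using assms
  proof
    assume a: "e \<in> epos \<Lambda> - eneg \<Lambda>"
    have nin: "(m, j) \<notin> \<Lambda>" using a by (cases b) (auto simp: eneg_def e)
    show ?thesis
    proof (cases b)
      case True
      then obtain i where i: "j = Suc i" "(m, i) \<in> \<Lambda>" using a by (auto simp: epos_def e)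
      then have "eown \<Lambda> e = (m, i)" using nin True by (simp add: eown_def e)
      then show ?thesis using i nin True by (simp add: bsides_def e inner_node_def)
    next
      case False
      then obtain k i where i: "m = Suc k" "(k, i) \<in> \<Lambda>" "j = 2 * i \<or> j = Suc (2 * i)" using a by (auto simp: epos_def e)
      then have "eown \<Lambda> e = (k, i)" using nin False by (auto simp: eown_def e)
      then show ?thesis using i nin False by (auto simp: bsides_def e inner_node_def)
    qed
  next
    assume a: "e \<in> eneg \<Lambda> - epos \<Lambda>"
    then have J: "(m, j) \<in> \<Lambda>" by (auto simp: eneg_def e)
    then have o: "eown \<Lambda> e = (m, j)" by (simp add: eown_def e)
    have "\<not> inner_node \<Lambda> (m, j)"
    proof
      assume i: "inner_node \<Lambda> (m, j)"
      show False
      proof (cases b)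
        case True
        have "(True, m, j) = (\<lambda>J. (True, fst J, Suc (snd J))) (m, j - 1)" using i by (simp add: inner_node_def)
        moreover have "(m, j - 1) \<in> \<Lambda>" using i by (simp add: inner_node_def)
        ultimately have "(True, m, j) \<in> epos \<Lambda>" unfolding epos_def by blast
        then show False using a True by (simp add: e)
      next
        case False
        have P: "(m - 1, j div 2) \<in> \<Lambda>" "m = Suc (m - 1)" using i by (auto simp: inner_node_def)
        have "(False, m, j) = (\<lambda>J. (False, Suc (fst J), 2 * snd J)) (m - 1, j div 2) \<or> (False, m, j) = (\<lambda>J. (False, Suc (fst J), Suc (2 * snd J))) (m - 1, j div 2)"
          using P(2) by simp presburger
        then have "(False, m, j) \<in> epos \<Lambda>" unfolding epos_def using P(1) by blast
        then show False using a False by (simp add: e)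
      qed
    qed
    then show ?thesis using J o by (cases b) (auto simp: bsides_def e)
  qed
  then show "eown \<Lambda> e \<in> \<Lambda>" "e \<in> bsides (eown \<Lambda> e)" "\<not> inner_node \<Lambda> (eown \<Lambda> e)" by blast+
qed

text \<open>\<open>16/25 = 4 * (3/2)\<^sup>2 / (15/4)\<^sup>2\<close>, and \<open>exp (- 3)\<close>
  is \<open>jones_lower\<close> with \<open>s = 2\<close>, since points of the disc have at least
  half the height of its centre.\<close>

lemma jones_lower_box:
  assumes c: "car K W cen" and K: "K > 0" and J: "J \<in> W" and z: "z \<in> ball (cen J) (3/4 * side (fst J))"
  shows "cmod (jones K W cen J z) \<ge> (16/25) * exp (- 3)"
proof -
  define h where "h = side (fst J)"
  have h: "h > 0" by (simp add: h_def)
  have d: "cmod (z - cen J) \<le> 3/4 * h" using z by (simp add: dist_norm norm_minus_commute h_def less_imp_le)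
  have "\<bar>Im (z - cen J)\<bar> \<le> 3/4 * h" using d abs_Im_le_cmod order_trans by blast
  moreover have "Im (z - cen J) = Im z - 3/2 * h" by (simp add: Im_cen h_def)
  ultimately have Iz: "Im z \<ge> 3/4 * h" by linarith
  then have "Im z > 0" using h by linarith
  then have zu: "z \<in> uhp" by (simp add: uhp_def)
  have "cmod (z - cnj (cen J)) \<le> cmod (z - cen J) + cmod (cen J - cnj (cen J))"
    using norm_triangle_ineq[of "z - cen J" "cen J - cnj (cen J)"] by simp
  also have "cen J - cnj (cen J) = \<i> * of_real (3 * h)" by (simp add: complex_eq_iff Im_cen h_def)
  also have "cmod (\<i> * of_real (3 * h)) = 3 * h" using h by (simp add: norm_mult)
  finally have D: "cmod (z - cnj (cen J)) \<le> 15/4 * h" using d by linarith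
  have Dp: "cmod (z - cnj (cen J)) > 0" using uhp_cnj_ne[OF zu cen_uhp] by simp
  have "(16/25) * exp (- 3) = 4 * (Im (cen J))\<^sup>2 / (15/4 * h)\<^sup>2 * exp (- (1 + 2))"
    using h by (simp add: Im_cen h_def[symmetric] power_mult_distrib power_divide)
  also have "\<dots> \<le> 4 * (Im (cen J))\<^sup>2 / (cmod (z - cnj (cen J)))\<^sup>2 * exp (- (1 + 2))"
    using D Dp h by (intro mult_right_mono divide_left_mono power_mono) auto
  also have "\<dots> \<le> cmod (jones K W cen J z)"
    using Iz h by (intro jones_lower[OF c K J zu]) (auto simp: Im_cen h_def)
  finally show ?thesis .
qed

lemma segment_far:
  assumes e: "e \<in> bsides J" and z: "z \<notin> cball (cen J) (73/100 * side (fst J))" and \<zeta>: "\<zeta> \<in> closed_segment (ebeg e) (eend e)"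
  shows "cmod (\<zeta> - z) \<ge> side (fst J) / 50"
proof -
  have "\<zeta> \<in> cball (cen J) (71/100 * side (fst J))" using bsides_segment(1)[OF e] cbox_cen \<zeta> by blast
  then have "dist (cen J) \<zeta> \<le> 71/100 * side (fst J)" by simp
  moreover have "dist (cen J) z > 73/100 * side (fst J)" using z by simp
  moreover have "dist (cen J) z \<le> dist (cen J) \<zeta> + dist \<zeta> z" by (rule dist_triangle)
  ultimately have "dist \<zeta> z \<ge> side (fst J) / 50" by linarith
  then show ?thesis by (simp add: dist_norm)
qed

text \<open>\<open>F\<close> is the sum over the jump edges of the Cauchy integrals of \<open>a\<close> with the kernel
  \<open>(\<psi> \<zeta> - \<psi> z) / ((\<zeta> - z) \<psi> \<zeta>)\<close>, where \<open>\<psi>\<close> is \<open>f\<close> times the Jones function of the wall carrying the edge.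
  The correction \<open>\<psi> z\<close> removes the jump and costs only \<open>O(|f z|)\<close>.\<close>

lemma glue:
  assumes \<Lambda>: "finite \<Lambda>" and W: "\<And>J. J \<in> \<Lambda> \<Longrightarrow> J \<notin> W \<Longrightarrow> inner_node \<Lambda> J"
    and c: "car K W cen" and K: "K > 0"
    and f: "f holomorphic_on uhp" "\<And>z. z \<in> uhp \<Longrightarrow> cmod (f z) \<le> L" and L: "L > 0" and \<delta>: "\<delta> > 0"
    and fW: "\<And>J z. J \<in> W \<Longrightarrow> z \<in> ball (cen J) (3/4 * side (fst J)) \<Longrightarrow> cmod (f z) \<ge> \<delta>"
    and a: "\<And>J. J \<in> \<Lambda> \<Longrightarrow> a holomorphic_on ball (cen J) (3/4 * side (fst J))"
      "\<And>J z. J \<in> \<Lambda> \<Longrightarrow> z \<in> ball (cen J) (3/4 * side (fst J)) \<Longrightarrow> cmod (a z) \<le> A" and A: "A \<ge> 0"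
  defines "La \<equiv> \<lambda>z. if \<exists>J\<in>\<Lambda>. z \<in> cbox (blo J) (bhi J) then a z else 0"
  shows "\<exists>F. F holomorphic_on uhp \<and> (\<forall>z\<in>uhp. cmod (F z) \<le> gluec K L \<delta> * A \<and> cmod (F z - La z) \<le> gluec K L \<delta> * A * cmod (f z))"
proof -
  define E where "E = (epos \<Lambda> - eneg \<Lambda>) \<union> (eneg \<Lambda> - epos \<Lambda>)"
  define sg :: "_ \<Rightarrow> complex" where "sg e = (if e \<in> epos \<Lambda> then 1 else -1) / (2 * pi * \<i>)" for e
  define own where "own = eown \<Lambda>"
  have Efin: "finite E" using \<Lambda> by (auto simp: E_def epos_def eneg_def)
  have sg1: "cmod (sg e) \<le> 1" for e
  proof -
    have "cmod (sg e) = 1 / (2 * pi)" by (simp add: sg_def norm_divide norm_mult)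
    also have "\<dots> \<le> 1" using pi_gt3 by simp
    finally show ?thesis .
  qed
  have own: "own e \<in> \<Lambda>" "own e \<in> W" "e \<in> bsides (own e)" if "e \<in> E" for e
    using eown_jump[of e \<Lambda>] that W unfolding E_def own_def by blast+
  have Wfin: "finite W" using c by (simp add: car_def)
  define B where "B J = ball (cen J) (3/4 * side (fst J))" for J
  define S where "S e = closed_segment (ebeg e) (eend e)" for e
  have c71: "cball (cen J) (71/100 * side (fst J)) \<subseteq> B J" for J
    using side_pos[of "fst J"] by (auto simp: B_def cball_subset_ball_iff)
  have B9: "B J \<subseteq> cball (cen J) (9/10 * side (fst J))" for J
    using side_pos[of "fst J"] by (auto simp: B_def ball_subset_cball_iff)
  have Bu: "B J \<subseteq> uhp" for J using B9[of J] near_cen(4)[of _ J] by blast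
  have boxB: "cbox (blo J) (bhi J) \<subseteq> B J" for J using cbox_cen[of J] c71[of J] by blast
  have SB: "S e \<subseteq> B (own e)" if "e \<in> E" for e
    using bsides_segment(1)[OF own(3)[OF that]] boxB[of "own e"] unfolding S_def by blast
  define \<psi> where "\<psi> e z = f z * jones K W cen (own e) z" for e z
  define u where "u e z = a z / \<psi> e z" for e z
  have jh: "jones K W cen J holomorphic_on uhp" if "J \<in> W" for J by (rule jones_hol[OF c that])
  define c0 where "c0 = (16/25) * exp (- 3 :: real)"
  have c0: "c0 > 0" by (simp add: c0_def)
  have \<psi>h: "\<psi> e holomorphic_on uhp" if "e \<in> E" for e unfolding \<psi>_def[abs_def] by (intro holomorphic_intros f jh own that)
  have \<psi>low: "cmod (\<psi> e z) \<ge> \<delta> * c0" if "e \<in> E" "z \<in> B (own e)" for e z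
    unfolding \<psi>_def norm_mult using fW[OF own(2)[OF that(1)], of z] jones_lower_box[OF c K own(2)[OF that(1)], of z] that(2) c0 \<delta>
    by (intro mult_mono) (auto simp: B_def c0_def)
  have \<psi>nz: "\<psi> e z \<noteq> 0" if "e \<in> E" "z \<in> B (own e)" for e z
    using \<psi>low[OF that] mult_pos_pos[OF \<delta> c0] by auto
  have ah: "a holomorphic_on B (own e)" if "e \<in> E" for e using a(1)[OF own(1)[OF that]] by (simp add: B_def)
  have uh: "u e holomorphic_on B (own e)" if "e \<in> E" for e
    unfolding u_def[abs_def] using \<psi>nz[OF that]
    by (intro holomorphic_intros ah that holomorphic_on_subset[OF \<psi>h[OF that] Bu]) auto
  have ub: "cmod (u e z) \<le> A / (\<delta> * c0)" if "e \<in> E" "z \<in> B (own e)" for e z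
    unfolding u_def norm_divide using a(2)[OF own(1)[OF that(1)], of z] \<psi>low[OF that] that(2) mult_pos_pos[OF \<delta> c0] A
    by (intro frac_le) (auto simp: B_def)
  have ucont: "continuous_on (S e) (u e)" if "e \<in> E" for e
    using holomorphic_on_imp_continuous_on[OF uh[OF that]] SB[OF that] continuous_on_subset by blast
  have "\<exists>D. D holomorphic_on uhp \<and> (\<forall>z\<in>uhp - S e. D z = contour_integral (linepath (ebeg e) (eend e)) (\<lambda>\<zeta>. u e \<zeta> * ((\<psi> e \<zeta> - \<psi> e z) / (\<zeta> - z))))"
    if "e \<in> E" for e
    unfolding S_def
    by (rule difference_quotient_integral[OF \<psi>h[OF that] open_uhp convex_uhp])
      (use order_trans[OF SB[OF that] Bu] ucont[OF that] in \<open>simp_all add: S_def\<close>)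
  then obtain D where D: "\<And>e. e \<in> E \<Longrightarrow> D e holomorphic_on uhp"
    "\<And>e z. e \<in> E \<Longrightarrow> z \<in> uhp \<Longrightarrow> z \<notin> S e \<Longrightarrow> D e z = contour_integral (linepath (ebeg e) (eend e)) (\<lambda>\<zeta>. u e \<zeta> * ((\<psi> e \<zeta> - \<psi> e z) / (\<zeta> - z)))"
    unfolding Ball_def by (metis DiffI)
  define F where "F z = (\<Sum>e\<in>E. sg e * D e z)" for z
  have F: "F holomorphic_on uhp" unfolding F_def[abs_def] by (intro holomorphic_intros D)
  define w where "w z = (\<Sum>e\<in>E. sg e * jones K W cen (own e) z * eint (\<lambda>\<zeta>. u e \<zeta> / (\<zeta> - z)) e)" for z
  \<comment> \<open>Here every jump edge is at distance at least 1/50 of the side of its owner, so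
    the Cauchy integrals can be bounded one by one; inside the excluded discs the maximum principle
    takes over.\<close>
  define far where "far = uhp - (\<Union>J\<in>W. cball (cen J) (73/100 * side (fst J)))"
  have faropen: "open far" unfolding far_def by (intro open_Diff open_uhp closed_UN) (use Wfin in auto)
  have sub73: "cbox (blo J) (bhi J) \<subseteq> cball (cen J) (73/100 * side (fst J))" for J
  proof -
    have "cball (cen J) (71/100 * side (fst J)) \<subseteq> cball (cen J) (73/100 * side (fst J))" by (intro subset_cball mult_right_mono) auto
    then show ?thesis using cbox_cen[of J] by blast
  qed
  have farS: "z \<notin> S e" if "z \<in> far" "e \<in> E" for z e
    using that own[OF that(2)] bsides_segment(1)[OF own(3)[OF that(2)]] sub73[of "own e"] unfolding far_def S_def by blast
  have wb: "cmod (w z) \<le> gluec1 K \<delta> * A" if z: "z \<in> far" for z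
  proof -
    have zu: "z \<in> uhp" using z by (simp add: far_def)
    have ei: "cmod (eint (\<lambda>\<zeta>. u e \<zeta> / (\<zeta> - z)) e) \<le> 50 * (A / (\<delta> * c0))" if e: "e \<in> E" for e
    proof -
      define h where "h = side (fst (own e))"
      have h: "h > 0" by (simp add: h_def)
      have zn: "z \<notin> cball (cen (own e)) (73/100 * side (fst (own e)))" using z own(2)[OF e] by (auto simp: far_def)
      have "cmod (eint (\<lambda>\<zeta>. u e \<zeta> / (\<zeta> - z)) e) \<le> (A / (\<delta> * c0) / (h / 50)) * cmod (eend e - ebeg e)"
        unfolding eint_def
      proof (rule contour_integral_bound_linepath)
        show "(\<lambda>\<zeta>. u e \<zeta> / (\<zeta> - z)) contour_integrable_on linepath (ebeg e) (eend e)"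
          using ucont[OF e] farS[OF z e] unfolding S_def
          by (intro contour_integrable_continuous_linepath continuous_intros) auto
        show "0 \<le> A / (\<delta> * c0) / (h / 50)" using A \<delta> c0 h by simp
        fix \<zeta> assume \<zeta>: "\<zeta> \<in> closed_segment (ebeg e) (eend e)"
        then have "cmod (\<zeta> - z) \<ge> h / 50" using segment_far[OF own(3)[OF e] zn] by (simp add: h_def)
        moreover have "cmod (u e \<zeta>) \<le> A / (\<delta> * c0)" using ub[OF e] SB[OF e] \<zeta> unfolding S_def by blast
        ultimately show "cmod (u e \<zeta> / (\<zeta> - z)) \<le> A / (\<delta> * c0) / (h / 50)"
          unfolding norm_divide using h A \<delta> c0 by (intro frac_le) auto
      qed
      also have "\<dots> \<le> (A / (\<delta> * c0) / (h / 50)) * h"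
        using bsides_segment(2)[OF own(3)[OF e]] A \<delta> c0 h by (intro mult_left_mono) (auto simp: h_def)
      also have "\<dots> = 50 * (A / (\<delta> * c0))" using h by simp
      finally show ?thesis .
    qed
    define X where "X = 50 * (A / (\<delta> * c0))"
    have X: "X \<ge> 0" using A \<delta> c0 by (simp add: X_def)
    have "cmod (w z) \<le> (\<Sum>e\<in>E. cmod (jones K W cen (own e) z) * X)"
      unfolding w_def
    proof (rule sum_norm_le)
      fix e assume e: "e \<in> E"
      have "cmod (sg e) * cmod (jones K W cen (own e) z) \<le> 1 * cmod (jones K W cen (own e) z)"
        by (intro mult_right_mono sg1) simp
      then show "cmod (sg e * jones K W cen (own e) z * eint (\<lambda>\<zeta>. u e \<zeta> / (\<zeta> - z)) e) \<le> cmod (jones K W cen (own e) z) * X"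
        unfolding norm_mult X_def by (intro mult_mono ei e) auto
    qed
    also have "\<dots> = (\<Sum>e\<in>E. cmod (jones K W cen (own e) z)) * X" by (rule sum_distrib_right[symmetric])
    finally have w1: "cmod (w z) \<le> (\<Sum>e\<in>E. cmod (jones K W cen (own e) z)) * X" .
    have "(\<Sum>e\<in>E. cmod (jones K W cen (own e) z)) = (\<Sum>J\<in>W. \<Sum>e\<in>{e\<in>E. own e = J}. cmod (jones K W cen (own e) z))"
      by (rule sum.group[symmetric]) (use Efin Wfin own(2) in auto)
    also have "\<dots> \<le> (\<Sum>J\<in>W. 5 * cmod (jones K W cen J z))"
    proof (rule sum_mono)
      fix J assume "J \<in> W"
      have "{e\<in>E. own e = J} \<subseteq> bsides J" using own(3) by auto
      then have "card {e\<in>E. own e = J} \<le> card (bsides J)" by (intro card_mono) (simp add: bsides_def)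
      also have "\<dots> \<le> 5" unfolding bsides_def
        by (rule order_trans[OF card_length[of "[(True, J), (False, J), (True, fst J, Suc (snd J)), (False, Suc (fst J), 2 * snd J), (False, Suc (fst J), Suc (2 * snd J))]", simplified list.set]]) simp
      finally have "real (card {e\<in>E. own e = J}) \<le> 5" by simp
      then have "real (card {e\<in>E. own e = J}) * cmod (jones K W cen J z) \<le> 5 * cmod (jones K W cen J z)" by (rule mult_right_mono) simp
      then show "(\<Sum>e\<in>{e\<in>E. own e = J}. cmod (jones K W cen (own e) z)) \<le> 5 * cmod (jones K W cen J z)" by simp
    qed
    also have "\<dots> \<le> 5 * (exp 2 * K)" unfolding sum_distrib_left[symmetric] using jones_sum[OF c K zu] by (intro mult_left_mono) auto
    finally have "(\<Sum>e\<in>E. cmod (jones K W cen (own e) z)) * X \<le> 5 * (exp 2 * K) * X" using X by (rule mult_right_mono)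
    then have "cmod (w z) \<le> 5 * (exp 2 * K) * X" using w1 by linarith
    then show ?thesis by (simp add: gluec1_def c0_def X_def)
  qed
  define P where "P = (\<Union>J\<in>\<Lambda>. cbox (blo J) (bhi J) - box (blo J) (bhi J))"
  \<comment> \<open>Off the edges the kernel splits into the Cauchy kernel of a, whose signed edge
    sum reproduces \<open>La\<close>, and a term with the factor \<open>\<psi> e z\<close>, hence
    with the factor \<open>f z\<close>.\<close>
  have Fw: "F z = La z - f z * w z" if z: "z \<in> far" "z \<notin> P" for z
  proof -
    have zu: "z \<in> uhp" using z by (simp add: far_def)
    have intg: "(\<lambda>\<zeta>. u e \<zeta> / (\<zeta> - z)) contour_integrable_on linepath (ebeg e) (eend e)" "(\<lambda>\<zeta>. a \<zeta> / (\<zeta> - z)) contour_integrable_on linepath (ebeg e) (eend e)" if "e \<in> E" for e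
      using ucont[OF that] farS[OF z(1) that] holomorphic_on_imp_continuous_on[OF ah[OF that]] SB[OF that] unfolding S_def
      by (auto intro!: contour_integrable_continuous_linepath continuous_intros elim: continuous_on_subset)
    have De: "D e z = eint (\<lambda>\<zeta>. a \<zeta> / (\<zeta> - z)) e - \<psi> e z * eint (\<lambda>\<zeta>. u e \<zeta> / (\<zeta> - z)) e" if e: "e \<in> E" for e
    proof -
      have "D e z = contour_integral (linepath (ebeg e) (eend e)) (\<lambda>\<zeta>. a \<zeta> / (\<zeta> - z) - \<psi> e z * (u e \<zeta> / (\<zeta> - z)))"
        unfolding D(2)[OF e zu farS[OF z(1) e]]
      proof (rule contour_integral_cong[OF refl])
        fix \<zeta> assume "\<zeta> \<in> path_image (linepath (ebeg e) (eend e))"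
        then have "\<zeta> \<in> B (own e)" using SB[OF e] by (auto simp: S_def)
        then have "u e \<zeta> * \<psi> e \<zeta> = a \<zeta>" using \<psi>nz[OF e] by (simp add: u_def)
        then show "u e \<zeta> * ((\<psi> e \<zeta> - \<psi> e z) / (\<zeta> - z)) = a \<zeta> / (\<zeta> - z) - \<psi> e z * (u e \<zeta> / (\<zeta> - z))"
          by (simp add: diff_divide_distrib right_diff_distrib)
      qed
      then show ?thesis using intg[OF e]
        by (simp add: eint_def contour_integral_diff contour_integral_lmul contour_integrable_lmul del: times_divide_eq_right)
    qed
    have "F z = (\<Sum>e\<in>E. sg e * eint (\<lambda>\<zeta>. a \<zeta> / (\<zeta> - z)) e) - f z * w z"
      unfolding F_def w_def sum_distrib_left sum_subtractf[symmetric]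
      by (intro sum.cong refl) (simp add: De \<psi>_def algebra_simps)
    also have "(\<Sum>e\<in>E. sg e * eint (\<lambda>\<zeta>. a \<zeta> / (\<zeta> - z)) e) = La z"
    proof -
      have "(\<Sum>e\<in>E. sg e * eint (\<lambda>\<zeta>. a \<zeta> / (\<zeta> - z)) e) = (\<Sum>e\<in>epos \<Lambda> - eneg \<Lambda>. sg e * eint (\<lambda>\<zeta>. a \<zeta> / (\<zeta> - z)) e) + (\<Sum>e\<in>eneg \<Lambda> - epos \<Lambda>. sg e * eint (\<lambda>\<zeta>. a \<zeta> / (\<zeta> - z)) e)"
        unfolding E_def by (rule sum.union_disjoint) (use Efin in \<open>auto simp: E_def\<close>)
      also have "\<dots> = ((\<Sum>e\<in>epos \<Lambda> - eneg \<Lambda>. eint (\<lambda>\<zeta>. a \<zeta> / (\<zeta> - z)) e) - (\<Sum>e\<in>eneg \<Lambda> - epos \<Lambda>. eint (\<lambda>\<zeta>. a \<zeta> / (\<zeta> - z)) e)) / (2 * pi * \<i>)"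
        unfolding diff_divide_distrib sum_divide_distrib sg_def by (simp add: sum_negf)
      also have "\<dots> = (\<Sum>J\<in>\<Lambda>. contour_integral (rectpath (blo J) (bhi J)) (\<lambda>\<zeta>. a \<zeta> / (\<zeta> - z))) / (2 * pi * \<i>)"
      proof (subst sum_jump_edges[OF \<Lambda>])
        fix J assume J: "J \<in> \<Lambda>"
        have "continuous_on (cbox (blo J) (bhi J) - box (blo J) (bhi J)) a"
          using holomorphic_on_imp_continuous_on[OF a(1)[OF J]] boxB[of J] unfolding B_def by (elim continuous_on_subset) auto
        then show "continuous_on (cbox (blo J) (bhi J) - box (blo J) (bhi J)) (\<lambda>\<zeta>. a \<zeta> / (\<zeta> - z))"
          using z(2) J by (intro continuous_intros) (auto simp: P_def)
      qed simp
      also have "\<dots> = (\<Sum>J\<in>\<Lambda>. if z \<in> box (blo J) (bhi J) then a z else 0)"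
        unfolding sum_divide_distrib
      proof (rule sum.cong[OF refl])
        fix J assume J: "J \<in> \<Lambda>"
        then have "z \<notin> cbox (blo J) (bhi J) - box (blo J) (bhi J)" using z(2) by (auto simp: P_def)
        from cauchy_box[OF a(1)[OF J] this]
        show "contour_integral (rectpath (blo J) (bhi J)) (\<lambda>\<zeta>. a \<zeta> / (\<zeta> - z)) / (2 * pi * \<i>) = (if z \<in> box (blo J) (bhi J) then a z else 0)"
          by simp
      qed
      also have "\<dots> = La z"
      proof (cases "\<exists>J\<in>\<Lambda>. z \<in> cbox (blo J) (bhi J)")
        case True
        then obtain J where J: "J \<in> \<Lambda>" "z \<in> cbox (blo J) (bhi J)" by blast
        then have zb: "z \<in> box (blo J) (bhi J)" using z(2) by (auto simp: P_def)
        have "z \<in> box (blo J') (bhi J') \<longleftrightarrow> J' = J" for J' using zb box_unique by blast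
        then have "(\<Sum>J'\<in>\<Lambda>. if z \<in> box (blo J') (bhi J') then a z else 0) = (\<Sum>J'\<in>\<Lambda>. if J' = J then a z else 0)"
          by simp
        then show ?thesis using J \<Lambda> True by (simp add: La_def)
      next
        case False
        then have "\<forall>J\<in>\<Lambda>. z \<notin> box (blo J) (bhi J)" using box_subset_cbox by blast
        then show ?thesis using False by (simp add: La_def)
      qed
      finally show ?thesis .
    qed
    finally show ?thesis .
  qed
  define C1 where "C1 = gluec1 K \<delta>"
  have C1: "C1 \<ge> 0" using K \<delta> by (simp add: C1_def gluec1_def)
  have fcont: "continuous_on uhp F" "continuous_on uhp f" using F f by (auto intro: holomorphic_on_imp_continuous_on)
  \<comment> \<open>A point on the boundary of a square of \<Lambda> is a limit of points inside
    that square, where the generic estimate holds and \<open>La\<close> equals the continuous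
    function a.\<close>
  have est: "cmod (F z - La z) \<le> C1 * A * cmod (f z)" if z: "z \<in> far" for z
  proof -
    have generic: "cmod (F z - La z) \<le> C1 * A * cmod (f z)" if "z \<in> far" "z \<notin> P" for z
    proof -
      have "cmod (F z - La z) = cmod (f z) * cmod (w z)" using Fw[OF that] by (simp add: norm_mult)
      also have "\<dots> \<le> cmod (f z) * (C1 * A)" using wb[OF that(1)] by (intro mult_left_mono) (auto simp: C1_def)
      finally show ?thesis by (simp add: mult_ac)
    qed
    show ?thesis
    proof (cases "z \<in> P")
      case False then show ?thesis using generic z by blast
    next
      case True
      then obtain J where J: "J \<in> \<Lambda>" "z \<in> cbox (blo J) (bhi J)" by (auto simp: P_def)
      have zu: "z \<in> uhp" using z by (simp add: far_def)
      have ne: "box (blo J) (bhi J) \<noteq> {}"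
        by (simp add: box_ne_empty Basis_complex_def inner_complex_def blo_def bhi_def)
      have zcl: "z \<in> closure (box (blo J) (bhi J))" using J ne by (simp add: closure_box)
      have zcl2: "z \<in> closure (far \<inter> box (blo J) (bhi J))"
        using open_Int_closure_subset[OF faropen, of "box (blo J) (bhi J)"] z zcl by blast
      let ?T = "far \<inter> box (blo J) (bhi J)"
      have zB: "z \<in> B J" using J boxB by blast
      have Bs: "?T \<subseteq> B J \<inter> uhp" using boxB[of J] box_subset_cbox by (auto simp: far_def)
      have "continuous_on (B J \<inter> uhp) (\<lambda>x. C1 * A * cmod (f x) - cmod (F x - a x))"
        using a(1)[OF J(1)] by (intro continuous_intros continuous_on_subset[OF fcont(1)] continuous_on_subset[OF fcont(2)]
          continuous_on_subset[OF holomorphic_on_imp_continuous_on[OF a(1)[OF J(1)]]]) (auto simp: B_def)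
      moreover have "open (B J \<inter> uhp)" unfolding B_def by (intro open_Int open_ball open_uhp)
      ultimately have "continuous (at z) (\<lambda>x. C1 * A * cmod (f x) - cmod (F x - a x))"
        using zB zu continuous_on_eq_continuous_at by blast
      then have lim: "((\<lambda>x. C1 * A * cmod (f x) - cmod (F x - a x)) \<longlongrightarrow> C1 * A * cmod (f z) - cmod (F z - a z)) (at z within ?T)"
        by (simp add: continuous_at tendsto_within_subset[of _ _ z UNIV])
      have zT: "z \<notin> ?T"
      proof
        assume "z \<in> ?T"
        then have zb: "z \<in> box (blo J) (bhi J)" by blast
        from True obtain J' where J': "J' \<in> \<Lambda>" "z \<in> cbox (blo J') (bhi J')" "z \<notin> box (blo J') (bhi J')" by (auto simp: P_def)
        have "z \<in> closure (box (blo J') (bhi J'))" using J'(2)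
          by (subst closure_box) (simp_all add: box_ne_empty Basis_complex_def inner_complex_def blo_def bhi_def)
        then have "box (blo J) (bhi J) \<inter> box (blo J') (bhi J') \<noteq> {}"
          using open_Int_closure_eq_empty[OF open_box, of "blo J" "bhi J" "box (blo J') (bhi J')"] zb by blast
        then have "J = J'" using box_unique by blast
        then show False using J' zb by blast
      qed
      then have "z islimpt ?T" using zcl2 unfolding closure_def by blast
      then have "at z within ?T \<noteq> bot" by (simp add: trivial_limit_within)
      moreover have "eventually (\<lambda>x. C1 * A * cmod (f x) - cmod (F x - a x) \<ge> 0) (at z within ?T)"
      proof -
        have "C1 * A * cmod (f x) - cmod (F x - a x) \<ge> 0" if x: "x \<in> ?T" for x
        proof -
          have "x \<notin> P"
          proof
            assume "x \<in> P"
            then obtain J' where J': "J' \<in> \<Lambda>" "x \<in> cbox (blo J') (bhi J')" "x \<notin> box (blo J') (bhi J')" by (auto simp: P_def)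
            have "x \<in> closure (box (blo J') (bhi J'))" using J'(2)
              by (subst closure_box) (simp_all add: box_ne_empty Basis_complex_def inner_complex_def blo_def bhi_def)
            then have "box (blo J) (bhi J) \<inter> box (blo J') (bhi J') \<noteq> {}"
              using open_Int_closure_eq_empty[OF open_box, of "blo J" "bhi J" "box (blo J') (bhi J')"] x by blast
            then have "J = J'" using box_unique by blast
            then show False using J' x by blast
          qed
          moreover have "La x = a x" using x J(1) box_subset_cbox by (auto simp: La_def)
          ultimately show ?thesis using generic[of x] x by simp
        qed
        then show ?thesis by (simp add: eventually_at_filter)
      qed
      ultimately have "0 \<le> C1 * A * cmod (f z) - cmod (F z - a z)" using tendsto_lowerbound[OF lim] by blast
      moreover have "La z = a z" using J by (auto simp: La_def)
      ultimately show ?thesis by simp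
    qed
  qed
  have LaA: "cmod (La z) \<le> A" for z
    using a(2) boxB A unfolding La_def B_def by (auto simp: subset_iff)
  have Ffar: "cmod (F z) \<le> (1 + L * C1) * A" if z: "z \<in> far" for z
  proof -
    have "cmod (F z) \<le> cmod (La z) + cmod (F z - La z)" by (metis add.commute diff_add_cancel norm_triangle_ineq)
    also have "cmod (La z) + cmod (F z - La z) \<le> A + C1 * A * L"
    proof (intro add_mono LaA)
      have "C1 * A * cmod (f z) \<le> C1 * A * L" using f(2)[of z] z C1 A by (intro mult_left_mono) (auto simp: far_def)
      then show "cmod (F z - La z) \<le> C1 * A * L" using est[OF z] by linarith
    qed
    finally show ?thesis by (simp add: algebra_simps)
  qed
  \<comment> \<open>The radius exceeds the 73/100 of \<open>far\<close>, so the frontier of Q lies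
    in \<open>far\<close>, where F is already bounded.\<close>
  define Q where "Q = (\<Union>J\<in>W. cball (cen J) (74/100 * side (fst J)))"
  have Qc: "compact Q" unfolding Q_def by (intro compact_UN Wfin compact_cball)
  have QB: "cball (cen J) (74/100 * side (fst J)) \<subseteq> B J" for J
    using side_pos[of "fst J"] by (auto simp: B_def cball_subset_ball_iff)
  have Qu: "Q \<subseteq> uhp" using QB Bu unfolding Q_def by blast
  have notQ: "z \<in> far" if "z \<in> uhp" "z \<notin> Q \<or> z \<in> frontier Q" for z
  proof -
    have "z \<notin> ball (cen J) (74/100 * side (fst J))" if J: "J \<in> W" for J
    proof
      assume zb: "z \<in> ball (cen J) (74/100 * side (fst J))"
      have sub: "ball (cen J) (74/100 * side (fst J)) \<subseteq> Q" using J ball_subset_cball unfolding Q_def by blast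
      then have "z \<in> interior Q" using zb by (meson open_ball interiorI)
      then show False using \<open>z \<notin> Q \<or> z \<in> frontier Q\<close> interior_subset by (auto simp: frontier_def)
    qed
    moreover have "cball (cen J) (73/100 * side (fst J)) \<subseteq> ball (cen J) (74/100 * side (fst J))" for J
      using side_pos[of "fst J"] by (auto simp: cball_subset_ball_iff)
    ultimately show ?thesis using that(1) unfolding far_def by blast
  qed
  have Fall: "cmod (F z) \<le> (1 + L * C1) * A" if z: "z \<in> uhp" for z
  proof (cases "z \<in> Q")
    case False then show ?thesis using Ffar notQ z by blast
  next
    case True
    show ?thesis
    proof (rule maximum_modulus_frontier[where f = F and S = Q])
      show "F holomorphic_on interior Q" using holomorphic_on_subset[OF F] Qu interior_subset by blast
      show "continuous_on (closure Q) F" using continuous_on_subset[OF fcont(1) Qu] Qc by (simp add: compact_imp_closed)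
      show "bounded Q" using Qc by (rule compact_imp_bounded)
      show "z \<in> Q" by (rule True)
      fix x assume x: "x \<in> frontier Q"
      then have "x \<in> Q" using Qc by (simp add: compact_imp_closed frontier_def)
      then show "cmod (F x) \<le> (1 + L * C1) * A" using Ffar notQ x Qu by blast
    qed
  qed
  have G: "gluec K L \<delta> = (1 + L * C1) + C1 + (2 + L * C1) / \<delta>" by (simp add: gluec_def C1_def)
  have nn: "L * C1 \<ge> 0" "(2 + L * C1) / \<delta> \<ge> 0" using L C1 \<delta> by auto
  show ?thesis
  proof (intro exI[of _ F] conjI ballI)
    show "F holomorphic_on uhp" by (rule F)
    fix z assume z: "z \<in> uhp"
    have "(1 + L * C1) * A \<le> gluec K L \<delta> * A" unfolding G using nn C1 A by (intro mult_right_mono) auto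
    then show "cmod (F z) \<le> gluec K L \<delta> * A" using Fall[OF z] by linarith
    show "cmod (F z - La z) \<le> gluec K L \<delta> * A * cmod (f z)"
    proof (cases "z \<in> Q")
      case False
      then have "cmod (F z - La z) \<le> C1 * A * cmod (f z)" using est notQ z by blast
      also have "\<dots> \<le> gluec K L \<delta> * A * cmod (f z)" unfolding G using nn C1 A L by (intro mult_right_mono) auto
      finally show ?thesis .
    next
      case True
      then obtain J where J: "J \<in> W" "z \<in> B J" using QB unfolding Q_def by blast
      then have fz: "cmod (f z) \<ge> \<delta>" using fW by (simp add: B_def)
      have "cmod (F z - La z) \<le> (1 + L * C1) * A + A"
        using norm_triangle_ineq4[of "F z" "La z"] Fall[OF z] LaA[of z] by linarith
      also have "\<dots> = (2 + L * C1) / \<delta> * A * \<delta>" using \<delta> by (simp add: field_simps)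
      also have "\<dots> \<le> (2 + L * C1) / \<delta> * A * cmod (f z)" using fz nn A by (intro mult_left_mono mult_nonneg_nonneg)
      also have "\<dots> \<le> gluec K L \<delta> * A * cmod (f z)" unfolding G using nn C1 A L by (intro mult_right_mono) auto
      finally show ?thesis .
    qed
  qed
qed

section \<open>Approximation by unimodular pairs on the half-plane\<close>

text \<open>Harnack's inequality for the harmonic function \<open>- ln (cmod (h z))\<close>, from
  the Schwarz lemma for a Cayley transform of \<open>t - k\<close> with \<open>exp k = h\<close>;
  the constant \<open>t > 0\<close> secures strict positivity and is removed at the end. Passing
  from w to z through the centre squares the Harnack constant, hence the exponent.\<close>

lemma zero_free_lower:
  assumes h: "h holomorphic_on ball c R" "\<And>z. z \<in> ball c R \<Longrightarrow> h z \<noteq> 0 \<and> cmod (h z) \<le> 1"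
    and r: "0 < r" "r < R" and w: "w \<in> cball c r" "cmod (h w) \<ge> \<kappa>" "\<kappa> > 0" and z: "z \<in> cball c r"
  shows "cmod (h z) \<ge> \<kappa> powr (((R + r) / (R - r))\<^sup>2)"
proof -
  define q where "q = (R + r) / (R - r)"
  have q: "q \<ge> 1" using r by (simp add: q_def)
  obtain k where k: "k holomorphic_on ball c R" "\<And>z. z \<in> ball c R \<Longrightarrow> h z = exp (k z)"
    using contractible_imp_holomorphic_log[OF h(1) convex_imp_contractible[OF convex_ball]] h(2) by metis
  have one: "Re (t - k x) \<le> q * Re (t - k y)" if t: "t > 0" and xy: "x \<in> cball c r" "y \<in> cball c r" "x = c \<or> y = c" for t :: real and x y
  proof -
    define K where "K z = of_real t - k z" for z
    have Kpos: "Re (K z) > 0" if "z \<in> ball c R" for z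
    proof -
      have "exp (Re (k z)) \<le> 1" using h(2)[OF that] k(2)[OF that] by (metis norm_exp_eq_Re)
      then show ?thesis using t by (simp add: K_def)
    qed
    have cR: "c \<in> ball c R" using r by simp
    define m where "m \<zeta> = (K (c + of_real R * \<zeta>) - K c) / (K (c + of_real R * \<zeta>) + cnj (K c))" for \<zeta>
    have inR: "c + of_real R * \<zeta> \<in> ball c R" if "cmod \<zeta> < 1" for \<zeta>
      using that r by (simp add: dist_norm norm_mult)
    have den: "K z + cnj (K c) \<noteq> 0" if "z \<in> ball c R" for z
      using Kpos[OF that] Kpos[OF cR] by (auto simp: complex_eq_iff)
    have Kh: "K holomorphic_on ball c R" unfolding K_def by (intro holomorphic_intros k)
    have "(\<lambda>\<zeta>. K (c + of_real R * \<zeta>)) holomorphic_on ball 0 1"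
      by (rule holomorphic_on_compose_gen[OF _ Kh, unfolded o_def]) (use inR in \<open>auto intro!: holomorphic_intros\<close>)
    then have mh: "m holomorphic_on ball 0 1" unfolding m_def using den inR by (intro holomorphic_intros) auto
    have ineq: "cmod (z - a) < cmod (z + cnj a)" if "Re z > 0" "Re a > 0" for z a :: complex
    proof -
      have "(cmod (z - a))\<^sup>2 < (cmod (z + cnj a))\<^sup>2" using that
        unfolding cmod_power2 by (simp add: power2_eq_square algebra_simps)
      then show ?thesis by (rule power2_less_imp_less) simp
    qed
    have m1: "cmod (m \<zeta>) < 1" if "cmod \<zeta> < 1" for \<zeta>
    proof -
      have "cmod (K (c + of_real R * \<zeta>) + cnj (K c)) > 0" using den[OF inR[OF that]] by simp
      then show ?thesis using ineq[OF Kpos[OF inR[OF that]] Kpos[OF cR]] by (simp add: m_def norm_divide)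
    qed
    have schw: "\<bar>Re (K p) - Re (K c)\<bar> \<le> r / R * (Re (K p) + Re (K c))" if p: "p \<in> cball c r" for p
    proof -
      define \<zeta> where "\<zeta> = (p - c) / of_real R"
      have pr: "cmod (p - c) \<le> r" using p by (simp add: dist_norm norm_minus_commute)
      have p1: "cmod \<zeta> \<le> r / R" using pr r by (simp add: \<zeta>_def norm_divide divide_right_mono)
      then have p2: "cmod \<zeta> < 1" using r by (smt (verit) divide_less_eq_1)
      have pe: "c + of_real R * \<zeta> = p" using r by (simp add: \<zeta>_def)
      have pR: "p \<in> ball c R" using inR[OF p2] pe by simp
      have "cmod (m \<zeta>) \<le> cmod \<zeta>" by (rule Schwarz_Lemma(1)[OF mh _ m1 p2]) (auto simp: m_def)
      then have "cmod (m \<zeta>) \<le> r / R" using p1 by linarith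
      then have "cmod (K p - K c) \<le> r / R * cmod (K p + cnj (K c))"
        using den[OF pR] by (simp add: m_def pe norm_divide divide_le_eq)
      then have "(cmod (K p - K c))\<^sup>2 \<le> (r / R * cmod (K p + cnj (K c)))\<^sup>2" by (intro power_mono) auto
      then have A: "(Re (K p) - Re (K c))\<^sup>2 + (Im (K p) - Im (K c))\<^sup>2 \<le> (r / R)\<^sup>2 * ((Re (K p) + Re (K c))\<^sup>2 + (Im (K p) - Im (K c))\<^sup>2)"
        by (simp only: power_mult_distrib cmod_power2) simp
      have rR: "(r / R)\<^sup>2 \<le> 1" using r by (simp add: power_le_one)
      have "(r / R)\<^sup>2 * (Im (K p) - Im (K c))\<^sup>2 \<le> 1 * (Im (K p) - Im (K c))\<^sup>2" by (intro mult_right_mono rR) simp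
      then have "(Re (K p) - Re (K c))\<^sup>2 \<le> (r / R * (Re (K p) + Re (K c)))\<^sup>2" using A unfolding power_mult_distrib distrib_left[of "(r / R)\<^sup>2"] by linarith
      then have "\<bar>Re (K p) - Re (K c)\<bar> \<le> \<bar>r / R * (Re (K p) + Re (K c))\<bar>" by (rule abs_le_square_iff[THEN iffD2])
      then show ?thesis using r Kpos[OF pR] Kpos[OF cR] by simp
    qed
    have fin: "A \<le> q * B" if "A - B \<le> r / R * (A + B)" for A B :: real
    proof -
      have "R * A - R * B \<le> r * A + r * B" using that r by (simp add: field_simps)
      then have "(R - r) * A \<le> (R + r) * B" by (simp add: algebra_simps)
      then show ?thesis using r by (simp add: q_def field_simps)
    qed
    have "Re (K x) \<le> q * Re (K y)"
      using xy(3) schw[OF xy(1)] schw[OF xy(2)] by (intro fin) (auto simp: algebra_simps)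
    then show ?thesis by (simp add: K_def)
  qed
  have cc: "c \<in> cball c r" using r by simp
  have lim: "Re (t - k z) \<le> q\<^sup>2 * Re (t - k w)" if t: "t > 0" for t :: real
  proof -
    have "Re (t - k z) \<le> q * Re (t - k c)" by (rule one[OF t z cc]) simp
    also have "\<dots> \<le> q * (q * Re (t - k w))" using one[OF t cc w(1)] q by (intro mult_left_mono) auto
    finally show ?thesis by (simp add: power2_eq_square)
  qed
  have "- Re (k z) \<le> q\<^sup>2 * - Re (k w)"
  proof (rule field_le_epsilon)
    fix e :: real assume e: "e > 0"
    have q2: "q \<noteq> 0" using q by simp
    have "e / q\<^sup>2 > 0" using e q2 by (intro divide_pos_pos) simp_all
    from lim[OF this] have "e / q\<^sup>2 - Re (k z) \<le> q\<^sup>2 * (e / q\<^sup>2 - Re (k w))" by simp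
    also have "\<dots> = e + q\<^sup>2 * - Re (k w)" using q2 by (simp add: algebra_simps)
    finally show "- Re (k z) \<le> q\<^sup>2 * - Re (k w) + e" using \<open>e / q\<^sup>2 > 0\<close> by linarith
  qed
  moreover have wR: "w \<in> ball c R" "z \<in> ball c R" using w z r by auto
  have "exp (ln \<kappa>) \<le> exp (Re (k w))" using w(2,3) k(2)[OF wR(1)] by simp
  then have "ln \<kappa> \<le> Re (k w)" unfolding exp_le_cancel_iff .
  then have "q\<^sup>2 * ln \<kappa> \<le> q\<^sup>2 * Re (k w)" by (intro mult_left_mono) auto
  ultimately have "q\<^sup>2 * ln \<kappa> \<le> Re (k z)" by simp
  then have "exp (q\<^sup>2 * ln \<kappa>) \<le> exp (Re (k z))" by simp
  then show ?thesis using w(3) k(2)[OF wR(2)] by (simp add: powr_def q_def)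
qed

lemma pk_near:
  assumes z: "z \<in> cball (cen J) (9/10 * side (fst J))" and w: "w \<in> cball (cen J) (9/10 * side (fst J))"
  shows "pk w z \<ge> 1/16"
proof -
  define s where "s = side (fst J)"
  have s: "s > 0" by (simp add: s_def)
  note nz = near_cen[OF z, folded s_def] and nw = near_cen[OF w, folded s_def]
  have d: "cmod (w - cen J) \<le> 9/10 * s" "cmod (z - cen J) \<le> 9/10 * s"
    using z w by (simp_all add: dist_norm norm_minus_commute s_def)
  have "w - cnj z = ((w - cen J) + (cen J - cnj (cen J))) + cnj (cen J - z)" by simp
  then have "cmod (w - cnj z) \<le> cmod ((w - cen J) + (cen J - cnj (cen J))) + cmod (cnj (cen J - z))"
    by (simp only: norm_triangle_ineq)
  also have "cmod ((w - cen J) + (cen J - cnj (cen J))) \<le> cmod (w - cen J) + cmod (cen J - cnj (cen J))"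
    by (rule norm_triangle_ineq)
  also have "cen J - cnj (cen J) = \<i> * of_real (3 * s)" by (simp add: complex_eq_iff Im_cen s_def)
  also have "cmod (\<i> * of_real (3 * s)) = 3 * s" using s by (simp add: norm_mult)
  also have "cmod (cnj (cen J - z)) = cmod (z - cen J)" by (simp add: norm_minus_commute del: complex_cnj_diff)
  finally have D: "cmod (w - cnj z) \<le> 48/10 * s" using d by linarith
  have Dp: "cmod (w - cnj z) > 0" using uhp_cnj_ne nz(4) nw(4) by simp
  have "1/16 = 4 * (3/5 * s) * (3/5 * s) / (48/10 * s)\<^sup>2" using s by (simp add: power2_eq_square)
  also have "\<dots> \<le> 4 * Im w * Im z / (48/10 * s)\<^sup>2" using nz(1) nw(1) s by (intro divide_right_mono mult_mono) auto
  also have "\<dots> \<le> 4 * Im w * Im z / (cmod (w - cnj z))\<^sup>2"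
    using D Dp nz(1) nw(1) s by (intro divide_left_mono power_mono mult_nonneg_nonneg mult_pos_pos) auto
  finally show ?thesis by (simp add: pk_def)
qed

text \<open>The zeros of f are isolated because f does not vanish identically on the connected set
  S, and the quotient stays bounded near them, so its singularities are removable. Defining X
  through \<open>Lim\<close> makes the local extensions agree.\<close>

lemma bounded_quotient:
  assumes S: "open S" "connected S" and h: "h holomorphic_on S" and f: "f holomorphic_on S"
    and le: "\<And>z. z \<in> S \<Longrightarrow> cmod (h z) \<le> C * cmod (f z)" and nz: "p \<in> S" "f p \<noteq> 0"
  shows "\<exists>X. X holomorphic_on S \<and> (\<forall>z\<in>S. h z = X z * f z \<and> cmod (X z) \<le> C)"
proof -
  define Z where "Z = {z\<in>S. f z = 0}"
  have nc: "\<not> f constant_on S \<or> Z = {}"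
    using nz unfolding constant_on_def Z_def by auto
  have C0: "C \<ge> 0" using le[OF nz(1)] nz(2) by (smt (verit) mult_nonneg_nonneg norm_ge_zero mult_neg_pos zero_less_norm_iff)
  have iso: "\<exists>e>0. ball z e \<subseteq> S \<and> (\<forall>w\<in>ball z e - {z}. f w \<noteq> 0)" if z: "z \<in> S" for z
  proof (cases "f z = 0")
    case True
    then have "Z \<noteq> {}" using z by (auto simp: Z_def)
    then have "\<not> f constant_on S" using nc by blast
    then obtain r where "0 < r" "ball z r \<subseteq> S" "\<And>w. w \<in> ball z r - {z} \<Longrightarrow> f w \<noteq> 0"
      using isolated_zeros[OF f S z True] unfolding constant_on_def using nz(1) nz(2) by metis
    then show ?thesis by blast
  next
    case False
    obtain e1 where e1: "e1 > 0" "ball z e1 \<subseteq> S" using S(1) z openE by blast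
    have "isCont f z" using f S(1) z by (meson continuous_on_eq_continuous_at holomorphic_on_imp_continuous_on)
    then obtain e2 where e2: "e2 > 0" "\<And>w. dist z w < e2 \<Longrightarrow> f w \<noteq> 0"
      using False continuous_at_avoid[of z f 0] by (metis dist_commute)
    show ?thesis by (rule exI[of _ "min e1 e2"]) (use e1 e2 in auto)
  qed
  have loc: "\<exists>e>0. \<exists>g. ball z e \<subseteq> S \<and> g holomorphic_on ball z e \<and> (\<forall>w\<in>ball z e - {z}. f w \<noteq> 0 \<and> g w = h w / f w)" if z: "z \<in> S" for z
  proof -
    obtain e where e: "e > 0" "ball z e \<subseteq> S" "\<And>w. w\<in>ball z e - {z} \<Longrightarrow> f w \<noteq> 0" using iso[OF z] by blast
    have hol: "(\<lambda>w. h w / f w) holomorphic_on ball z e - {z}"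
      using e by (intro holomorphic_intros holomorphic_on_subset[OF h] holomorphic_on_subset[OF f]) auto
    have bd: "cmod (h w / f w) \<le> C" if "w \<in> ball z e - {z}" for w
      using le[of w] e(2) e(3)[OF that] that by (simp add: norm_divide divide_le_eq subset_iff)
    have "\<exists>g. g holomorphic_on ball z e \<and> (\<forall>w\<in>ball z e - {z}. g w = h w / f w)"
    proof (rule holomorphic_on_extend_bounded[THEN iffD2, OF hol])
      show "z \<in> interior (ball z e)" using e by simp
      show "\<exists>B. eventually (\<lambda>w. cmod (h w / f w) \<le> B) (at z)"
        using eventually_at_ball[OF e(1), of z UNIV] bd
        by (intro exI[of _ C]) (auto simp: eventually_at_filter elim: eventually_mono)
    qed
    then show ?thesis using e by blast
  qed
  define X where "X z = Lim (at z) (\<lambda>w. h w / f w)" for z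
  have Xg: "X w = g w" if g: "ball z e \<subseteq> S" "g holomorphic_on ball z e" "\<And>w. w\<in>ball z e - {z} \<Longrightarrow> f w \<noteq> 0 \<and> g w = h w / f w" and w: "w \<in> ball z e" for z e g w
  proof -
    have "isCont g w" using g(2) w by (meson continuous_on_eq_continuous_at holomorphic_on_imp_continuous_on open_ball)
    then have "(g \<longlongrightarrow> g w) (at w)" by (simp add: isCont_def)
    moreover have "eventually (\<lambda>x. g x = h x / f x) (at w)"
    proof -
      have "eventually (\<lambda>x. x \<in> ball z e) (at w)" using w eventually_at_in_open'[OF open_ball] by blast
      moreover have "eventually (\<lambda>x. x \<noteq> z) (at w)" by (rule eventually_neq_at_within)
      ultimately show ?thesis by eventually_elim (use g in auto)
    qed
    ultimately have "((\<lambda>x. h x / f x) \<longlongrightarrow> g w) (at w)" by (rule Lim_transform_eventually)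
    then show ?thesis unfolding X_def by (intro tendsto_Lim) auto
  qed
  have XS: "X holomorphic_on S"
  proof (rule holomorphic_on_open[OF S(1), THEN iffD2], intro ballI)
    fix z assume z: "z \<in> S"
    obtain e g where g: "e > 0" "ball z e \<subseteq> S" "g holomorphic_on ball z e" "\<And>w. w\<in>ball z e - {z} \<Longrightarrow> f w \<noteq> 0 \<and> g w = h w / f w"
      using loc[OF z] by blast
    have "X holomorphic_on ball z e" using g(3) by (rule holomorphic_transform) (use Xg[OF g(2,3,4)] in auto)
    then show "\<exists>f'. (X has_field_derivative f') (at z)" using g(1) holomorphic_on_open[OF open_ball] by (metis centre_in_ball)
  qed
  have Xcont: "isCont X z" if "z \<in> S" for z using XS S(1) that by (meson continuous_on_eq_continuous_at holomorphic_on_imp_continuous_on)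
  have fin: "h z = X z * f z \<and> cmod (X z) \<le> C" if z: "z \<in> S" for z
  proof -
    obtain e g where g: "e > 0" "ball z e \<subseteq> S" "g holomorphic_on ball z e" "\<And>w. w\<in>ball z e - {z} \<Longrightarrow> f w \<noteq> 0 \<and> g w = h w / f w"
      using loc[OF z] by blast
    have off: "X w = h w / f w \<and> f w \<noteq> 0 \<and> w \<in> S" if "w \<in> ball z e - {z}" for w using Xg[OF g(2,3,4)] g(2,4) that by auto
    have "eventually (\<lambda>w. w \<in> ball z e - {z}) (at z)" using g(1) eventually_at_in_open[OF open_ball, of z z e] by simp
    then have ev: "eventually (\<lambda>w. cmod (X w) \<le> C) (at z)"
      by eventually_elim (use off le in \<open>auto simp: norm_divide divide_le_eq\<close>)
    have b: "cmod (X z) \<le> C"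
    proof (rule tendsto_upperbound[OF _ ev])
      show "((\<lambda>w. cmod (X w)) \<longlongrightarrow> cmod (X z)) (at z)" using Xcont[OF z] by (intro tendsto_norm) (simp add: isCont_def)
    qed simp
    have "h z = X z * f z"
    proof (cases "f z = 0")
      case True then show ?thesis using le[OF z] by simp
    next
      case False
      have "isCont h z" "isCont f z" using h f S(1) z by (meson continuous_on_eq_continuous_at holomorphic_on_imp_continuous_on)+
      then have "((\<lambda>w. h w / f w) \<longlongrightarrow> h z / f z) (at z)" using False by (intro tendsto_divide) (auto simp: isCont_def)
      then have "X z = h z / f z" unfolding X_def by (intro tendsto_Lim) auto
      then show ?thesis using False by simp
    qed
    then show ?thesis using b by blast
  qed
  then show ?thesis using XS by blast
qed

lemma below_cases:
  assumes "below (l, i) J" "J \<noteq> (l, i)"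
  shows "below (Suc l, 2 * i) J \<or> below (Suc l, 2 * i + 1) J"
proof -
  obtain m j where J: "J = (m, j)" by (cases J)
  have lm: "l < m" using assms by (cases "l = m") (auto simp: below_def J)
  define k where "k = m - Suc l"
  have mk: "m - l = Suc k" "m - Suc l = k" using lm by (auto simp: k_def)
  have "(j div 2 ^ k) div 2 = i" using assms(1) by (simp add: below_def J mk div_mult2_eq[symmetric] mult.commute)
  moreover have "x = 2 * i \<or> x = 2 * i + 1" if "x div 2 = i" for x :: nat using that by presburger
  ultimately have "j div 2 ^ k = 2 * i \<or> j div 2 ^ k = 2 * i + 1" by blast
  then show ?thesis using lm by (auto simp: below_def J mk)
qed

lemma box_cbox_unique:
  assumes "z \<in> box (blo J) (bhi J)" "z \<in> cbox (blo J') (bhi J')" shows "J = J'"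
proof -
  have "z \<in> closure (box (blo J') (bhi J'))" using assms(2)
    by (subst closure_box) (simp_all add: box_ne_empty Basis_complex_def inner_complex_def blo_def bhi_def)
  then have "box (blo J) (bhi J) \<inter> box (blo J') (bhi J') \<noteq> {}"
    using open_Int_closure_eq_empty[OF open_box, of "blo J" "bhi J" "box (blo J') (bhi J')"] assms(1) by blast
  then show ?thesis using box_unique by blast
qed

text \<open>The interior of the rectangle tiled by the squares of generations 0 to n over the unit
  interval.\<close>

definition window :: "nat \<Rightarrow> complex set" where
  "window n = {z. 0 < Re z \<and> Re z < 1 \<and> side n < Im z \<and> Im z < 2}"

lemma window_box: "window n = box (Complex 0 (side n)) (Complex 1 2)"
  by (auto simp: window_def in_box_complex_iff)

lemma window_cover:
  assumes z: "z \<in> window n"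
  shows "\<exists>J. fst J \<le> n \<and> snd J < 2 ^ fst J \<and> z \<in> cbox (blo J) (bhi J)"
proof -
  have zz: "0 < Re z" "Re z < 1" "side n < Im z" "Im z < 2" using z by (auto simp: window_def)
  define m where "m = (LEAST m. side m \<le> Im z)"
  have m: "side m \<le> Im z" "\<And>k. k < m \<Longrightarrow> \<not> side k \<le> Im z" "m \<le> n"
    unfolding m_def using LeastI[of "\<lambda>m. side m \<le> Im z" n] Least_le[of "\<lambda>m. side m \<le> Im z" n] zz(3)
    by (auto dest: not_less_Least)
  have m2: "Im z \<le> 2 * side m"
  proof (cases m)
    case 0 then show ?thesis using zz by simp
  next
    case (Suc k) then show ?thesis using m(2)[of k] by (simp add: side_Suc)
  qed
  define j where "j = nat \<lfloor>Re z / side m\<rfloor>"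
  have nn: "Re z / side m \<ge> 0" using zz by simp
  have j: "real j \<le> Re z / side m" "Re z / side m < real j + 1" using nn unfolding j_def by linarith+
  have "Re z / side m < 2 ^ m" using zz by (simp add: side_def field_simps)
  then have "real j < 2 ^ m" using j by linarith
  then have "j < 2 ^ m" by (metis of_nat_less_iff of_nat_numeral of_nat_power)
  moreover have "z \<in> cbox (blo (m, j)) (bhi (m, j))"
    using j m(1) m2 by (auto simp: in_cbox_complex_iff blo_def bhi_def field_simps)
  ultimately show ?thesis using m(3) by (intro exI[of _ "(m, j)"]) auto
qed

text \<open>Hysteresis at work: a switch to \<open>False\<close> needs a value above \<eta>, and the
  next switches to \<open>True\<close> need g below \<open>exp (- 3 * packc * real P)\<close> on
  whole discs, so by \<open>small_below_large\<close> they cover at most half of the base. This is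
  the hypothesis of \<open>Wall_npack\<close>.\<close>

lemma node_labelling:
  assumes g: "g holomorphic_on uhp" "\<And>z. z \<in> uhp \<Longrightarrow> cmod (g z) \<le> 1"
    and \<eta>: "0 < \<eta>" "exp (- 3 * packc * real P) \<le> \<eta>" and P: "20 * ln (1 / \<eta>) \<le> real P" "P > 0"
  shows "\<exists>\<Lambda>1 \<Lambda>0 W. finite \<Lambda>1 \<and> finite \<Lambda>0 \<and> npack 65 W id \<and> \<Lambda>1 \<inter> \<Lambda>0 = {} \<and> (0, 0) \<in> W \<and>
     \<Lambda>1 \<union> \<Lambda>0 = {J. fst J \<le> n \<and> snd J < 2 ^ fst J} \<and>
     (\<forall>J\<in>\<Lambda>1 - W. inner_node \<Lambda>1 J) \<and> (\<forall>J\<in>\<Lambda>0 - W. inner_node \<Lambda>0 J) \<and>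
     (\<forall>J\<in>\<Lambda>1. \<forall>z\<in>cball (cen J) (4/5 * side (fst J)). cmod (g z) \<le> \<eta>) \<and>
     (\<forall>J\<in>\<Lambda>0. \<exists>z\<in>cball (cen J) (4/5 * side (fst J)). cmod (g z) > exp (- 3 * packc * real P))"
proof -
  define e1 where "e1 = exp (- 3 * packc * real P)"
  define sm where "sm m j \<longleftrightarrow> (\<forall>z\<in>cball (cen (m, j)) (4/5 * side m). cmod (g z) \<le> e1)" for m j
  \<comment> \<open>Indices beyond the unit interval never count as large and are therefore labelled
    \<open>True\<close>; so a node labelled \<open>False\<close> has its index in range, as
    \<open>FS_npack\<close> requires.\<close>
  define bg where "bg m j \<longleftrightarrow> j < 2 ^ m \<and> (\<exists>z\<in>cball (cen (m, j)) (4/5 * side m). cmod (g z) > \<eta>)" for m j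
  interpret labelled_tree sm bg .
  have e1: "e1 \<le> \<eta>" using \<eta>(2) by (simp add: e1_def)
  have smbg: "\<not> bg m j" if "sm m j" for m j using that e1 unfolding sm_def bg_def by (meson leD le_less_trans)
  have lab1: "\<not> bg m j" if "lab m j" for m j
    using that smbg by (cases m) (auto simp: lab.simps split: if_splits)
  have lab0: "\<not> sm m j" if "\<not> lab m j" for m j
    using that smbg by (cases m) (auto simp: lab.simps split: if_splits)
  have nbg: "\<not> bg m j" if "j \<ge> 2 ^ m" for m j using that by (simp add: bg_def)
  have out: "lab m j" if "j \<ge> 2 ^ m" for m j
    using that
  proof (induction m arbitrary: j)
    case 0 then show ?case using nbg by simp
  next
    case (Suc m)
    then have "lab m (j div 2)" by simp
    then show ?case using nbg[OF Suc.prems] by (simp add: lab.simps)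
  qed
  have pack: "fs d m j \<le> side m / 2" if s: "swt m j" "\<not> lab m j" for d m j
  proof -
    have j: "j < 2 ^ m" using out s(2) not_le by blast
    obtain w where w: "w \<in> cball (cen (m, j)) (4/5 * side m)" "cmod (g w) > \<eta>"
      using swt_big[OF s(1,2)] unfolding bg_def by blast
    have "(\<Sum>J\<in>FS d m j. side (fst J)) \<le> side (fst (m, j)) / 2"
    proof (rule small_below_large[OF FS_finite FS_npack[OF j] FS_disjoint _ g _ _ w(2) \<eta>(1,2) P])
      show "below (m, j) J" if "J \<in> FS d m j" for J using FS_below[OF that] by blast
      show "cmod (g z) \<le> exp (- 3 * packc * real P)" if J: "J \<in> FS d m j" and z: "z \<in> cball (cen J) (4/5 * side (fst J))" for J z
      proof -
        have "swt (fst J) (snd J)" "lab (fst J) (snd J)" using FS_swt[OF J] s(2) by auto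
        from swt_small[OF this] show ?thesis using z unfolding sm_def e1_def by simp
      qed
      show "w \<in> cball (cen (m, j)) (4/5 * side (fst (m, j)))" using w(1) by simp
    qed
    then show ?thesis by (simp add: fs_sum)
  qed
  define \<Lambda> where "\<Lambda> b = {J. fst J \<le> n \<and> snd J < 2 ^ fst J \<and> lab (fst J) (snd J) = b}" for b
  have fin: "finite (\<Lambda> b)" for b
  proof (rule finite_subset)
    show "\<Lambda> b \<subseteq> {..n} \<times> {..<2 ^ n}"
      unfolding \<Lambda>_def by (auto intro: less_le_trans power_increasing)
  qed auto
  have inner: "inner_node (\<Lambda> b) J" if J: "J \<in> \<Lambda> b" "J \<notin> Wall n" for J b
  proof -
    obtain m j where mj: "J = (m, j)" by (cases J)
    have b: "m \<le> n" "j < 2 ^ m" "lab m j = b" using J(1) by (auto simp: \<Lambda>_def mj)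
    have nw: "\<not> wall n m j" using J(2) b by (simp add: Wall_def mj)
    have m: "m \<noteq> 0" "m \<noteq> n" "j \<noteq> 0" "Suc j \<noteq> 2 ^ m" using nw by (simp_all add: wall_def)
    have l: "lab (m - 1) (j div 2) = b" "lab (Suc m) (2 * j) = b" "lab (Suc m) (Suc (2 * j)) = b" "lab m (j - 1) = b" "lab m (Suc j) = b"
      using nw m(1) unfolding wall_def swt_def b(3)[symmetric] by auto
    obtain k where k: "m = Suc k" using m(1) not0_implies_Suc by blast
    have "j div 2 < 2 ^ k" using b(2) k by auto
    then show ?thesis using b m l unfolding inner_node_def \<Lambda>_def mj by (auto simp: k)
  qed
  show ?thesis
  proof (rule exI[of _ "\<Lambda> True"], rule exI[of _ "\<Lambda> False"], rule exI[of _ "Wall n"], intro conjI ballI)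
    show "npack 65 (Wall n) id" by (rule Wall_npack[OF pack])
    show "\<Lambda> True \<union> \<Lambda> False = {J. fst J \<le> n \<and> snd J < 2 ^ fst J}" by (auto simp: \<Lambda>_def)
    show "\<Lambda> True \<inter> \<Lambda> False = {}" by (auto simp: \<Lambda>_def)
    show "(0, 0) \<in> Wall n" by (simp add: Wall_def wall_def)
    show "cmod (g z) \<le> \<eta>" if J: "J \<in> \<Lambda> True" and z: "z \<in> cball (cen J) (4/5 * side (fst J))" for J z
    proof -
      have "snd J < 2 ^ fst J" "\<not> bg (fst J) (snd J)" using J lab1 by (auto simp: \<Lambda>_def)
      then show ?thesis using z unfolding bg_def by (auto simp: not_less)
    qed
    show "\<exists>z\<in>cball (cen J) (4/5 * side (fst J)). cmod (g z) > exp (- 3 * packc * real P)" if J: "J \<in> \<Lambda> False" for J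
    proof -
      have "\<not> sm (fst J) (snd J)" using J lab0 by (auto simp: \<Lambda>_def)
      then show ?thesis unfolding sm_def e1_def by (auto simp: not_le)
    qed
  qed (use fin inner in auto)
qed

lemma car_mono: "car K A p \<Longrightarrow> K \<le> K' \<Longrightarrow> car K' A p"
  unfolding car_def by fastforce

text \<open>Converts Jensen's bound at w into a packing bound for zeros in squares below I; 20
  rounds up \<open>27 / (4 * (7/10) * (3/5))\<close>.\<close>

lemma pk_below:
  assumes b: "below I J" and w: "w \<in> cball (cen I) (4/5 * side (fst I))" and z: "z \<in> cball (cen J) (9/10 * side (fst J))"
  shows "side (fst J) \<le> 20 * side (fst I) * pk w z"
proof -
  define s t where "s = side (fst I)" and "t = side (fst J)"
  have t: "0 < t" "t \<le> s" using b by (simp_all add: s_def t_def below_def side_le_iff)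
  note nz = near_cen[OF z, folded t_def]
  have dw: "cmod (cen I - w) \<le> 4/5 * s" using w by (simp add: dist_norm s_def)
  have w1: "Im w \<ge> 7/10 * s" "Im w \<le> 23/10 * s" "\<bar>Re w - Re (cen I)\<bar> \<le> 4/5 * s"
    using abs_Im_le_cmod[of "cen I - w"] abs_Re_le_cmod[of "cen I - w"] dw unfolding minus_complex.simps Im_cen s_def[symmetric] by linarith+
  have "\<bar>Re (cen J) - Re (cen I)\<bar> \<le> 1/2 * s"
    using below_Re[OF b] unfolding Re_cen[of I] s_def[symmetric] abs_le_iff by (simp add: algebra_simps)
  then have r: "\<bar>Re w - Re z\<bar> \<le> 22/10 * s" using w1(3) nz(3) t by linarith
  have "(cmod (w - cnj z))\<^sup>2 = \<bar>Re w - Re z\<bar>\<^sup>2 + (Im w + Im z)\<^sup>2" by (simp add: cmod_power2)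
  also have "\<dots> \<le> (22/10 * s)\<^sup>2 + (47/10 * s)\<^sup>2" using r w1 nz(1,2) t by (intro add_mono power_mono) auto
  also have "\<dots> \<le> 27 * s\<^sup>2" by (simp add: power2_eq_square)
  finally have D: "(cmod (w - cnj z))\<^sup>2 \<le> 27 * s\<^sup>2" .
  have "w \<in> uhp" using w1(1) t by (simp add: uhp_Im)
  then have Dp: "(cmod (w - cnj z))\<^sup>2 > 0" using uhp_cnj_ne nz(4) by simp
  have "t * (cmod (w - cnj z))\<^sup>2 \<le> t * (27 * s\<^sup>2)" using D t by (intro mult_left_mono) auto
  also have "\<dots> \<le> 20 * s * (4 * (7/10 * s) * (3/5 * t))" using t by (simp add: power2_eq_square)
  also have "\<dots> \<le> 20 * s * (4 * Im w * Im z)" using w1 nz(1) t by (intro mult_left_mono mult_mono) auto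
  finally show ?thesis using Dp unfolding pk_def s_def[symmetric] t_def[symmetric] by (simp add: field_simps)
qed

lemma sum_union_le:
  fixes f :: "'a \<Rightarrow> real" assumes "finite A" "finite B" "\<And>x. f x \<ge> 0"
  shows "sum f (A \<union> B) \<le> sum f A + sum f B"
proof -
  have "sum f (A \<union> B) = sum f A + sum f B - sum f (A \<inter> B)" by (rule sum_Un[OF assms(1,2)])
  moreover have "sum f (A \<inter> B) \<ge> 0" using assms(3) by (intro sum_nonneg)
  ultimately show ?thesis by simp
qed

text \<open>At a node of \<Lambda>, Jensen's inequality at a point where g is large bounds all zeros
  attached to nodes below; at any other node the zeros are shared out between the two children.
  Induction on the remaining depth gives packing with \<open>40 = 20 * 2\<close>. After division by
  the product, Harnack turns the large value into a lower bound, with exponent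
  \<open>289 = 17\<^sup>2\<close>.\<close>

lemma zeros_near_large_nodes:
  assumes g: "g holomorphic_on uhp" "\<And>z. z \<in> uhp \<Longrightarrow> cmod (g z) \<le> 1"
    and \<Lambda>: "finite \<Lambda>" "\<And>J. J \<in> \<Lambda> \<Longrightarrow> snd J < 2 ^ fst J" and \<eta>: "0 < \<eta>" "\<eta> \<le> 1"
    and big: "\<And>J. J \<in> \<Lambda> \<Longrightarrow> \<exists>z\<in>cball (cen J) (4/5 * side (fst J)). cmod (g z) > \<eta>"
  shows "\<exists>(N::nat) p Q. car (packc * (40 * ln (1 / \<eta>))) {..<N} p \<and> Q holomorphic_on uhp \<and>
     (\<forall>z\<in>uhp. g z = bprod {..<N} p z * Q z \<and> cmod (Q z) \<le> 1) \<and>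
     (\<forall>J\<in>\<Lambda>. \<forall>z\<in>cball (cen J) (4/5 * side (fst J)). cmod (Q z) \<ge> \<eta> powr 289)"
proof (cases "\<Lambda> = {}")
  case True
  have "car (packc * (40 * ln (1 / \<eta>))) {..<0::nat} (\<lambda>_. \<i>)" using \<eta> by (simp add: car_def packc_def)
  then show ?thesis using g True by - (rule exI[of _ "0::nat"], rule exI[of _ "\<lambda>_. \<i>"], rule exI[of _ g], simp add: bprod_def)
next
  case False
  define K where "K = (\<Union>J\<in>\<Lambda>. cball (cen J) (9/10 * side (fst J)))"
  have "compact K" unfolding K_def using \<Lambda>(1) by (intro compact_UN) auto
  moreover have "K \<subseteq> uhp" unfolding K_def using near_cen(4) by blast
  ultimately have K: "compact K" "K \<subseteq> uhp" .
  obtain wt where wt: "\<And>J. J \<in> \<Lambda> \<Longrightarrow> wt J \<in> cball (cen J) (4/5 * side (fst J)) \<and> cmod (g (wt J)) > \<eta>" using big by metis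
  have in_uhp: "z \<in> uhp \<and> z \<in> cball (cen J) (9/10 * side (fst J))" if "z \<in> cball (cen J) (4/5 * side (fst J))" for z J
  proof -
    have "z \<in> cball (cen J) (9/10 * side (fst J))" using that side_pos[of "fst J"] unfolding mem_cball by linarith
    then show ?thesis using near_cen(4) by blast
  qed
  obtain J0 where J0: "J0 \<in> \<Lambda>" using False by blast
  have "wt J0 \<in> uhp" using in_uhp wt[OF J0] by blast
  moreover have "g (wt J0) \<noteq> 0" using wt[OF J0] \<eta>(1) by auto
  ultimately have "wt J0 \<in> uhp" "g (wt J0) \<noteq> 0" .
  from bprod_factor[OF g this K] obtain N :: nat and p Q where
    Q: "p ` {..<N} \<subseteq> K" "Q holomorphic_on uhp" "\<And>z. z \<in> uhp \<Longrightarrow> g z = bprod {..<N} p z * Q z \<and> cmod (Q z) \<le> 1" "\<And>z. z \<in> K \<Longrightarrow> Q z \<noteq> 0"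
    by blast
  have "\<forall>i\<in>{..<N}. \<exists>J. J \<in> \<Lambda> \<and> p i \<in> cball (cen J) (9/10 * side (fst J))" using Q(1) unfolding K_def by blast
  then obtain nd where nd: "\<And>i. i < N \<Longrightarrow> nd i \<in> \<Lambda> \<and> p i \<in> cball (cen (nd i)) (9/10 * side (fst (nd i)))" by (metis lessThan_iff)
  have pu: "p i \<in> uhp" if "i \<in> {..<N}" for i using nd near_cen(4) that by blast
  define \<kappa> where "\<kappa> = 40 * ln (1 / \<eta>)"
  have \<kappa>: "\<kappa> \<ge> 0" using \<eta> by (simp add: \<kappa>_def)
  define S where "S I = (\<Sum>i\<in>{i\<in>{..<N}. below I (nd i)}. side (fst (nd i)))" for I
  define D where "D = Max (fst ` \<Lambda>)"
  have D: "fst J \<le> D" if "J \<in> \<Lambda>" for J unfolding D_def using \<Lambda>(1) that by simp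
  have pack: "S (l, a) \<le> \<kappa> * side l" if "Suc D - l = k" for k l a
    using that
  proof (induction k arbitrary: l a)
    case 0
    have "{i\<in>{..<N}. below (l, a) (nd i)} = {}"
    proof -
      have "\<not> below (l, a) (nd i)" if "i < N" for i using nd[OF that] D[of "nd i"] 0 by (auto simp: below_def)
      then show ?thesis by auto
    qed
    then have "S (l, a) = 0" unfolding S_def by (simp only: sum.empty)
    then show ?case using \<kappa> by simp
  next
    case (Suc k)
    show ?case
    proof (cases "(l, a) \<in> \<Lambda>")
      case True
      define w where "w = wt (l, a)"
      have w: "w \<in> cball (cen (l, a)) (4/5 * side (fst (l, a)))" "cmod (g w) \<ge> \<eta>" using wt[OF True] by (simp_all add: w_def)
      have wu: "w \<in> uhp" using in_uhp[OF w(1)] by blast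
      have "S (l, a) \<le> (\<Sum>i\<in>{i\<in>{..<N}. below (l, a) (nd i)}. 20 * side l * pk w (p i))"
        unfolding S_def using pk_below[OF _ w(1)] nd by (intro sum_mono) auto
      also have "\<dots> \<le> (\<Sum>i\<in>{..<N}. 20 * side l * pk w (p i))"
      proof (rule sum_mono2)
        show "0 \<le> 20 * side l * pk w (p i)" if "i \<in> {..<N} - {i\<in>{..<N}. below (l, a) (nd i)}" for i
          using pk_pos[OF wu pu, of i] that by simp
      qed auto
      also have "\<dots> = 20 * side l * (\<Sum>i\<in>{..<N}. pk w (p i))" by (simp add: sum_distrib_left)
      also have "\<dots> \<le> 20 * side l * (2 * ln (1 / \<eta>))"
        by (intro mult_left_mono bprod_jensen[where F=g and p=p, OF _ pu wu _ _ w(2) \<eta>(1)]) (use Q(3)[OF wu] in auto)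
      finally show ?thesis by (simp add: \<kappa>_def mult_ac)
    next
      case F: False
      have "{i\<in>{..<N}. below (l, a) (nd i)} \<subseteq> {i\<in>{..<N}. below (Suc l, 2 * a) (nd i)} \<union> {i\<in>{..<N}. below (Suc l, 2 * a + 1) (nd i)}"
      proof -
        have "nd i \<noteq> (l, a)" if "i < N" for i using nd[OF that] F by auto
        then show ?thesis using below_cases[of l a] by blast
      qed
      then have "S (l, a) \<le> (\<Sum>i\<in>{i\<in>{..<N}. below (Suc l, 2 * a) (nd i)} \<union> {i\<in>{..<N}. below (Suc l, 2 * a + 1) (nd i)}. side (fst (nd i)))"
        unfolding S_def by (intro sum_mono2) auto
      also have "\<dots> \<le> S (Suc l, 2 * a) + S (Suc l, 2 * a + 1)"
        unfolding S_def by (rule sum_union_le) simp_all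
      also have "\<dots> \<le> \<kappa> * side (Suc l) + \<kappa> * side (Suc l)" using Suc.prems by (intro add_mono Suc.IH) auto
      finally show ?thesis by (simp add: side_Suc)
    qed
  qed
  have np: "npack \<kappa> {..<N} nd"
    unfolding npack_def
  proof (intro conjI allI ballI)
    show "(\<Sum>i\<in>{i\<in>{..<N}. below I (nd i)}. side (fst (nd i))) \<le> \<kappa> * side (fst I)" for I
      using pack[OF refl, of "fst I" "snd I"] unfolding S_def by simp
  qed (use nd \<Lambda>(2) in auto)
  have c: "car (packc * \<kappa>) {..<N} p" by (rule npack_car[OF np \<kappa>]) (use nd in auto)
  have low: "cmod (Q z) \<ge> \<eta> powr 289" if J: "J \<in> \<Lambda>" and z: "z \<in> cball (cen J) (4/5 * side (fst J))" for J z
  proof -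
    have sub: "ball (cen J) (9/10 * side (fst J)) \<subseteq> K" using J ball_subset_cball unfolding K_def by blast
    have wu: "wt J \<in> uhp" using wt[OF J] in_uhp by blast
    have "\<eta> \<le> cmod (bprod {..<N} p (wt J)) * cmod (Q (wt J))" using wt[OF J] Q(3)[OF wu] by (simp add: norm_mult)
    also have "\<dots> \<le> 1 * cmod (Q (wt J))" by (intro mult_right_mono bprod_le1 pu wu) auto
    finally have k: "cmod (Q (wt J)) \<ge> \<eta>" by simp
    have "cmod (Q z) \<ge> \<eta> powr (((9/10 * side (fst J) + 4/5 * side (fst J)) / (9/10 * side (fst J) - 4/5 * side (fst J)))\<^sup>2)"
    proof (rule zero_free_lower[where h=Q and c="cen J" and w="wt J", OF _ _ _ _ _ k \<eta>(1) z])
      show "Q z \<noteq> 0 \<and> cmod (Q z) \<le> 1" if "z \<in> ball (cen J) (9/10 * side (fst J))" for z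
      proof -
        have "z \<in> K" using that sub by blast
        then show ?thesis using Q(3,4) K(2) by blast
      qed
      show "Q holomorphic_on ball (cen J) (9/10 * side (fst J))" using Q(2) sub K(2) by (meson holomorphic_on_subset subset_trans)
    qed (use sub K(2) Q wt[OF J] in auto)
    also have "(9/10 * side (fst J) + 4/5 * side (fst J)) / (9/10 * side (fst J) - 4/5 * side (fst J)) = 17"
      using side_ne0[of "fst J"] by (simp add: field_simps)
    finally show ?thesis by simp
  qed
  show ?thesis using c Q(2,3) low unfolding \<kappa>_def by blast
qed

text \<open>Jensen at the centre bounds the number of zeros attached to a wall square by
  \<open>32 * ln (M / d)\<close>, with \<open>32 = 16 * 2\<close> from \<open>pk_near\<close>; the
  packing of the walls does the rest. Removing zeros up to radius 17/20 leaves a margin for Harnack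
  on radius 3/4, with exponent \<open>256 = 16\<^sup>2\<close>.\<close>

lemma zeros_near_walls:
  assumes F: "F holomorphic_on uhp" "\<And>z. z \<in> uhp \<Longrightarrow> cmod (F z) \<le> M"
    and W: "npack K W id" "K \<ge> 0" "J0 \<in> W" and d: "d > 0" "d \<le> M" "\<And>J. J \<in> W \<Longrightarrow> cmod (F (cen J)) \<ge> d"
  shows "\<exists>(N::nat) p Q. car (packc * (32 * ln (M / d) * K)) {..<N} p \<and> Q holomorphic_on uhp \<and>
     (\<forall>z\<in>uhp. F z = bprod {..<N} p z * Q z \<and> cmod (Q z) \<le> M) \<and>
     (\<forall>J\<in>W. \<forall>z\<in>ball (cen J) (3/4 * side (fst J)). cmod (Q z) \<ge> M * (d / M) powr 256)"
proof -
  have W': "finite W" "\<And>J. J \<in> W \<Longrightarrow> snd J < 2 ^ fst J" "\<And>I. (\<Sum>J\<in>{J\<in>W. below I J}. side (fst J)) \<le> K * side (fst I)"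
    using W(1) by (auto simp: npack_def)
  define T where "T = (\<Union>J\<in>W. cball (cen J) (17/20 * side (fst J)))"
  have in9: "cball (cen J) (17/20 * side (fst J)) \<subseteq> cball (cen J) (9/10 * side (fst J))" for J
    using side_pos[of "fst J"] by (intro subset_cball) linarith
  have "compact T" unfolding T_def using W'(1) by (intro compact_UN) auto
  moreover have "T \<subseteq> uhp" unfolding T_def using near_cen(4) in9 by blast
  ultimately have T: "compact T" "T \<subseteq> uhp" .
  have M: "M > 0" using d by linarith
  have "F (cen J0) \<noteq> 0" using d(1) d(3)[OF W(3)] by auto
  from bprod_factor[OF F cen_uhp this T] obtain N :: nat and p Q where
    Q: "p ` {..<N} \<subseteq> T" "Q holomorphic_on uhp" "\<And>z. z \<in> uhp \<Longrightarrow> F z = bprod {..<N} p z * Q z \<and> cmod (Q z) \<le> M" "\<And>z. z \<in> T \<Longrightarrow> Q z \<noteq> 0"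
    by blast
  have "\<forall>i\<in>{..<N}. \<exists>J. J \<in> W \<and> p i \<in> cball (cen J) (17/20 * side (fst J))" using Q(1) unfolding T_def by blast
  then obtain nd where nd: "\<And>i. i < N \<Longrightarrow> nd i \<in> W \<and> p i \<in> cball (cen (nd i)) (17/20 * side (fst (nd i)))" by (metis lessThan_iff)
  have nd9: "p i \<in> cball (cen (nd i)) (9/10 * side (fst (nd i)))" if "i < N" for i using nd[OF that] in9 by blast
  have pu: "p i \<in> uhp" if "i \<in> {..<N}" for i using nd9 near_cen(4) that by blast
  define L where "L = ln (M / d)"
  have L: "L \<ge> 0" using d by (simp add: L_def)
  have cnt: "real (card {i\<in>{..<N}. nd i = J}) \<le> 32 * L" if J: "J \<in> W" for J
  proof -
    have "real (card {i\<in>{..<N}. nd i = J}) = (\<Sum>i\<in>{i\<in>{..<N}. nd i = J}. 1)" by simp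
    also have "\<dots> \<le> (\<Sum>i\<in>{i\<in>{..<N}. nd i = J}. 16 * pk (cen J) (p i))"
    proof (rule sum_mono)
      fix i assume i: "i \<in> {i\<in>{..<N}. nd i = J}"
      have "pk (cen J) (p i) \<ge> 1/16" by (rule pk_near) (use nd9[of i] i in auto)
      then show "1 \<le> 16 * pk (cen J) (p i)" by simp
    qed
    also have "\<dots> \<le> (\<Sum>i\<in>{..<N}. 16 * pk (cen J) (p i))"
    proof (rule sum_mono2)
      show "0 \<le> 16 * pk (cen J) (p i)" if "i \<in> {..<N} - {i\<in>{..<N}. nd i = J}" for i
        using pk_pos[OF cen_uhp pu, of i J] that by simp
    qed auto
    also have "\<dots> = 16 * (\<Sum>i\<in>{..<N}. pk (cen J) (p i))" by (simp add: sum_distrib_left)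
    also have "\<dots> \<le> 16 * (2 * L)" unfolding L_def
      by (intro mult_left_mono bprod_jensen[where F=F and p=p, OF _ pu cen_uhp _ _ d(3)[OF J] d(1)]) (use Q(3)[OF cen_uhp[of J]] in auto)
    finally show ?thesis by simp
  qed
  have np: "npack (32 * L * K) {..<N} nd"
    unfolding npack_def
  proof (intro conjI allI ballI)
    fix I
    have "(\<Sum>i\<in>{i\<in>{..<N}. below I (nd i)}. side (fst (nd i))) = (\<Sum>J\<in>{J\<in>W. below I J}. \<Sum>i\<in>{i\<in>{i\<in>{..<N}. below I (nd i)}. nd i = J}. side (fst (nd i)))"
    proof (rule sum.group[symmetric])
      show "nd ` {i\<in>{..<N}. below I (nd i)} \<subseteq> {J\<in>W. below I J}"
      proof (rule image_subsetI)
        fix i assume i: "i \<in> {i\<in>{..<N}. below I (nd i)}"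
        then have "i < N" by simp
        with i nd[of i] show "nd i \<in> {J\<in>W. below I J}" by simp
      qed
      show "finite {J\<in>W. below I J}" using W'(1) by simp
    qed simp
    also have "\<dots> = (\<Sum>J\<in>{J\<in>W. below I J}. real (card {i\<in>{..<N}. nd i = J}) * side (fst J))"
    proof (intro sum.cong refl)
      fix J assume "J \<in> {J\<in>W. below I J}"
      then have "{i\<in>{i\<in>{..<N}. below I (nd i)}. nd i = J} = {i\<in>{..<N}. nd i = J}" by auto
      then show "(\<Sum>i\<in>{i\<in>{i\<in>{..<N}. below I (nd i)}. nd i = J}. side (fst (nd i))) = real (card {i\<in>{..<N}. nd i = J}) * side (fst J)" by simp
    qed
    also have "\<dots> \<le> (\<Sum>J\<in>{J\<in>W. below I J}. 32 * L * side (fst J))" using cnt by (intro sum_mono mult_right_mono) auto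
    also have "\<dots> = 32 * L * (\<Sum>J\<in>{J\<in>W. below I J}. side (fst J))" by (simp add: sum_distrib_left)
    also have "\<dots> \<le> 32 * L * (K * side (fst I))" using L by (intro mult_left_mono W') auto
    finally show "(\<Sum>i\<in>{i\<in>{..<N}. below I (nd i)}. side (fst (nd i))) \<le> 32 * L * K * side (fst I)" by simp
  qed (use nd W'(2) in auto)
  have c: "car (packc * (32 * L * K)) {..<N} p" by (rule npack_car[OF np]) (use nd9 L W(2) in auto)
  have low: "cmod (Q z) \<ge> M * (d / M) powr 256" if J: "J \<in> W" and z: "z \<in> ball (cen J) (3/4 * side (fst J))" for J z
  proof -
    have sub: "ball (cen J) (17/20 * side (fst J)) \<subseteq> T" using J ball_subset_cball unfolding T_def by blast
    have "d \<le> cmod (bprod {..<N} p (cen J)) * cmod (Q (cen J))" using d(3)[OF J] Q(3)[OF cen_uhp] by (simp add: norm_mult)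
    also have "\<dots> \<le> 1 * cmod (Q (cen J))" by (intro mult_right_mono bprod_le1 pu cen_uhp) auto
    finally have k: "cmod (Q (cen J) / of_real M) \<ge> d / M" using M by (simp add: norm_divide divide_right_mono)
    have "cmod (Q z / of_real M) \<ge> (d / M) powr (((17/20 * side (fst J) + 3/4 * side (fst J)) / (17/20 * side (fst J) - 3/4 * side (fst J)))\<^sup>2)"
    proof (rule zero_free_lower[where h="\<lambda>z. Q z / of_real M" and c="cen J" and w="cen J", OF _ _ _ _ _ k])
      show "(\<lambda>z. Q z / of_real M) holomorphic_on ball (cen J) (17/20 * side (fst J))"
        using Q(2) sub T(2) M by (intro holomorphic_intros) (auto intro: holomorphic_on_subset)
      show "Q z / of_real M \<noteq> 0 \<and> cmod (Q z / of_real M) \<le> 1" if "z \<in> ball (cen J) (17/20 * side (fst J))" for z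
      proof -
        have "z \<in> T" using that sub by blast
        then show ?thesis using Q(3)[of z] Q(4)[of z] T(2) M by (auto simp: norm_divide)
      qed
      show "z \<in> cball (cen J) (3/4 * side (fst J))" using z by auto
    qed (use d M side_pos[of "fst J"] in auto)
    also have "(17/20 * side (fst J) + 3/4 * side (fst J)) / (17/20 * side (fst J) - 3/4 * side (fst J)) = 16"
      using side_ne0[of "fst J"] by (simp add: field_simps)
    finally show ?thesis using M by (simp add: norm_divide field_simps)
  qed
  show ?thesis using c Q(2,3) low unfolding L_def by blast
qed

lemma window_uhp: "window n \<subseteq> uhp"
proof
  fix x assume "x \<in> window n"
  then show "x \<in> uhp" using side_pos[of n] unfolding window_def uhp_Im mem_Collect_eq by linarith
qed

text \<open>The new ingredient is \<open>X0\<close>, which inverts the Blaschke part b of g up to a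
  multiple of f; a Bezout coefficient of b and f has this property. It replaces the inverse of b,
  which does not exist in the large region.\<close>

lemma glued_bezout:
  fixes K \<delta> s A0 B :: real and f g b q X0 :: "complex \<Rightarrow> complex"
  defines "G \<equiv> gluec K 2 \<delta>"
  assumes \<Lambda>: "finite \<Lambda>1" "finite \<Lambda>0" "\<Lambda>1 \<inter> \<Lambda>0 = {}" "\<Lambda>1 \<union> \<Lambda>0 = {J. fst J \<le> n \<and> snd J < 2 ^ fst J}"
    and inn: "\<forall>J\<in>\<Lambda>1 - W. inner_node \<Lambda>1 J" "\<forall>J\<in>\<Lambda>0 - W. inner_node \<Lambda>0 J"
    and c: "car K W cen" "K > 0" "(0, 0) \<in> W"
    and f: "f holomorphic_on uhp" "\<And>z. z \<in> uhp \<Longrightarrow> cmod (f z) \<le> 2" and \<delta>: "\<delta> > 0"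
    and fW': "\<forall>J\<in>W. \<forall>z\<in>ball (cen J) (3/4 * side (fst J)). cmod (f z) \<ge> \<delta>"
    and g: "g holomorphic_on uhp" "\<And>z. z \<in> uhp \<Longrightarrow> cmod (g z) \<le> 1" and s: "s > 0" "s * G \<le> 1"
    and small: "\<forall>J\<in>\<Lambda>1. \<forall>z\<in>cball (cen J) (4/5 * side (fst J)). cmod (g z) \<le> s / 2"
    and g0: "b holomorphic_on uhp" "q holomorphic_on uhp" "\<And>z. z \<in> uhp \<Longrightarrow> g z = b z * q z"
    and large: "\<forall>J\<in>\<Lambda>0. \<forall>z\<in>cball (cen J) (4/5 * side (fst J)). cmod (q z) \<ge> 1 / A0" and A0: "A0 > 0"
    and X0: "X0 holomorphic_on uhp" "\<And>z. z \<in> uhp \<Longrightarrow> cmod (X0 z) \<le> B" "\<And>z. z \<in> uhp \<Longrightarrow> cmod (X0 z * b z - 1) \<le> B * cmod (f z)"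
  shows "\<exists>e X Y. e holomorphic_on uhp \<and> (\<forall>z\<in>uhp. cmod (e z) \<le> G) \<and> X holomorphic_on window n \<and> Y holomorphic_on window n \<and>
    (\<forall>z\<in>window n. X z * f z + Y z * (g z + of_real s * e z) = 1 \<and>
       cmod (X z) \<le> G * (2 * G / s) * 2 + 2 * G / s * 2 + 2 * G + G * B * (G * A0) * 2 + B * (G * A0) * 2 + B * (A0 * (s * G)) + B \<and>
       cmod (Y z) \<le> G * (2 * G / s) + G * B * (G * A0))"
proof -
  have fW: "cmod (f z) \<ge> \<delta>" if "J \<in> W" "z \<in> ball (cen J) (3/4 * side (fst J))" for J z using fW' that by blast
  have ball45: "z \<in> cball (cen J) (4/5 * side (fst J))" if "z \<in> ball (cen J) (3/4 * side (fst J))" for z J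
    using that side_pos[of "fst J"] unfolding mem_ball mem_cball by linarith
  have bu: "ball (cen J) (3/4 * side (fst J)) \<subseteq> uhp" for J
  proof
    fix z assume "z \<in> ball (cen J) (3/4 * side (fst J))"
    then have "z \<in> cball (cen J) (9/10 * side (fst J))" using side_pos[of "fst J"] unfolding mem_ball mem_cball by linarith
    then show "z \<in> uhp" by (rule near_cen(4))
  qed
  have inv: "cmod (1 / x) \<le> 1 / d" if "d > 0" "cmod x \<ge> d" for x d
    using that by (simp add: norm_divide frac_le)
  define a1 where "a1 z = 1 / (g z + of_real s)" for z
  define a0 where "a0 z = 1 / q z" for z
  have a1: "cmod (a1 z) \<le> 2 / s \<and> g z + of_real s \<noteq> 0" if "J \<in> \<Lambda>1" "z \<in> ball (cen J) (3/4 * side (fst J))" for J z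
  proof -
    have "cmod (g z) \<le> s / 2" using small that ball45 by blast
    moreover have "cmod (of_real s) \<le> cmod (g z + of_real s) + cmod (g z)"
      using norm_triangle_ineq4[of "g z + of_real s" "g z"] by simp
    ultimately have l: "cmod (g z + of_real s) \<ge> s / 2" using s by simp
    have "cmod (a1 z) \<le> 1 / (s / 2)" unfolding a1_def by (rule inv[OF _ l]) (use s in simp)
    then show ?thesis using l s by auto
  qed
  have a0: "cmod (a0 z) \<le> A0 \<and> q z \<noteq> 0" if "J \<in> \<Lambda>0" "z \<in> ball (cen J) (3/4 * side (fst J))" for J z
  proof -
    have l: "cmod (q z) \<ge> 1 / A0" using large that ball45 by blast
    have "cmod (a0 z) \<le> 1 / (1 / A0)" unfolding a0_def by (rule inv[OF _ l]) (use A0 in simp)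
    then show ?thesis using l A0 by auto
  qed
  have a1h: "a1 holomorphic_on ball (cen J) (3/4 * side (fst J))" if "J \<in> \<Lambda>1" for J
    unfolding a1_def using a1[OF that] by (intro holomorphic_intros holomorphic_on_subset[OF g(1) bu]) auto
  have a0h: "a0 holomorphic_on ball (cen J) (3/4 * side (fst J))" if "J \<in> \<Lambda>0" for J
    unfolding a0_def using a0[OF that] by (intro holomorphic_intros holomorphic_on_subset[OF g0(2) bu]) auto
  define ind where "ind \<Lambda> a z = (if \<exists>J\<in>\<Lambda>. z \<in> cbox (blo J) (bhi J) then a z else 0)" for \<Lambda> :: "(nat \<times> nat) set" and a :: "complex \<Rightarrow> complex" and z
  have glued: "\<exists>F. F holomorphic_on uhp \<and> (\<forall>z\<in>uhp. cmod (F z) \<le> G * A \<and> cmod (F z - ind \<Lambda> a z) \<le> G * A * cmod (f z))"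
    if "finite \<Lambda>" "\<forall>J\<in>\<Lambda> - W. inner_node \<Lambda> J" "A \<ge> 0"
      "\<forall>J\<in>\<Lambda>. a holomorphic_on ball (cen J) (3/4 * side (fst J))"
      "\<forall>J\<in>\<Lambda>. \<forall>z\<in>ball (cen J) (3/4 * side (fst J)). cmod (a z) \<le> A" for \<Lambda> a A
  proof -
    have i: "inner_node \<Lambda> J" if "J \<in> \<Lambda>" "J \<notin> W" for J using \<open>\<forall>J\<in>\<Lambda> - W. inner_node \<Lambda> J\<close> that by blast
    have ah: "a holomorphic_on ball (cen J) (3/4 * side (fst J))" if "J \<in> \<Lambda>" for J
      using \<open>\<forall>J\<in>\<Lambda>. a holomorphic_on ball (cen J) (3/4 * side (fst J))\<close> that by blast
    have ab: "cmod (a z) \<le> A" if "J \<in> \<Lambda>" "z \<in> ball (cen J) (3/4 * side (fst J))" for J z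
      using \<open>\<forall>J\<in>\<Lambda>. \<forall>z\<in>ball (cen J) (3/4 * side (fst J)). cmod (a z) \<le> A\<close> that by blast
    show ?thesis unfolding ind_def G_def
      by (rule glue[where a=a and A=A and \<Lambda>=\<Lambda> and W=W and K=K and \<delta>=\<delta> and f=f and L=2])
        (fact that(1) i c(1,2) f \<delta> fW ah ab that(3) | simp)+
  qed
  have s2: "2 / s \<ge> 0" using s by simp
  have "\<forall>J\<in>\<Lambda>. (\<lambda>_. 1) holomorphic_on ball (cen J) (3/4 * side (fst J))"
    "\<forall>J\<in>\<Lambda>. \<forall>z\<in>ball (cen J) (3/4 * side (fst J)). cmod 1 \<le> 1" for \<Lambda> :: "(nat \<times> nat) set" by simp_all
  note one = glued[OF _ _ zero_le_one this]
  obtain e1 where e1: "e1 holomorphic_on uhp" "\<And>z. z \<in> uhp \<Longrightarrow> cmod (e1 z) \<le> G * 1 \<and> cmod (e1 z - ind \<Lambda>1 (\<lambda>_. 1) z) \<le> G * 1 * cmod (f z)"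
    using one[OF \<Lambda>(1) inn(1)] by blast
  obtain e0 where e0: "e0 holomorphic_on uhp" "\<And>z. z \<in> uhp \<Longrightarrow> cmod (e0 z) \<le> G * 1 \<and> cmod (e0 z - ind \<Lambda>0 (\<lambda>_. 1) z) \<le> G * 1 * cmod (f z)"
    using one[OF \<Lambda>(2) inn(2)] by blast
  have "\<forall>J\<in>\<Lambda>1. a1 holomorphic_on ball (cen J) (3/4 * side (fst J))" "\<forall>J\<in>\<Lambda>1. \<forall>z\<in>ball (cen J) (3/4 * side (fst J)). cmod (a1 z) \<le> 2 / s"
    using a1h a1 by blast+
  from glued[OF \<Lambda>(1) inn(1) s2 this]
  obtain y1 where y1: "y1 holomorphic_on uhp" "\<And>z. z \<in> uhp \<Longrightarrow> cmod (y1 z) \<le> G * (2 / s) \<and> cmod (y1 z - ind \<Lambda>1 a1 z) \<le> G * (2 / s) * cmod (f z)"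
    by blast
  have "\<forall>J\<in>\<Lambda>0. a0 holomorphic_on ball (cen J) (3/4 * side (fst J))" "\<forall>J\<in>\<Lambda>0. \<forall>z\<in>ball (cen J) (3/4 * side (fst J)). cmod (a0 z) \<le> A0"
    using a0h a0 by blast+
  from glued[OF \<Lambda>(2) inn(2) less_imp_le[OF A0] this]
  obtain y0 where y0: "y0 holomorphic_on uhp" "\<And>z. z \<in> uhp \<Longrightarrow> cmod (y0 z) \<le> G * A0 \<and> cmod (y0 z - ind \<Lambda>0 a0 z) \<le> G * A0 * cmod (f z)"
    by blast
  define g1 where "g1 z = g z + of_real s * e1 z" for z
  \<comment> \<open>In the small region \<open>e1\<close> is near 1, \<open>e0\<close> near 0 and
    \<open>y1\<close> near \<open>1 / (g + s)\<close>. In the large region the roles are exchanged,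
    and \<open>X0 * y0 * g\<close> is near \<open>X0 * b\<close>, hence near 1. Near means up to a
    bounded multiple of the modulus of f.\<close>
  define Y where "Y z = e1 z * y1 z + e0 z * X0 z * y0 z" for z
  define C where "C = G * (2 * G / s) * 2 + 2 * G / s * 2 + 2 * G + G * B * (G * A0) * 2 + B * (G * A0) * 2 + B * (A0 * (s * G)) + B"
  have G0: "G \<ge> 0" using e1(2)[OF cen_uhp, of "(0,0)"] norm_ge_zero[of "e1 (cen (0,0))"] by linarith
  have B0: "B \<ge> 0" using X0(2)[OF cen_uhp, of "(0,0)"] norm_ge_zero[of "X0 (cen (0,0))"] by linarith
  have Yh: "Y holomorphic_on uhp" unfolding Y_def by (intro holomorphic_intros e1 e0 y1 y0 X0)
  have g1h: "g1 holomorphic_on uhp" unfolding g1_def by (intro holomorphic_intros e1 g)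
  have g1b: "cmod (g1 z) \<le> 2" if z: "z \<in> uhp" for z
  proof -
    have "cmod (g1 z) \<le> cmod (g z) + cmod (of_real s * e1 z)" unfolding g1_def by (rule norm_triangle_ineq)
    also have "cmod (of_real s * e1 z) \<le> s * G" using e1(2)[OF z] s by (simp add: norm_mult)
    finally show ?thesis using g(2)[OF z] s by linarith
  qed
  have Yb: "cmod (Y z) \<le> G * (2 * G / s) + G * B * (G * A0)" if z: "z \<in> uhp" for z
  proof -
    have "cmod (Y z) \<le> cmod (e1 z) * cmod (y1 z) + cmod (e0 z) * cmod (X0 z) * cmod (y0 z)"
      unfolding Y_def norm_mult[symmetric] by (rule norm_triangle_ineq)
    also have "\<dots> \<le> G * (2 * G / s) + G * B * (G * A0)"
      using e1(2)[OF z] e0(2)[OF z] y1(2)[OF z] y0(2)[OF z] X0(2)[OF z] G0 B0 by (intro add_mono mult_mono) (auto simp: mult_ac)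
    finally show ?thesis .
  qed
  have key: "cmod (1 - Y z * g1 z) \<le> C * cmod (f z)" if J: "J \<in> \<Lambda>1 \<union> \<Lambda>0" and zJ: "z \<in> box (blo J) (bhi J)" for z J
  proof -
    have zc: "z \<in> cbox (blo J) (bhi J)" using zJ box_subset_cbox by blast
    have "z \<in> cball (cen J) (71/100 * side (fst J))" using cbox_cen zc by blast
    then have zb: "z \<in> ball (cen J) (3/4 * side (fst J))" using side_pos[of "fst J"] unfolding mem_ball mem_cball by linarith
    then have z: "z \<in> uhp" using bu by blast
    have ind: "ind \<Lambda> a z = (if J \<in> \<Lambda> then a z else 0)" for \<Lambda> a
    proof -
      have "(\<exists>J'\<in>\<Lambda>. z \<in> cbox (blo J') (bhi J')) \<longleftrightarrow> J \<in> \<Lambda>" using box_cbox_unique[OF zJ] zc by blast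
      then show ?thesis by (simp add: ind_def)
    qed
    define E where "E = cmod (f z)"
    have E: "E \<ge> 0" by (simp add: E_def)
    note b = e1(2)[OF z, unfolded ind E_def[symmetric]] e0(2)[OF z, unfolded ind E_def[symmetric]] y1(2)[OF z, unfolded ind E_def[symmetric]] y0(2)[OF z, unfolded ind E_def[symmetric]]
    note gb = g1b[OF z] and xb = X0(2)[OF z] and xb' = X0(3)[OF z, folded E_def]
    have t4: "cmod (- a + (- b) + (- c) + (- d)) \<le> cmod a + cmod b + cmod c + cmod d" for a b c d
      using norm_triangle_ineq[of "- a" "- b"] norm_triangle_ineq[of "- a + - b" "- c"] norm_triangle_ineq[of "- a + - b + - c" "- d"]
      unfolding norm_minus_cancel by linarith
    have t5: "cmod (- a + (- b) + (- c) + (- d) + (- e)) \<le> cmod a + cmod b + cmod c + cmod d + cmod e" for a b c d e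
      using t4[of a b c d] norm_triangle_ineq[of "- a + - b + - c + - d" "- e"] unfolding norm_minus_cancel by linarith
    have p3: "cmod (u * v * w) \<le> a * b * c" if "cmod u \<le> a" "cmod v \<le> b" "cmod w \<le> c" for u v w a b c
      unfolding norm_mult using that norm_ge_zero[of u] norm_ge_zero[of v] norm_ge_zero[of w] by (intro mult_mono mult_nonneg_nonneg) linarith+
    have p2: "cmod (u * v) \<le> a * b" if "cmod u \<le> a" "cmod v \<le> b" for u v a b
      unfolding norm_mult using that norm_ge_zero[of u] norm_ge_zero[of v] by (intro mult_mono) linarith+
    have nn: "0 \<le> G * (2 * G / s) * 2" "0 \<le> 2 * G / s * 2" "0 \<le> 2 * G" "0 \<le> G * B * (G * A0) * 2" "0 \<le> B * (G * A0) * 2" "0 \<le> B * (A0 * (s * G))"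
      using G0 B0 A0 s by auto
    show ?thesis
    proof (cases "J \<in> \<Lambda>1")
      case True
      then have J0: "J \<notin> \<Lambda>0" using \<Lambda>(3) by blast
      note a = a1[OF True zb]
      have "1 = a1 z * (g z + of_real s)" using a by (simp add: a1_def)
      \<comment> \<open>Each of the four terms has one factor that is \<open>O(|f|)\<close>, a
        gluing error or \<open>e0\<close> itself, while its other factors are bounded.\<close>
      then have eq: "1 - Y z * g1 z = - ((e1 z - 1) * y1 z * g1 z) + (- ((y1 z - a1 z) * g1 z)) + (- (a1 z * (of_real s * (e1 z - 1)))) + (- (e0 z * X0 z * (y0 z * g1 z)))"
        by (simp add: Y_def g1_def algebra_simps)
      have "cmod (1 - Y z * g1 z) \<le> cmod ((e1 z - 1) * y1 z * g1 z) + cmod ((y1 z - a1 z) * g1 z) + cmod (a1 z * (of_real s * (e1 z - 1))) + cmod (e0 z * X0 z * (y0 z * g1 z))"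
        unfolding eq by (rule t4)
      also have "\<dots> \<le> (G * E) * (G * (2 / s)) * 2 + (G * (2 / s) * E) * 2 + (2 / s) * (s * (G * E)) + (G * E) * B * ((G * A0) * 2)"
        using b True J0 gb xb a s by (intro add_mono p3 p2) auto
      also have "\<dots> = (G * (2 * G / s) * 2 + 2 * G / s * 2 + 2 * G + G * B * (G * A0) * 2) * E"
        using s by (simp add: algebra_simps)
      also have "\<dots> \<le> C * E" unfolding C_def using nn B0 by (intro mult_right_mono E) linarith
      finally show ?thesis by (simp add: E_def)
    next
      case False
      then have J0: "J \<in> \<Lambda>0" using J by blast
      note a = a0[OF J0 zb]
      have "b z = a0 z * g z" using a g0(3)[OF z] by (simp add: a0_def)
      then have eq: "1 - Y z * g1 z = - (X0 z * b z - 1) + (- (e1 z * y1 z * g1 z)) + (- (X0 z * ((e0 z - 1) * y0 z * g1 z))) + (- (X0 z * ((y0 z - a0 z) * g1 z))) + (- (X0 z * (a0 z * (of_real s * e1 z))))"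
        by (simp add: Y_def g1_def algebra_simps)
      have "cmod (1 - Y z * g1 z) \<le> cmod (X0 z * b z - 1) + cmod (e1 z * y1 z * g1 z) + cmod (X0 z * ((e0 z - 1) * y0 z * g1 z)) + cmod (X0 z * ((y0 z - a0 z) * g1 z)) + cmod (X0 z * (a0 z * (of_real s * e1 z)))"
        unfolding eq by (rule t5)
      also have "\<dots> \<le> B * E + (G * E) * (G * (2 / s)) * 2 + B * ((G * E) * (G * A0) * 2) + B * ((G * A0 * E) * 2) + B * (A0 * (s * (G * E)))"
        using b False J0 gb xb xb' a s by (intro add_mono p3 p2) auto
      also have "\<dots> = (G * (2 * G / s) * 2 + G * B * (G * A0) * 2 + B * (G * A0) * 2 + B * (A0 * (s * G)) + B) * E"
        using s by (simp add: algebra_simps)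
      also have "\<dots> \<le> C * E" unfolding C_def using nn B0 by (intro mult_right_mono E) linarith
      finally show ?thesis by (simp add: E_def)
    qed
  qed
  have wu: "window n \<subseteq> uhp" by (rule window_uhp)
  have kw: "cmod (1 - Y z * g1 z) \<le> C * cmod (f z)" if z: "z \<in> window n" for z
  proof -
    obtain J where J: "fst J \<le> n" "snd J < 2 ^ fst J" "z \<in> cbox (blo J) (bhi J)" using window_cover[OF z] by blast
    have JL: "J \<in> \<Lambda>1 \<union> \<Lambda>0" using J \<Lambda>(4) by blast
    have cl: "closure (box (blo J) (bhi J)) = cbox (blo J) (bhi J)"
      by (rule closure_box) (simp add: box_ne_empty Basis_complex_def inner_complex_def blo_def bhi_def)
    have cu: "cbox (blo J) (bhi J) \<subseteq> uhp"
    proof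
      fix x assume "x \<in> cbox (blo J) (bhi J)"
      then have "x \<in> cball (cen J) (71/100 * side (fst J))" using cbox_cen by blast
      then have "x \<in> ball (cen J) (3/4 * side (fst J))" using side_pos[of "fst J"] unfolding mem_ball mem_cball by linarith
      then show "x \<in> uhp" using bu by blast
    qed
    \<comment> \<open>So far the estimate is known on open squares; continuity carries it to the
      closed ones, which cover the window.\<close>
    have "0 \<le> C * cmod (f z) - cmod (1 - Y z * g1 z)"
    proof (rule continuous_ge_on_closure[where f="\<lambda>z. C * cmod (f z) - cmod (1 - Y z * g1 z)"])
      show "continuous_on (closure (box (blo J) (bhi J))) (\<lambda>z. C * cmod (f z) - cmod (1 - Y z * g1 z))"
        unfolding cl using cu f(1) Yh g1h by (intro continuous_intros holomorphic_on_imp_continuous_on) (auto intro: holomorphic_on_subset)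
      show "z \<in> closure (box (blo J) (bhi J))" using J(3) cl by simp
    qed (use key[OF JL] in auto)
    then show ?thesis by simp
  qed
  have cc: "cen (0, 0) \<in> window n"
  proof -
    have "side n \<le> 1" using side_le_iff[of n 0] by simp
    then show ?thesis by (simp add: window_def cen_def)
  qed
  have "f (cen (0, 0)) \<noteq> 0" using fW[OF c(3), of "cen (0,0)"] \<delta> by auto
  then have "\<exists>X. X holomorphic_on window n \<and> (\<forall>z\<in>window n. 1 - Y z * g1 z = X z * f z \<and> cmod (X z) \<le> C)"
  proof (intro bounded_quotient[OF _ _ _ _ kw cc])
    show "open (window n)" "connected (window n)" unfolding window_box by (rule open_box, rule convex_connected, rule convex_box)
    show "(\<lambda>z. 1 - Y z * g1 z) holomorphic_on window n"
      using wu by (intro holomorphic_intros holomorphic_on_subset[OF Yh] holomorphic_on_subset[OF g1h])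
    show "f holomorphic_on window n" using wu f(1) holomorphic_on_subset by blast
  qed
  then obtain X where X: "X holomorphic_on window n" "\<And>z. z \<in> window n \<Longrightarrow> 1 - Y z * g1 z = X z * f z \<and> cmod (X z) \<le> C" by blast
  have "X z * f z + Y z * (g z + of_real s * e1 z) = 1" if "z \<in> window n" for z
    using X(2)[OF that] unfolding g1_def by (metis diff_add_cancel)
  moreover have "Y holomorphic_on window n" using Yh wu holomorphic_on_subset by blast
  moreover have "cmod (Y z) \<le> G * (2 * G / s) + G * B * (G * A0)" if "z \<in> window n" for z using Yb wu that by blast
  ultimately show ?thesis using e1 X unfolding C_def
    by - (rule exI[of _ e1], rule exI[of _ X], rule exI[of _ Y], simp)
qed

text \<open>One more perturbation bounds g below at the zeros of the product, so
  \<open>P * bprod A p + Q * g' = 1\<close> is solvable. As \<open>C * \<tau> \<le> 1/2\<close>, the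
  old relation survives with an invertible D in place of 1; inserting the new relation into its
  f-term gives the one for \<open>bprod A p * f\<close> and \<open>g'\<close>.\<close>

lemma bezout_through_product:
  assumes S: "S \<subseteq> uhp" and X: "X holomorphic_on S" "Y holomorphic_on S" "\<And>z. z \<in> S \<Longrightarrow> X z * f z + Y z * g z = 1 \<and> cmod (X z) \<le> C \<and> cmod (Y z) \<le> C" and C: "C > 0"
    and c: "car K A p" "K > 0" and f: "f holomorphic_on uhp" "\<And>z. z \<in> uhp \<Longrightarrow> cmod (f z) \<le> 2"
    and g: "g holomorphic_on uhp" "\<And>z. z \<in> uhp \<Longrightarrow> cmod (g z) \<le> 2" and \<tau>: "0 < \<tau>" "\<tau> \<le> 1" "C * \<tau> \<le> 1/2"
  defines "B \<equiv> bezoutc K 3 (perturbc K \<tau>)"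
  shows "\<exists>g' U V. g' holomorphic_on uhp \<and> (\<forall>z\<in>uhp. cmod (g' z - g z) \<le> \<tau>) \<and> U holomorphic_on S \<and> V holomorphic_on S \<and>
    (\<forall>z\<in>S. U z * (bprod A p z * f z) + V z * g' z = 1 \<and> cmod (U z) \<le> 2 * C * B \<and> cmod (V z) \<le> 2 * C * 2 * B + 2 * C)"
proof -
  obtain g' where g': "g' holomorphic_on uhp" "\<And>z. z \<in> uhp \<Longrightarrow> cmod (g' z - g z) \<le> \<tau>" "\<And>i. i \<in> A \<Longrightarrow> cmod (g' (p i)) \<ge> perturbc K \<tau>"
    using perturb_off_zero[OF c g(1) \<tau>(1)] by blast
  have g'3: "cmod (g' z) \<le> 3" if "z \<in> uhp" for z
    using g'(2)[OF that] g(2)[OF that] \<tau>(2) norm_triangle_ineq[of "g' z - g z" "g z"] by simp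
  obtain P Q where PQ: "P holomorphic_on uhp" "Q holomorphic_on uhp"
    "\<And>z. z \<in> uhp \<Longrightarrow> P z * bprod A p z + Q z * g' z = 1 \<and> cmod (P z) \<le> B \<and> cmod (Q z) \<le> B"
    using bezout_bprod[OF c g'(1) _ g'3 perturbc_pos[OF c(2) \<tau>(1)] g'(3)] unfolding B_def by auto
  define D where "D z = Y z * g' z + X z * f z" for z
  have D: "cmod (1 / D z) \<le> 2 \<and> D z \<noteq> 0" if z: "z \<in> S" for z
  proof -
    have zu: "z \<in> uhp" using S z by blast
    have "D z = 1 + Y z * (g' z - g z)" using X(3)[OF z] by (simp add: D_def algebra_simps)
    then have "1 = D z - Y z * (g' z - g z)" by simp
    then have "cmod 1 \<le> cmod (D z) + cmod (Y z * (g' z - g z))" by (metis norm_triangle_ineq4)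
    moreover have "cmod (Y z * (g' z - g z)) \<le> C * \<tau>" unfolding norm_mult using X(3)[OF z] g'(2)[OF zu] C by (intro mult_mono) auto
    ultimately have l: "cmod (D z) \<ge> 1/2" using \<tau>(3) by simp
    then have "cmod (1 / D z) \<le> 1 / (1/2)" unfolding norm_divide norm_one by (intro frac_le) auto
    then show ?thesis using l by auto
  qed
  define U where "U z = X z / D z * P z" for z
  define V where "V z = X z / D z * f z * Q z + Y z / D z" for z
  have hol: "X holomorphic_on S" "Y holomorphic_on S" "P holomorphic_on S" "Q holomorphic_on S" "f holomorphic_on S" "g' holomorphic_on S"
    using X PQ f g' S holomorphic_on_subset by blast+
  have Dh: "D holomorphic_on S" unfolding D_def by (intro holomorphic_intros hol)
  have UV: "U holomorphic_on S" "V holomorphic_on S" unfolding U_def V_def using D by (intro holomorphic_intros hol Dh; blast)+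
  have fin: "U z * (bprod A p z * f z) + V z * g' z = 1 \<and> cmod (U z) \<le> 2 * C * B \<and> cmod (V z) \<le> 2 * C * 2 * B + 2 * C" if z: "z \<in> S" for z
  proof -
    have zu: "z \<in> uhp" using S z by blast
    note b = X(3)[OF z] PQ(3)[OF zu] D[OF z] f(2)[OF zu]
    have "U z * (bprod A p z * f z) + V z * g' z = X z / D z * f z * (P z * bprod A p z + Q z * g' z) + Y z / D z * g' z"
      by (simp add: U_def V_def algebra_simps)
    also have "\<dots> = (Y z * g' z + X z * f z) / D z" using b by (simp add: add_divide_distrib)
    also have "\<dots> = 1" using b by (simp add: D_def)
    finally have 1: "U z * (bprod A p z * f z) + V z * g' z = 1" .
    have B: "B \<ge> 0" using b norm_ge_zero[of "P z"] by linarith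
    have d: "cmod (X z / D z) \<le> 2 * C" "cmod (Y z / D z) \<le> 2 * C"
    proof -
      have "cmod (u / D z) \<le> 2 * C" if "cmod u \<le> C" for u
      proof -
        have "cmod (u / D z) = cmod (1 / D z) * cmod u" by (simp add: norm_divide)
        also have "\<dots> \<le> 2 * C" using b that by (intro mult_mono) auto
        finally show ?thesis .
      qed
      then show "cmod (X z / D z) \<le> 2 * C" "cmod (Y z / D z) \<le> 2 * C" using b by blast+
    qed
    have 2: "cmod (U z) \<le> 2 * C * B" unfolding U_def norm_mult using d b B C by (intro mult_mono) auto
    have "cmod (V z) \<le> cmod (X z / D z) * cmod (f z) * cmod (Q z) + cmod (Y z / D z)"
      unfolding V_def norm_mult[symmetric] by (rule norm_triangle_ineq)
    also have "\<dots> \<le> 2 * C * 2 * B + 2 * C" using d b B C by (intro add_mono mult_mono) auto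
    finally show ?thesis using 1 2 by blast
  qed
  show ?thesis using g'(1,2) UV fin by - (rule exI[of _ g'], rule exI[of _ U], rule exI[of _ V], blast)
qed

text \<open>All constants are fixed from \<epsilon> alone, before f, g and n are introduced; the
  passage to the limit rests on this uniformity.\<close>

theorem halfplane_pairs:
  assumes "0 < \<epsilon>" "\<epsilon> \<le> 1"
  shows "\<exists>C. \<forall>f g n. f holomorphic_on uhp \<longrightarrow> g holomorphic_on uhp \<longrightarrow> (\<forall>z\<in>uhp. cmod (f z) \<le> 1 \<and> cmod (g z) \<le> 1) \<longrightarrow>
    (\<exists>f' g' X Y. f' holomorphic_on uhp \<and> g' holomorphic_on uhp \<and> (\<forall>z\<in>uhp. cmod (f' z - f z) \<le> \<epsilon> \<and> cmod (g' z - g z) \<le> \<epsilon>) \<and>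
       X holomorphic_on window n \<and> Y holomorphic_on window n \<and>
       (\<forall>z\<in>window n. X z * f' z + Y z * g' z = 1 \<and> cmod (X z) \<le> C \<and> cmod (Y z) \<le> C))"
proof -
  define KW where "KW = packc * 65"
  define \<delta>1 where "\<delta>1 = perturbc KW (\<epsilon> / 2)"
  \<comment> \<open>The bound \<open>M * (d / M) powr 256\<close> of \<open>zeros_near_walls\<close>
    for \<open>M = 2\<close> and \<open>d = \<delta>1 / 2\<close>.\<close>
  define \<delta> where "\<delta> = 2 * (\<delta>1 / 2 / 2) powr 256"
  define G where "G = gluec KW 2 \<delta>"
  \<comment> \<open>The absolute value and the summand 1 give both
    \<open>s * G \<le> \<epsilon> / 2\<close> and \<open>s \<le> 1\<close> without any sign analysis
    of G.\<close>
  define s where "s = \<epsilon> / (2 * (\<bar>G\<bar> + 1))"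
  \<comment> \<open>The upper threshold of the labelling is \<open>s / 2\<close>, and \<eta> below
    is the lower one. The first summand meets the requirement of \<open>node_labelling\<close>, the
    second yields \<open>\<eta> \<le> s / 2\<close>.\<close>
  define P where "P = nat \<lceil>20 * ln (1 / (s / 2))\<rceil> + nat \<lceil>ln (1 / (s / 2))\<rceil> + 1"
  define \<eta> where "\<eta> = exp (- 3 * packc * real P)"
  define A0 where "A0 = 1 / (\<eta> powr 289)"
  define KZ where "KZ = packc * (40 * ln (1 / \<eta>))"
  \<comment> \<open>At most half of \<delta>1, so that the second perturbation of f keeps half of
    the lower bound at the wall centres.\<close>
  define \<tau>f where "\<tau>f = min (\<epsilon> / 2) (\<delta>1 / 2)"
  define B where "B = bezoutc KZ 2 (perturbc KZ \<tau>f)"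
  define C3 where "C3 = G * (2 * G / s) * 2 + 2 * G / s * 2 + 2 * G + G * B * (G * A0) * 2 + B * (G * A0) * 2 + B * (A0 * (s * G)) + B"
  define C4 where "C4 = G * (2 * G / s) + G * B * (G * A0)"
  define C where "C = \<bar>C3\<bar> + \<bar>C4\<bar> + 1"
  define KB where "KB = \<bar>packc * (32 * ln (2 / (\<delta>1 / 2)) * 65)\<bar> + 1"
  \<comment> \<open>\<open>1 / (2 * C)\<close> is the change of g that coefficients bounded by C
    tolerate.\<close>
  define \<tau> where "\<tau> = min (\<epsilon> / 2) (1 / (2 * C))"
  define B' where "B' = bezoutc KB 3 (perturbc KB \<tau>)"
  define C' where "C' = \<bar>2 * C * B'\<bar> + \<bar>2 * C * 2 * B' + 2 * C\<bar>"
  have KW: "KW > 0" by (simp add: KW_def packc_def)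
  have \<delta>1: "\<delta>1 > 0" using KW assms unfolding \<delta>1_def by (intro perturbc_pos) auto
  have \<delta>1u: "\<delta>1 \<le> \<epsilon> / 2"
  proof -
    have "1 \<le> (4 * interpc KW) ^ ncol KW" using interpc_ge1[OF KW] by (intro one_le_power) linarith
    then show ?thesis using assms unfolding \<delta>1_def perturbc_def by (simp add: divide_le_eq_1 mult_le_cancel_left1 field_simps)
  qed
  have \<delta>: "\<delta> > 0" using \<delta>1 by (simp add: \<delta>_def)
  have s: "s > 0" "s \<le> 1" "s * G \<le> \<epsilon> / 2"
  proof -
    show "s > 0" using assms by (simp add: s_def)
    have "s * (\<bar>G\<bar> + 1) = \<epsilon> / 2" by (simp add: s_def field_simps)
    moreover have "s * G \<le> s * (\<bar>G\<bar> + 1)" "s * 1 \<le> s * (\<bar>G\<bar> + 1)" using \<open>s > 0\<close> by (intro mult_left_mono; simp)+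
    ultimately show "s \<le> 1" "s * G \<le> \<epsilon> / 2" using assms by linarith+
  qed
  have P: "20 * ln (1 / (s / 2)) \<le> real P" "P > 0" "ln (1 / (s / 2)) \<le> real P" unfolding P_def by linarith+
  have \<eta>: "0 < \<eta>" "\<eta> < 1" using P(2) by (simp_all add: \<eta>_def packc_def)
  have \<eta>s: "\<eta> \<le> s / 2"
  proof -
    have "ln (1 / (s / 2)) \<le> 3 * packc * real P" using P by (simp add: packc_def)
    then have "- 3 * packc * real P \<le> ln (s / 2)" using s(1) by (simp add: ln_div)
    then have "\<eta> \<le> exp (ln (s / 2))" unfolding \<eta>_def exp_le_cancel_iff .
    then show ?thesis using s(1) by simp
  qed
  have A0: "A0 > 0" using \<eta> by (simp add: A0_def)
  have KZ: "KZ > 0" using \<eta> by (simp add: KZ_def packc_def)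
  have \<tau>f: "\<tau>f > 0" "\<tau>f \<le> \<epsilon> / 2" "\<tau>f \<le> \<delta>1 / 2" using \<delta>1 assms by (simp_all add: \<tau>f_def)
  have C: "C > 0" by (simp add: C_def)
  have KB: "KB > 0" by (simp add: KB_def)
  have \<tau>: "0 < \<tau>" "\<tau> \<le> 1" "C * \<tau> \<le> 1/2" "\<tau> \<le> \<epsilon> / 2"
  proof -
    have "C * \<tau> \<le> C * (1 / (2 * C))" using C by (intro mult_left_mono) (auto simp: \<tau>_def)
    then show "C * \<tau> \<le> 1/2" using C by simp
  qed (use C assms in \<open>auto simp: \<tau>_def\<close>)
  show ?thesis
  proof (intro exI[of _ C'] allI impI)
    fix f g n assume f: "f holomorphic_on uhp" and g: "g holomorphic_on uhp" and b: "\<forall>z\<in>uhp. cmod (f z) \<le> 1 \<and> cmod (g z) \<le> 1"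
    have f1: "cmod (f z) \<le> 1" and g1: "cmod (g z) \<le> 1" if "z \<in> uhp" for z using b that by blast+
    from node_labelling[OF g g1 _ \<eta>s[unfolded \<eta>_def] P(1,2), of n] s(1)
    obtain \<Lambda>1 \<Lambda>0 W where \<Lambda>: "finite \<Lambda>1" "finite \<Lambda>0" "npack 65 W id" "\<Lambda>1 \<inter> \<Lambda>0 = {}" "(0, 0) \<in> W"
      "\<Lambda>1 \<union> \<Lambda>0 = {J. fst J \<le> n \<and> snd J < 2 ^ fst J}"
      "\<forall>J\<in>\<Lambda>1 - W. inner_node \<Lambda>1 J" "\<forall>J\<in>\<Lambda>0 - W. inner_node \<Lambda>0 J"
      "\<forall>J\<in>\<Lambda>1. \<forall>z\<in>cball (cen J) (4/5 * side (fst J)). cmod (g z) \<le> s / 2"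
      "\<forall>J\<in>\<Lambda>0. \<exists>z\<in>cball (cen J) (4/5 * side (fst J)). cmod (g z) > \<eta>"
      unfolding \<eta>_def[symmetric] by (auto simp del: mem_cball)
    have cW: "car KW W cen" unfolding KW_def by (rule npack_car[OF \<Lambda>(3)]) auto
    have l0: "snd J < 2 ^ fst J" if "J \<in> \<Lambda>0" for J using \<Lambda>(6) that by blast
    obtain N p q where q: "car KZ {..<N::nat} p" "q holomorphic_on uhp"
      "\<And>z. z \<in> uhp \<Longrightarrow> g z = bprod {..<N} p z * q z \<and> cmod (q z) \<le> 1"
      "\<forall>J\<in>\<Lambda>0. \<forall>z\<in>cball (cen J) (4/5 * side (fst J)). cmod (q z) \<ge> \<eta> powr 289"
      using zeros_near_large_nodes[OF g g1 \<Lambda>(2) l0 \<eta>(1) less_imp_le[OF \<eta>(2)] bspec[OF \<Lambda>(10)]] unfolding KZ_def by blast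
    have pu: "p i \<in> uhp" if "i \<in> {..<N}" for i using q(1) that by (auto simp: car_def)
    obtain f1 where f1h: "f1 holomorphic_on uhp" "\<And>z. z \<in> uhp \<Longrightarrow> cmod (f1 z - f z) \<le> \<epsilon> / 2" "\<And>J. J \<in> W \<Longrightarrow> cmod (f1 (cen J)) \<ge> \<delta>1"
      using perturb_off_zero[OF cW KW f, of "\<epsilon> / 2"] assms unfolding \<delta>1_def by auto
    obtain f' where f': "f' holomorphic_on uhp" "\<And>z. z \<in> uhp \<Longrightarrow> cmod (f' z - f1 z) \<le> \<tau>f" "\<And>i. i \<in> {..<N} \<Longrightarrow> cmod (f' (p i)) \<ge> perturbc KZ \<tau>f"
      using perturb_off_zero[OF q(1) KZ f1h(1) \<tau>f(1)] by blast
    have ff: "cmod (f' z - f z) \<le> \<epsilon>" if "z \<in> uhp" for z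
      using f1h(2)[OF that] f'(2)[OF that] \<tau>f(2) norm_triangle_ineq[of "f' z - f1 z" "f1 z - f z"] by simp
    have f'2: "cmod (f' z) \<le> 2" if "z \<in> uhp" for z
      using ff[OF that] f1[OF that] assms(2) norm_triangle_ineq[of "f' z - f z" "f z"] by simp
    have f'W: "cmod (f' (cen J)) \<ge> \<delta>1 / 2" if "J \<in> W" for J
      using f1h(3)[OF that] f'(2)[OF cen_uhp, of J] \<tau>f(3) norm_triangle_ineq4[of "f' (cen J)" "f' (cen J) - f1 (cen J)"] by simp
    obtain M r f2 where f2: "car (packc * (32 * ln (2 / (\<delta>1 / 2)) * 65)) {..<M::nat} r" "f2 holomorphic_on uhp"
      "\<And>z. z \<in> uhp \<Longrightarrow> f' z = bprod {..<M} r z * f2 z \<and> cmod (f2 z) \<le> 2"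
      "\<forall>J\<in>W. \<forall>z\<in>ball (cen J) (3/4 * side (fst J)). cmod (f2 z) \<ge> \<delta>"
      using zeros_near_walls[OF f'(1) f'2 \<Lambda>(3) _ \<Lambda>(5) _ _ f'W] \<delta>1 \<delta>1u assms unfolding \<delta>_def by auto
    have cB: "car KB {..<M} r" by (rule car_mono[OF f2(1)]) (simp add: KB_def)
    have ru: "r i \<in> uhp" if "i \<in> {..<M}" for i using cB that by (auto simp: car_def)
    obtain X0 Y0 where X0: "X0 holomorphic_on uhp" "Y0 holomorphic_on uhp"
      "\<And>z. z \<in> uhp \<Longrightarrow> X0 z * bprod {..<N} p z + Y0 z * f' z = 1 \<and> cmod (X0 z) \<le> B \<and> cmod (Y0 z) \<le> B"
      using bezout_bprod[OF q(1) KZ f'(1) _ f'2 perturbc_pos[OF KZ \<tau>f(1)] f'(3)] unfolding B_def by auto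
    \<comment> \<open>The Bezout equation was solved for all of \<open>f'\<close>; the product over
      its zeros near the walls has modulus at most 1, so the error is even a multiple of the
      remaining factor \<open>f2\<close>.\<close>
    have X0b: "cmod (X0 z * bprod {..<N} p z - 1) \<le> B * cmod (f2 z)" if z: "z \<in> uhp" for z
    proof -
      have "X0 z * bprod {..<N} p z - 1 = - (Y0 z * bprod {..<M} r z * f2 z)" using X0(3)[OF z] f2(3)[OF z] by (simp add: algebra_simps)
      then have "cmod (X0 z * bprod {..<N} p z - 1) = cmod (Y0 z) * cmod (bprod {..<M} r z) * cmod (f2 z)" by (simp add: norm_mult)
      also have "\<dots> \<le> B * 1 * cmod (f2 z)"
      proof (intro mult_right_mono mult_mono norm_ge_zero)
        show "cmod (bprod {..<M} r z) \<le> 1" by (rule bprod_le1[OF ru z])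
        show "cmod (Y0 z) \<le> B" using X0(3)[OF z] by blast
        then show "0 \<le> B" using norm_ge_zero[of "Y0 z"] by linarith
      qed
      finally show ?thesis by simp
    qed
    have sG: "s * gluec KW 2 \<delta> \<le> 1" using s(3) assms unfolding G_def by linarith
    have f22: "cmod (f2 z) \<le> 2" and gq: "g z = bprod {..<N} p z * q z" and X0B: "cmod (X0 z) \<le> B" if "z \<in> uhp" for z
      using f2(3) q(3) X0(3) that by blast+
    have lq: "\<forall>J\<in>\<Lambda>0. \<forall>z\<in>cball (cen J) (4/5 * side (fst J)). cmod (q z) \<ge> 1 / A0" using q(4) by (simp add: A0_def)
    obtain e X Y where e: "e holomorphic_on uhp" "\<And>z. z \<in> uhp \<Longrightarrow> cmod (e z) \<le> G" "X holomorphic_on window n" "Y holomorphic_on window n"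
      "\<And>z. z \<in> window n \<Longrightarrow> X z * f2 z + Y z * (g z + of_real s * e z) = 1 \<and> cmod (X z) \<le> C3 \<and> cmod (Y z) \<le> C4"
      using glued_bezout[OF \<Lambda>(1,2,4,6,7,8) cW KW \<Lambda>(5) f2(2) f22 \<delta> f2(4) g g1 s(1) sG \<Lambda>(9) bprod_hol[OF pu] q(2) gq lq A0 X0(1) X0B X0b]
      unfolding G_def[symmetric] C3_def[symmetric] C4_def[symmetric] by blast
    define g1 where "g1 z = g z + of_real s * e z" for z
    have g1h: "g1 holomorphic_on uhp" unfolding g1_def by (intro holomorphic_intros g e)
    have gg: "cmod (g1 z - g z) \<le> \<epsilon> / 2" if "z \<in> uhp" for z
    proof -
      have "cmod (g1 z - g z) = s * cmod (e z)" using s(1) by (simp add: g1_def norm_mult)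
      also have "\<dots> \<le> s * G" using e(2)[OF that] s(1) by (intro mult_left_mono) auto
      finally show ?thesis using s(3) by linarith
    qed
    have g12: "cmod (g1 z) \<le> 2" if "z \<in> uhp" for z
      using gg[OF that] b that assms(2) norm_triangle_ineq[of "g1 z - g z" "g z"] by force
    have XY: "X z * f2 z + Y z * g1 z = 1 \<and> cmod (X z) \<le> C \<and> cmod (Y z) \<le> C" if "z \<in> window n" for z
      using e(5)[OF that] unfolding g1_def C_def by linarith
    obtain g' U V where g': "g' holomorphic_on uhp" "\<And>z. z \<in> uhp \<Longrightarrow> cmod (g' z - g1 z) \<le> \<tau>" "U holomorphic_on window n" "V holomorphic_on window n"
      "\<And>z. z \<in> window n \<Longrightarrow> U z * (bprod {..<M} r z * f2 z) + V z * g' z = 1 \<and> cmod (U z) \<le> 2 * C * B' \<and> cmod (V z) \<le> 2 * C * 2 * B' + 2 * C"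
      using bezout_through_product[OF window_uhp e(3,4) XY C cB KB f2(2) f22 g1h g12 \<tau>(1,2,3)] unfolding B'_def by blast
    have "cmod (g' z - g z) \<le> \<epsilon>" if "z \<in> uhp" for z
      using gg[OF that] g'(2)[OF that] \<tau>(4) norm_triangle_ineq[of "g' z - g1 z" "g1 z - g z"] by simp
    moreover have "U z * f' z + V z * g' z = 1 \<and> cmod (U z) \<le> C' \<and> cmod (V z) \<le> C'" if z: "z \<in> window n" for z
    proof -
      have zu: "z \<in> uhp" using window_uhp z by blast
      have "2 * C * B' \<le> C'" "2 * C * 2 * B' + 2 * C \<le> C'" unfolding C'_def
        using abs_ge_self[of "2 * C * B'"] abs_ge_self[of "2 * C * 2 * B' + 2 * C"]
          abs_ge_zero[of "2 * C * B'"] abs_ge_zero[of "2 * C * 2 * B' + 2 * C"] by linarith+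
      then show ?thesis using g'(5)[OF z] f2(3)[OF zu] by (metis order_trans)
    qed
    ultimately show "\<exists>f' g' X Y. f' holomorphic_on uhp \<and> g' holomorphic_on uhp \<and> (\<forall>z\<in>uhp. cmod (f' z - f z) \<le> \<epsilon> \<and> cmod (g' z - g z) \<le> \<epsilon>) \<and>
       X holomorphic_on window n \<and> Y holomorphic_on window n \<and>
       (\<forall>z\<in>window n. X z * f' z + Y z * g' z = 1 \<and> cmod (X z) \<le> C' \<and> cmod (Y z) \<le> C')"
      using f'(1) g' ff by - (rule exI[of _ f'], rule exI[of _ g'], rule exI[of _ U], rule exI[of _ V], blast)
  qed
qed

section \<open>Approximation by unimodular pairs on the disc\<close>

lemma bounded_subsequence:
  assumes "\<And>k. h k holomorphic_on ball 0 1" "\<And>k z. z \<in> ball 0 1 \<Longrightarrow> cmod (h k z) \<le> B"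
  shows "\<exists>g r. strict_mono (r :: nat \<Rightarrow> nat) \<and> g holomorphic_on ball 0 1 \<and> (\<forall>z\<in>ball 0 1. (\<lambda>k. h (r k) z) \<longlonglongrightarrow> g z)"
proof -
  have hol: "\<And>f. f \<in> range h \<Longrightarrow> f holomorphic_on ball 0 1" using assms(1) by blast
  have bd: "\<exists>B. \<forall>f\<in>range h. \<forall>z\<in>K. cmod (f z) \<le> B" if "compact K" "K \<subseteq> ball 0 1" for K
    using that assms(2) by (intro exI[of _ B]) blast
  obtain g r where "g holomorphic_on ball 0 1" "strict_mono (r :: nat \<Rightarrow> nat)" "\<And>x. x \<in> ball 0 1 \<Longrightarrow> ((\<lambda>n. h (r n) x) \<longlongrightarrow> g x) sequentially"
    using Montel[OF open_ball hol bd order_refl] by metis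
  then show ?thesis by blast
qed

text \<open>The Cayley map scaled by s and centred over 1/2: for small s, a disc of radius below 1
  lands over the unit interval.\<close>

definition disc_to_uhp :: "real \<Rightarrow> complex \<Rightarrow> complex" where
  "disc_to_uhp s z = 1/2 + of_real s * \<i> * ((1 + z) / (1 - z))"

definition uhp_to_disc :: "real \<Rightarrow> complex \<Rightarrow> complex" where
  "uhp_to_disc s w = (w - 1/2 - of_real s * \<i>) / (w - 1/2 + of_real s * \<i>)"

lemma common_subsequence:
  fixes h :: "nat \<Rightarrow> nat \<Rightarrow> complex \<Rightarrow> complex"
  assumes "\<And>i k. i < n \<Longrightarrow> h i k holomorphic_on ball 0 1" "\<And>i k z. i < n \<Longrightarrow> z \<in> ball 0 1 \<Longrightarrow> cmod (h i k z) \<le> B"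
  shows "\<exists>g r. strict_mono (r :: nat \<Rightarrow> nat) \<and> (\<forall>i<n. g i holomorphic_on ball 0 1 \<and> (\<forall>z\<in>ball 0 1. (\<lambda>k. h i (r k) z) \<longlonglongrightarrow> g i z))"
  using assms
proof (induction n)
  case 0 then show ?case using strict_mono_id by auto
next
  case (Suc n)
  then obtain g r where r: "strict_mono (r :: nat \<Rightarrow> nat)" "\<forall>i<n. g i holomorphic_on ball 0 1 \<and> (\<forall>z\<in>ball 0 1. (\<lambda>k. h i (r k) z) \<longlonglongrightarrow> g i z)"
    by (metis less_SucI)
  have "\<exists>g' q. strict_mono (q :: nat \<Rightarrow> nat) \<and> g' holomorphic_on ball 0 1 \<and> (\<forall>z\<in>ball 0 1. (\<lambda>k. h n (r (q k)) z) \<longlonglongrightarrow> g' z)"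
    by (rule bounded_subsequence[of "\<lambda>k. h n (r k)" B]) (use Suc.prems in auto)
  then obtain g' q where q: "strict_mono (q :: nat \<Rightarrow> nat)" "g' holomorphic_on ball 0 1" "\<forall>z\<in>ball 0 1. (\<lambda>k. h n (r (q k)) z) \<longlonglongrightarrow> g' z" by blast
  have "(g(n := g')) i holomorphic_on ball 0 1 \<and> (\<forall>z\<in>ball 0 1. (\<lambda>k. h i ((r \<circ> q) k) z) \<longlonglongrightarrow> (g(n := g')) i z)" if "i < Suc n" for i
  proof (cases "i = n")
    case True then show ?thesis using q by simp
  next
    case False
    then have "i < n" using that by simp
    then show ?thesis using r(2) False LIMSEQ_subseq_LIMSEQ[OF _ q(1)] by (auto simp: o_def)
  qed
  then show ?case using strict_mono_o[OF r(1) q(1)] by blast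
qed

lemma Re_cayley: "Re ((1 + z) / (1 - z)) = (1 - (cmod z)\<^sup>2) / (cmod (1 - z))\<^sup>2"
  by (simp add: Re_divide cmod_power2) (simp add: power2_eq_square algebra_simps)

lemma disc_to_uhp:
  assumes "s > 0" "cmod z < 1"
  shows "disc_to_uhp s z \<in> uhp" "uhp_to_disc s (disc_to_uhp s z) = z"
proof -
  have z1: "1 - z \<noteq> 0" using assms by auto
  have "(cmod z)\<^sup>2 < 1" using assms by (simp add: power_less_one_iff abs_square_less_1)
  then have "Re ((1 + z) / (1 - z)) > 0" unfolding Re_cayley using z1 by simp
  moreover have "Im (disc_to_uhp s z) = s * Re ((1 + z) / (1 - z))" unfolding disc_to_uhp_def by (simp del: times_divide_eq_right)
  ultimately show "disc_to_uhp s z \<in> uhp" using assms by (simp add: uhp_Im)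
  have "uhp_to_disc s (disc_to_uhp s z) = (of_real s * \<i> * ((1 + z) / (1 - z) - 1)) / (of_real s * \<i> * ((1 + z) / (1 - z) + 1))"
    by (simp add: uhp_to_disc_def disc_to_uhp_def algebra_simps)
  also have "\<dots> = ((1 + z) / (1 - z) - 1) / ((1 + z) / (1 - z) + 1)" using assms by simp
  also have "(1 + z) / (1 - z) - 1 = 2 * z / (1 - z)" using z1 by (simp add: field_simps)
  also have "(1 + z) / (1 - z) + 1 = 2 / (1 - z)" using z1 by (simp add: field_simps)
  finally show "uhp_to_disc s (disc_to_uhp s z) = z" using z1 by simp
qed

lemma uhp_to_disc:
  assumes "s > 0" "w \<in> uhp" shows "w - 1/2 + of_real s * \<i> \<noteq> 0" "cmod (uhp_to_disc s w) < 1"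
proof -
  have a: "1/2 + of_real s * \<i> \<in> uhp" using assms by (simp add: uhp_Im)
  have e: "w - 1/2 + of_real s * \<i> = w - cnj (1/2 + of_real s * \<i>)" "w - 1/2 - of_real s * \<i> = w - (1/2 + of_real s * \<i>)" by simp_all
  show "w - 1/2 + of_real s * \<i> \<noteq> 0" unfolding e by (rule uhp_cnj_ne[OF assms(2) a])
  show "cmod (uhp_to_disc s w) < 1" using bf_le1[OF assms(2) a] unfolding uhp_to_disc_def e bf_def .
qed

text \<open>On the disc of radius r the Cayley transform has modulus at most
  \<open>(1 + r) / (1 - r)\<close>, so the scale \<open>(1 - r) / 5\<close> keeps the deviation from
  1/2 below 1/2. Its real part is at least \<open>(1 - r) / 2\<close>, which is the source of
  \<open>(1 - r)\<^sup>2 / 10\<close>.\<close>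

lemma disc_to_window:
  assumes r: "0 < r" "r < 1" and n: "side n < (1 - r)\<^sup>2 / 10" and z: "cmod z < 1"
  shows "disc_to_uhp ((1 - r) / 5) (of_real r * z) \<in> window n"
proof -
  define s where "s = (1 - r) / 5"
  define u where "u = of_real r * z"
  have s: "s > 0" using r by (simp add: s_def)
  have u: "cmod u < r" using r z by (simp add: u_def norm_mult)
  have l: "1 - r \<le> cmod (1 - u)" "cmod (1 - u) \<le> 1 + r" using u norm_triangle_ineq4[of 1 u] norm_triangle_ineq2[of 1 u] by simp_all
  have "cmod ((1 + u) / (1 - u)) \<le> (1 + r) / (1 - r)" unfolding norm_divide
    using u l r norm_triangle_ineq[of 1 u] by (intro frac_le) auto
  then have "s * cmod ((1 + u) / (1 - u)) \<le> s * ((1 + r) / (1 - r))" using s by (intro mult_left_mono) auto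
  also have "\<dots> = (1 + r) / 5" using r by (simp add: s_def field_simps)
  finally have b: "s * cmod ((1 + u) / (1 - u)) < 1/2" using r by simp
  have i: "Im (disc_to_uhp s u) = s * Re ((1 + u) / (1 - u))" "Re (disc_to_uhp s u) = 1/2 - s * Im ((1 + u) / (1 - u))"
    unfolding disc_to_uhp_def by (simp_all del: times_divide_eq_right)
  have "s * Re ((1 + u) / (1 - u)) \<le> s * cmod ((1 + u) / (1 - u))" using s complex_Re_le_cmod by (intro mult_left_mono) auto
  then have 1: "Im (disc_to_uhp s u) < 1/2" using b i by linarith
  have "\<bar>s * Im ((1 + u) / (1 - u))\<bar> \<le> s * cmod ((1 + u) / (1 - u))" using s abs_Im_le_cmod[of "(1 + u) / (1 - u)"] by (simp add: abs_mult)
  then have 2: "\<bar>Re (disc_to_uhp s u) - 1/2\<bar> < 1/2" using b i by linarith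
  have "(1 - r) / 2 \<le> (1 - r\<^sup>2) / (1 + r)\<^sup>2"
  proof -
    have "(1 - r\<^sup>2) / (1 + r)\<^sup>2 = (1 - r) * (1 + r) / ((1 + r) * (1 + r))" by (simp add: power2_eq_square algebra_simps)
    also have "\<dots> = (1 - r) / (1 + r)" using r by simp
    also have "\<dots> \<ge> (1 - r) / 2" by (rule divide_left_mono) (use r in auto)
    finally show ?thesis .
  qed
  also have "\<dots> \<le> (1 - (cmod u)\<^sup>2) / (cmod (1 - u))\<^sup>2"
  proof (intro frac_le)
    have "1 - u \<noteq> 0" using l r by auto
    then show "0 < (cmod (1 - u))\<^sup>2" by simp
    show "(cmod (1 - u))\<^sup>2 \<le> (1 + r)\<^sup>2" using l by (intro power_mono) auto
    have "(cmod u)\<^sup>2 \<le> r\<^sup>2" using u by (intro power_mono) auto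
    moreover have "r\<^sup>2 \<le> 1" using r by (simp add: power_le_one)
    ultimately show "1 - r\<^sup>2 \<le> 1 - (cmod u)\<^sup>2" "0 \<le> 1 - (cmod u)\<^sup>2" by linarith+
  qed
  finally have "s * ((1 - r) / 2) \<le> Im (disc_to_uhp s u)" unfolding i Re_cayley using s by (intro mult_left_mono) auto
  then have "side n < Im (disc_to_uhp s u)" using n by (simp add: s_def power2_eq_square)
  then show ?thesis using 1 2 unfolding window_def s_def[symmetric] u_def[symmetric] mem_Collect_eq abs_less_iff by linarith
qed

text \<open>Dilation by r makes the image of the disc fit into a single window. The constant of
  \<open>halfplane_pairs\<close> is the same for all windows, hence C does not depend on r.\<close>

lemma disc_pairs_scaled:
  assumes "0 < \<epsilon>" "\<epsilon> \<le> 1"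
  shows "\<exists>C. \<forall>f g r. f holomorphic_on ball 0 1 \<longrightarrow> g holomorphic_on ball 0 1 \<longrightarrow> (\<forall>z\<in>ball 0 1. cmod (f z) \<le> 1 \<and> cmod (g z) \<le> 1) \<longrightarrow> 0 < r \<longrightarrow> r < 1 \<longrightarrow>
    (\<exists>f' g' x y. f' holomorphic_on ball 0 1 \<and> g' holomorphic_on ball 0 1 \<and> x holomorphic_on ball 0 1 \<and> y holomorphic_on ball 0 1 \<and>
       (\<forall>z\<in>ball 0 1. cmod (f' z - f (of_real r * z)) \<le> \<epsilon> \<and> cmod (g' z - g (of_real r * z)) \<le> \<epsilon> \<and>
          x z * f' z + y z * g' z = 1 \<and> cmod (x z) \<le> C \<and> cmod (y z) \<le> C))"
proof -
  obtain C where C: "\<And>f g n. f holomorphic_on uhp \<Longrightarrow> g holomorphic_on uhp \<Longrightarrow> (\<forall>z\<in>uhp. cmod (f z) \<le> 1 \<and> cmod (g z) \<le> 1) \<Longrightarrow>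
    (\<exists>f' g' X Y. f' holomorphic_on uhp \<and> g' holomorphic_on uhp \<and> (\<forall>z\<in>uhp. cmod (f' z - f z) \<le> \<epsilon> \<and> cmod (g' z - g z) \<le> \<epsilon>) \<and>
       X holomorphic_on window n \<and> Y holomorphic_on window n \<and>
       (\<forall>z\<in>window n. X z * f' z + Y z * g' z = 1 \<and> cmod (X z) \<le> C \<and> cmod (Y z) \<le> C))"
    using halfplane_pairs[OF assms] by blast
  show ?thesis
  proof (intro exI[of _ C] allI impI)
    fix f g :: "complex \<Rightarrow> complex" and r :: real
    assume f: "f holomorphic_on ball 0 1" and g: "g holomorphic_on ball 0 1" and b: "\<forall>z\<in>ball 0 1. cmod (f z) \<le> 1 \<and> cmod (g z) \<le> 1" and r: "0 < r" "r < 1"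
    define s where "s = (1 - r) / 5"
    have s: "s > 0" using r by (simp add: s_def)
    have "\<exists>n. side n < (1 - r)\<^sup>2 / 10"
      using real_arch_pow_inv[of "(1 - r)\<^sup>2 / 10" "1/2"] r by (auto simp: side_def power_divide)
    then obtain n where n: "side n < (1 - r)\<^sup>2 / 10" by blast
    let ?u = "uhp_to_disc s" and ?d = "disc_to_uhp s"
    have uh: "?u holomorphic_on uhp" unfolding uhp_to_disc_def using uhp_to_disc(1)[OF s] by (intro holomorphic_intros)
    have ub: "?u ` uhp \<subseteq> ball 0 1" using uhp_to_disc(2)[OF s] by auto
    have h: "(\<lambda>w. f (?u w)) holomorphic_on uhp" "(\<lambda>w. g (?u w)) holomorphic_on uhp"
      using holomorphic_on_compose_gen[OF uh f ub] holomorphic_on_compose_gen[OF uh g ub] by (simp_all add: o_def)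
    have "\<forall>z\<in>uhp. cmod (f (?u z)) \<le> 1 \<and> cmod (g (?u z)) \<le> 1" using b ub by blast
    from C[OF h this, of n] obtain f' g' X Y where F: "f' holomorphic_on uhp" "g' holomorphic_on uhp"
       "\<forall>z\<in>uhp. cmod (f' z - f (?u z)) \<le> \<epsilon> \<and> cmod (g' z - g (?u z)) \<le> \<epsilon>"
       "X holomorphic_on window n" "Y holomorphic_on window n"
       "\<forall>z\<in>window n. X z * f' z + Y z * g' z = 1 \<and> cmod (X z) \<le> C \<and> cmod (Y z) \<le> C" by blast
    define m where "m z = ?d (of_real r * z)" for z
    have rz: "cmod (of_real r * z) < 1" if "cmod z < 1" for z :: complex
    proof -
      have "r * cmod z \<le> 1 * cmod z" using r by (intro mult_right_mono) auto
      then show ?thesis using that r by (simp add: norm_mult)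
    qed
    have mw: "m ` ball 0 1 \<subseteq> window n" using disc_to_window[OF r n] by (auto simp: m_def s_def)
    have mu: "m ` ball 0 1 \<subseteq> uhp" using mw window_uhp by blast
    have mh: "m holomorphic_on ball 0 1" unfolding m_def disc_to_uhp_def
    proof (intro holomorphic_intros)
      show "1 - of_real r * z \<noteq> 0" if "z \<in> ball 0 1" for z :: complex using rz[of z] that by auto
    qed
    have um: "?u (m z) = of_real r * z" if "z \<in> ball 0 1" for z :: complex unfolding m_def using disc_to_uhp(2)[OF s rz] that by simp
    have hol: "(\<lambda>z. f' (m z)) holomorphic_on ball 0 1" "(\<lambda>z. g' (m z)) holomorphic_on ball 0 1" "(\<lambda>z. X (m z)) holomorphic_on ball 0 1" "(\<lambda>z. Y (m z)) holomorphic_on ball 0 1"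
      using holomorphic_on_compose_gen[OF mh F(1) mu] holomorphic_on_compose_gen[OF mh F(2) mu] holomorphic_on_compose_gen[OF mh F(4) mw] holomorphic_on_compose_gen[OF mh F(5) mw] by (simp_all add: o_def)
    have "cmod (f' (m z) - f (of_real r * z)) \<le> \<epsilon> \<and> cmod (g' (m z) - g (of_real r * z)) \<le> \<epsilon> \<and>
          X (m z) * f' (m z) + Y (m z) * g' (m z) = 1 \<and> cmod (X (m z)) \<le> C \<and> cmod (Y (m z)) \<le> C" if z: "z \<in> ball 0 1" for z
    proof -
      have "m z \<in> uhp" "m z \<in> window n" using mu mw z by blast+
      then show ?thesis using F(3,6) um[OF z] by (metis (no_types))
    qed
    then show "\<exists>f' g' x y. f' holomorphic_on ball 0 1 \<and> g' holomorphic_on ball 0 1 \<and> x holomorphic_on ball 0 1 \<and> y holomorphic_on ball 0 1 \<and>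
       (\<forall>z\<in>ball 0 1. cmod (f' z - f (of_real r * z)) \<le> \<epsilon> \<and> cmod (g' z - g (of_real r * z)) \<le> \<epsilon> \<and>
          x z * f' z + y z * g' z = 1 \<and> cmod (x z) \<le> C \<and> cmod (y z) \<le> C)"
      using hol by - (rule exI[of _ "\<lambda>z. f' (m z)"], rule exI[of _ "\<lambda>z. g' (m z)"], rule exI[of _ "\<lambda>z. X (m z)"], rule exI[of _ "\<lambda>z. Y (m z)"], simp)
  qed
qed

text \<open>Let r tend to 1. The pairs and their coefficients are uniformly bounded, so a common
  subsequence converges pointwise, and closeness, bounds and the Bezout equation pass to the
  limit.\<close>

lemma disc_pairs_unit:
  assumes f: "f holomorphic_on ball 0 1" and g: "g holomorphic_on ball 0 1" and b: "\<forall>z\<in>ball 0 1. cmod (f z) \<le> 1 \<and> cmod (g z) \<le> 1"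
    and e: "0 < \<epsilon>" "\<epsilon> \<le> 1"
  shows "\<exists>f' g' x y C. f' holomorphic_on ball 0 1 \<and> g' holomorphic_on ball 0 1 \<and> x holomorphic_on ball 0 1 \<and> y holomorphic_on ball 0 1 \<and>
       (\<forall>z\<in>ball 0 1. cmod (f' z - f z) \<le> \<epsilon> \<and> cmod (g' z - g z) \<le> \<epsilon> \<and>
          x z * f' z + y z * g' z = 1 \<and> cmod (x z) \<le> C \<and> cmod (y z) \<le> C)"
proof -
  define r where "r k = 1 - 1 / (real k + 2)" for k
  have r: "0 < r k" "r k < 1" for k by (simp_all add: r_def)
  have "r \<longlonglongrightarrow> 1 - 0" unfolding r_def by (intro tendsto_diff tendsto_const) real_asymp
  then have rl: "r \<longlonglongrightarrow> 1" by simp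
  obtain C where CC: "\<forall>f g r. f holomorphic_on ball 0 1 \<longrightarrow> g holomorphic_on ball 0 1 \<longrightarrow> (\<forall>z\<in>ball 0 1. cmod (f z) \<le> 1 \<and> cmod (g z) \<le> 1) \<longrightarrow> 0 < r \<longrightarrow> r < 1 \<longrightarrow>
    (\<exists>f' g' x y. f' holomorphic_on ball 0 1 \<and> g' holomorphic_on ball 0 1 \<and> x holomorphic_on ball 0 1 \<and> y holomorphic_on ball 0 1 \<and>
       (\<forall>z\<in>ball 0 1. cmod (f' z - f (of_real r * z)) \<le> \<epsilon> \<and> cmod (g' z - g (of_real r * z)) \<le> \<epsilon> \<and>
          x z * f' z + y z * g' z = 1 \<and> cmod (x z) \<le> C \<and> cmod (y z) \<le> C))"
    using disc_pairs_scaled[OF e] by blast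
  note C = CC[THEN spec[of _ f], THEN spec[of _ g], THEN spec, THEN mp, OF f, THEN mp, OF g, THEN mp, OF b, THEN mp, OF r(1), THEN mp, OF r(2)]
  have "\<exists>F :: nat \<Rightarrow> complex \<Rightarrow> complex. (\<forall>i<4. F i holomorphic_on ball 0 1) \<and> (\<forall>z\<in>ball 0 1. cmod (F 0 z - f (of_real (r k) * z)) \<le> \<epsilon> \<and> cmod (F 1 z - g (of_real (r k) * z)) \<le> \<epsilon> \<and>
          F 2 z * F 0 z + F 3 z * F 1 z = 1 \<and> cmod (F 2 z) \<le> C \<and> cmod (F 3 z) \<le> C)" for k
  proof -
    obtain f' g' x y where F: "f' holomorphic_on ball 0 1" "g' holomorphic_on ball 0 1" "x holomorphic_on ball 0 1" "y holomorphic_on ball 0 1"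
       "\<forall>z\<in>ball 0 1. cmod (f' z - f (of_real (r k) * z)) \<le> \<epsilon> \<and> cmod (g' z - g (of_real (r k) * z)) \<le> \<epsilon> \<and>
          x z * f' z + y z * g' z = 1 \<and> cmod (x z) \<le> C \<and> cmod (y z) \<le> C" using C[of k] by blast
    have "([f', g', x, y] ! i) holomorphic_on ball 0 1" if "i < 4" for i
      using that F(1-4) by (auto simp: numeral_eq_Suc less_Suc_eq)
    then show ?thesis using F(5) by (intro exI[of _ "\<lambda>i. [f', g', x, y] ! i"]) simp
  qed
  then obtain F :: "nat \<Rightarrow> nat \<Rightarrow> complex \<Rightarrow> complex" where F: "\<And>k i. i < 4 \<Longrightarrow> F k i holomorphic_on ball 0 1"
    "\<And>k z. z \<in> ball 0 1 \<Longrightarrow> cmod (F k 0 z - f (of_real (r k) * z)) \<le> \<epsilon> \<and> cmod (F k 1 z - g (of_real (r k) * z)) \<le> \<epsilon> \<and>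
          F k 2 z * F k 0 z + F k 3 z * F k 1 z = 1 \<and> cmod (F k 2 z) \<le> C \<and> cmod (F k 3 z) \<le> C"
    by metis
  have rz: "of_real (r k) * z \<in> ball 0 1" if "z \<in> ball 0 1" for z :: complex and k
  proof -
    have "r k * cmod z \<le> 1 * cmod z" using r[of k] by (intro mult_right_mono) auto
    then show ?thesis using that r[of k] by (simp add: norm_mult)
  qed
  have bd: "cmod (F k i z) \<le> C + 2" if "i < 4" "z \<in> ball 0 1" for k i z
  proof -
    note a = F(2)[OF that(2), of k]
    have "cmod (F k 0 z) \<le> 2" "cmod (F k 1 z) \<le> 2"
      using a b rz[OF that(2), of k] e(2) norm_triangle_ineq[of "F k 0 z - f (of_real (r k) * z)" "f (of_real (r k) * z)"]
        norm_triangle_ineq[of "F k 1 z - g (of_real (r k) * z)" "g (of_real (r k) * z)"] by force+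
    moreover have "C \<ge> 0" using a norm_ge_zero[of "F k 2 z"] by linarith
    moreover have "i = 0 \<or> i = 1 \<or> i = 2 \<or> i = 3" using that(1) by linarith
    ultimately show ?thesis using a by auto
  qed
  obtain G q where q: "strict_mono (q :: nat \<Rightarrow> nat)" "\<forall>i<4. G i holomorphic_on ball 0 1 \<and> (\<forall>z\<in>ball 0 1. (\<lambda>k. F (q k) i z) \<longlonglongrightarrow> G i z)"
    using common_subsequence[of 4 "\<lambda>i k. F k i" "C + 2"] F(1) bd by auto
  have cont: "(\<lambda>k. h (of_real (r (q k)) * z)) \<longlonglongrightarrow> h z" if h: "h holomorphic_on ball 0 1" and z: "z \<in> ball 0 1" for h z
  proof -
    have "isCont h z" using h z by (meson continuous_on_eq_continuous_at holomorphic_on_imp_continuous_on open_ball)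
    moreover have "(\<lambda>k. of_real (r (q k)) * z) \<longlonglongrightarrow> of_real 1 * z"
      using LIMSEQ_subseq_LIMSEQ[OF rl q(1)] by (intro tendsto_intros) (simp add: o_def)
    ultimately show ?thesis using isCont_tendsto_compose by fastforce
  qed
  have fin: "cmod (G 0 z - f z) \<le> \<epsilon> \<and> cmod (G 1 z - g z) \<le> \<epsilon> \<and> G 2 z * G 0 z + G 3 z * G 1 z = 1 \<and> cmod (G 2 z) \<le> C \<and> cmod (G 3 z) \<le> C"
    if z: "z \<in> ball 0 1" for z
  proof -
    have l: "(\<lambda>k. F (q k) i z) \<longlonglongrightarrow> G i z" if "i < 4" for i using q(2) z that by blast
    note b = F(2)[OF z]
    have "cmod (G 0 z - f z) \<le> \<epsilon>"
      by (rule LIMSEQ_le_const2[OF tendsto_norm[OF tendsto_diff[OF l cont[OF f z]]]]) (use b in auto)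
    moreover have "cmod (G 1 z - g z) \<le> \<epsilon>"
      by (rule LIMSEQ_le_const2[OF tendsto_norm[OF tendsto_diff[OF l cont[OF g z]]]]) (use b in auto)
    moreover have "cmod (G 2 z) \<le> C" by (rule LIMSEQ_le_const2[OF tendsto_norm[OF l]]) (use b in auto)
    moreover have "cmod (G 3 z) \<le> C" by (rule LIMSEQ_le_const2[OF tendsto_norm[OF l]]) (use b in auto)
    moreover have "(\<lambda>k. F (q k) 2 z * F (q k) 0 z + F (q k) 3 z * F (q k) 1 z) \<longlonglongrightarrow> G 2 z * G 0 z + G 3 z * G 1 z"
      by (intro tendsto_add tendsto_mult l) auto
    then have "G 2 z * G 0 z + G 3 z * G 1 z = 1" using b by (simp add: LIMSEQ_const_iff)
    ultimately show ?thesis by blast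
  qed
  show ?thesis
    by (rule exI[of _ "G 0"], rule exI[of _ "G 1"], rule exI[of _ "G 2"], rule exI[of _ "G 3"], rule exI[of _ C]) (use q(2) fin in simp)
qed

theorem disc_pairs:
  assumes f: "f holomorphic_on ball 0 1" "bounded (f ` ball 0 1)" and g: "g holomorphic_on ball 0 1" "bounded (g ` ball 0 1)"
    and e: "0 < \<epsilon>"
  shows "\<exists>f' g' x y. f' holomorphic_on ball 0 1 \<and> g' holomorphic_on ball 0 1 \<and> x holomorphic_on ball 0 1 \<and> y holomorphic_on ball 0 1 \<and>
       bounded (f' ` ball 0 1) \<and> bounded (g' ` ball 0 1) \<and> bounded (x ` ball 0 1) \<and> bounded (y ` ball 0 1) \<and>
       (\<forall>z\<in>ball 0 1. cmod (f' z - f z) \<le> \<epsilon> \<and> cmod (g' z - g z) \<le> \<epsilon> \<and> x z * f' z + y z * g' z = 1)"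
proof -
  obtain M1 M2 where M12: "\<forall>z\<in>ball 0 1. cmod (f z) \<le> M1" "\<forall>z\<in>ball 0 1. cmod (g z) \<le> M2"
    using f(2) g(2) unfolding bounded_iff by blast
  define M where "M = \<bar>M1\<bar> + \<bar>M2\<bar> + 1"
  have M: "M > 0" by (simp add: M_def)
  have Mb: "cmod (f z) \<le> M \<and> cmod (g z) \<le> M" if "z \<in> ball 0 1" for z
    using bspec[OF M12(1) that] bspec[OF M12(2) that] unfolding M_def by linarith
  define \<delta> where "\<delta> = min 1 (\<epsilon> / M)"
  have d: "0 < \<delta>" "\<delta> \<le> 1" "M * \<delta> \<le> \<epsilon>" using e M by (auto simp: \<delta>_def min_def field_simps)
  have "(\<lambda>z. f z / of_real M) holomorphic_on ball 0 1" "(\<lambda>z. g z / of_real M) holomorphic_on ball 0 1"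
    using f(1) g(1) M by (auto intro!: holomorphic_intros)
  moreover have "\<forall>z\<in>ball 0 1. cmod (f z / of_real M) \<le> 1 \<and> cmod (g z / of_real M) \<le> 1" using Mb M by (simp add: norm_divide)
  ultimately have "\<exists>f' g' x y C. f' holomorphic_on ball 0 1 \<and> g' holomorphic_on ball 0 1 \<and> x holomorphic_on ball 0 1 \<and> y holomorphic_on ball 0 1 \<and>
       (\<forall>z\<in>ball 0 1. cmod (f' z - f z / of_real M) \<le> \<delta> \<and> cmod (g' z - g z / of_real M) \<le> \<delta> \<and>
          x z * f' z + y z * g' z = 1 \<and> cmod (x z) \<le> C \<and> cmod (y z) \<le> C)"
    by (rule disc_pairs_unit[OF _ _ _ d(1,2)])
  then obtain f' g' x y C where F: "f' holomorphic_on ball 0 1" "g' holomorphic_on ball 0 1" "x holomorphic_on ball 0 1" "y holomorphic_on ball 0 1"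
       "\<forall>z\<in>ball 0 1. cmod (f' z - f z / of_real M) \<le> \<delta> \<and> cmod (g' z - g z / of_real M) \<le> \<delta> \<and>
          x z * f' z + y z * g' z = 1 \<and> cmod (x z) \<le> C \<and> cmod (y z) \<le> C"
    by blast
  have close: "cmod (of_real M * u z - v z) \<le> \<epsilon>" if "cmod (u z - v z / of_real M) \<le> \<delta>" for u v :: "complex \<Rightarrow> complex" and z
  proof -
    have "of_real M * u z - v z = of_real M * (u z - v z / of_real M)" using M by (simp add: algebra_simps)
    then have "cmod (of_real M * u z - v z) = M * cmod (u z - v z / of_real M)" using M by (simp only: norm_mult norm_of_real abs_of_pos)
    also have "\<dots> \<le> M * \<delta>" using that M by (intro mult_left_mono) auto
    finally show ?thesis using d(3) by linarith
  qed
  have bd: "bounded ((\<lambda>z. of_real M * u z) ` ball 0 1)" if u: "\<And>z. z \<in> ball 0 1 \<Longrightarrow> cmod (u z - v z / of_real M) \<le> \<delta> \<and> cmod (v z) \<le> M" for u v :: "complex \<Rightarrow> complex"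
    unfolding bounded_iff
  proof (intro exI[of _ "\<epsilon> + M"] ballI, clarify)
    fix z :: complex assume "z \<in> ball 0 1"
    with u[OF this] close[of u z v] norm_triangle_ineq[of "of_real M * u z - v z" "v z"] show "cmod (of_real M * u z) \<le> \<epsilon> + M" by simp
  qed
  have bd2: "bounded ((\<lambda>z. u z / of_real M) ` ball 0 1)" if u: "\<And>z. z \<in> ball 0 1 \<Longrightarrow> cmod (u z) \<le> C" for u :: "complex \<Rightarrow> complex"
    unfolding bounded_iff using u M by (intro exI[of _ "C / M"]) (auto simp: norm_divide divide_right_mono)
  show ?thesis
  proof (rule exI[of _ "\<lambda>z. of_real M * f' z"], rule exI[of _ "\<lambda>z. of_real M * g' z"], rule exI[of _ "\<lambda>z. x z / of_real M"], rule exI[of _ "\<lambda>z. y z / of_real M"], intro conjI ballI)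
    show "bounded ((\<lambda>z. of_real M * f' z) ` ball 0 1)" by (rule bd[where v=f]) (use F(5) Mb in blast)
    show "bounded ((\<lambda>z. of_real M * g' z) ` ball 0 1)" by (rule bd[where v=g]) (use F(5) Mb in blast)
    show "bounded ((\<lambda>z. x z / of_real M) ` ball 0 1)" by (rule bd2) (use F(5) in blast)
    show "bounded ((\<lambda>z. y z / of_real M) ` ball 0 1)" by (rule bd2) (use F(5) in blast)
    show "x z / of_real M * (of_real M * f' z) + y z / of_real M * (of_real M * g' z) = 1" if "z \<in> ball 0 1" for z using bspec[OF F(5) that] M by simp
    show "cmod (of_real M * f' z - f z) \<le> \<epsilon>" if "z \<in> ball 0 1" for z by (rule close) (use bspec[OF F(5) that] in blast)
    show "cmod (of_real M * g' z - g z) \<le> \<epsilon>" if "z \<in> ball 0 1" for z by (rule close) (use bspec[OF F(5) that] in blast)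
  qed (use F(1-4) M in \<open>auto intro!: holomorphic_intros\<close>)
qed

section \<open>Boundary values and the lower bound\<close>

text \<open>Multiplicative constants disappear under m-th roots; this sharpens estimates that hold
  for all powers of a function.\<close>

lemma root_le:
  fixes a x c K :: real
  assumes "a > 0" "c \<ge> 0" and le: "\<And>m::nat. a * x ^ m \<le> K * c ^ m"
  shows "x \<le> c"
proof (rule ccontr)
  assume "\<not> x \<le> c"
  then have xc: "c < x" by simp
  show False
  proof (cases "c = 0")
    case True then show False using le[of 1] assms(1) xc by (simp add: mult_le_0_iff)
  next
    case False
    then have c: "c > 0" using assms by simp
    then obtain n where n: "K / a < (x / c) ^ n" using real_arch_pow[of "x / c" "K / a"] xc by auto
    have "a * x ^ n / c ^ n \<le> K" using le[of n] c by (simp add: divide_le_eq)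
    then have "a * (x / c) ^ n \<le> K" by (simp add: power_divide)
    then show False using n assms(1) by (simp add: divide_less_eq mult.commute)
  qed
qed

lemma rho_at_left: "filterlim (\<lambda>k::nat. 1 - 1 / (real k + 2)) (at_left 1) sequentially"
  by real_asymp

text \<open>Cauchy's formula on circles of radius tending to 1, with dominated convergence. The
  factor \<open>1 - cmod z\<close> from the Cauchy kernel is recovered in
  \<open>boundary_max_bound\<close>.\<close>

lemma boundary_mean_bound:
  assumes f: "f holomorphic_on ball 0 1" and B: "\<And>z. z \<in> ball 0 1 \<Longrightarrow> cmod (f z) \<le> B" and c: "c \<ge> 0"
    and ae: "AE z in circle_measure. \<exists>l. ((\<lambda>r::real. f (of_real r * z)) \<longlongrightarrow> l) (at_left 1) \<and> cmod l \<le> c"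
    and z: "z \<in> ball 0 1"
  shows "(1 - cmod z) * cmod (f z) \<le> c"
proof -
  define \<rho> where "\<rho> k = 1 - 1 / (real k + 2)" for k :: nat
  have \<rho>: "0 < \<rho> k" "\<rho> k < 1" for k by (simp_all add: \<rho>_def)
  have inb: "of_real (\<rho> k) * u \<in> ball 0 1" if "u \<in> cball 0 1" for u :: complex and k
  proof -
    have "\<rho> k * cmod u \<le> \<rho> k * 1" using that \<rho>[of k] by (intro mult_left_mono) auto
    then have "\<rho> k * cmod u < 1" using \<rho>[of k] by linarith
    then show ?thesis using \<rho>[of k] by (simp add: norm_mult)
  qed
  define g where "g k u = f (of_real (\<rho> k) * u)" for k u
  have gh: "g k holomorphic_on cball 0 1" for k
  proof -
    have "(\<lambda>u::complex. of_real (\<rho> k) * u) ` cball 0 1 \<subseteq> ball 0 1" using inb[of _ k] by blast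
    from holomorphic_on_compose_gen[OF _ f this] show ?thesis unfolding g_def o_def by (auto intro!: holomorphic_intros)
  qed
  have gc: "continuous_on (cball 0 1) (g k)" for k using gh holomorphic_on_imp_continuous_on by blast
  have cisc: "continuous_on {0..2*pi} (\<lambda>t. g k (cis t))" for k
    by (rule continuous_on_compose2[OF gc]) (auto intro!: continuous_intros)
  \<comment> \<open>The maximum with c makes the integrands converge to the constant c almost
    everywhere, although the radial limits are only bounded by c.\<close>
  define m where "m k t = max c (cmod (g k (cis t)))" for k t
  have mc: "continuous_on {0..2*pi} (m k)" for k unfolding m_def by (intro continuous_intros cisc)
  have zb: "1 - cmod z > 0" using z by simp
  have step: "(1 - cmod z) * (2 * pi * cmod (g k z)) \<le> integral {0..2*pi} (m k)" for k
  proof -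
    have "((\<lambda>u. g k u / (u - z)) has_contour_integral (2 * of_real pi * \<i> * g k z)) (circlepath 0 1)"
      by (rule Cauchy_integral_circlepath_simple[OF gh]) (use z in simp)
    then have hi: "((\<lambda>t. g k (cis t) / (cis t - z) * \<i> * cis t) has_integral (2 * of_real pi * \<i> * g k z)) {0..2*pi}"
      unfolding circlepath_def by (subst (asm) has_contour_integral_part_circlepath_iff) simp_all
    have "cmod (2 * of_real pi * \<i> * g k z) \<le> integral {0..2*pi} (\<lambda>t. m k t / (1 - cmod z))"
      unfolding integral_unique[OF hi, symmetric]
    proof (rule Henstock_Kurzweil_Integration.integral_norm_bound_integral)
      show "(\<lambda>t. g k (cis t) / (cis t - z) * \<i> * cis t) integrable_on {0..2*pi}" using hi by blast
      show "(\<lambda>t. m k t / (1 - cmod z)) integrable_on {0..2*pi}"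
        using mc zb by (intro integrable_continuous_real continuous_intros) auto
      fix t assume "t \<in> {0..2*pi}"
      have l: "1 - cmod z \<le> cmod (cis t - z)" using norm_triangle_ineq2[of "cis t" z] by simp
      have "cmod (g k (cis t) / (cis t - z) * \<i> * cis t) = cmod (g k (cis t)) / cmod (cis t - z)" by (simp add: norm_mult norm_divide)
      also have "\<dots> \<le> m k t / (1 - cmod z)" using l zb c by (intro frac_le) (auto simp: m_def)
      finally show "cmod (g k (cis t) / (cis t - z) * \<i> * cis t) \<le> m k t / (1 - cmod z)" .
    qed
    also have "\<dots> = integral {0..2*pi} (m k) / (1 - cmod z)" by simp
    also have "cmod (2 * of_real pi * \<i> * g k z) = 2 * pi * cmod (g k z)" by (simp add: norm_mult)
    finally show ?thesis using zb by (simp add: field_simps)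
  qed
  have int: "integral {0..2*pi} (m k) = (LINT t|lborel. indicator {0..2*pi} t *\<^sub>R m k t)" for k
    using set_borel_integral_eq_integral(2)[OF borel_integrable_atLeastAtMost'[OF mc[of k]]] by (simp add: set_lebesgue_integral_def)
  have c2: "(LINT t|lborel. indicator {0..2*pi} t *\<^sub>R c) = 2 * pi * c"
    using set_borel_integral_eq_integral(2)[OF borel_integrable_atLeastAtMost'[of 0 "2*pi" "\<lambda>_. c"]] by (simp add: set_lebesgue_integral_def)
  have "AE t in uniform_measure lborel {0..2*pi}. \<exists>l. ((\<lambda>r::real. f (of_real r * cis t)) \<longlongrightarrow> l) (at_left 1) \<and> cmod l \<le> c"
    by (rule AE_distrD[of cis _ borel, OF _ ae[unfolded circle_measure_def]]) simp
  then have aet: "AE t in lborel. t \<in> {0..2*pi} \<longrightarrow> (\<exists>l. ((\<lambda>r::real. f (of_real r * cis t)) \<longlongrightarrow> l) (at_left 1) \<and> cmod l \<le> c)"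
    by (subst (asm) AE_uniform_measure) auto
  have "(\<lambda>k. LINT t|lborel. indicator {0..2*pi} t *\<^sub>R m k t) \<longlonglongrightarrow> (LINT t|lborel. indicator {0..2*pi} t *\<^sub>R c)"
  proof (rule integral_dominated_convergence[where w="\<lambda>t. indicator {0..2*pi} t *\<^sub>R (c + B)"])
    show "(\<lambda>t. indicator {0..2*pi} t *\<^sub>R m k t) \<in> borel_measurable lborel" for k
      using borel_measurable_continuous_on_indicator[OF _ mc[of k]] by simp
    show "integrable lborel (\<lambda>t. indicator {0..2*pi} t *\<^sub>R (c + B))"
      using borel_integrable_atLeastAtMost'[of 0 "2*pi" "\<lambda>_. c + B"] by (simp add: set_integrable_def)
    show "AE t in lborel. norm (indicator {0..2*pi} t *\<^sub>R m k t) \<le> indicator {0..2*pi} t *\<^sub>R (c + B)" for k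
    proof (rule AE_I2)
      fix t :: real
      have "cmod (g k (cis t)) \<le> B" unfolding g_def by (intro B inb) simp
      moreover from this have "0 \<le> B" by (rule order_trans[OF norm_ge_zero])
      ultimately show "norm (indicator {0..2*pi} t *\<^sub>R m k t) \<le> indicator {0..2*pi} t *\<^sub>R (c + B)"
        using c by (auto simp: indicator_def m_def)
    qed
    show "AE t in lborel. (\<lambda>k. indicator {0..2*pi} t *\<^sub>R m k t) \<longlonglongrightarrow> indicator {0..2*pi} t *\<^sub>R c"
      using aet
    proof eventually_elim
      case (elim t)
      show ?case
      proof (cases "t \<in> {0..2*pi}")
        case True
        then obtain l where l: "((\<lambda>r::real. f (of_real r * cis t)) \<longlongrightarrow> l) (at_left 1)" "cmod l \<le> c" using elim by blast
        have "(\<lambda>k. g k (cis t)) \<longlonglongrightarrow> l" unfolding g_def \<rho>_def by (rule filterlim_compose[OF l(1) rho_at_left])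
        then have "(\<lambda>k. m k t) \<longlonglongrightarrow> max c (cmod l)" unfolding m_def by (intro tendsto_intros)
        then show ?thesis using l(2) True by (simp add: max_def split: if_splits)
      qed simp
    qed
  qed simp_all
  then have lim: "(\<lambda>k. integral {0..2*pi} (m k)) \<longlonglongrightarrow> 2 * pi * c" unfolding int c2 .
  have "isCont f z" using f z by (meson continuous_on_eq_continuous_at holomorphic_on_imp_continuous_on open_ball)
  moreover have "(\<lambda>k. of_real (\<rho> k) * z) \<longlonglongrightarrow> of_real 1 * z"
    using rho_at_left[THEN filterlim_mono, OF at_within_le_nhds order_refl] unfolding \<rho>_def by (intro tendsto_intros)
  ultimately have "(\<lambda>k. g k z) \<longlonglongrightarrow> f z" unfolding g_def using isCont_tendsto_compose by fastforce
  then have "(\<lambda>k. (1 - cmod z) * (2 * pi * cmod (g k z))) \<longlonglongrightarrow> (1 - cmod z) * (2 * pi * cmod (f z))" by (intro tendsto_intros)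
  then have "(1 - cmod z) * (2 * pi * cmod (f z)) \<le> 2 * pi * c" using lim step by (intro LIMSEQ_le) auto
  then have "2 * pi * ((1 - cmod z) * cmod (f z)) \<le> 2 * pi * c" by (simp only: mult.left_commute[of "2 * pi" "1 - cmod z"])
  then show ?thesis by (rule mult_left_le_imp_le) simp
qed

text \<open>The crude estimate holds for every power of f, and \<open>root_le\<close> removes its
  constant.\<close>

lemma boundary_max_bound:
  assumes f: "f holomorphic_on ball 0 1" and B: "\<And>z. z \<in> ball 0 1 \<Longrightarrow> cmod (f z) \<le> B" and c: "c \<ge> 0"
    and ae: "AE z in circle_measure. \<exists>l. ((\<lambda>r::real. f (of_real r * z)) \<longlongrightarrow> l) (at_left 1) \<and> cmod l \<le> c"
    and z: "z \<in> ball 0 1"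
  shows "cmod (f z) \<le> c"
proof (rule root_le)
  show "1 - cmod z > 0" using z by simp
  fix m :: nat
  have "(1 - cmod z) * cmod (f z ^ m) \<le> c ^ m"
  proof (rule boundary_mean_bound[where f="\<lambda>z. f z ^ m", OF _ _ _ _ z])
    show "(\<lambda>z. f z ^ m) holomorphic_on ball 0 1" by (intro holomorphic_intros f)
    show "cmod (f z ^ m) \<le> B ^ m" if "z \<in> ball 0 1" for z using B[OF that] by (simp add: norm_power power_mono)
    show "AE z in circle_measure. \<exists>l. ((\<lambda>r::real. f (of_real r * z) ^ m) \<longlongrightarrow> l) (at_left 1) \<and> cmod l \<le> c ^ m"
      using ae
    proof eventually_elim
      case (elim z)
      then obtain l where "((\<lambda>r::real. f (of_real r * z)) \<longlongrightarrow> l) (at_left 1)" "cmod l \<le> c" by blast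
      then show ?case by (intro exI[of _ "l ^ m"] conjI tendsto_power) (auto simp: norm_power power_mono)
    qed
  qed (use c in simp)
  then show "(1 - cmod z) * cmod (f z) ^ m \<le> 1 * c ^ m" by (simp add: norm_power)
qed (rule c)

lemma exp_minus_one_lower:
  fixes s :: complex assumes "cmod s = 1/4" shows "cmod (exp s - 1) \<ge> 1/8"
proof -
  have "cmod (exp s - (\<Sum>k\<le>1. s ^ k / fact k)) \<le> exp \<bar>Re s\<bar> * (cmod s) ^ Suc 1 / fact 1" by (rule Taylor_exp)
  then have t: "cmod (exp s - 1 - s) \<le> exp \<bar>Re s\<bar> * (1/16)" using assms by (simp add: power2_eq_square diff_diff_eq)
  have "\<bar>Re s\<bar> \<le> 1/4" using abs_Re_le_cmod[of s] assms by simp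
  then have "exp \<bar>Re s\<bar> \<le> exp (1/4)" by simp
  also have "\<dots> \<le> 3/2" using exp_bound_lemma[of "1/4::real"] by simp
  finally have "exp \<bar>Re s\<bar> \<le> 3/2" .
  then have "cmod (exp s - 1 - s) \<le> 3/32" using t by linarith
  moreover have "cmod s \<le> cmod (exp s - 1) + cmod (exp s - 1 - s)" using norm_triangle_ineq4[of "exp s - 1" "exp s - 1 - s"] by simp
  ultimately show ?thesis using assms by linarith
qed

text \<open>The zeros of \<open>exp(-(1+z)/(1-z)) - 1/2\<close> accumulate at \<open>1\<close>, while a function with an approximate inverse of
  the form \<open>z\<^sup>-\<^sup>n k\<close> has no zeros near \<open>1\<close>: the minimum principle gives a contradiction.\<close>

lemma no_near_inverse:
  assumes h: "h holomorphic_on ball 0 1" and hk: "\<And>z. z \<in> ball 0 1 \<Longrightarrow> cmod (h z * k z - z ^ n) \<le> 1/4"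
    and hf: "\<And>z. z \<in> ball 0 1 \<Longrightarrow> cmod (h z - z ^ N * (exp (- ((1 + z) / (1 - z))) - 1/2)) \<le> 1/64" and N: "N \<le> n"
  shows False
proof -
  \<comment> \<open>\<open>w0\<close> is a zero of \<open>exp (- w) - 1/2\<close>, as M is an
    integer; M is so large that by Bernoulli's inequality \<open>cmod (\<zeta> w) ^ n\<close> stays
    at least 3/4 near \<open>w0\<close>.\<close>
  define M where "M = 8 * real n + 2"
  define w0 where "w0 = Complex (ln 2) (2 * pi * M)"
  define \<zeta> where "\<zeta> w = (w - 1) / (w + 1)" for w :: complex
  have ew0: "exp (- w0) = 1/2"
  proof -
    have "cis (2 * pi * M) = cis (2 * pi * real (8 * n + 2))" by (simp add: M_def)
    also have "\<dots> = 1" by (rule cis_multiple_2pi) simp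
    finally have "exp w0 = 2" by (simp add: w0_def exp_eq_polar)
    then show ?thesis by (simp add: exp_minus)
  qed
  have W: "w + 1 \<noteq> 0 \<and> \<zeta> w \<in> ball 0 1 \<and> (1 + \<zeta> w) / (1 - \<zeta> w) = w \<and> cmod (\<zeta> w) ^ n \<ge> 3/4 \<and> cmod (\<zeta> w) ^ N \<ge> 3/4"
    if w: "w \<in> cball w0 (1/4)" for w
  proof -
    have d: "cmod (w0 - w) \<le> 1/4" using w by (simp add: dist_norm)
    have re: "Re w > 0" using abs_Re_le_cmod[of "w0 - w"] d ln2_ge_two_thirds by (simp add: w0_def)
    have "2 * pi * M \<ge> 6 * M" using pi_gt3 by (intro mult_right_mono) (auto simp: M_def)
    then have im: "Im w \<ge> 8 * real n + 8" using abs_Im_le_cmod[of "w0 - w"] d by (simp add: w0_def M_def)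
    have w1: "cmod (w + 1) \<ge> 8 * real n + 8" using abs_Im_le_cmod[of "w + 1"] im by simp
    then have nz: "w + 1 \<noteq> 0" by auto
    have e1: "1 - \<zeta> w = 2 / (w + 1)" "1 + \<zeta> w = 2 * w / (w + 1)" using nz by (simp_all add: \<zeta>_def field_simps)
    have inv: "(1 + \<zeta> w) / (1 - \<zeta> w) = w" unfolding e1 using nz by simp
    have "(cmod (w - 1))\<^sup>2 < (cmod (w + 1))\<^sup>2" unfolding cmod_power2 using re by (simp add: power2_eq_square algebra_simps)
    then have "cmod (w - 1) < cmod (w + 1)" by (rule power2_less_imp_less) simp
    then have b: "cmod (\<zeta> w) < 1" using nz by (simp add: \<zeta>_def norm_divide)
    define x where "x = 2 / cmod (w + 1)"
    have x: "cmod (1 - \<zeta> w) = x" by (simp add: e1 x_def norm_divide)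
    have "x \<le> 2 / (8 * real n + 8)" unfolding x_def using w1 by (intro divide_left_mono) (auto intro!: mult_pos_pos)
    then have "x * (8 * real n + 8) \<le> 2" by (simp add: le_divide_eq)
    moreover have "x \<ge> 0" by (simp add: x_def)
    moreover have "x * real n \<ge> 0" using \<open>x \<ge> 0\<close> by simp
    moreover have "x * (8 * real n + 8) = 8 * (x * real n) + 8 * x" by algebra
    ultimately have "x * real n \<le> 1/4" "x \<le> 1" by linarith+
    then have x1: "real n * x \<le> 1/4" "x \<le> 1" by (simp_all only: mult.commute[of "real n"])
    have "cmod (\<zeta> w) \<ge> 1 + (- x)" using x norm_triangle_ineq4[of 1 "1 - \<zeta> w"] norm_triangle_ineq[of "1 - \<zeta> w" "\<zeta> w"] by simp
    then have "(1 + (- x)) ^ n \<le> cmod (\<zeta> w) ^ n" using x1 by (intro power_mono) auto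
    moreover have "1 + real n * (- x) \<le> (1 + (- x)) ^ n" using x1 by (intro Bernoulli_inequality) auto
    ultimately have p: "cmod (\<zeta> w) ^ n \<ge> 3/4" using x1 by simp
    moreover have "cmod (\<zeta> w) ^ n \<le> cmod (\<zeta> w) ^ N" using N b by (intro power_decreasing) auto
    ultimately show ?thesis using nz b inv by auto
  qed
  have nz: "h (\<zeta> w) \<noteq> 0" if "w \<in> cball w0 (1/4)" for w
  proof
    assume "h (\<zeta> w) = 0"
    then have "cmod (\<zeta> w) ^ n \<le> 1/4" using hk[of "\<zeta> w"] W[OF that] by (simp add: norm_power)
    then show False using W[OF that] by linarith
  qed
  have \<zeta>h: "\<zeta> holomorphic_on cball w0 (1/4)" unfolding \<zeta>_def using W by (intro holomorphic_intros) auto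
  have "(\<lambda>w. h (\<zeta> w)) holomorphic_on cball w0 (1/4)"
  proof -
    have "\<zeta> ` cball w0 (1/4) \<subseteq> ball 0 1" using W by blast
    from holomorphic_on_compose_gen[OF \<zeta>h h this] show ?thesis unfolding o_def .
  qed
  then have H: "(\<lambda>w. 1 / h (\<zeta> w)) holomorphic_on cball w0 (1/4)" using nz by (intro holomorphic_intros) auto
  have circ: "cmod (1 / h (\<zeta> w)) \<le> 32" if w: "w \<in> frontier (ball w0 (1/4))" for w
  proof -
    have ws: "cmod (w0 - w) = 1/4" using w by (simp add: dist_norm)
    then have wc: "w \<in> cball w0 (1/4)" by (simp add: dist_norm)
    have "exp (- w) = exp (- w0) * exp (w0 - w)" by (simp flip: exp_add)
    then have eq: "exp (- w) - 1/2 = (exp (w0 - w) - 1) / 2" by (simp add: ew0 diff_divide_distrib)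
    have "cmod (exp (- w) - 1/2) = cmod (exp (w0 - w) - 1) / 2" unfolding eq by (simp add: norm_divide)
    then have "cmod (exp (- w) - 1/2) \<ge> 1/16" using exp_minus_one_lower[OF ws] by linarith
    then have "cmod (\<zeta> w) ^ N * cmod (exp (- w) - 1/2) \<ge> 3/4 * (1/16)" using W[OF wc] by (intro mult_mono) auto
    moreover have "cmod (h (\<zeta> w) - \<zeta> w ^ N * (exp (- w) - 1/2)) \<le> 1/64" using hf[of "\<zeta> w"] W[OF wc] by simp
    moreover have "cmod (\<zeta> w ^ N * (exp (- w) - 1/2)) \<le> cmod (h (\<zeta> w)) + cmod (h (\<zeta> w) - \<zeta> w ^ N * (exp (- w) - 1/2))"
      using norm_triangle_ineq4[of "h (\<zeta> w)" "h (\<zeta> w) - \<zeta> w ^ N * (exp (- w) - 1/2)"] by simp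
    ultimately have "cmod (h (\<zeta> w)) \<ge> 1/32" unfolding norm_mult norm_power by linarith
    then have "1 / cmod (h (\<zeta> w)) \<le> 1 / (1/32)" by (intro divide_left_mono) auto
    then show ?thesis by (simp add: norm_divide)
  qed
  \<comment> \<open>On the circle h is at least 1/32 in modulus, at the centre at most 1/64.\<close>
  have "cmod (1 / h (\<zeta> w0)) \<le> 32"
  proof (rule maximum_modulus_frontier[where f="\<lambda>w. 1 / h (\<zeta> w)" and S="ball w0 (1/4)"])
    show "(\<lambda>w. 1 / h (\<zeta> w)) holomorphic_on interior (ball w0 (1/4))" using H holomorphic_on_subset ball_subset_cball by (metis interior_open open_ball)
    show "continuous_on (closure (ball w0 (1/4))) (\<lambda>w. 1 / h (\<zeta> w))" using holomorphic_on_imp_continuous_on[OF H] by simp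
  qed (use circ in auto)
  moreover have "cmod (h (\<zeta> w0)) \<le> 1/64" using hf[of "\<zeta> w0"] W[of w0] ew0 by simp
  moreover have "h (\<zeta> w0) \<noteq> 0" by (rule nz) simp
  ultimately show False by (simp add: norm_divide divide_le_eq)
qed

section \<open>Radial limits\<close>

text \<open>\<open>x / 2 + H x\<close> and \<open>x / 2 - H x\<close> are both increasing, and their
  interval measures add up to Lebesgue measure. The first is therefore absolutely continuous, and
  its Radon-Nikodym density minus 1/2 serves as derivative of H.\<close>

lemma lipschitz_indefinite_integral:
  fixes H :: "real \<Rightarrow> real"
  assumes lip: "\<And>x y. \<bar>H x - H y\<bar> \<le> \<bar>x - y\<bar> / 2"
  shows "\<exists>h. \<forall>a b. a \<le> b \<longrightarrow> (h has_integral (H b - H a)) {a..b}"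
proof -
  have Hc: "continuous_on UNIV H"
    by (rule lipschitz_on_continuous_on[of "1/2"], rule lipschitz_onI) (use lip in \<open>auto simp: dist_real_def\<close>)
  define F where "F s x = x / 2 + s * H x" for s x
  have mono: "F s x \<le> F s y" if "x \<le> y" "\<bar>s\<bar> = 1" for s x y
  proof -
    have "s = 1 \<or> s = - 1" using that(2) by linarith
    then show ?thesis using abs_ge_self[of "H x - H y"] abs_ge_minus_self[of "H x - H y"] lip[of x y] that(1) by (auto simp: F_def)
  qed
  have Fc: "continuous_on UNIV (F s)" for s unfolding F_def by (intro continuous_intros Hc) auto
  define M where "M s = interval_measure (F s)" for s
  have MI: "emeasure (M s) {a..b} = ennreal (F s b - F s a)" if "a \<le> b" "\<bar>s\<bar> = 1" for a b s
    unfolding M_def using that mono Fc by (intro emeasure_interval_measure_Icc) auto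
  have Mo: "emeasure (M s) {a<..<b} = ennreal (F s b - F s a)" if "a \<le> b" "\<bar>s\<bar> = 1" for a b s
  proof -
    have n: "{x} \<in> null_sets (M s)" for x using MI[OF order_refl that(2), of x] by (intro null_setsI) (auto simp: M_def)
    have ab: "{a..b} - {a} - {b} = {a<..<b}" by auto
    have "emeasure (M s) ({a..b} - {a} - {b}) = emeasure (M s) {a..b}"
      using n by (subst emeasure_Diff_null_set, simp, simp add: M_def)+ simp
    then show ?thesis unfolding ab using MI[OF that] by simp
  qed
  define N where "N = measure_of UNIV (sets borel) (\<lambda>A. emeasure (M 1) A + emeasure (M (- 1)) A)"
  have setsN: "sets N = sets borel" unfolding N_def by (metis sets.sigma_sets_eq sets_measure_of space_borel subset_UNIV Pow_UNIV)
  have Nem: "emeasure N A = emeasure (M 1) A + emeasure (M (- 1)) A" if "A \<in> sets borel" for A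
  proof (rule emeasure_measure_of[OF N_def])
    show "countably_additive (sets N) (\<lambda>A. emeasure (M 1) A + emeasure (M (- 1)) A)"
      unfolding countably_additive_def setsN
    proof (intro allI impI)
      fix A :: "nat \<Rightarrow> real set" assume A: "range A \<subseteq> sets borel" "disjoint_family A"
      have "(\<Sum>i. emeasure (M s) (A i)) = emeasure (M s) (\<Union> (range A))" for s
        using A by (intro suminf_emeasure) (auto simp: M_def)
      then show "(\<Sum>i. emeasure (M 1) (A i) + emeasure (M (- 1)) (A i)) = emeasure (M 1) (\<Union> (range A)) + emeasure (M (- 1)) (\<Union> (range A))"
        by (subst suminf_add[symmetric]) auto
    qed
  qed (use that setsN in \<open>auto simp: positive_def\<close>)
  have "lborel = N"
  proof (rule lborel_eqI[OF _ setsN])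
    fix l u :: real assume "\<And>b. b \<in> Basis \<Longrightarrow> l \<bullet> b \<le> u \<bullet> b"
    then have lu: "l \<le> u" by simp
    have "emeasure N (box l u) = ennreal (F 1 u - F 1 l) + ennreal (F (- 1) u - F (- 1) l)"
      using Mo[OF lu, of 1] Mo[OF lu, of "- 1"] by (simp add: Nem box_real)
    also have "\<dots> = ennreal ((F 1 u - F 1 l) + (F (- 1) u - F (- 1) l))"
      using mono[OF lu, of 1] mono[OF lu, of "- 1"] by (intro ennreal_plus[symmetric]) auto
    also have "(F 1 u - F 1 l) + (F (- 1) u - F (- 1) l) = u - l" by (simp add: F_def field_simps)
    finally show "emeasure N (box l u) = ennreal (\<Prod>b\<in>Basis. (u - l) \<bullet> b)" by simp
  qed
  then have "emeasure (M 1) A = 0" if "A \<in> null_sets lborel" for A using that Nem[of A] by (auto simp: null_sets_def)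
  then have ac: "absolutely_continuous lborel (M 1)" unfolding absolutely_continuous_def by (auto simp: null_sets_def M_def)
  have sM: "sets (M 1) = sets lborel" by (simp add: M_def)
  have sf: "sigma_finite_measure (M 1)" unfolding M_def
  proof (rule sigma_finite_interval_measure)
    show "continuous (at_right a) (F 1)" for a using Fc[of 1] by (meson UNIV_I continuous_on_eq_continuous_at open_UNIV continuous_at_imp_continuous_at_within)
  qed (use mono[of _ _ 1] in auto)
  define R where "R = RN_deriv lborel (M 1)"
  have Rm [measurable]: "R \<in> borel_measurable borel" unfolding R_def using borel_measurable_RN_deriv[of lborel "M 1"] by simp
  have dens: "density lborel R = M 1" unfolding R_def by (rule sigma_finite_measure.density_RN_deriv[OF sigma_finite_lborel ac sM])
  have fin: "AE x in lborel. R x \<noteq> \<infinity>" unfolding R_def by (rule sigma_finite_measure.RN_deriv_finite[OF sigma_finite_lborel sf ac sM])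
  have "((\<lambda>x. enn2real (R x) - 1/2) has_integral (H b - H a)) {a..b}" if ab: "a \<le> b" for a b
  proof -
    have "(\<integral>\<^sup>+x. ennreal (if x \<in> {a..b} then enn2real (R x) else 0) \<partial>lborel) = (\<integral>\<^sup>+x. R x * indicator {a..b} x \<partial>lborel)"
    proof (rule nn_integral_cong_AE, use fin in eventually_elim)
      fix x assume "R x \<noteq> \<infinity>"
      then have "ennreal (enn2real (R x)) = R x" by (simp add: less_top)
      then show "ennreal (if x \<in> {a..b} then enn2real (R x) else 0) = R x * indicator {a..b} x" by (auto simp: indicator_def)
    qed
    also have "\<dots> = emeasure (density lborel R) {a..b}" by (rule emeasure_density[symmetric]) auto
    also have "\<dots> = ennreal (F 1 b - F 1 a)" unfolding dens by (rule MI[OF ab]) simp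
    finally have "((\<lambda>x. if x \<in> {a..b} then enn2real (R x) else 0) has_integral (F 1 b - F 1 a)) UNIV"
      using mono[OF ab, of 1] by (intro nn_integral_has_integral) auto
    then have "((\<lambda>x. enn2real (R x)) has_integral (F 1 b - F 1 a)) {a..b}" by (simp only: has_integral_restrict_UNIV)
    from has_integral_diff[OF this has_integral_const_real[of "1/2" a b]]
    have "((\<lambda>x. enn2real (R x) - 1/2) has_integral (F 1 b - F 1 a - measure lborel {a..b} *\<^sub>R (1/2))) {a..b}" .
    moreover have "F 1 b - F 1 a - measure lborel {a..b} *\<^sub>R (1/2) = H b - H a" using ab by (simp add: F_def field_simps)
    ultimately show ?thesis by simp
  qed
  then show ?thesis by blast
qed

text \<open>Lebesgue differentiation is applied to intervals to the right of x; the left-hand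
  derivative comes from the reflected function, and both have the value \<open>h x\<close>.\<close>

lemma lipschitz_differentiable_AE:
  fixes H :: "real \<Rightarrow> real"
  assumes lip: "\<And>x y. \<bar>H x - H y\<bar> \<le> \<bar>x - y\<bar> / 2"
  shows "\<exists>N. negligible N \<and> (\<forall>x. x \<notin> N \<longrightarrow> (\<exists>c. \<forall>e>0. \<exists>d>0. \<forall>y. \<bar>y - x\<bar> < d \<longrightarrow> \<bar>H y - H x - (y - x) * c\<bar> \<le> e * \<bar>y - x\<bar>))"
proof -
  obtain h where h: "\<And>a b. a \<le> b \<Longrightarrow> (h has_integral (H b - H a)) {a..b}" using lipschitz_indefinite_integral[OF lip] by blast
  have h': "((\<lambda>x. h (- x)) has_integral (H (- a) - H (- b))) {a..b}" if "a \<le> b" for a b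
    using h[of "- b" "- a"] that has_integral_reflect_real[of h "H (- a) - H (- b)" "- a" "- b"] by simp
  have i: "h integrable_on cbox a b" "(\<lambda>x. h (- x)) integrable_on cbox a b" for a b
    using h[of a b] h'[of a b] by (cases "a \<le> b"; force simp: cbox_interval)+
  obtain N1 where N1: "negligible N1" "\<And>x e. x \<notin> N1 \<Longrightarrow> 0 < e \<Longrightarrow> \<exists>d>0. \<forall>t. 0 < t \<and> t < d \<longrightarrow> norm (integral (cbox x (x + t *\<^sub>R One)) h /\<^sub>R t ^ DIM(real) - h x) < e"
    using integrable_ccontinuous_explicit[of h] i(1) by metis
  obtain N2 where N2: "negligible N2" "\<And>x e. x \<notin> N2 \<Longrightarrow> 0 < e \<Longrightarrow> \<exists>d>0. \<forall>t. 0 < t \<and> t < d \<longrightarrow> norm (integral (cbox x (x + t *\<^sub>R One)) (\<lambda>x. h (- x)) /\<^sub>R t ^ DIM(real) - h (- x)) < e"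
    using integrable_ccontinuous_explicit[of "\<lambda>x. h (- x)"] i(2) by metis
  have "negligible ((\<lambda>x. - x) ` N2)"
  proof (rule negligible_locally_Lipschitz_image[OF order_refl N2(1)])
    fix x :: real
    show "\<exists>T B. open T \<and> x \<in> T \<and> (\<forall>y\<in>N2 \<inter> T. norm (- y - - x) \<le> B * norm (y - x))"
      by (rule exI[of _ UNIV], rule exI[of _ 1]) auto
  qed
  then have "negligible (N1 \<union> (\<lambda>x. - x) ` N2)" by (rule negligible_Un[OF N1(1)])
  moreover have "\<exists>c. \<forall>e>0. \<exists>d>0. \<forall>y. \<bar>y - x\<bar> < d \<longrightarrow> \<bar>H y - H x - (y - x) * c\<bar> \<le> e * \<bar>y - x\<bar>" if x: "x \<notin> N1 \<union> (\<lambda>x. - x) ` N2" for x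
  proof (rule exI[of _ "h x"], intro allI impI)
    fix e :: real assume e: "e > 0"
    have x2: "- x \<notin> N2" using x by (metis UnI2 image_eqI minus_minus)
    have conv: "\<bar>I - t * c\<bar> \<le> e * t" if "\<bar>I / t - c\<bar> < e" "t > 0" for I t c :: real
    proof -
      have "I - t * c = t * (I / t - c)" using that by (simp add: algebra_simps)
      then have "\<bar>I - t * c\<bar> = t * \<bar>I / t - c\<bar>" using that by (simp add: abs_mult)
      also have "\<dots> \<le> t * e" using that by (intro mult_left_mono) auto
      finally show ?thesis by (simp add: mult.commute)
    qed
    obtain d1 where d1: "d1 > 0" "\<And>t. 0 < t \<and> t < d1 \<Longrightarrow> norm (integral (cbox x (x + t *\<^sub>R One)) h /\<^sub>R t ^ DIM(real) - h x) < e"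
      using N1(2)[of x, OF _ e] x by blast
    obtain d2 where d2: "d2 > 0" "\<And>t. 0 < t \<and> t < d2 \<Longrightarrow> norm (integral (cbox (- x) (- x + t *\<^sub>R One)) (\<lambda>x. h (- x)) /\<^sub>R t ^ DIM(real) - h (- (- x))) < e"
      using N2(2)[OF x2 e] by blast
    have R: "\<bar>H (x + t) - H x - t * h x\<bar> \<le> e * t" if "0 < t" "t < d1" for t
    proof (rule conv)
      have "integral {x..x + t} h = H (x + t) - H x" using h[of x "x + t"] that by (intro integral_unique) simp
      then show "\<bar>(H (x + t) - H x) / t - h x\<bar> < e" using d1(2)[of t] that by (simp add: cbox_interval divide_inverse mult.commute)
    qed (use that in simp)
    have L: "\<bar>H x - H (x - t) - t * h x\<bar> \<le> e * t" if "0 < t" "t < d2" for t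
    proof (rule conv)
      have "integral {- x..- x + t} (\<lambda>x. h (- x)) = H x - H (x - t)" using h'[of "- x" "- x + t"] that by (intro integral_unique) simp
      then show "\<bar>(H x - H (x - t)) / t - h x\<bar> < e" using d2(2)[of t] that by (simp add: cbox_interval divide_inverse mult.commute)
    qed (use that in simp)
    show "\<exists>d>0. \<forall>y. \<bar>y - x\<bar> < d \<longrightarrow> \<bar>H y - H x - (y - x) * h x\<bar> \<le> e * \<bar>y - x\<bar>"
    proof (intro exI[of _ "min d1 d2"] conjI allI impI)
      fix y assume y: "\<bar>y - x\<bar> < min d1 d2"
      consider "y = x" | "y > x" | "y < x" by linarith
      then show "\<bar>H y - H x - (y - x) * h x\<bar> \<le> e * \<bar>y - x\<bar>"
      proof cases
        case 2 then show ?thesis using R[of "y - x"] y by simp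
      next
        case 3
        then have "\<bar>H x - H y - (x - y) * h x\<bar> \<le> e * (x - y)" using L[of "x - y"] y by simp
        moreover have "H y - H x - (y - x) * h x = - (H x - H y - (x - y) * h x)" by (simp add: algebra_simps)
        ultimately show ?thesis using 3 by (simp only: abs_minus_cancel) simp
      qed simp
    qed (use d1 d2 in simp)
  qed
  ultimately show ?thesis by blast
qed

lemma lipschitz_differentiable_AE_complex:
  fixes G :: "real \<Rightarrow> complex"
  assumes lip: "\<And>x y. cmod (G x - G y) \<le> L * \<bar>x - y\<bar>" and L: "L > 0"
  shows "\<exists>N. negligible N \<and> (\<forall>x. x \<notin> N \<longrightarrow> (\<exists>c. \<forall>e>0. \<exists>d>0. \<forall>y. \<bar>y - x\<bar> < d \<longrightarrow> cmod (G y - G x - of_real (y - x) * c) \<le> e * \<bar>y - x\<bar>))"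
proof -
  define u v where "u x = Re (G x) / (2 * L)" and "v x = Im (G x) / (2 * L)" for x
  have sc: "\<bar>r / (2 * L)\<bar> \<le> \<bar>x - y\<bar> / 2" if "\<bar>r\<bar> \<le> L * \<bar>x - y\<bar>" for r x y
    using that L by (simp add: abs_divide divide_le_eq abs_mult mult.commute)
  have du: "u x - u y = Re (G x - G y) / (2 * L)" "v x - v y = Im (G x - G y) / (2 * L)" for x y
    by (simp_all add: u_def v_def diff_divide_distrib)
  have lu: "\<bar>u x - u y\<bar> \<le> \<bar>x - y\<bar> / 2" for x y
    unfolding du by (rule sc, rule order_trans[OF abs_Re_le_cmod lip])
  have lv: "\<bar>v x - v y\<bar> \<le> \<bar>x - y\<bar> / 2" for x y
    unfolding du by (rule sc, rule order_trans[OF abs_Im_le_cmod lip])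
  obtain N1 where N1: "negligible N1" "\<And>x. x \<notin> N1 \<Longrightarrow> \<exists>c. \<forall>e>0. \<exists>d>0. \<forall>y. \<bar>y - x\<bar> < d \<longrightarrow> \<bar>u y - u x - (y - x) * c\<bar> \<le> e * \<bar>y - x\<bar>"
    using lipschitz_differentiable_AE[OF lu] by blast
  obtain N2 where N2: "negligible N2" "\<And>x. x \<notin> N2 \<Longrightarrow> \<exists>c. \<forall>e>0. \<exists>d>0. \<forall>y. \<bar>y - x\<bar> < d \<longrightarrow> \<bar>v y - v x - (y - x) * c\<bar> \<le> e * \<bar>y - x\<bar>"
    using lipschitz_differentiable_AE[OF lv] by blast
  have "\<exists>c. \<forall>e>0. \<exists>d>0. \<forall>y. \<bar>y - x\<bar> < d \<longrightarrow> cmod (G y - G x - of_real (y - x) * c) \<le> e * \<bar>y - x\<bar>" if "x \<notin> N1 \<union> N2" for x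
  proof -
    have x12: "x \<notin> N1" "x \<notin> N2" using that by simp_all
    from N1(2)[OF x12(1)] obtain c1 where c1': "\<forall>e>0. \<exists>d>0. \<forall>y. \<bar>y - x\<bar> < d \<longrightarrow> \<bar>u y - u x - (y - x) * c1\<bar> \<le> e * \<bar>y - x\<bar>" ..
    from N2(2)[OF x12(2)] obtain c2 where c2': "\<forall>e>0. \<exists>d>0. \<forall>y. \<bar>y - x\<bar> < d \<longrightarrow> \<bar>v y - v x - (y - x) * c2\<bar> \<le> e * \<bar>y - x\<bar>" ..
    note c1 = c1'[THEN spec, THEN mp] and c2 = c2'[THEN spec, THEN mp]
    show ?thesis
    proof (intro exI[of _ "of_real (2 * L) * Complex c1 c2"] allI impI)
      fix e :: real assume e: "e > 0"
      define e' where "e' = e / (4 * L)"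
      have e': "e' > 0" using e L by (simp add: e'_def)
      obtain d1 where d1: "d1 > 0" "\<And>y. \<bar>y - x\<bar> < d1 \<Longrightarrow> \<bar>u y - u x - (y - x) * c1\<bar> \<le> e' * \<bar>y - x\<bar>" using c1[OF e'] by blast
      obtain d2 where d2: "d2 > 0" "\<And>y. \<bar>y - x\<bar> < d2 \<Longrightarrow> \<bar>v y - v x - (y - x) * c2\<bar> \<le> e' * \<bar>y - x\<bar>" using c2[OF e'] by blast
      show "\<exists>d>0. \<forall>y. \<bar>y - x\<bar> < d \<longrightarrow> cmod (G y - G x - of_real (y - x) * (of_real (2 * L) * Complex c1 c2)) \<le> e * \<bar>y - x\<bar>"
      proof (intro exI[of _ "min d1 d2"] conjI allI impI)
        fix y assume y: "\<bar>y - x\<bar> < min d1 d2"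
        define D where "D = G y - G x - of_real (y - x) * (of_real (2 * L) * Complex c1 c2)"
        have D: "Re D = 2 * L * (u y - u x - (y - x) * c1)" "Im D = 2 * L * (v y - v x - (y - x) * c2)"
          using L by (simp_all add: D_def u_def v_def field_simps)
        have "cmod D \<le> \<bar>Re D\<bar> + \<bar>Im D\<bar>" by (rule cmod_le)
        also have "\<dots> = 2 * L * \<bar>u y - u x - (y - x) * c1\<bar> + 2 * L * \<bar>v y - v x - (y - x) * c2\<bar>" using L by (simp add: D abs_mult)
        also have "\<dots> \<le> 2 * L * (e' * \<bar>y - x\<bar>) + 2 * L * (e' * \<bar>y - x\<bar>)" using d1(2)[of y] d2(2)[of y] y L by (intro add_mono mult_left_mono) auto
        also have "\<dots> = e * \<bar>y - x\<bar>" using L by (simp add: e'_def)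
        finally show "cmod (G y - G x - of_real (y - x) * (of_real (2 * L) * Complex c1 c2)) \<le> e * \<bar>y - x\<bar>" by (simp add: D_def)
      qed (use d1 d2 in simp)
    qed
  qed
  then show ?thesis using N1(1) N2(1) by (intro exI[of _ "N1 \<union> N2"]) (auto simp: negligible_Un)
qed

text \<open>If \<open>T = o(u - \<omega>)\<close> on the circle with constant \<open>\<epsilon>\<close> and \<open>T = O(u - \<omega>)\<close> on the disc, then the first bound holds on the disc:
  apply the maximum principle to \<open>T (T/(z-\<omega>))\<^sup>m\<close>, which vanishes at \<open>\<omega>\<close>.\<close>

lemma phragmen_lindelof_point:
  assumes T: "continuous_on (cball 0 1) T" "T holomorphic_on ball 0 1" and \<omega>: "cmod \<omega> = 1"
    and K: "\<And>u. u \<in> cball 0 1 \<Longrightarrow> cmod (T u) \<le> K * cmod (u - \<omega>)"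
    and e: "\<epsilon> > 0" "\<And>u. cmod u = 1 \<Longrightarrow> cmod (T u) \<le> \<epsilon> * cmod (u - \<omega>)" and z: "z \<in> ball 0 1"
  shows "cmod (T z) \<le> \<epsilon> * cmod (z - \<omega>)"
proof (cases "T z = 0")
  case True then show ?thesis using e by simp
next
  case False
  have z\<omega>: "z - \<omega> \<noteq> 0" using z \<omega> by auto
  define q where "q u = (if u = \<omega> then 0 else T u / (u - \<omega>))" for u
  have K0: "K \<ge> 0" using order_trans[OF norm_ge_zero K[of 0]] \<omega> by simp
  have qb: "cmod (q u) \<le> K" if "u \<in> cball 0 1" for u
    using K[OF that] K0 by (auto simp: q_def norm_divide divide_le_eq)
  have "cmod (T z / (z - \<omega>)) \<le> \<epsilon>"
  proof (rule root_le)
    show "cmod (T z) > 0" using False by simp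
    fix m :: nat
    have T\<omega>: "T \<omega> = 0" using e(2)[OF \<omega>] by simp
    define F where "F u = T u * q u ^ m" for u
    have "cmod (F z) \<le> 2 * \<epsilon> * \<epsilon> ^ m"
    proof (rule maximum_modulus_frontier[where f=F and S="ball 0 1"])
      have qh: "q holomorphic_on ball 0 1"
      proof (rule holomorphic_transform)
        show "(\<lambda>u. T u / (u - \<omega>)) holomorphic_on ball 0 1" using \<omega> by (intro holomorphic_intros T) auto
      qed (use \<omega> in \<open>auto simp: q_def\<close>)
      show "F holomorphic_on interior (ball 0 1)" unfolding F_def by (simp, intro holomorphic_intros T qh)
      have "continuous (at u within cball 0 1) F" if u: "u \<in> cball 0 1" for u
      proof (cases "u = \<omega>")
        case True
        have TT: "(T \<longlongrightarrow> 0) (at \<omega> within cball 0 1)" using bspec[OF T(1)[unfolded continuous_on_def], of \<omega>] T\<omega> \<omega> by simp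
        have "(F \<longlongrightarrow> 0) (at \<omega> within cball 0 1)"
        proof (rule Lim_null_comparison)
          show "\<forall>\<^sub>F u in at \<omega> within cball 0 1. cmod (F u) \<le> cmod (T u) * K ^ m"
            unfolding eventually_at_filter F_def norm_mult norm_power using qb by (intro always_eventually) (auto intro!: mult_left_mono power_mono)
          show "((\<lambda>u. cmod (T u) * K ^ m) \<longlongrightarrow> 0) (at \<omega> within cball 0 1)"
            using tendsto_mult_left_zero[OF tendsto_norm_zero[OF TT]] by blast
        qed
        then show ?thesis using True T\<omega> by (simp add: continuous_within F_def)
      next
        case False
        have "continuous (at u within cball 0 1) (\<lambda>u. T u * (T u / (u - \<omega>)) ^ m)"
          using T(1) u False by (intro continuous_intros) (auto simp: continuous_on_eq_continuous_within)
        moreover have "\<forall>\<^sub>F v in at u within cball 0 1. T v * (T v / (v - \<omega>)) ^ m = F v"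
          using eventually_neq_at_within[of \<omega> u "cball 0 1"] by eventually_elim (simp add: F_def q_def)
        ultimately show ?thesis using False unfolding continuous_within F_def q_def
          by (auto elim!: Lim_transform_eventually)
      qed
      then show "continuous_on (closure (ball 0 1)) F" by (simp add: continuous_on_eq_continuous_within)
      fix u :: complex assume "u \<in> frontier (ball 0 1)"
      then have u: "cmod u = 1" by simp
      show "cmod (F u) \<le> 2 * \<epsilon> * \<epsilon> ^ m"
      proof (cases "u = \<omega>")
        case True then show ?thesis using T\<omega> e(1) by (simp add: F_def)
      next
        case False
        have "cmod (u - \<omega>) \<le> 2" using norm_triangle_ineq4[of u \<omega>] u \<omega> by simp
        then have "\<epsilon> * cmod (u - \<omega>) \<le> \<epsilon> * 2" using e(1) by (intro mult_left_mono) auto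
        then have t: "cmod (T u) \<le> 2 * \<epsilon>" using e(2)[OF u] by simp
        have "cmod (q u) \<le> \<epsilon>" using e(2)[OF u] False by (simp add: q_def norm_divide divide_le_eq)
        then show ?thesis unfolding F_def norm_mult norm_power using t e(1) by (intro mult_mono power_mono) auto
      qed
    qed (use z in auto)
    then show "cmod (T z) * cmod (T z / (z - \<omega>)) ^ m \<le> 2 * \<epsilon> * \<epsilon> ^ m" using z\<omega> by (simp add: F_def q_def norm_mult norm_power)
  qed (use e in simp)
  then show ?thesis using z\<omega> by (simp add: norm_divide divide_le_eq)
qed

text \<open>A high power of \<open>(1 + cnj \<omega> * u) / 2\<close>, which is 1 at \<omega> and
  smaller in modulus elsewhere on the circle, extends the local estimate to the whole circle, so
  \<open>phragmen_lindelof_point\<close> applies. Close to \<omega> the power has modulus at least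
  1/2, which costs the factor 2.\<close>

lemma peak_localisation:
  assumes R: "continuous_on (cball 0 1) R" "R holomorphic_on ball 0 1" and \<omega>: "cmod \<omega> = 1"
    and K: "\<And>u. u \<in> cball 0 1 \<Longrightarrow> cmod (R u) \<le> K * cmod (u - \<omega>)"
    and e: "\<epsilon> > 0" and d: "d > 0" "\<And>u. cmod u = 1 \<Longrightarrow> cmod (u - \<omega>) < d \<Longrightarrow> cmod (R u) \<le> \<epsilon> * cmod (u - \<omega>)"
  shows "\<exists>s>0. \<forall>z\<in>ball 0 1. cmod (z - \<omega>) < s \<longrightarrow> cmod (R z) \<le> 2 * \<epsilon> * cmod (z - \<omega>)"
proof -
  have K0: "K \<ge> 0" using order_trans[OF norm_ge_zero K[of 0]] \<omega> by simp
  define p where "p u = (1 + cnj \<omega> * u) / 2" for u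
  have p1: "cmod (p u) \<le> 1" if "cmod u \<le> 1" for u
    using norm_triangle_ineq[of 1 "cnj \<omega> * u"] that \<omega> by (simp add: p_def norm_divide norm_mult)
  have \<omega>c: "cnj \<omega> * \<omega> = 1" using \<omega> complex_norm_square[of \<omega>] by (simp add: mult.commute)
  have p\<omega>: "p \<omega> = 1" by (simp add: p_def \<omega>c)
  have pn: "(cmod (p u))\<^sup>2 = 1 - (cmod (u - \<omega>))\<^sup>2 / 4" if u: "cmod u = 1" for u
  proof -
    define v where "v = cnj \<omega> * u"
    have "cmod v = 1" using u \<omega> by (simp add: v_def norm_mult)
    then have v: "(Re v)\<^sup>2 + (Im v)\<^sup>2 = 1" using cmod_power2[of v] by simp
    have "u - \<omega> = \<omega> * (v - 1)" using \<omega>c by (simp add: v_def algebra_simps)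
    then have a: "cmod (u - \<omega>) = cmod (v - 1)" using \<omega> by (simp add: norm_mult)
    show ?thesis using v unfolding a p_def v_def[symmetric] cmod_power2 by (simp add: power2_eq_square field_simps)
  qed
  define \<kappa> where "\<kappa> = sqrt (1 - (min d 1)\<^sup>2 / 4)"
  have md: "0 < (min d 1)\<^sup>2" "(min d 1)\<^sup>2 \<le> 1" using d(1) by (auto simp: power_le_one)
  have \<kappa>: "0 \<le> \<kappa>" "\<kappa> < 1" unfolding \<kappa>_def using md by (auto simp: real_sqrt_lt_1_iff)
  have pf: "cmod (p u) \<le> \<kappa>" if u: "cmod u = 1" "cmod (u - \<omega>) \<ge> d" for u
  proof -
    have "(min d 1)\<^sup>2 \<le> (cmod (u - \<omega>))\<^sup>2" using u(2) d(1) by (intro power_mono) auto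
    then have "(cmod (p u))\<^sup>2 \<le> \<kappa>\<^sup>2" using md unfolding pn[OF u(1)] \<kappa>_def by simp
    then show ?thesis using \<kappa>(1) by (rule power2_le_imp_le)
  qed
  obtain m where m: "K * \<kappa> ^ m \<le> \<epsilon>"
  proof -
    obtain m where "\<kappa> ^ m < \<epsilon> / (K + 1)" using real_arch_pow_inv[of "\<epsilon> / (K + 1)" \<kappa>] \<kappa> e K0 by auto
    then have "\<kappa> ^ m * (K + 1) < \<epsilon>" using K0 by (simp add: less_divide_eq)
    moreover have "K * \<kappa> ^ m \<le> \<kappa> ^ m * (K + 1)" using \<kappa>(1) by (simp add: algebra_simps)
    ultimately show ?thesis using that[of m] by linarith
  qed
  define T where "T u = R u * p u ^ m" for u
  have T: "cmod (T z) \<le> \<epsilon> * cmod (z - \<omega>)" if z: "z \<in> ball 0 1" for z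
  proof (rule phragmen_lindelof_point[OF _ _ \<omega> _ e _ z])
    show "continuous_on (cball 0 1) T" unfolding T_def p_def by (intro continuous_intros R) auto
    show "T holomorphic_on ball 0 1" unfolding T_def p_def by (intro holomorphic_intros R) auto
    show "cmod (T u) \<le> K * cmod (u - \<omega>)" if "u \<in> cball 0 1" for u
    proof -
      have "cmod (T u) \<le> (K * cmod (u - \<omega>)) * 1" unfolding T_def norm_mult norm_power
        using K[OF that] p1[of u] that K0 by (intro mult_mono power_le_one) auto
      then show ?thesis by simp
    qed
    show "cmod (T u) \<le> \<epsilon> * cmod (u - \<omega>)" if u: "cmod u = 1" for u
    proof (cases "cmod (u - \<omega>) < d")
      case True
      have "cmod (T u) \<le> (\<epsilon> * cmod (u - \<omega>)) * 1" unfolding T_def norm_mult norm_power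
        using d(2)[OF u True] p1[of u] u e by (intro mult_mono power_le_one) auto
      then show ?thesis by simp
    next
      case False
      have "cmod (T u) \<le> (K * cmod (u - \<omega>)) * \<kappa> ^ m" unfolding T_def norm_mult norm_power
        using K[of u] pf[OF u] False u K0 by (intro mult_mono power_mono) auto
      also have "\<dots> = (K * \<kappa> ^ m) * cmod (u - \<omega>)" by simp
      also have "\<dots> \<le> \<epsilon> * cmod (u - \<omega>)" using m by (intro mult_right_mono) auto
      finally show ?thesis .
    qed
  qed
  have "isCont (\<lambda>u. cmod (p u ^ m)) \<omega>" unfolding p_def by (intro continuous_intros) auto
  then obtain s where s: "s > 0" "\<And>u. dist u \<omega> < s \<Longrightarrow> dist (cmod (p u ^ m)) (cmod (p \<omega> ^ m)) < 1/2"
    unfolding continuous_at_eps_delta by (metis half_gt_zero zero_less_one)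
  show ?thesis
  proof (intro exI[of _ s] conjI ballI impI)
    fix z :: complex assume z: "z \<in> ball 0 1" "cmod (z - \<omega>) < s"
    have "dist (cmod (p z ^ m)) (cmod (p \<omega> ^ m)) < 1/2" by (rule s(2)) (use z(2) in \<open>simp add: dist_norm\<close>)
    then have "\<bar>cmod (p z ^ m) - 1\<bar> < 1/2" using p\<omega> by (simp add: dist_real_def)
    then have "cmod (p z ^ m) \<ge> 1/2" using abs_ge_minus_self[of "cmod (p z ^ m) - 1"] by linarith
    then have "cmod (R z) * (1/2) \<le> cmod (R z) * cmod (p z ^ m)" by (intro mult_left_mono) auto
    also have "\<dots> \<le> \<epsilon> * cmod (z - \<omega>)" using T[OF z(1)] by (simp add: T_def norm_mult)
    finally show "cmod (R z) \<le> 2 * \<epsilon> * cmod (z - \<omega>)" by simp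
  qed (rule s)
qed

text \<open>Subtract from G its first-order part at \<omega>. The remainder is
  \<open>o(|u - \<omega>|)\<close> along the circle, by \<open>peak_localisation\<close> also inside
  the disc, and Cauchy's estimate on the disc of radius \<open>1 - r\<close> around
  \<open>r * \<omega>\<close> shows that its derivative \<open>f - c'\<close> tends to 0.\<close>

lemma radial_limit_at_differentiable:
  assumes G: "continuous_on (cball 0 1) G" "\<And>z. z \<in> ball 0 1 \<Longrightarrow> (G has_field_derivative f z) (at z)"
    and L: "\<And>u v. u \<in> cball 0 1 \<Longrightarrow> v \<in> cball 0 1 \<Longrightarrow> cmod (G u - G v) \<le> L * cmod (u - v)"
    and c: "\<And>e. e > 0 \<Longrightarrow> \<exists>d>0. \<forall>y. \<bar>y - x\<bar> < d \<longrightarrow> cmod (G (cis y) - G (cis x) - of_real (y - x) * c) \<le> e * \<bar>y - x\<bar>"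
  shows "((\<lambda>r::real. f (of_real r * cis x)) \<longlongrightarrow> c / (\<i> * cis x)) (at_left 1)"
proof -
  define \<omega> where "\<omega> = cis x"
  define c' where "c' = c / (\<i> * \<omega>)"
  have \<omega>: "cmod \<omega> = 1" "\<omega> \<noteq> 0" by (auto simp: \<omega>_def)
  have cc: "c = c' * \<i> * \<omega>" using \<omega> by (simp add: c'_def)
  define R where "R u = G u - G \<omega> - c' * (u - \<omega>)" for u
  have Rc: "continuous_on (cball 0 1) R" unfolding R_def by (intro continuous_intros G)
  have Rd: "(R has_field_derivative f z - c') (at z)" if "z \<in> ball 0 1" for z
    unfolding R_def by (rule derivative_eq_intros G(2)[OF that] refl | simp)+
  have Rh: "R holomorphic_on ball 0 1" unfolding holomorphic_on_open[OF open_ball] using Rd by blast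
  have RK: "cmod (R u) \<le> (L + cmod c') * cmod (u - \<omega>)" if "u \<in> cball 0 1" for u
  proof -
    have "cmod (R u) \<le> cmod (G u - G \<omega>) + cmod (c' * (u - \<omega>))" unfolding R_def by (rule norm_triangle_ineq4)
    also have "\<dots> \<le> L * cmod (u - \<omega>) + cmod c' * cmod (u - \<omega>)" using L[OF that, of \<omega>] \<omega> by (simp add: norm_mult)
    finally show ?thesis by (simp add: distrib_right)
  qed
  have near: "\<exists>d>0. \<forall>u. cmod u = 1 \<longrightarrow> cmod (u - \<omega>) < d \<longrightarrow> cmod (R u) \<le> e * cmod (u - \<omega>)" if e: "e > 0" for e
  proof -
    define e1 where "e1 = min 1 (e / (2 * (cmod c' + 1)))"
    have e1: "e1 > 0" "e1 \<le> 1" "cmod c' * e1 \<le> e / 2"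
    proof -
      have p: "cmod c' + 1 > 0" using norm_ge_zero[of c'] by linarith
      then show pos: "e1 > 0" using e by (simp add: e1_def)
      have "cmod c' * e1 \<le> (cmod c' + 1) * e1" using pos by (intro mult_right_mono) auto
      also have "\<dots> \<le> (cmod c' + 1) * (e / (2 * (cmod c' + 1)))" using p by (intro mult_left_mono) (auto simp: e1_def)
      also have "\<dots> = e / 2"
      proof -
        have "k * (e / (2 * k)) = e / 2" if "k > 0" for k :: real using that by simp
        from this[OF p] show ?thesis .
      qed
      finally show "cmod c' * e1 \<le> e / 2" .
    qed (simp add: e1_def)
    obtain d1 where d1: "d1 > 0" "\<And>y. \<bar>y - x\<bar> < d1 \<Longrightarrow> cmod (G (cis y) - G (cis x) - of_real (y - x) * c) \<le> e / 4 * \<bar>y - x\<bar>"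
      using c[of "e / 4"] e by auto
    \<comment> \<open>Differentiability is given in the angle but needed in terms of the chord
      \<open>u - \<omega>\<close>; the derivative of \<open>Ln\<close> at 1 relates the two.\<close>
    have "(Ln has_field_derivative 1) (at 1)" by (rule derivative_eq_intros refl | simp)+
    then have "\<exists>d>0. \<forall>v. cmod (v - 1) < d \<longrightarrow> cmod (Ln v - Ln 1 - 1 * (v - 1)) \<le> e1 * cmod (v - 1)"
      using e1(1) unfolding has_field_derivative_def has_derivative_at_alt by blast
    then obtain d2 where d2: "d2 > 0" "\<And>v. cmod (v - 1) < d2 \<Longrightarrow> cmod (Ln v - (v - 1)) \<le> e1 * cmod (v - 1)" by auto
    show ?thesis
    proof (intro exI[of _ "min d2 (d1 / 2)"] conjI allI impI)
      fix u assume u: "cmod u = 1" "cmod (u - \<omega>) < min d2 (d1 / 2)"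
      define v where "v = u / \<omega>"
      define a where "a = cmod (u - \<omega>)"
      have v: "cmod v = 1" "v \<noteq> 0" "u = \<omega> * v" using u \<omega> by (auto simp: v_def norm_divide)
      have "u - \<omega> = \<omega> * (v - 1)" using v by (simp add: algebra_simps)
      then have va: "cmod (v - 1) = a" using \<omega> by (simp add: a_def norm_mult)
      define t where "t = Im (Ln v)"
      have Lt: "Ln v = \<i> * of_real t" using v by (simp add: complex_eq_iff t_def)
      have b: "cmod (\<i> * of_real t - (v - 1)) \<le> e1 * a" using d2(2)[of v] u(2) va Lt a_def by simp
      have "\<bar>t\<bar> = cmod (\<i> * of_real t)" by (simp add: norm_mult)
      also have "\<dots> \<le> cmod (\<i> * of_real t - (v - 1)) + cmod (v - 1)" using norm_triangle_ineq[of "\<i> * of_real t - (v - 1)" "v - 1"] by simp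
      also have "\<dots> \<le> 1 * a + a" using b va e1(2) mult_right_mono[OF e1(2), of a] by (simp add: a_def)
      finally have t2: "\<bar>t\<bar> \<le> 2 * a" by simp
      have "cis t = exp (Ln v)" by (simp add: Lt cis_conv_exp)
      then have cu: "cis (x + t) = u" using v by (simp add: \<omega>_def cis_mult[symmetric])
      have "cmod (G u - G \<omega> - of_real t * c) \<le> e / 4 * \<bar>t\<bar>" using d1(2)[of "x + t"] t2 u(2) cu by (simp add: a_def \<omega>_def)
      also have "\<dots> \<le> e / 4 * (2 * a)" using t2 e by (intro mult_left_mono) auto
      finally have 1: "cmod (G u - G \<omega> - of_real t * c) \<le> e / 2 * a" by (simp add: mult_ac)
      have "of_real t * c - c' * (u - \<omega>) = c' * \<omega> * (\<i> * of_real t - (v - 1))" using v(3) by (simp add: cc algebra_simps)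
      then have "cmod (of_real t * c - c' * (u - \<omega>)) = cmod c' * cmod (\<i> * of_real t - (v - 1))" using \<omega> by (simp add: norm_mult)
      also have "\<dots> \<le> cmod c' * (e1 * a)" using b by (intro mult_left_mono) auto
      also have "\<dots> = (cmod c' * e1) * a" by simp
      also have "\<dots> \<le> e / 2 * a" using e1(3) by (intro mult_right_mono) (auto simp: a_def)
      finally have 2: "cmod (of_real t * c - c' * (u - \<omega>)) \<le> e / 2 * a" .
      have "R u = (G u - G \<omega> - of_real t * c) + (of_real t * c - c' * (u - \<omega>))" by (simp add: R_def)
      then have "cmod (R u) \<le> cmod (G u - G \<omega> - of_real t * c) + cmod (of_real t * c - c' * (u - \<omega>))" by (simp only: norm_triangle_ineq)
      then have "cmod (R u) \<le> e / 2 * a + e / 2 * a" using 1 2 by linarith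
      then show "cmod (R u) \<le> e * cmod (u - \<omega>)" by (simp add: a_def)
    qed (use d1 d2 in simp)
  qed
  have lim: "\<exists>s<1. \<forall>r. s < r \<and> r < 1 \<longrightarrow> cmod (f (of_real r * \<omega>) - c') < e" if e: "e > 0" for e
  proof -
    have e5: "e / 5 > 0" using e by simp
    obtain d where d: "d > 0" "\<And>u. cmod u = 1 \<Longrightarrow> cmod (u - \<omega>) < d \<Longrightarrow> cmod (R u) \<le> e / 5 * cmod (u - \<omega>)" using near[OF e5] by blast
    obtain s where s: "s > 0" "\<And>z. z \<in> ball 0 1 \<Longrightarrow> cmod (z - \<omega>) < s \<Longrightarrow> cmod (R z) \<le> 2 * (e / 5) * cmod (z - \<omega>)"
      using peak_localisation[OF Rc Rh \<omega>(1) RK e5 d] by blast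
    show ?thesis
    proof (intro exI[of _ "max 0 (1 - s / 2)"] conjI allI impI)
      fix r :: real assume r: "max 0 (1 - s / 2) < r \<and> r < 1"
      define \<delta> where "\<delta> = 1 - r"
      have \<delta>: "0 < \<delta>" "2 * \<delta> < s" using r by (auto simp: \<delta>_def)
      define z where "z = of_real r * \<omega>"
      have z: "cmod z = r" using r \<omega> by (simp add: z_def norm_mult)
      have z\<omega>: "cmod (z - \<omega>) = \<delta>"
      proof -
        have "z - \<omega> = - (of_real \<delta> * \<omega>)" by (simp add: z_def \<delta>_def algebra_simps)
        then show ?thesis using \<delta> \<omega> by (simp add: norm_mult)
      qed
      have sub: "ball z \<delta> \<subseteq> ball 0 1"
      proof
        fix w assume "w \<in> ball z \<delta>"
        then have "cmod (w - z) < \<delta>" by (simp add: dist_norm norm_minus_commute)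
        then show "w \<in> ball 0 1" using norm_triangle_ineq[of "w - z" z] z by (simp add: \<delta>_def)
      qed
      \<comment> \<open>On this disc w is within \<open>2 * \<delta>\<close> of \<omega>, so R is at
        most \<open>4/5 * e * \<delta>\<close>; 9/10 leaves room for the strict
        inequalities.\<close>
      have "cmod ((deriv ^^ 1) R z) \<le> fact 1 * (e * \<delta> * 9 / 10) / \<delta> ^ 1"
      proof (rule Cauchy_higher_deriv_bound[where y=0])
        show "R holomorphic_on ball z \<delta>" using Rh sub holomorphic_on_subset by blast
        have "cball z \<delta> \<subseteq> cball 0 1"
        proof
          fix w assume "w \<in> cball z \<delta>"
          then have "cmod (w - z) \<le> \<delta>" by (simp add: dist_norm norm_minus_commute)
          then show "w \<in> cball 0 1" using norm_triangle_ineq[of "w - z" z] z by (simp add: \<delta>_def)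
        qed
        then show "continuous_on (cball z \<delta>) R" using Rc continuous_on_subset by blast
        fix w assume w: "w \<in> ball z \<delta>"
        have "cmod (w - z) < \<delta>" using w by (simp add: dist_norm norm_minus_commute)
        then have w2: "cmod (w - \<omega>) < 2 * \<delta>" using norm_triangle_ineq[of "w - z" "z - \<omega>"] z\<omega> by simp
        have "cmod (R w) \<le> 2 * (e / 5) * cmod (w - \<omega>)" using s(2)[of w] w sub w2 \<delta> by auto
        also have "\<dots> \<le> 2 * (e / 5) * (2 * \<delta>)" using w2 e by (intro mult_left_mono) auto
        also have "\<dots> < e * \<delta> * 9 / 10" using e \<delta> by simp
        finally show "R w \<in> ball 0 (e * \<delta> * 9 / 10)" by simp
      qed (use \<delta> in auto)
      moreover have "(deriv ^^ 1) R z = f z - c'" using Rd[of z] z r by (simp add: DERIV_imp_deriv)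
      ultimately have "cmod (f z - c') \<le> e * 9 / 10" using \<delta> by simp
      then show "cmod (f (of_real r * \<omega>) - c') < e" using e by (simp add: z_def)
    qed (use s in simp)
  qed
  show ?thesis unfolding \<omega>_def[symmetric] c'_def[symmetric]
  proof (rule tendstoI)
    fix e :: real assume "e > 0"
    from lim[OF this] obtain s where "s < 1" "\<And>r. s < r \<and> r < 1 \<Longrightarrow> cmod (f (of_real r * \<omega>) - c') < e" by blast
    then show "\<forall>\<^sub>F r in at_left 1. dist (f (complex_of_real r * \<omega>)) c' < e"
      unfolding eventually_at_left_field by (auto simp: dist_norm)
  qed
qed

lemma cis_lipschitz: "cmod (cis x - cis y) \<le> \<bar>x - y\<bar>"
proof -
  have "cis x - cis y = cis y * (cis (x - y) - 1)" by (simp add: cis_mult right_diff_distrib)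
  then have "cmod (cis x - cis y) = cmod (cis (x - y) - 1)" by (simp add: norm_mult)
  also have "\<dots> \<le> \<bar>x - y\<bar>" using iexp_approx1[of "x - y" 0] by (simp add: cis_conv_exp)
  finally show ?thesis .
qed

text \<open>Fatou's theorem through a primitive: it is Lipschitz because f is bounded, so it extends
  to the closed disc and is differentiable along the circle almost everywhere.\<close>

lemma radial_limits_negligible:
  assumes f: "f holomorphic_on ball 0 1" and B: "\<And>z. z \<in> ball 0 1 \<Longrightarrow> cmod (f z) \<le> B"
  shows "\<exists>N. negligible N \<and> (\<forall>x. x \<notin> N \<longrightarrow> (\<exists>l. ((\<lambda>r::real. f (of_real r * cis x)) \<longlongrightarrow> l) (at_left 1)))"
proof -
  obtain G0 where G0: "\<And>z. z \<in> ball 0 1 \<Longrightarrow> (G0 has_field_derivative f z) (at z within ball 0 1)"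
    using holomorphic_convex_primitive[OF convex_ball finite.emptyI holomorphic_on_imp_continuous_on[OF f]] f
    by (metis Diff_empty holomorphic_on_imp_differentiable_at interior_open open_ball)
  have B0: "B \<ge> 0" using order_trans[OF norm_ge_zero B[of 0]] by simp
  have "B-lipschitz_on (ball 0 1) G0"
    by (rule lipschitz_onI) (use field_differentiable_bound[OF convex_ball G0 B] B0 in \<open>auto simp: dist_norm\<close>)
  then obtain G where G: "B-lipschitz_on (cball 0 1) G" "\<forall>z\<in>ball 0 1. G z = G0 z"
    using lipschitz_extend_closure[of B "ball 0 1" G0] by (auto simp: closure_ball)
  have L: "cmod (G u - G v) \<le> B * cmod (u - v)" if "u \<in> cball 0 1" "v \<in> cball 0 1" for u v
    using lipschitz_onD[OF G(1) that] by (simp add: dist_norm)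
  have Gd: "(G has_field_derivative f z) (at z)" if z: "z \<in> ball 0 1" for z
  proof (rule has_field_derivative_transform_within_open[where S="ball 0 1"])
    show "(G0 has_field_derivative f z) (at z)" using G0[OF z] unfolding at_within_open[OF z open_ball] .
  qed (use z G(2) in auto)
  have "cmod (G (cis x) - G (cis y)) \<le> (B + 1) * \<bar>x - y\<bar>" for x y
  proof -
    have "cmod (G (cis x) - G (cis y)) \<le> B * cmod (cis x - cis y)" by (rule L) auto
    also have "\<dots> \<le> (B + 1) * \<bar>x - y\<bar>" using B0 cis_lipschitz by (intro mult_mono) auto
    finally show ?thesis .
  qed
  from lipschitz_differentiable_AE_complex[OF this] B0 obtain N where N: "negligible N"
    "\<And>x. x \<notin> N \<Longrightarrow> \<exists>c. \<forall>e>0. \<exists>d>0. \<forall>y. \<bar>y - x\<bar> < d \<longrightarrow> cmod (G (cis y) - G (cis x) - of_real (y - x) * c) \<le> e * \<bar>y - x\<bar>" by auto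
  have "\<exists>l. ((\<lambda>r::real. f (of_real r * cis x)) \<longlongrightarrow> l) (at_left 1)" if "x \<notin> N" for x
  proof -
    from N(2)[OF that] obtain c where c: "\<forall>e>0. \<exists>d>0. \<forall>y. \<bar>y - x\<bar> < d \<longrightarrow> cmod (G (cis y) - G (cis x) - of_real (y - x) * c) \<le> e * \<bar>y - x\<bar>" ..
    from radial_limit_at_differentiable[OF lipschitz_on_continuous_on[OF G(1)] Gd L c[THEN spec, THEN mp]] show ?thesis by blast
  qed
  then show ?thesis using N(1) by blast
qed

text \<open>Transfers the exceptional angles to \<open>circle_measure\<close>. The branch
  \<open>ag\<close> of the argument is Borel measurable and inverts \<open>cis\<close> on the open
  interval from 0 to \<open>2 * pi\<close>; the negligible set is first enlarged to a Borel null
  set.\<close>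

lemma radial_limits_AE:
  assumes f: "f holomorphic_on ball 0 1" and B: "\<And>z. z \<in> ball 0 1 \<Longrightarrow> cmod (f z) \<le> B"
  shows "AE z in circle_measure. \<exists>l. ((\<lambda>r::real. f (of_real r * z)) \<longlongrightarrow> l) (at_left 1)"
proof -
  obtain N0 where N0: "negligible N0" "\<And>x. x \<notin> N0 \<Longrightarrow> \<exists>l. ((\<lambda>r::real. f (of_real r * cis x)) \<longlongrightarrow> l) (at_left 1)"
    using radial_limits_negligible[OF f B] by blast
  obtain N where N: "N \<in> null_sets lborel" "N0 \<subseteq> N" using N0(1) unfolding negligible_iff_null_sets null_sets_completion_iff2 by blast
  define ag where "ag z = pi + Im (Ln (- z))" for z
  have agm [measurable]: "ag \<in> borel_measurable borel" unfolding ag_def by measurable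
  have Nb: "N \<in> sets borel" using N(1) by (auto simp: null_sets_def)
  have ag_cis: "ag (cis t) = t" if "0 < t" "t < 2 * pi" for t
  proof -
    have "- cis t = exp (\<i> * of_real (t - pi))" by (simp add: cis_conv_exp[symmetric] right_diff_distrib[symmetric] cis_divide[symmetric] flip: of_real_diff)
    then have "Ln (- cis t) = \<i> * of_real (t - pi)" using that by (simp add: Ln_exp)
    then show ?thesis by (simp add: ag_def)
  qed
  have "AE t in lborel. t \<in> {0..2 * pi} \<longrightarrow> ag (cis t) \<notin> N"
    using AE_not_in[OF N(1)] AE_lborel_singleton[of 0] AE_lborel_singleton[of "2 * pi"]
  proof eventually_elim
    case (elim t) then show ?case using ag_cis[of t] by (cases "t \<in> {0<..<2*pi}") auto
  qed
  then have "AE t in uniform_measure lborel {0..2 * pi}. ag (cis t) \<notin> N" by (subst AE_uniform_measure) auto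
  moreover have "{z \<in> space borel. ag z \<notin> N} \<in> sets borel" using measurable_sets[OF agm, of "- N"] Nb by (simp add: vimage_def Compl_in_sets_lebesgue[symmetric] borel_comp)
  ultimately have "AE z in circle_measure. ag z \<notin> N" unfolding circle_measure_def by (subst AE_distr_iff) auto
  then show ?thesis using AE_circle_measure_norm
  proof eventually_elim
    case (elim z)
    have "z \<noteq> 0" using elim(2) by auto
    then have "Ln (- z) = \<i> * of_real (Im (Ln (- z)))" using elim(2) by (simp add: complex_eq_iff)
    then have "exp (\<i> * of_real (Im (Ln (- z)))) = - z" using \<open>z \<noteq> 0\<close> by (metis exp_Ln neg_equal_0_iff_equal)
    then have "cis (Im (Ln (- z))) = - z" by (simp add: cis_conv_exp)
    then have "cis (ag z) = z" by (simp add: ag_def cis_mult[symmetric])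
    moreover have "ag z \<notin> N0" using elim(1) N(2) by blast
    ultimately show ?case using N0(2)[of "ag z"] by simp
  qed
qed

section \<open>The algebra \<open>H\<^sup>\<infinity> + C\<close>\<close>

definition bhol :: "(complex \<Rightarrow> complex) \<Rightarrow> bool" where
  "bhol f \<longleftrightarrow> f holomorphic_on ball 0 1 \<and> bounded (f ` ball 0 1)"

lemma bhol_I: "f holomorphic_on ball 0 1 \<Longrightarrow> (\<And>z. z \<in> ball 0 1 \<Longrightarrow> cmod (f z) \<le> B) \<Longrightarrow> bhol f"
  unfolding bhol_def bounded_iff by blast

lemma bhol_E: "bhol f \<Longrightarrow> \<exists>B\<ge>0. \<forall>z\<in>ball 0 1. cmod (f z) \<le> B"
proof -
  assume "bhol f"
  then obtain B where B: "\<forall>z\<in>ball 0 1. cmod (f z) \<le> B" unfolding bhol_def bounded_iff by blast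
  have "(0::complex) \<in> ball 0 1" by simp
  then have "0 \<le> B" using B order_trans[OF norm_ge_zero] by blast
  then show ?thesis using B by blast
qed

lemma bhol_mult: assumes "bhol f" "bhol g" shows "bhol (\<lambda>z. f z * g z)"
proof -
  obtain B where B: "B \<ge> 0" "\<And>z. z\<in>ball 0 1 \<Longrightarrow> cmod (f z) \<le> B" using bhol_E[OF assms(1)] by blast
  obtain C where C: "C \<ge> 0" "\<And>z. z\<in>ball 0 1 \<Longrightarrow> cmod (g z) \<le> C" using bhol_E[OF assms(2)] by blast
  show ?thesis
  proof (rule bhol_I[of _ "B * C"])
    show "(\<lambda>z. f z * g z) holomorphic_on ball 0 1" using assms by (auto simp: bhol_def intro!: holomorphic_intros)
    show "cmod (f z * g z) \<le> B * C" if "z \<in> ball 0 1" for z by (rule norm_mult_mono) (use B C that in auto)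
  qed
qed

lemma bhol_add: assumes "bhol f" "bhol g" shows "bhol (\<lambda>z. f z + g z)"
proof -
  obtain B where B: "B \<ge> 0" "\<And>z. z\<in>ball 0 1 \<Longrightarrow> cmod (f z) \<le> B" using bhol_E[OF assms(1)] by blast
  obtain C where C: "C \<ge> 0" "\<And>z. z\<in>ball 0 1 \<Longrightarrow> cmod (g z) \<le> C" using bhol_E[OF assms(2)] by blast
  show ?thesis
  proof (rule bhol_I[of _ "B + C"])
    show "(\<lambda>z. f z + g z) holomorphic_on ball 0 1" using assms by (auto simp: bhol_def intro!: holomorphic_intros)
    show "cmod (f z + g z) \<le> B + C" if "z \<in> ball 0 1" for z by (rule norm_triangle_mono) (use B C that in auto)
  qed
qed

lemma bhol_const: "bhol (\<lambda>_. c)" by (rule bhol_I[of _ "cmod c"]) auto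

lemma bhol_ident: "bhol (\<lambda>z. z)" by (rule bhol_I[of _ 1]) auto

lemma bhol_power: "bhol (\<lambda>z. z ^ n)"
  by (induction n) (auto intro: bhol_const bhol_mult[OF bhol_ident])

lemma bhol_entire: assumes q: "q holomorphic_on UNIV" shows "bhol q"
proof -
  have "compact (q ` cball 0 1)" using holomorphic_on_imp_continuous_on[OF q]
    by (intro compact_continuous_image) (auto intro: continuous_on_subset)
  then have "bounded (q ` ball 0 1)" using compact_imp_bounded bounded_subset image_mono[OF ball_subset_cball] by metis
  then show ?thesis unfolding bhol_def using q holomorphic_on_subset by blast
qed

section \<open>Calculus of boundary values and of continuous representatives\<close>

lemma linf_rel_refl: "ess_bounded f \<Longrightarrow> linf_rel f f" by (simp add: linf_rel_def)

lemma ess_bounded_ident: "ess_bounded (\<lambda>z. z)" and ess_bounded_cnj: "ess_bounded cnj"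
proof -
  have "AE z in circle_measure. norm z \<le> 1" using AE_circle_measure_norm by eventually_elim simp
  moreover have "cnj \<in> borel_measurable borel" by (intro borel_measurable_continuous_onI continuous_intros)
  then have "cnj \<in> borel_measurable circle_measure" by (simp add: measurable_cong_sets[OF sets_circle_measure refl])
  ultimately show "ess_bounded (\<lambda>z. z)" "ess_bounded cnj" unfolding ess_bounded_iff by auto
qed

lift_definition linf_z :: linf is "\<lambda>z. z" by (rule linf_rel_refl[OF ess_bounded_ident])

lift_definition linf_zbar :: linf is cnj by (rule linf_rel_refl[OF ess_bounded_cnj])

lift_definition linf_const :: "complex \<Rightarrow> linf" is "\<lambda>c _. c" by (rule linf_rel_refl[OF ess_bounded_const])

lemma zbar_z: "linf_zbar * linf_z = 1"
proof transfer
  have "AE z in circle_measure. cnj z * z = 1" using AE_circle_measure_norm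
    by eventually_elim (metis complex_norm_square mult.commute of_real_1 one_power2)
  then show "linf_rel (\<lambda>z. cnj z * z) (\<lambda>_. 1)"
    unfolding linf_rel_def by (intro conjI ess_bounded_mult ess_bounded_ident ess_bounded_cnj ess_bounded_const)
qed

lemma zbar_z_power: "linf_zbar ^ n * linf_z ^ n = 1"
  by (simp add: zbar_z flip: power_mult_distrib)

lemma norm_z_le: "norm linf_z \<le> 1" and norm_zbar_le: "norm linf_zbar \<le> 1"
proof -
  have a: "AE z in circle_measure. norm z \<le> 1" "AE z in circle_measure. norm (cnj z) \<le> 1" using AE_circle_measure_norm by (eventually_elim, simp)+
  show "norm linf_z \<le> 1" unfolding norm_linf_le_iff by transfer (rule a(1))
  show "norm linf_zbar \<le> 1" unfolding norm_linf_le_iff by transfer (rule a(2))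
qed

lemma norm_power_mult_le:
  fixes x y :: linf assumes "norm x \<le> 1" shows "norm (x ^ n * y) \<le> norm y"
proof -
  have "norm (x ^ n) \<le> norm x ^ n" by (rule norm_power_ineq)
  also have "\<dots> \<le> 1" using assms by (intro power_le_one) auto
  finally have p: "norm (x ^ n) \<le> 1" .
  have "norm (x ^ n * y) \<le> norm (x ^ n) * norm y" by (rule norm_mult_ineq)
  also have "\<dots> \<le> 1 * norm y" using p by (intro mult_right_mono) auto
  finally show ?thesis by simp
qed

lemma bv_add: "boundary_value_of \<phi> f \<Longrightarrow> boundary_value_of \<psi> g \<Longrightarrow> boundary_value_of (\<phi> + \<psi>) (\<lambda>z. f z + g z)"
  by transfer (erule (1) eventually_elim2, rule tendsto_add)

lemma bv_diff: "boundary_value_of \<phi> f \<Longrightarrow> boundary_value_of \<psi> g \<Longrightarrow> boundary_value_of (\<phi> - \<psi>) (\<lambda>z. f z - g z)"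
  by transfer (erule (1) eventually_elim2, rule tendsto_diff)

lemma bv_mult: "boundary_value_of \<phi> f \<Longrightarrow> boundary_value_of \<psi> g \<Longrightarrow> boundary_value_of (\<phi> * \<psi>) (\<lambda>z. f z * g z)"
  by transfer (erule (1) eventually_elim2, rule tendsto_mult)

lemma bv_z: "boundary_value_of linf_z (\<lambda>z. z)"
  by transfer (rule AE_I2, auto intro!: tendsto_eq_intros)

lemma bv_const: "boundary_value_of (linf_const c) (\<lambda>_. c)"
  by transfer simp

lemma bv_one: "boundary_value_of 1 (\<lambda>_. 1)"
  by transfer simp

lemma bv_power: "boundary_value_of (linf_z ^ n) (\<lambda>z. z ^ n)"
  by (induction n) (auto intro: bv_one bv_mult[OF bv_z])

lemma AE_radial_bound:
  assumes "AE z in circle_measure. ((\<lambda>r::real. f (of_real r * z)) \<longlongrightarrow> \<phi> z) (at_left 1)"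
    and b: "\<forall>z\<in>ball 0 1. cmod (f z) \<le> c"
  shows "AE z in circle_measure. norm (\<phi> z) \<le> c"
  using assms(1) AE_circle_measure_norm
proof eventually_elim
  case (elim z)
  have "\<forall>\<^sub>F r in at_left (1::real). r \<in> {0<..<1}" by (rule eventually_at_leftI[of 0]) auto
  then have "\<forall>\<^sub>F r in at_left (1::real). cmod (f (of_real r * z)) \<le> c"
    by eventually_elim (use b elim(2) in \<open>auto simp: norm_mult\<close>)
  then show ?case by (rule tendsto_upperbound[OF tendsto_norm[OF elim(1)]]) simp
qed

lemma bv_norm_le: "boundary_value_of \<phi> f \<Longrightarrow> \<forall>z\<in>ball 0 1. cmod (f z) \<le> c \<Longrightarrow> norm \<phi> \<le> c"
  unfolding norm_linf_le_iff by transfer (erule (1) AE_radial_bound)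

lemma bv_unique: assumes "boundary_value_of \<phi> f" "boundary_value_of \<psi> g" "\<And>z. z \<in> ball 0 1 \<Longrightarrow> f z = g z" shows "\<phi> = \<psi>"
proof -
  have "norm (\<phi> - \<psi>) \<le> 0" by (rule bv_norm_le[OF bv_diff[OF assms(1,2)]]) (use assms(3) in simp)
  then show ?thesis by simp
qed

lemma bv_AE: "boundary_value_of \<phi> f \<Longrightarrow> linf_bounded_by \<phi> c \<Longrightarrow>
   AE z in circle_measure. \<exists>l. ((\<lambda>r::real. f (of_real r * z)) \<longlongrightarrow> l) (at_left 1) \<and> cmod l \<le> c"
  by transfer (erule (1) eventually_elim2, blast)

text \<open>The converse of \<open>bv_norm_le\<close>: it reads estimates in \<open>linf\<close>
  back as estimates on the disc.\<close>

lemma bv_le_norm: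
  assumes "boundary_value_of \<phi> f" "bhol f" "norm \<phi> \<le> c" "z \<in> ball 0 1" shows "cmod (f z) \<le> c"
proof -
  obtain B where B: "\<forall>z\<in>ball 0 1. cmod (f z) \<le> B" using bhol_E[OF assms(2)] by blast
  have c: "c \<ge> 0" using assms(3) norm_ge_zero[of \<phi>] by linarith
  show ?thesis
    by (rule boundary_max_bound[OF _ _ c bv_AE[OF assms(1)] assms(4)]) (use assms B in \<open>auto simp: bhol_def norm_linf_le_iff\<close>)
qed

text \<open>F extends f by zero to a Borel function, so the limit along the radii
  \<open>1 - 1 / (k + 2)\<close> is measurable; on the circle it agrees with the radial limit
  wherever that exists.\<close>

lemma bv_exists: assumes "bhol f" shows "\<exists>\<phi>. boundary_value_of \<phi> f"
proof -
  obtain B where B: "B \<ge> 0" "\<And>z. z\<in>ball 0 1 \<Longrightarrow> cmod (f z) \<le> B" using bhol_E[OF assms] by blast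
  have fh: "f holomorphic_on ball 0 1" using assms by (simp add: bhol_def)
  define F where "F u = indicator (ball 0 1) u *\<^sub>R f u" for u
  have Fm [measurable]: "F \<in> borel_measurable borel" unfolding F_def
    by (rule borel_measurable_continuous_on_indicator) (auto intro: holomorphic_on_imp_continuous_on fh)
  define \<phi> where "\<phi> z = lim (\<lambda>k::nat. F (of_real (1 - 1 / (real k + 2)) * z))" for z
  have \<phi>m: "\<phi> \<in> borel_measurable circle_measure" unfolding \<phi>_def by measurable
  have "AE z in circle_measure. \<exists>l. ((\<lambda>r::real. f (of_real r * z)) \<longlongrightarrow> l) (at_left 1)" by (rule radial_limits_AE[OF fh B(2)])
  then have ae: "AE z in circle_measure. ((\<lambda>r::real. f (of_real r * z)) \<longlongrightarrow> \<phi> z) (at_left 1)"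
    using AE_circle_measure_norm
  proof eventually_elim
    case (elim z)
    then obtain l where l: "((\<lambda>r::real. f (of_real r * z)) \<longlongrightarrow> l) (at_left 1)" by blast
    have "(\<lambda>k::nat. f (of_real (1 - 1 / (real k + 2)) * z)) \<longlonglongrightarrow> l" by (rule filterlim_compose[OF l rho_at_left])
    moreover have Fe: "F (of_real (1 - 1 / (real k + 2)) * z) = f (of_real (1 - 1 / (real k + 2)) * z)" for k
    proof -
      have "\<bar>1 - 1 / (real k + 2)\<bar> < 1" by (simp add: abs_less_iff)
      then have "cmod (of_real (1 - 1 / (real k + 2)) * z) < 1" using elim(2) unfolding norm_mult norm_of_real by simp
      then show ?thesis by (simp add: F_def)
    qed
    ultimately have "(\<lambda>k::nat. F (of_real (1 - 1 / (real k + 2)) * z)) \<longlonglongrightarrow> l" by (simp only: Fe)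
    then have "\<phi> z = l" unfolding \<phi>_def by (rule limI)
    then show ?case using l by simp
  qed
  have "AE z in circle_measure. norm (\<phi> z) \<le> B" by (rule AE_radial_bound[OF ae]) (use B in blast)
  then have "ess_bounded \<phi>" unfolding ess_bounded_iff using \<phi>m by (intro conjI exI)
  then have "boundary_value_of (abs_linf \<phi>) f" using ae by (simp only: boundary_value_of.abs_eq[OF linf_rel_refl])
  then show ?thesis by blast
qed

lemma H_infI: "bhol f \<Longrightarrow> boundary_value_of \<phi> f \<Longrightarrow> \<phi> \<in> H_inf"
  unfolding H_inf_def bhol_def by blast

lemma H_infE: "\<phi> \<in> H_inf \<Longrightarrow> \<exists>f. bhol f \<and> boundary_value_of \<phi> f"
  unfolding H_inf_def bhol_def by blast

lemma rep_add: "represented_by \<phi> f \<Longrightarrow> represented_by \<psi> g \<Longrightarrow> represented_by (\<phi> + \<psi>) (\<lambda>z. f z + g z)"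
  by transfer (erule (1) eventually_elim2, simp)

lemma rep_diff: "represented_by \<phi> f \<Longrightarrow> represented_by \<psi> g \<Longrightarrow> represented_by (\<phi> - \<psi>) (\<lambda>z. f z - g z)"
  by transfer (erule (1) eventually_elim2, simp)

lemma rep_mult: "represented_by \<phi> f \<Longrightarrow> represented_by \<psi> g \<Longrightarrow> represented_by (\<phi> * \<psi>) (\<lambda>z. f z * g z)"
  by transfer (erule (1) eventually_elim2, simp)

lemma rep_basic: "represented_by linf_z (\<lambda>z. z)" "represented_by linf_zbar cnj" "represented_by (linf_const c) (\<lambda>_. c)" "represented_by 1 (\<lambda>_. 1)" "represented_by 0 (\<lambda>_. 0)"
  by (transfer, simp)+

lemma rep_power: "represented_by \<phi> f \<Longrightarrow> represented_by (\<phi> ^ n) (\<lambda>z. f z ^ n)"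
  by (induction n) (auto intro: rep_basic rep_mult)

lemma AE_circle_bound: "AE z in circle_measure. \<phi> z = f z \<Longrightarrow> \<forall>z\<in>sphere 0 1. cmod (f z) \<le> c \<Longrightarrow> AE z in circle_measure. norm (\<phi> z) \<le> c"
  by (erule eventually_elim2[OF _ AE_circle_measure_norm]) auto

lemma rep_norm_le: "represented_by \<phi> f \<Longrightarrow> \<forall>z\<in>sphere 0 1. cmod (f z) \<le> c \<Longrightarrow> norm \<phi> \<le> c"
  unfolding norm_linf_le_iff by transfer (erule (1) AE_circle_bound)

lemma bv_rep: "boundary_value_of \<phi> q \<Longrightarrow> continuous_on UNIV q \<Longrightarrow> represented_by \<phi> q"
proof (transfer)
  fix \<phi> q :: "complex \<Rightarrow> complex" assume a: "AE z in circle_measure. ((\<lambda>r::real. q (of_real r * z)) \<longlongrightarrow> \<phi> z) (at_left 1)" and q: "continuous_on UNIV q"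
  show "AE z in circle_measure. \<phi> z = q z" using a
  proof eventually_elim
    case (elim z)
    have "((\<lambda>r::real. of_real r * z) \<longlongrightarrow> of_real 1 * z) (at_left 1)" by (intro tendsto_intros)
    moreover have "isCont q (of_real 1 * z)" using q by (simp add: continuous_on_eq_continuous_at)
    ultimately have "((\<lambda>r::real. q (of_real r * z)) \<longlongrightarrow> q (of_real 1 * z)) (at_left 1)" by (rule isCont_tendsto_compose[rotated])
    then show ?case using tendsto_unique[OF _ elim] by simp
  qed
qed

lemma C_circle_I: "represented_by \<phi> g \<Longrightarrow> continuous_on (sphere 0 1) g \<Longrightarrow> \<phi> \<in> C_circle"
  unfolding C_circle_def by blast

lemma C_circle_add: "\<phi> \<in> C_circle \<Longrightarrow> \<psi> \<in> C_circle \<Longrightarrow> \<phi> + \<psi> \<in> C_circle"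
  unfolding C_circle_def using rep_add continuous_on_add by blast

lemma sarason_add: assumes "a \<in> H_inf_plus_C" "b \<in> H_inf_plus_C" shows "a + b \<in> H_inf_plus_C"
proof -
  obtain p c where a: "a = p + c" "p \<in> H_inf" "c \<in> C_circle" using assms(1) by (auto simp: H_inf_plus_C_def)
  obtain q d where b: "b = q + d" "q \<in> H_inf" "d \<in> C_circle" using assms(2) by (auto simp: H_inf_plus_C_def)
  obtain f g where "bhol f" "boundary_value_of p f" "bhol g" "boundary_value_of q g" using H_infE a(2) b(2) by meson
  then have "p + q \<in> H_inf" by (intro H_infI[OF bhol_add bv_add])
  moreover have "a + b = (p + q) + (c + d)" by (simp add: a b)
  ultimately show ?thesis using C_circle_add[OF a(3) b(3)] unfolding H_inf_plus_C_def by blast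
qed

lemma H_inf_sarason: assumes "a \<in> H_inf" shows "a \<in> H_inf_plus_C"
proof -
  have "0 \<in> C_circle" by (rule C_circle_I[OF rep_basic(5)]) simp
  then show ?thesis using assms unfolding H_inf_plus_C_def by force
qed

lemma C_sarason: assumes "a \<in> C_circle" shows "a \<in> H_inf_plus_C"
proof -
  have "linf_const 0 \<in> H_inf" by (rule H_infI[OF bhol_const bv_const])
  moreover have "linf_const 0 = 0" by transfer (simp add: linf_rel_def ess_bounded_const)
  ultimately show ?thesis using assms unfolding H_inf_plus_C_def by force
qed

text \<open>One Taylor coefficient is peeled off at a time: with \<open>f z = f 0 + z * X z\<close>
  the product becomes \<open>linf_zbar ^ Suc n\<close> times a constant, which is continuous, plus
  \<open>linf_zbar ^ n\<close> times the boundary value of X. The Schwarz lemma keeps X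
  bounded.\<close>

lemma zbar_power_sarason:
  "bhol f \<Longrightarrow> boundary_value_of \<phi> f \<Longrightarrow> linf_zbar ^ n * \<phi> \<in> H_inf_plus_C"
proof (induction n arbitrary: f \<phi>)
  case 0 then show ?case using H_inf_sarason H_infI by simp
next
  case (Suc n)
  obtain B where B: "B \<ge> 0" "\<And>z. z\<in>ball 0 1 \<Longrightarrow> cmod (f z) \<le> B" using bhol_E[OF Suc.prems(1)] by blast
  have fh: "f holomorphic_on ball 0 1" using Suc.prems by (simp add: bhol_def)
  \<comment> \<open>Strictly above the bound \<open>2 * B\<close> for \<open>f z - f 0\<close>,
    because \<open>Schwarz_Lemma\<close> needs values of modulus below 1.\<close>
  define M where "M = 2 * B + 1"
  have M: "M > 0" using B by (simp add: M_def)
  have le: "cmod (f z - f 0) \<le> M * cmod z" if z: "z \<in> ball 0 1" for z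
  proof -
    have "cmod ((f z - f 0) / of_real M) \<le> cmod z"
    proof (rule Schwarz_Lemma(1)[where f="\<lambda>z. (f z - f 0) / of_real M"])
      show "(\<lambda>z. (f z - f 0) / of_real M) holomorphic_on ball 0 1" using M by (intro holomorphic_intros fh) auto
      fix w :: complex assume w: "cmod w < 1"
      have "cmod (f w - f 0) \<le> B + B" using norm_triangle_ineq4[of "f w" "f 0"] B(2)[of w] B(2)[of 0] w by simp
      then have "cmod (f w - f 0) < M" by (simp add: M_def)
      then show "cmod ((f w - f 0) / of_real M) < 1" using M by (simp add: norm_divide)
    qed (use z in auto)
    then show ?thesis using M by (simp add: norm_divide divide_le_eq mult.commute)
  qed
  have "(\<lambda>z. f z - f 0) holomorphic_on ball 0 1" by (intro holomorphic_intros fh)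
  then have "\<exists>X. X holomorphic_on ball 0 1 \<and> (\<forall>z\<in>ball 0 1. f z - f 0 = X z * z \<and> cmod (X z) \<le> M)"
    by (rule bounded_quotient[where f="\<lambda>z. z" and p="1/2", OF open_ball connected_ball _ _ le]) (auto intro: holomorphic_intros)
  then obtain X where X: "X holomorphic_on ball 0 1" "\<forall>z\<in>ball 0 1. f z - f 0 = X z * z \<and> cmod (X z) \<le> M" by blast
  have bX: "bhol X" by (rule bhol_I[OF X(1)]) (use X(2) in blast)
  obtain \<beta> where \<beta>: "boundary_value_of \<beta> X" using bv_exists[OF bX] by blast
  have \<phi>: "\<phi> = linf_const (f 0) + linf_z * \<beta>"
  proof (rule bv_unique[OF Suc.prems(2) bv_add[OF bv_const bv_mult[OF bv_z \<beta>]]])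
    show "f z = f 0 + z * X z" if "z \<in> ball 0 1" for z using bspec[OF X(2) that] by (simp add: algebra_simps)
  qed
  have "linf_zbar ^ Suc n * \<phi> = linf_zbar ^ Suc n * linf_const (f 0) + linf_zbar ^ n * (linf_zbar * linf_z) * \<beta>"
    by (simp add: \<phi> algebra_simps)
  also have "\<dots> = linf_zbar ^ Suc n * linf_const (f 0) + linf_zbar ^ n * \<beta>" by (simp add: zbar_z)
  finally have eq: "linf_zbar ^ Suc n * \<phi> = linf_zbar ^ Suc n * linf_const (f 0) + linf_zbar ^ n * \<beta>" .
  have "linf_zbar ^ Suc n * linf_const (f 0) \<in> C_circle"
    by (rule C_circle_I[OF rep_mult[OF rep_power[OF rep_basic(2)] rep_basic(3)]]) (intro continuous_intros)
  then show ?case unfolding eq using sarason_add C_sarason Suc.IH[OF bX \<beta>] by blast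
qed

text \<open>On the circle \<open>cnj z = 1 / z\<close>, so \<open>Re z\<close> and
  \<open>Im z\<close> are Laurent polynomials in z; a power of z clears the denominators, and sums
  and products preserve this.\<close>

lemma real_polynomial_circle:
  fixes p :: "complex \<Rightarrow> real"
  assumes "real_polynomial_function p"
  shows "\<exists>N q. q holomorphic_on UNIV \<and> (\<forall>z. cmod z = 1 \<longrightarrow> z ^ N * of_real (p z) = q z)"
  using assms
proof (induction rule: real_polynomial_function.induct)
  case (linear f)
  then interpret bounded_linear f .
  have "z ^ 1 * of_real (f z) = of_real (f 1) * ((z\<^sup>2 + 1) / 2) + of_real (f \<i>) * ((z\<^sup>2 - 1) / (2 * \<i>))" if z: "cmod z = 1" for z
  proof -
    have "z = Re z *\<^sub>R 1 + Im z *\<^sub>R \<i>" by (simp add: complex_eq_iff)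
    then have fz: "f z = Re z * f 1 + Im z * f \<i>" by (metis add scaleR real_scaleR_def)
    have zz: "z * cnj z = 1" using z complex_norm_square[of z] by simp
    have "2 * (z * of_real (Re z)) = z * (z + cnj z)" by (simp add: complex_add_cnj)
    also have "\<dots> = z\<^sup>2 + 1" by (simp add: distrib_left zz power2_eq_square)
    finally have re: "z\<^sup>2 + 1 = 2 * (z * of_real (Re z))" by (rule sym)
    have "2 * \<i> * (z * of_real (Im z)) = z * (z - cnj z)" by (simp add: complex_diff_cnj)
    also have "\<dots> = z\<^sup>2 - 1" by (simp add: right_diff_distrib zz power2_eq_square)
    finally have im: "z\<^sup>2 - 1 = 2 * \<i> * (z * of_real (Im z))" by (rule sym)
    show ?thesis unfolding re im by (simp add: fz algebra_simps)
  qed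
  then show ?case
    by (intro exI[of _ 1], intro exI[of _ "\<lambda>z. of_real (f 1) * ((z\<^sup>2 + 1) / 2) + of_real (f \<i>) * ((z\<^sup>2 - 1) / (2 * \<i>))"]) (auto intro!: holomorphic_intros)
next
  case (const c)
  show ?case by (rule exI[of _ 0], rule exI[of _ "\<lambda>_. of_real c"]) simp
next
  case (add f g)
  then obtain N q M r where q: "q holomorphic_on UNIV" "\<forall>z. cmod z = 1 \<longrightarrow> z ^ N * of_real (f z) = q z" and r: "r holomorphic_on UNIV" "\<forall>z. cmod z = 1 \<longrightarrow> z ^ M * of_real (g z) = r z" by metis
  have "z ^ (N + M) * of_real (f z + g z) = z ^ M * q z + z ^ N * r z" if z: "cmod z = 1" for z
  proof -
    have "z ^ (N + M) * of_real (f z + g z) = z ^ M * (z ^ N * of_real (f z)) + z ^ N * (z ^ M * of_real (g z))" by (simp add: power_add algebra_simps)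
    then show ?thesis using q(2) r(2) z by simp
  qed
  moreover have "(\<lambda>z. z ^ M * q z + z ^ N * r z) holomorphic_on UNIV" by (intro holomorphic_intros q r)
  ultimately show ?case by blast
next
  case (mult f g)
  then obtain N q M r where q: "q holomorphic_on UNIV" "\<forall>z. cmod z = 1 \<longrightarrow> z ^ N * of_real (f z) = q z" and r: "r holomorphic_on UNIV" "\<forall>z. cmod z = 1 \<longrightarrow> z ^ M * of_real (g z) = r z" by metis
  have "z ^ (N + M) * of_real (f z * g z) = q z * r z" if z: "cmod z = 1" for z
  proof -
    have "z ^ (N + M) * of_real (f z * g z) = (z ^ N * of_real (f z)) * (z ^ M * of_real (g z))" by (simp add: power_add)
    then show ?thesis using q(2) r(2) z by simp
  qed
  moreover have "(\<lambda>z. q z * r z) holomorphic_on UNIV" by (intro holomorphic_intros q r)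
  ultimately show ?case by blast
qed

lemma continuous_circle_approx:
  fixes g :: "complex \<Rightarrow> complex"
  assumes g: "continuous_on (sphere 0 1) g" and e: "e > 0"
  shows "\<exists>N q. q holomorphic_on UNIV \<and> (\<forall>z\<in>sphere 0 1. cmod (z ^ N * g z - q z) \<le> e)"
proof -
  obtain P where P: "polynomial_function P" "\<And>z. z \<in> sphere 0 1 \<Longrightarrow> cmod (g z - P z) < e"
    using Stone_Weierstrass_polynomial_function[OF compact_sphere g e] by blast
  have "real_polynomial_function (Re \<circ> P)" "real_polynomial_function (Im \<circ> P)"
    using P(1) bounded_linear_Re bounded_linear_Im unfolding polynomial_function_def by blast+
  then obtain N q M r where q: "q holomorphic_on UNIV" "\<forall>z. cmod z = 1 \<longrightarrow> z ^ N * of_real ((Re \<circ> P) z) = q z"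
    and r: "r holomorphic_on UNIV" "\<forall>z. cmod z = 1 \<longrightarrow> z ^ M * of_real ((Im \<circ> P) z) = r z" using real_polynomial_circle by metis
  have "cmod (z ^ (N + M) * g z - (z ^ M * q z + \<i> * (z ^ N * r z))) \<le> e" if z: "z \<in> sphere 0 1" for z
  proof -
    have z1: "cmod z = 1" using z by simp
    have "P z = of_real (Re (P z)) + \<i> * of_real (Im (P z))" by (simp add: complex_eq_iff)
    then have "z ^ (N + M) * P z = z ^ M * (z ^ N * of_real (Re (P z))) + \<i> * (z ^ N * (z ^ M * of_real (Im (P z))))"
      by (rule ssubst[where P="\<lambda>p. z ^ (N + M) * p = z ^ M * (z ^ N * of_real (Re (P z))) + \<i> * (z ^ N * (z ^ M * of_real (Im (P z))))"])
        (simp add: power_add algebra_simps)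
    also have "\<dots> = z ^ M * q z + \<i> * (z ^ N * r z)" using q(2) r(2) z1 by simp
    finally have "z ^ (N + M) * g z - (z ^ M * q z + \<i> * (z ^ N * r z)) = z ^ (N + M) * (g z - P z)" by (simp add: right_diff_distrib)
    then show ?thesis using P(2)[OF z] z1 by (simp add: norm_mult norm_power)
  qed
  moreover have "(\<lambda>z. z ^ M * q z + \<i> * (z ^ N * r z)) holomorphic_on UNIV" by (intro holomorphic_intros q r)
  ultimately show ?thesis by (intro exI[of _ "N + M"], intro exI[of _ "\<lambda>z. z ^ M * q z + \<i> * (z ^ N * r z)"]) blast
qed

text \<open>Up to e the continuous part is a Laurent polynomial; multiplication by
  \<open>z ^ N\<close> makes it entire and leaves the other part in \<open>H_inf\<close>.\<close>

lemma sarason_approx: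
  assumes a: "a \<in> H_inf_plus_C" and e: "e > 0"
  shows "\<exists>N f \<phi>. bhol f \<and> boundary_value_of \<phi> f \<and> norm (linf_z ^ N * a - \<phi>) \<le> e"
proof -
  obtain p c where pc: "a = p + c" "p \<in> H_inf" "c \<in> C_circle" using a by (auto simp: H_inf_plus_C_def)
  obtain f where f: "bhol f" "boundary_value_of p f" using H_infE[OF pc(2)] by blast
  obtain g where g: "continuous_on (sphere 0 1) g" "represented_by c g" using pc(3) by (auto simp: C_circle_def)
  obtain N q where q: "q holomorphic_on UNIV" "\<forall>z\<in>sphere 0 1. cmod (z ^ N * g z - q z) \<le> e" using continuous_circle_approx[OF g(1) e] by blast
  obtain \<psi> where \<psi>: "boundary_value_of \<psi> q" using bv_exists[OF bhol_entire[OF q(1)]] by blast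
  have "represented_by (linf_z ^ N * c - \<psi>) (\<lambda>z. z ^ N * g z - q z)"
    by (intro rep_diff rep_mult rep_power rep_basic g bv_rep[OF \<psi>] holomorphic_on_imp_continuous_on q)
  then have "norm (linf_z ^ N * c - \<psi>) \<le> e" using q(2) by (rule rep_norm_le)
  moreover have "linf_z ^ N * c - \<psi> = linf_z ^ N * a - (linf_z ^ N * p + \<psi>)" by (simp add: pc algebra_simps)
  moreover have "bhol (\<lambda>z. z ^ N * f z + q z)" by (intro bhol_add bhol_mult bhol_power f bhol_entire q)
  moreover have "boundary_value_of (linf_z ^ N * p + \<psi>) (\<lambda>z. z ^ N * f z + q z)" by (intro bv_add bv_mult bv_power f \<psi>)
  ultimately show ?thesis by (metis (no_types, lifting))
qed

section \<open>Density of unimodular pairs and its failure for single elements\<close>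

lemma sarason_dense_2: "unimodular_dense 2 H_inf_plus_C"
  unfolding unimodular_dense_iff
proof (intro ballI allI impI)
  fix a :: "nat \<Rightarrow> linf" and e :: real assume a: "a \<in> {..<2} \<rightarrow>\<^sub>E H_inf_plus_C" and e: "e > 0"
  have e3: "e / 3 > 0" using e by simp
  have a01: "a 0 \<in> H_inf_plus_C" "a 1 \<in> H_inf_plus_C" using a by (auto simp: PiE_iff)
  obtain N f \<phi> where f: "bhol f" "boundary_value_of \<phi> f" "norm (linf_z ^ N * a 0 - \<phi>) \<le> e / 3" using sarason_approx[OF a01(1) e3] by blast
  obtain M g \<psi> where g: "bhol g" "boundary_value_of \<psi> g" "norm (linf_z ^ M * a 1 - \<psi>) \<le> e / 3" using sarason_approx[OF a01(2) e3] by blast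
  \<comment> \<open>The crossed powers bring both components to the common power
    \<open>z ^ (N + M)\<close>, by which everything is divided again at the end.\<close>
  define F where "F z = z ^ M * f z" for z
  define G where "G z = z ^ N * g z" for z
  have FG: "bhol F" "bhol G" unfolding F_def G_def by (intro bhol_mult bhol_power f g)+
  have bF: "boundary_value_of (linf_z ^ M * \<phi>) F" "boundary_value_of (linf_z ^ N * \<psi>) G" unfolding F_def G_def by (intro bv_mult bv_power f g)+
  obtain F' G' x y where P: "bhol F'" "bhol G'" "bhol x" "bhol y"
    "\<forall>z\<in>ball 0 1. cmod (F' z - F z) \<le> e / 3 \<and> cmod (G' z - G z) \<le> e / 3 \<and> x z * F' z + y z * G' z = 1"
    using disc_pairs[of F G "e / 3"] FG e3 unfolding bhol_def by blast
  obtain \<phi>' \<psi>' \<xi> \<upsilon> where bv: "boundary_value_of \<phi>' F'" "boundary_value_of \<psi>' G'" "boundary_value_of \<xi> x" "boundary_value_of \<upsilon> y"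
    using bv_exists P(1-4) by meson
  have one: "\<phi>' * \<xi> + \<psi>' * \<upsilon> = 1"
    by (rule bv_unique[OF bv_add[OF bv_mult[OF bv(1,3)] bv_mult[OF bv(2,4)]] bv_one]) (use P(5) in \<open>simp add: mult.commute\<close>)
  \<comment> \<open>Two errors of \<open>e / 3\<close> occur, from the approximation in
    \<open>H_inf\<close> and from the perturbation on the disc; powers of \<open>linf_z\<close> and
    \<open>linf_zbar\<close> do not enlarge them.\<close>
  have near: "norm (linf_zbar ^ (N + M) * \<beta> - b) < e"
    if "boundary_value_of \<beta> X" "boundary_value_of (linf_z ^ K * \<theta>) Y" "\<forall>z\<in>ball 0 1. cmod (X z - Y z) \<le> e / 3" "norm (linf_z ^ J * b - \<theta>) \<le> e / 3" "K + J = N + M" for \<beta> X K \<theta> Y J b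
  proof -
    have 1: "norm (\<beta> - linf_z ^ K * \<theta>) \<le> e / 3" by (rule bv_norm_le[OF bv_diff[OF that(1,2)] that(3)])
    have "norm (linf_z ^ K * (linf_z ^ J * b - \<theta>)) \<le> e / 3" using norm_power_mult_le[OF norm_z_le] that(4) order_trans by blast
    then have 2: "norm (linf_z ^ K * \<theta> - linf_z ^ (N + M) * b) \<le> e / 3"
      unfolding that(5)[symmetric] by (simp add: power_add right_diff_distrib mult.assoc norm_minus_commute)
    have "norm (\<beta> - linf_z ^ (N + M) * b) \<le> e / 3 + e / 3"
      using norm_triangle_mono[OF 1 2] by simp
    moreover have "linf_zbar ^ (N + M) * (\<beta> - linf_z ^ (N + M) * b) = linf_zbar ^ (N + M) * \<beta> - (linf_zbar ^ (N + M) * linf_z ^ (N + M)) * b"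
      by (simp add: right_diff_distrib mult.assoc)
    then have "linf_zbar ^ (N + M) * (\<beta> - linf_z ^ (N + M) * b) = linf_zbar ^ (N + M) * \<beta> - b" by (simp only: zbar_z_power mult_1)
    ultimately show ?thesis using norm_power_mult_le[OF norm_zbar_le, of "N + M" "\<beta> - linf_z ^ (N + M) * b"] e by simp
  qed
  define u where "u = (\<lambda>j\<in>{..<2::nat}. linf_zbar ^ (N + M) * (if j = 0 then \<phi>' else \<psi>'))"
  define v where "v = (\<lambda>j\<in>{..<2::nat}. linf_z ^ (N + M) * (if j = 0 then \<xi> else \<upsilon>))"
  have "u \<in> {..<2} \<rightarrow>\<^sub>E H_inf_plus_C" unfolding u_def using zbar_power_sarason P bv by (auto simp: PiE_iff)
  moreover have "v \<in> {..<2} \<rightarrow>\<^sub>E H_inf_plus_C" unfolding v_def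
    using H_inf_sarason[OF H_infI[OF bhol_mult[OF bhol_power P(3)] bv_mult[OF bv_power bv(3)]]]
      H_inf_sarason[OF H_infI[OF bhol_mult[OF bhol_power P(4)] bv_mult[OF bv_power bv(4)]]] by (auto simp: PiE_iff)
  moreover have "(\<Sum>j<2. u j * v j) = 1"
  proof -
    have r: "(linf_zbar ^ n * s) * (linf_z ^ n * t) = (linf_zbar ^ n * linf_z ^ n) * (s * t)" for n s t by (simp add: mult_ac)
    have "(\<Sum>j<2. u j * v j) = u 0 * v 0 + u 1 * v 1" by (simp add: numeral_2_eq_2)
    also have "\<dots> = \<phi>' * \<xi> + \<psi>' * \<upsilon>" by (simp add: u_def v_def r zbar_z_power)
    finally show ?thesis using one by simp
  qed
  ultimately have "u \<in> unimodular_tuples 2 H_inf_plus_C" unfolding unimodular_tuples_def by blast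
  moreover have "u 0 = linf_zbar ^ (N + M) * \<phi>'" "u 1 = linf_zbar ^ (N + M) * \<psi>'" by (simp_all add: u_def)
  moreover have "norm (linf_zbar ^ (N + M) * \<phi>' - a 0) < e" by (rule near[OF bv(1) bF(1) _ f(3)]) (use P(5) in auto)
  moreover have "norm (linf_zbar ^ (N + M) * \<psi>' - a 1) < e" by (rule near[OF bv(2) bF(2) _ g(3)]) (use P(5) in auto)
  moreover have "j = 0 \<or> j = 1" if "j < 2" for j :: nat using that by linarith
  ultimately show "\<exists>u\<in>unimodular_tuples 2 H_inf_plus_C. \<forall>j<2. norm (u j - a j) < e" by metis
qed

lemma sarason_not_dense_1: "\<not> unimodular_dense 1 H_inf_plus_C"
proof
  assume dense: "unimodular_dense 1 H_inf_plus_C"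
  define f0 where "f0 z = exp (- ((1 + z) / (1 - z))) - 1/2" for z :: complex
  have bf0: "bhol f0"
  proof (rule bhol_I[of _ 2])
    show "f0 holomorphic_on ball 0 1" unfolding f0_def by (intro holomorphic_intros) auto
    fix z :: complex assume z: "z \<in> ball 0 1"
    then have "(cmod z)\<^sup>2 \<le> 1" by (simp add: power_le_one)
    then have "Re ((1 + z) / (1 - z)) \<ge> 0" unfolding Re_cayley by simp
    then have "cmod (exp (- ((1 + z) / (1 - z)))) \<le> 1" unfolding norm_exp_eq_Re by simp
    moreover have "cmod (f0 z) \<le> cmod (exp (- ((1 + z) / (1 - z)))) + cmod (1/2)" unfolding f0_def by (rule norm_triangle_ineq4)
    moreover have "cmod (1/2) = 1/2" by (simp add: norm_divide)
    ultimately show "cmod (f0 z) \<le> 2" by linarith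
  qed
  obtain \<alpha> where \<alpha>: "boundary_value_of \<alpha> f0" using bv_exists[OF bf0] by blast
  have \<alpha>A: "\<alpha> \<in> H_inf_plus_C" by (rule H_inf_sarason[OF H_infI[OF bf0 \<alpha>]])
  have "(\<lambda>j\<in>{..<1::nat}. \<alpha>) \<in> {..<1} \<rightarrow>\<^sub>E H_inf_plus_C" using \<alpha>A by auto
  moreover have "(1/128::real) > 0" by simp
  ultimately obtain w where w: "w \<in> unimodular_tuples 1 H_inf_plus_C" "\<forall>j<1. norm (w j - (\<lambda>j\<in>{..<1::nat}. \<alpha>) j) < 1/128"
    using dense[unfolded unimodular_dense_iff] by blast
  then obtain x where x: "x \<in> {..<1} \<rightarrow>\<^sub>E H_inf_plus_C" "(\<Sum>j<1. w j * x j) = 1" unfolding unimodular_tuples_def by blast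
  define u v where "u = w 0" and "v = x 0"
  have u: "u \<in> H_inf_plus_C" "norm (u - \<alpha>) \<le> 1/128" using w unfolding unimodular_tuples_def u_def by (auto simp: PiE_iff)
  have v: "v \<in> H_inf_plus_C" "u * v = 1" using x unfolding u_def v_def by (auto simp: PiE_iff)
  \<comment> \<open>\<open>e1\<close> is weighed against the norm of v and \<open>e2\<close> against
    that of u, so that \<open>\<beta> * \<kappa>\<close> is within 1/4 of
    \<open>linf_z ^ (N + M)\<close>; 1/128 taken twice is the 1/64 of
    \<open>no_near_inverse\<close>.\<close>
  define e1 where "e1 = min (1/128) (1 / (8 * (norm v + 1)))"
  define e2 where "e2 = min 1 (1 / (8 * (norm u + 1)))"
  have nn: "norm u + 1 > 0" "norm v + 1 > 0" using norm_ge_zero[of u] norm_ge_zero[of v] by linarith+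
  have e: "e1 > 0" "e2 > 0" "e1 \<le> 1/128" "e2 \<le> 1" using nn by (auto simp: e1_def e2_def)
  have k8: "k * (1 / (8 * k)) = 1/8" if "k > 0" for k :: real using that by simp
  have "(norm v + 1) * e1 \<le> (norm v + 1) * (1 / (8 * (norm v + 1)))" using nn by (intro mult_left_mono) (auto simp: e1_def)
  then have ev: "(norm v + 1) * e1 \<le> 1/8" unfolding k8[OF nn(2)] .
  have "(norm u + 1) * e2 \<le> (norm u + 1) * (1 / (8 * (norm u + 1)))" using nn by (intro mult_left_mono) (auto simp: e2_def)
  then have eu: "(norm u + 1) * e2 \<le> 1/8" unfolding k8[OF nn(1)] .
  obtain N h \<beta> where h: "bhol h" "boundary_value_of \<beta> h" "norm (linf_z ^ N * u - \<beta>) \<le> e1" using sarason_approx[OF u(1) e(1)] by blast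
  obtain M k \<kappa> where k: "bhol k" "boundary_value_of \<kappa> k" "norm (linf_z ^ M * v - \<kappa>) \<le> e2" using sarason_approx[OF v(1) e(2)] by blast
  have n\<kappa>: "norm \<kappa> \<le> norm v + 1"
  proof -
    have "norm \<kappa> \<le> norm (linf_z ^ M * v) + norm (linf_z ^ M * v - \<kappa>)" using norm_triangle_ineq4[of "linf_z ^ M * v" "linf_z ^ M * v - \<kappa>"] by simp
    then show ?thesis using norm_power_mult_le[OF norm_z_le, of M v] k(3) e(4) by linarith
  qed
  have "\<beta> * \<kappa> - linf_z ^ (N + M) = - ((linf_z ^ N * u - \<beta>) * \<kappa>) - (linf_z ^ N * u) * (linf_z ^ M * v - \<kappa>)"
  proof -
    have "(linf_z ^ N * u) * (linf_z ^ M * v) = linf_z ^ (N + M) * (u * v)" by (simp add: power_add mult_ac)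
    then have "(linf_z ^ N * u) * (linf_z ^ M * v) = linf_z ^ (N + M)" using v(2) by simp
    then show ?thesis by (simp add: algebra_simps)
  qed
  also have "norm \<dots> \<le> norm ((linf_z ^ N * u - \<beta>) * \<kappa>) + norm ((linf_z ^ N * u) * (linf_z ^ M * v - \<kappa>))"
    using norm_triangle_ineq4[of "- ((linf_z ^ N * u - \<beta>) * \<kappa>)"] by (simp only: norm_minus_cancel)
  also have "\<dots> \<le> e1 * (norm v + 1) + (norm u + 1) * e2"
  proof (intro add_mono norm_mult_mono h k n\<kappa>)
    show "norm (linf_z ^ N * u) \<le> norm u + 1" using norm_power_mult_le[OF norm_z_le, of N u] by linarith
  qed
  also have "\<dots> \<le> 1/4" using ev eu by (simp add: mult.commute)
  finally have n1: "norm (\<beta> * \<kappa> - linf_z ^ (N + M)) \<le> 1/4" .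
  have n2: "norm (\<beta> - linf_z ^ N * \<alpha>) \<le> 1/64"
  proof -
    have "norm (linf_z ^ N * (u - \<alpha>)) \<le> 1/128" using norm_power_mult_le[OF norm_z_le, of N "u - \<alpha>"] u(2) by linarith
    moreover have "norm (\<beta> - linf_z ^ N * u) \<le> 1/128" using h(3) e(3) by (simp add: norm_minus_commute)
    moreover have "\<beta> - linf_z ^ N * \<alpha> = (\<beta> - linf_z ^ N * u) + linf_z ^ N * (u - \<alpha>)" by (simp add: algebra_simps)
    then have "norm (\<beta> - linf_z ^ N * \<alpha>) \<le> norm (\<beta> - linf_z ^ N * u) + norm (linf_z ^ N * (u - \<alpha>))" by (simp only: norm_triangle_ineq)
    ultimately show ?thesis by linarith
  qed
  have bm: "bhol (\<lambda>z. p z - q z)" if "bhol p" "bhol q" for p q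
    using bhol_add[OF that(1) bhol_mult[OF bhol_const[of "-1"] that(2)]] by simp
  show False
  proof (rule no_near_inverse)
    show "h holomorphic_on ball 0 1" using h(1) by (simp add: bhol_def)
    show "cmod (h z * k z - z ^ (N + M)) \<le> 1/4" if "z \<in> ball 0 1" for z
      by (rule bv_le_norm[OF bv_diff[OF bv_mult[OF h(2) k(2)] bv_power] _ n1 that]) (intro bm bhol_mult bhol_power h k)
    show "cmod (h z - z ^ N * (exp (- ((1 + z) / (1 - z))) - 1/2)) \<le> 1/64" if "z \<in> ball 0 1" for z
      using bv_le_norm[OF bv_diff[OF h(2) bv_mult[OF bv_power \<alpha>]] bm[OF h(1) bhol_mult[OF bhol_power bf0]] n2 that] by (simp add: f0_def)
  qed simp
qed

theorem theorem3p7: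
  shows "tsr H_inf_plus_C = 2"
proof (rule antisym)
  show "tsr H_inf_plus_C \<le> 2" unfolding tsr_def
    by (rule Inf_lower) (use sarason_dense_2 in \<open>auto intro!: exI[of _ 2] simp: numeral_eq_enat\<close>)
  show "2 \<le> tsr H_inf_plus_C" unfolding tsr_def
  proof (rule Inf_greatest)
    fix x assume "x \<in> {enat n |n. n \<ge> 1 \<and> unimodular_dense n H_inf_plus_C}"
    then obtain n where n: "x = enat n" "n \<ge> 1" "unimodular_dense n H_inf_plus_C" by blast
    then have "n \<noteq> 1" using sarason_not_dense_1 by blast
    then show "2 \<le> x" using n by (simp add: numeral_eq_enat)
  qed
qed

end
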